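(* (i) For each integer $j>1$, there exists a uniformly convergent Maclaurin series $$p_{2j+1}(x)=\sum_{k=0}^\infty r_{2j+1,k}\,x^{2k+1},\qquad 0\le x\le 1.$$ (For the special case $j=1$, $p_3(1^-)$ diverges, and the power series $\sum_{k=0}^\infty r_{3,k}x^{2k+1}$ of $p_3$ converges uniformly for $0\le x\le\delta$ for each $\delta\in(0,1)$.) (ii) For each $j\in\mathbb Z_{>0}$, the analytic continuation of the corresponding ramble integral $W_{2j+1}(s)=\int_0^\infty x^s p_{2j+1}(x)\,dx$ has only simple poles. (iii) For each $j\in\mathbb Z_{>0}$, the infinite series $$\sum_{k=0}^\infty\frac{r_{2j+1,k}}{s+2k+2}$$ converges absolutely and uniformly when $s$ is restricted to any compact subset of $\mathbb C\smallsetminus(2\mathbb Z_{<0})$.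
   Context: $J_0$ is the Bessel function of the first kind of order zero. For an integer $n\ge2$, Kluyver's $n$-step density for planar uniform random walks is $p_n(x)=\int_0^\infty J_0(xt)[J_0(t)]^n\,xt\,dt$; it is supported on $[0,n]$. The ramble integral is $W_n(s)=\int_0^1dt_1\cdots\int_0^1dt_n\left|\sum_{k=1}^n e^{2\pi i t_k}\right|^s$, which for $\operatorname{Re}s>0$ equals $\int_0^\infty x^sp_n(x)\,dx$, and which is continued meromorphically to the complex $s$-plane. The $r_{2j+1,k}$ are the Taylor coefficients of $p_{2j+1}$ at $0^+$, i.e. $p_{2j+1}(x)=\sum_{k\ge0}r_{2j+1,k}x^{2k+1}$ for small $x\geq 0$. Here $2\mathbb Z_{<0}=\{-2,-4,-6,\dots\}$, and $p_3(1^-)=\lim_{x\to1^-}p_3(x)$. *)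

theory Defs
  imports "HOL-Complex_Analysis.Complex_Analysis"
begin

definition bessel_J0 :: "real \<Rightarrow> real" where
  "bessel_J0 x = (\<Sum>m. (-1) ^ m * (x / 2) ^ (2 * m) / (fact m)\<^sup>2)"

(* For small n Kluyver's integral converges only conditionally. By Hake's theorem the
   Henstock-Kurzweil integral over {0..} agrees with the improper integral, the limit of
   the integrals over {0..R} as R tends to infinity. *)
definition kluyver_density :: "nat \<Rightarrow> real \<Rightarrow> real" where
  "kluyver_density n x = integral {0..} (\<lambda>t. bessel_J0 (x * t) * bessel_J0 t ^ n * (x * t))"

(* Literally meaningful for Re s > 0; note that 0 powr s = 0. *)
definition ramble_integral :: "nat \<Rightarrow> complex \<Rightarrow> complex" where
  "ramble_integral n s =
     (LINT t : (\<Pi>\<^sub>E k\<in>{1..n}. {0..1}) | (\<Pi>\<^sub>M k\<in>{1..n}. lborel).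
        complex_of_real (cmod (\<Sum>k=1..n. exp (2 * of_real pi * \<i> * of_real (t k)))) powr s)"

(* Meromorphic functions on the plane are unconstrained at isolated points, so such an F is
   unique only up to its values on a discrete subset of {s. Re s <= 0}; the location and the
   order of its poles are unaffected. *)
definition ramble_continuation :: "nat \<Rightarrow> (complex \<Rightarrow> complex) \<Rightarrow> bool" where
  "ramble_continuation n F \<longleftrightarrow>
     F meromorphic_on UNIV \<and> (\<forall>s. Re s > 0 \<longrightarrow> F s = ramble_integral n s)"

(* The coefficients r k in p_n(x) = sum_k r k * x^(2k+1) for all small x >= 0. They are unique
   if they exist, by the identity theorem for power series. *)
definition kluyver_coeff :: "nat \<Rightarrow> nat \<Rightarrow> real" where
  "kluyver_coeff n = (THE r. \<exists>\<delta>>0. \<forall>x\<in>{0..<\<delta>}.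
     (\<lambda>k. r k * x ^ (2 * k + 1)) sums kluyver_density n x)"

end

theory Submission
  imports Defs "HOL-Probability.Probability"
begin

text \<open>Put \<open>n = 2 * j + 1\<close>. Kluyver's integral for the density oscillates and, for \<open>n = 3\<close>, converges only
conditionally, so the proof works with the integral
\<open>F x = \<integral> x * J1 (x * t) * J0 t ^ n dt\<close> (\<open>kluyver_cdf\<close>), which converges absolutely and has the density
as its derivative, for \<open>n = 3\<close> away from \<open>x = 1\<close> and \<open>x = 3\<close>.

The Maclaurin series comes from a rotation of the contour. On the ray \<open>z = - \<i> * t\<close> one has
\<open>J0 t = Re H\<close> with \<open>H z = - (2 * \<i> / pi) * K0 z\<close>, and the complex conjugate of \<open>H\<close> is
\<open>2 * I0 - H\<close>. Expand \<open>(H + cnj H) ^ n\<close> and keep the half of the terms that have at least \<open>j + 1\<close>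
factors \<open>H\<close>. Because \<open>n\<close> is odd, the real part of this half is \<open>J0 t ^ n\<close> up to the factor \<open>2 ^ (2 * j)\<close>, and
as a function of \<open>z\<close> it is holomorphic on the right half-plane. It decays like
\<open>exp (- Re z)\<close>, since every \<open>H\<close> contributes a factor \<open>exp (- Re z)\<close>, every \<open>2 * I0 - H\<close> at most
\<open>exp (Re z)\<close>, and the factors \<open>H\<close> are in the majority. For \<open>0 \<le> x < 1\<close> this beats the growth
\<open>exp (x * Re z)\<close> of \<open>I1 (x * z)\<close>, and Cauchy's theorem moves the integral to the positive real axis:
\<open>F x = \<integral> x * I1 (x * \<tau>) * w \<tau> d\<tau>\<close> with a real weight \<open>w\<close> (\<open>kluyver_cdf_rotation\<close>). Expanding \<open>I1\<close> gives
the series, with coefficients \<open>r k = \<integral> \<tau> * (\<tau> / 2) ^ (2 * k) / (fact k)\<^sup>2 * w \<tau> d\<tau>\<close> (\<open>maclaurin_coeff\<close>).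
The kernels sum to \<open>\<tau> * I0 \<tau>\<close>, and for large \<open>\<tau>\<close> the function \<open>I0 \<tau>\<close> is of order \<open>exp \<tau> / sqrt \<tau>\<close>, while \<open>w \<tau>\<close> is at most of order
\<open>exp (- \<tau>) * \<tau> powr (- n / 2)\<close>. Hence \<open>\<Sum>k. \<bar>r k\<bar>\<close> converges when \<open>n \<ge> 5\<close>. For \<open>n = 3\<close> the weight
is a positive multiple of \<open>I0 * K0\<^sup>2\<close>; all coefficients are nonnegative and their sum diverges
logarithmically, which is the blow-up of the density at \<open>1\<close>.

The moments are identified by showing that \<open>F\<close> is the distribution function of the distance \<open>R\<close> of the walk
from its origin. Weber's integrals and Fubini's theorem give \<open>F\<close> and \<open>R\<close> the same Gaussian transform
(\<open>gauss_transforms_agree\<close>). Polynomials in \<open>exp (- x\<^sup>2)\<close> are dense by the Weierstrass theorem, so the agreement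
extends to all continuous test functions; this yields \<open>F x = 1\<close> for \<open>x > n\<close> and
\<open>W s = N powr s - s * \<integral> x powr (s - 1) * F x dx\<close> over \<open>{0..N}\<close>, where \<open>N = n + 1\<close> (\<open>ramble_integral_eq_cdf\<close>).

On \<open>{0..1}\<close> the series of \<open>F\<close> can be integrated term by term, because \<open>\<Sum>k. \<bar>r k\<bar> / (2 * k + 2)\<close> converges for
every \<open>j\<close>. The result \<open>W s = (entire function) - s * (\<Sum>k. r k / (2 * k + 2) / (s + 2 * k + 2))\<close> continues \<open>W\<close> with at
most simple poles (\<open>ramble_integral_formula\<close>). On a compact set without negative even integers
\<open>\<bar>s + 2 * k + 2\<bar>\<close> is at least a constant times \<open>2 * k + 2\<close>, and the same convergence gives the last
claim.\<close>

section \<open>The modified Bessel functions I0 and I1\<close>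

lemma even_if_not_in_odd_range: "n \<notin> range (\<lambda>k::nat. 2 * k + 1) \<Longrightarrow> even n"
  by (metis oddE rangeI)

text \<open>Integrate the derivative of \<open>sin * cos ^ (m + 1)\<close>, which vanishes at both ends.\<close>

lemma integral_cos_power_recurrence:
  "integral {0..pi} (\<lambda>\<theta>. cos \<theta> ^ (m + 2)) * real (m + 2) = real (m + 1) * integral {0..pi} (\<lambda>\<theta>. cos \<theta> ^ m)"
proof -
  have "((\<lambda>\<theta>. real (m + 2) * cos \<theta> ^ (m + 2) - real (m + 1) * cos \<theta> ^ m) has_integral
         sin pi * cos pi ^ (m + 1) - sin 0 * cos 0 ^ (m + 1)) {0..pi}"
  proof (rule fundamental_theorem_of_calculus)
    fix \<theta> :: real
    have "((\<lambda>\<theta>. cos \<theta> ^ Suc m) has_real_derivative real (Suc m) * cos \<theta> ^ m * (- sin \<theta>)) (at \<theta> within {0..pi})"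
      using DERIV_chain'[OF DERIV_cos[of \<theta>] DERIV_pow[of "Suc m" "cos \<theta>" UNIV]]
      by (auto intro: has_field_derivative_at_within simp: mult_ac simp del: power_Suc)
    from DERIV_mult[OF has_field_derivative_at_within[OF DERIV_sin] this]
    have "((\<lambda>\<theta>. sin \<theta> * cos \<theta> ^ (m + 1)) has_real_derivative
            cos \<theta> * cos \<theta> ^ (m + 1) + real (m + 1) * cos \<theta> ^ m * (- sin \<theta>) * sin \<theta>) (at \<theta> within {0..pi})"
      by (simp add: mult_ac)
    moreover have "cos \<theta> * cos \<theta> ^ (m + 1) + real (m + 1) * cos \<theta> ^ m * (- sin \<theta>) * sin \<theta>
        = cos \<theta> ^ (m+2) - real (m+1) * cos \<theta> ^ m * (sin \<theta>)\<^sup>2"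
      by (simp add: power2_eq_square algebra_simps)
    moreover have "\<dots> = real (m + 2) * cos \<theta> ^ (m + 2) - real (m + 1) * cos \<theta> ^ m"
      unfolding sin_squared_eq by (simp add: algebra_simps power_add power2_eq_square)
    ultimately show "((\<lambda>\<theta>. sin \<theta> * cos \<theta> ^ (m + 1)) has_vector_derivative
            real (m + 2) * cos \<theta> ^ (m + 2) - real (m + 1) * cos \<theta> ^ m) (at \<theta> within {0..pi})"
      by (simp only: has_real_derivative_iff_has_vector_derivative)
  qed simp
  then have "integral {0..pi} (\<lambda>\<theta>. real (m + 2) * cos \<theta> ^ (m + 2) - real (m + 1) * cos \<theta> ^ m) = 0"
    by (simp add: integral_unique)
  moreover have "integral {0..pi} (\<lambda>\<theta>. real (m + 2) * cos \<theta> ^ (m + 2) - real (m + 1) * cos \<theta> ^ m)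
     = real (m + 2) * integral {0..pi} (\<lambda>\<theta>. cos \<theta> ^ (m + 2)) - real (m + 1) * integral {0..pi} (\<lambda>\<theta>. cos \<theta> ^ m)"
    by (subst integral_diff)
       (auto intro!: integrable_continuous_interval continuous_intros simp del: power_Suc of_nat_add)
  ultimately show ?thesis by (simp add: algebra_simps)
qed

lemma integral_cos_power_even:
  "integral {0..pi} (\<lambda>\<theta>. cos \<theta> ^ (2 * k)) = pi * fact (2 * k) / (4 ^ k * (fact k)\<^sup>2)"
proof (induction k)
  case 0 then show ?case by simp
next
  case (Suc k)
  have "integral {0..pi} (\<lambda>\<theta>. cos \<theta> ^ (2 * Suc k)) * real (2 * k + 2)
      = real (2 * k + 1) * (pi * fact (2 * k) / (4 ^ k * (fact k)\<^sup>2))"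
    using integral_cos_power_recurrence[of "2 * k"] Suc.IH by simp
  then have "integral {0..pi} (\<lambda>\<theta>. cos \<theta> ^ (2 * Suc k))
      = real (2 * k + 1) * (pi * fact (2 * k) / (4 ^ k * (fact k)\<^sup>2)) / real (2 * k + 2)"
    by (intro eq_divide_imp) auto
  also have "\<dots> = pi * fact (2 * Suc k) / (4 ^ Suc k * (fact (Suc k))\<^sup>2)"
    by (simp add: divide_simps power2_eq_square) (simp add: algebra_simps)
  finally show ?case .
qed

lemma integral_cos_power_odd:
  "integral {0..pi} (\<lambda>\<theta>. cos \<theta> ^ (2 * k + 1)) = 0"
proof (induction k)
  case 0
  have "((\<lambda>\<theta>. cos \<theta>) has_integral sin pi - sin 0) {0..pi}"
    by (rule fundamental_theorem_of_calculus)
       (auto intro!: derivative_eq_intros simp: has_real_derivative_iff_has_vector_derivative[symmetric])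
  then show ?case by (simp add: integral_unique)
next
  case (Suc k)
  show ?case using integral_cos_power_recurrence[of "2 * k + 1"] Suc.IH by simp
qed

text \<open>The modified Bessel functions \<open>I0\<close> and \<open>I1\<close>. Their integral representation is used as the definition because it gives the growth bound \<open>exp \<bar>Re z\<bar>\<close> at once; the power series follows.\<close>

definition mbessel0 :: "complex \<Rightarrow> complex" where
  "mbessel0 z = integral {0..pi} (\<lambda>\<theta>. exp (z * of_real (cos \<theta>))) / of_real pi"

definition mbessel1 :: "complex \<Rightarrow> complex" where
  "mbessel1 z = integral {0..pi} (\<lambda>\<theta>. of_real (cos \<theta>) * exp (z * of_real (cos \<theta>))) / of_real pi"

text \<open>One interchange of sum and integral serves both functions: \<open>p = 0\<close> for \<open>I0\<close> and \<open>p = 1\<close> for \<open>I1\<close>.\<close>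

lemma integral_cos_power_exp_sums:
  fixes z :: complex
  shows
  "(\<lambda>m. z ^ m / fact m * of_real (integral {0..pi} (\<lambda>\<theta>. cos \<theta> ^ (m + p)))) sums
     integral {0..pi} (\<lambda>\<theta>. of_real (cos \<theta>) ^ p * exp (z * of_real (cos \<theta>)))"
proof -
  have ul: "uniform_limit {0..pi} (\<lambda>n \<theta>. \<Sum>m<n. z ^ m / fact m * of_real (cos \<theta> ^ (m + p)))
      (\<lambda>\<theta>. \<Sum>m. z ^ m / fact m * of_real (cos \<theta> ^ (m + p))) sequentially"
  proof (rule Weierstrass_m_test)
    fix m :: nat and \<theta> :: real
    have "\<bar>cos \<theta>\<bar> ^ (m + p) \<le> 1" by (simp add: power_le_one)
    then have "norm z ^ m / fact m * \<bar>cos \<theta>\<bar> ^ (m + p) \<le> norm z ^ m / fact m"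
      by (intro mult_left_le) auto
    then show "norm (z ^ m / fact m * of_real (cos \<theta> ^ (m + p))) \<le> norm z ^ m / fact m"
      by (simp only: norm_mult norm_divide norm_power norm_of_real power_abs norm_fact)
  next
    show "summable (\<lambda>m. norm z ^ m / fact m)"
      using summable_exp[of "norm z"] by (simp add: field_simps)
  qed
  have eq: "(\<Sum>m. z ^ m / fact m * of_real (cos \<theta> ^ (m + p))) = of_real (cos \<theta>) ^ p * exp (z * of_real (cos \<theta>))" for \<theta>
  proof -
    have "(\<lambda>m. (z * of_real (cos \<theta>)) ^ m /\<^sub>R fact m) sums exp (z * of_real (cos \<theta>))"
      by (rule exp_converges)
    then have "(\<lambda>m. of_real (cos \<theta>) ^ p * ((z * of_real (cos \<theta>)) ^ m /\<^sub>R fact m)) sums (of_real (cos \<theta>) ^ p * exp (z * of_real (cos \<theta>)))"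
      by (rule sums_mult)
    moreover have "(\<lambda>m. of_real (cos \<theta>) ^ p * ((z * of_real (cos \<theta>)) ^ m /\<^sub>R fact m)) =
        (\<lambda>m. z ^ m / fact m * of_real (cos \<theta> ^ (m + p)))"
      by (auto simp: power_mult_distrib power_add scaleR_conv_of_real field_simps)
    ultimately show ?thesis by (simp add: sums_iff)
  qed
  obtain I J where I: "\<And>n. ((\<lambda>\<theta>. \<Sum>m<n. z ^ m / fact m * of_real (cos \<theta> ^ (m + p))) has_integral I n) {0..pi}"
    and J: "((\<lambda>\<theta>. \<Sum>m. z ^ m / fact m * of_real (cos \<theta> ^ (m + p))) has_integral J) {0..pi}"
    and IJ: "I \<longlonglongrightarrow> J"
    by (rule uniform_limit_integral[OF ul]) (auto intro!: continuous_intros)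
  have "I n = (\<Sum>m<n. z ^ m / fact m * of_real (integral {0..pi} (\<lambda>\<theta>. cos \<theta> ^ (m + p))))" for n
  proof (rule has_integral_unique[OF I], rule has_integral_sum)
    fix m
    have "((\<lambda>\<theta>. cos \<theta> ^ (m + p)) has_integral integral {0..pi} (\<lambda>\<theta>. cos \<theta> ^ (m + p))) {0..pi}"
      by (intro integrable_integral integrable_continuous_interval continuous_intros)
    then show "((\<lambda>\<theta>. z ^ m / fact m * of_real (cos \<theta> ^ (m + p))) has_integral
       z ^ m / fact m * of_real (integral {0..pi} (\<lambda>\<theta>. cos \<theta> ^ (m + p)))) {0..pi}"
      by (intro has_integral_mult_right has_integral_of_real)
  qed simp
  moreover have "J = integral {0..pi} (\<lambda>\<theta>. of_real (cos \<theta>) ^ p * exp (z * of_real (cos \<theta>)))"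
    using J unfolding eq by (simp add: integral_unique)
  moreover have "I = (\<lambda>n. \<Sum>m<n. z ^ m / fact m * of_real (integral {0..pi} (\<lambda>\<theta>. cos \<theta> ^ (m + p))))"
    using calculation(1) by blast
  ultimately show ?thesis using IJ unfolding sums_def by (simp only:)
qed

lemma mbessel0_sums: "(\<lambda>k. (z / 2) ^ (2 * k) / (fact k)\<^sup>2) sums mbessel0 z"
proof -
  let ?g = "\<lambda>m. z ^ m / fact m * of_real (integral {0..pi} (\<lambda>\<theta>. cos \<theta> ^ m))"
  have "?g sums integral {0..pi} (\<lambda>\<theta>. exp (z * of_real (cos \<theta>)))"
    using integral_cos_power_exp_sums[of z 0] by simp
  moreover have "(\<lambda>k. ?g (2 * k)) sums s \<longleftrightarrow> ?g sums s" for s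
  proof (rule sums_mono_reindex)
    fix n :: nat assume "n \<notin> range (\<lambda>k. 2 * k)"
    then have "odd n" by blast
    then obtain k where "n = 2 * k + 1" by (auto elim!: oddE)
    then show "?g n = 0" by (simp add: integral_cos_power_odd[simplified])
  qed (auto simp: strict_mono_def)
  ultimately have "(\<lambda>k. ?g (2 * k) / of_real pi) sums mbessel0 z"
    unfolding mbessel0_def by (intro sums_divide) simp
  moreover have "?g (2 * k) / of_real pi = (z / 2) ^ (2 * k) / (fact k)\<^sup>2" for k
  proof -
    have "(2 ^ k)\<^sup>2 = (4 ^ k :: complex)" by (simp add: power2_eq_square power_mult_distrib[symmetric])
    then show ?thesis
      unfolding integral_cos_power_even by (simp add: power_divide power_mult field_simps)
  qed
  ultimately show ?thesis by simp
qed

lemma mbessel1_sums: "(\<lambda>k. (z / 2) ^ (2 * k + 1) / (fact k * fact (Suc k))) sums mbessel1 z"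
proof -
  let ?g = "\<lambda>m. z ^ m / fact m * of_real (integral {0..pi} (\<lambda>\<theta>. cos \<theta> ^ (m + 1)))"
  have "?g sums integral {0..pi} (\<lambda>\<theta>. of_real (cos \<theta>) * exp (z * of_real (cos \<theta>)))"
    using integral_cos_power_exp_sums[of z 1] by simp
  moreover have "(\<lambda>k. ?g (2 * k + 1)) sums s \<longleftrightarrow> ?g sums s" for s
  proof (rule sums_mono_reindex)
    fix n :: nat assume "n \<notin> range (\<lambda>k. 2 * k + 1)"
    then have "even n" by (rule even_if_not_in_odd_range)
    then obtain k where "n = 2 * k" by blast
    then show "?g n = 0" by (simp add: integral_cos_power_odd[simplified])
  qed (auto simp: strict_mono_def)
  ultimately have "(\<lambda>k. ?g (2 * k + 1) / of_real pi) sums mbessel1 z"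
    unfolding mbessel1_def by (intro sums_divide) simp
  moreover have "?g (2 * k + 1) / of_real pi = (z / 2) ^ (2 * k + 1) / (fact k * fact (Suc k))" for k
  proof -
    have e: "2 * k + 1 + 1 = 2 * Suc k" by simp
    show ?thesis unfolding e integral_cos_power_even
      by (simp add: power_divide power_mult divide_simps power2_eq_square del: of_nat_Suc)
         (simp add: algebra_simps)
  qed
  ultimately show ?thesis by simp
qed

lemma mbessel0_has_field_derivative:
  "(mbessel0 has_field_derivative mbessel1 z) (at z within A)"
proof -
  have "((\<lambda>z. integral (cbox 0 pi) (\<lambda>\<theta>. exp (z * of_real (cos \<theta>)))) has_field_derivative
     integral (cbox 0 pi) (\<lambda>\<theta>. of_real (cos \<theta>) * exp (z * of_real (cos \<theta>)))) (at z within UNIV)"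
    by (rule leibniz_rule_field_derivative)
       (auto intro!: derivative_eq_intros integrable_continuous_interval continuous_intros simp: case_prod_unfold)
  then have "((\<lambda>z. integral {0..pi} (\<lambda>\<theta>. exp (z * of_real (cos \<theta>))) / of_real pi) has_field_derivative
     integral {0..pi} (\<lambda>\<theta>. of_real (cos \<theta>) * exp (z * of_real (cos \<theta>))) / of_real pi) (at z)"
    by (intro DERIV_cdivide) simp
  then show ?thesis unfolding mbessel0_def[abs_def] mbessel1_def
    by (rule has_field_derivative_at_within)
qed

lemma mbessel1_holomorphic: "mbessel1 holomorphic_on A"
proof -
  have "(\<lambda>z. integral (cbox 0 pi) (\<lambda>\<theta>. of_real (cos \<theta>) * exp (z * of_real (cos \<theta>)))) holomorphic_on UNIV"
    by (rule leibniz_rule_holomorphic[where fx = "\<lambda>z \<theta>. of_real (cos \<theta>) * (of_real (cos \<theta>) * exp (z * of_real (cos \<theta>)))"])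
       (auto intro!: derivative_eq_intros integrable_continuous_interval continuous_intros simp: case_prod_unfold)
  then have "(\<lambda>z. integral {0..pi} (\<lambda>\<theta>. of_real (cos \<theta>) * exp (z * of_real (cos \<theta>))) / of_real pi) holomorphic_on UNIV"
    by (intro holomorphic_intros) auto
  then show ?thesis unfolding mbessel1_def[abs_def]
    by (rule holomorphic_on_subset) simp
qed

lemma mbessel0_holomorphic: "mbessel0 holomorphic_on A"
  using mbessel0_has_field_derivative holomorphic_on_def field_differentiable_def by blast

lemma continuous_on_mbessel0 [continuous_intros]:
  "continuous_on A f \<Longrightarrow> continuous_on A (\<lambda>x. mbessel0 (f x))"
  by (rule continuous_on_compose2[OF holomorphic_on_imp_continuous_on[OF mbessel0_holomorphic[of UNIV]]]) auto

lemma continuous_on_mbessel1 [continuous_intros]: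
  "continuous_on A f \<Longrightarrow> continuous_on A (\<lambda>x. mbessel1 (f x))"
  by (rule continuous_on_compose2[OF holomorphic_on_imp_continuous_on[OF mbessel1_holomorphic[of UNIV]]]) auto

text \<open>Compared coefficient by coefficient: \<open>a\<close> below lists the Taylor coefficients of \<open>z * I1 z\<close>.\<close>

lemma z_mbessel1_has_field_derivative:
  "((\<lambda>z. z * mbessel1 z) has_field_derivative z * mbessel0 z) (at z)"
proof -
  define a :: "nat \<Rightarrow> complex" where
    "a m = (if even m \<and> m > 0 then of_nat m / (4 ^ (m div 2) * (fact (m div 2))\<^sup>2) else 0)" for m
  have S: "(\<lambda>m. a m * z ^ m) sums (z * mbessel1 z)" for z
  proof -
    have "(\<lambda>k. z * ((z / 2) ^ (2 * k + 1) / (fact k * fact (Suc k)))) sums (z * mbessel1 z)"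
      by (intro sums_mult mbessel1_sums)
    moreover have "z * ((z / 2) ^ (2 * k + 1) / (fact k * fact (Suc k))) = a (2 * Suc k) * z ^ (2 * Suc k)" for k
      unfolding a_def by (simp add: power_divide power_mult divide_simps power2_eq_square del: of_nat_Suc)
         (simp add: algebra_simps)
    moreover have "(\<lambda>k. a (2 * Suc k) * z ^ (2 * Suc k)) sums s \<longleftrightarrow> (\<lambda>m. a m * z ^ m) sums s" for s
    proof (rule sums_mono_reindex[where g = "\<lambda>k. 2 * Suc k"])
      fix n :: nat assume n: "n \<notin> range (\<lambda>k. 2 * Suc k)"
      have "\<not> (even n \<and> n > 0)"
      proof
        assume "even n \<and> n > 0"
        then obtain k where "n = 2 * k" "k > 0" by auto
        then have "n = 2 * Suc (k - 1)" by simp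
        then show False using n by blast
      qed
      then show "a n * z ^ n = 0" by (auto simp: a_def)
    qed (auto simp: strict_mono_def)
    ultimately show ?thesis by simp
  qed
  have "DERIV (\<lambda>z. \<Sum>m. a m * z ^ m) z :> (\<Sum>m. diffs a m * z ^ m)"
    by (rule termdiffs_strong_converges_everywhere) (use S in \<open>auto simp: sums_iff\<close>)
  moreover have "(\<lambda>z. \<Sum>m. a m * z ^ m) = (\<lambda>z. z * mbessel1 z)"
    using S by (auto simp: sums_iff)
  moreover have "(\<lambda>m. diffs a m * z ^ m) sums (z * mbessel0 z)"
  proof -
    have "(\<lambda>k. z * ((z / 2) ^ (2 * k) / (fact k)\<^sup>2)) sums (z * mbessel0 z)"
      by (intro sums_mult mbessel0_sums)
    moreover have "z * ((z / 2) ^ (2 * k) / (fact k)\<^sup>2) = diffs a (2 * k + 1) * z ^ (2 * k + 1)" for k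
      unfolding a_def diffs_def
      by (simp add: power_divide power_mult divide_simps power2_eq_square del: of_nat_Suc)
         (simp add: algebra_simps)
    moreover have "(\<lambda>k. diffs a (2 * k + 1) * z ^ (2 * k + 1)) sums s \<longleftrightarrow> (\<lambda>m. diffs a m * z ^ m) sums s" for s
    proof (rule sums_mono_reindex[where g = "\<lambda>k. 2 * k + 1"])
      fix n :: nat assume "n \<notin> range (\<lambda>k. 2 * k + 1)"
      then have "even n" by (rule even_if_not_in_odd_range)
      then show "diffs a n * z ^ n = 0" by (simp add: diffs_def a_def)
    qed (auto simp: strict_mono_def)
    ultimately show ?thesis by simp
  qed
  ultimately show ?thesis by (simp add: sums_iff)
qed

lemma norm_exp_mult_cos_le: "norm (exp (z * of_real (cos \<theta>))) \<le> exp \<bar>Re z\<bar>"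
proof -
  have "Re z * cos \<theta> \<le> \<bar>Re z * cos \<theta>\<bar>" by simp
  also have "\<dots> \<le> \<bar>Re z\<bar>" by (simp add: abs_mult mult_left_le)
  finally show ?thesis by (simp add: norm_exp_eq_Re)
qed

lemma norm_mbessel0_le: "norm (mbessel0 z) \<le> exp \<bar>Re z\<bar>"
proof -
  have "norm (integral {0..pi} (\<lambda>\<theta>. exp (z * of_real (cos \<theta>)))) \<le> exp \<bar>Re z\<bar> * (pi - 0)"
    by (rule integral_bound) (auto intro!: continuous_intros norm_exp_mult_cos_le simp del: norm_exp_eq_Re)
  then show ?thesis by (simp add: mbessel0_def norm_divide field_simps)
qed

lemma norm_mbessel1_le: "norm (mbessel1 z) \<le> exp \<bar>Re z\<bar>"
proof -
  have *: "norm (of_real (cos \<theta>) * exp (z * of_real (cos \<theta>))) \<le> exp \<bar>Re z\<bar>" for \<theta>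
    using mult_mono[OF abs_cos_le_one[of \<theta>] norm_exp_mult_cos_le[of z \<theta>]] by (simp add: norm_mult)
  have "norm (integral {0..pi} (\<lambda>\<theta>. of_real (cos \<theta>) * exp (z * of_real (cos \<theta>)))) \<le> exp \<bar>Re z\<bar> * (pi - 0)"
    by (rule integral_bound) (use * in \<open>auto intro!: continuous_intros\<close>)
  then show ?thesis by (simp add: mbessel1_def norm_divide field_simps)
qed

lemma mbessel0_minus: "mbessel0 (- z) = mbessel0 z"
  using mbessel0_sums[of z] mbessel0_sums[of "-z"] by (simp add: sums_iff power_mult)

section \<open>The Bessel functions J0 and J1 on the imaginary axis\<close>

lemma imaginary_half_power_even: "(\<i> * z / 2) ^ (2 * k) = (-1) ^ k * (z / 2) ^ (2 * k)"
proof (induction k)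
  case (Suc k)
  have "(\<i> * z / 2) ^ (2 * Suc k) = (\<i> * z / 2) ^ 2 * (\<i> * z / 2) ^ (2 * k)"
    by (simp add: power2_eq_square)
  also have "(\<i> * z / 2) ^ 2 = - ((z / 2) ^ 2)" by (simp add: power_mult_distrib power_divide)
  finally show ?case unfolding Suc.IH by (simp add: power2_eq_square)
qed simp

text \<open>The classical \<open>J1 t = - \<i> * I1 (\<i> * t)\<close>, taken as an imaginary part to have a real value.\<close>

definition bessel_J1 :: "real \<Rightarrow> real" where
  "bessel_J1 t = Im (mbessel1 (\<i> * of_real t))"

lemma mbessel0_imaginary: "mbessel0 (\<i> * of_real t) = of_real (bessel_J0 t)"
proof -
  have "complex_of_real ((-1) ^ k * (t / 2) ^ (2 * k) / (fact k)\<^sup>2) = (\<i> * of_real t / 2) ^ (2 * k) / (fact k)\<^sup>2" for k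
    unfolding imaginary_half_power_even by simp
  then have *: "(\<lambda>k. complex_of_real ((-1) ^ k * (t / 2) ^ (2 * k) / (fact k)\<^sup>2)) sums mbessel0 (\<i> * of_real t)"
    using mbessel0_sums[of "\<i> * of_real t"] by (simp only:)
  from sums_Re[OF *] have "Re (mbessel0 (\<i> * of_real t)) = bessel_J0 t"
    unfolding Re_complex_of_real by (simp add: bessel_J0_def sums_iff)
  moreover from sums_Im[OF *] have "Im (mbessel0 (\<i> * of_real t)) = 0"
    unfolding Im_complex_of_real by (simp add: sums_iff)
  ultimately show ?thesis by (simp add: complex_eq_iff)
qed

lemma mbessel0_of_real: "mbessel0 (of_real t) = of_real (Re (mbessel0 (of_real t)))"
proof -
  have "(\<lambda>k. complex_of_real ((t / 2) ^ (2 * k) / (fact k)\<^sup>2)) sums mbessel0 (of_real t)"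
    using mbessel0_sums[of "of_real t"] by simp
  then have "(\<lambda>k. 0) sums Im (mbessel0 (of_real t))"
    using sums_Im by (metis (no_types, lifting) Im_complex_of_real sums_cong)
  then show ?thesis by (simp add: complex_eq_iff sums_iff)
qed

lemma mbessel1_imaginary: "mbessel1 (\<i> * of_real t) = \<i> * of_real (bessel_J1 t)"
proof -
  have "(\<lambda>k. \<i> * complex_of_real ((-1) ^ k * (t / 2) ^ (2 * k + 1) / (fact k * fact (Suc k)))) sums mbessel1 (\<i> * of_real t)"
  proof -
    have "\<i> * complex_of_real ((-1) ^ k * (t / 2) ^ (2 * k + 1) / (fact k * fact (Suc k)))
        = (\<i> * of_real t / 2) ^ (2 * k + 1) / (fact k * fact (Suc k))" for k
      unfolding power_add imaginary_half_power_even by simp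
    then show ?thesis using mbessel1_sums[of "\<i> * of_real t"] by (simp only:)
  qed
  from sums_Re[OF this] have "(\<lambda>k. Re (\<i> * complex_of_real ((-1) ^ k * (t / 2) ^ (2 * k + 1) / (fact k * fact (Suc k))))) sums Re (mbessel1 (\<i> * of_real t))" .
  moreover have "Re (\<i> * complex_of_real c) = 0" for c by simp
  ultimately have "(\<lambda>k. 0) sums Re (mbessel1 (\<i> * of_real t))"
    by (simp only:)
  then show ?thesis by (simp add: complex_eq_iff sums_iff bessel_J1_def)
qed

lemma abs_bessel_J0_le: "\<bar>bessel_J0 t\<bar> \<le> 1"
  using norm_mbessel0_le[of "\<i> * of_real t"] by (simp add: mbessel0_imaginary)

lemma abs_bessel_J1_le: "\<bar>bessel_J1 t\<bar> \<le> 1"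
  using norm_mbessel1_le[of "\<i> * of_real t"] by (simp add: mbessel1_imaginary norm_mult)

lemma continuous_on_bessel_J0 [continuous_intros]:
  "continuous_on A f \<Longrightarrow> continuous_on A (\<lambda>x. bessel_J0 (f x))"
proof -
  have "continuous_on UNIV (\<lambda>t. Re (mbessel0 (\<i> * of_real t)))" by (auto intro!: continuous_intros)
  then have "continuous_on UNIV bessel_J0" by (simp add: mbessel0_imaginary)
  then show "continuous_on A f \<Longrightarrow> continuous_on A (\<lambda>x. bessel_J0 (f x))"
    by (rule continuous_on_compose2) auto
qed

lemma continuous_on_bessel_J1 [continuous_intros]:
  "continuous_on A f \<Longrightarrow> continuous_on A (\<lambda>x. bessel_J1 (f x))"
proof -
  have "continuous_on UNIV bessel_J1" unfolding bessel_J1_def[abs_def] by (auto intro!: continuous_intros)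
  then show "continuous_on A f \<Longrightarrow> continuous_on A (\<lambda>x. bessel_J1 (f x))"
    by (rule continuous_on_compose2) auto
qed

text \<open>This makes the integrand of \<open>F\<close> a primitive in \<open>x\<close> of Kluyver's integrand.\<close>

lemma x_bessel_J1_has_real_derivative:
  "((\<lambda>x. x * bessel_J1 (x * t)) has_real_derivative bessel_J0 (x * t) * (x * t)) (at x within A)"
proof (cases "t = 0")
  case True
  have "bessel_J1 0 = 0" using mbessel1_sums[of 0] by (simp add: bessel_J1_def sums_iff)
  then show ?thesis using True by simp
next
  case False
  have "((\<lambda>z. z * mbessel1 z) has_field_derivative z * mbessel0 z) (at z)" for z
    by (rule z_mbessel1_has_field_derivative)
  then have "((\<lambda>x. (\<lambda>z. z * mbessel1 z) (\<i> * of_real t * x)) has_field_derivative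
        ((\<i> * of_real t * of_real x) * mbessel0 (\<i> * of_real t * of_real x)) * (\<i> * of_real t)) (at (of_real x))"
    by (rule DERIV_chain2) (auto intro!: derivative_eq_intros)
  then have "((\<lambda>x. (\<i> * of_real t * complex_of_real x) * mbessel1 (\<i> * of_real t * of_real x)) has_vector_derivative
        ((\<i> * of_real t * of_real x) * mbessel0 (\<i> * of_real t * of_real x)) * (\<i> * of_real t)) (at x within A)"
    by (rule has_vector_derivative_real_field)
  then have "((\<lambda>x. Re ((\<i> * of_real t * complex_of_real x) * mbessel1 (\<i> * of_real t * of_real x))) has_real_derivative
        Re (((\<i> * of_real t * of_real x) * mbessel0 (\<i> * of_real t * of_real x)) * (\<i> * of_real t))) (at x within A)"
    by (simp only: has_real_derivative_iff_has_vector_derivative has_vector_derivative_complex_iff)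
  moreover have e: "\<i> * of_real t * complex_of_real x = \<i> * of_real (x * t)" for x
    by simp
  moreover have "Re ((\<i> * of_real (x * t)) * mbessel1 (\<i> * of_real (x * t))) = - (t * (x * bessel_J1 (x * t)))" for x
    unfolding mbessel1_imaginary by (simp add: mult_ac)
  moreover have "Re (((\<i> * of_real (x * t)) * mbessel0 (\<i> * of_real (x * t))) * (\<i> * of_real t))
     = - (t * (bessel_J0 (x * t) * (x * t)))"
    unfolding mbessel0_imaginary by (simp add: mult_ac)
  ultimately have "((\<lambda>x. - (t * (x * bessel_J1 (x * t)))) has_real_derivative - (t * (bessel_J0 (x * t) * (x * t)))) (at x within A)"
    by (simp only: )
  then have "((\<lambda>x. - (t * (x * bessel_J1 (x * t))) / (- t)) has_real_derivative - (t * (bessel_J0 (x * t) * (x * t))) / (- t)) (at x within A)"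
    by (rule DERIV_cdivide)
  then show ?thesis using False by simp
qed

section \<open>The Macdonald function K0 in the right half-plane\<close>

text \<open>Substituting \<open>y\<^sup>2 = z * (cosh u - 1)\<close> in \<open>K0 z = \<integral> exp (- z * cosh u) du\<close> gives \<open>2 * exp (- z) * \<integral> exp (- y\<^sup>2) / sqrt (y\<^sup>2 + 2 * z) dy\<close>. In this form the integral converges absolutely up to the imaginary axis, with the origin excluded, and the factor \<open>exp (- z)\<close> shows the decay.\<close>

definition half_gauss_integrand :: "complex \<Rightarrow> real \<Rightarrow> complex" where
  "half_gauss_integrand z y = of_real (exp (- y\<^sup>2)) / csqrt (of_real (y\<^sup>2) + 2 * z)"

definition macdonald0 :: "complex \<Rightarrow> complex" where
  "macdonald0 z = 2 * exp (- z) * integral {0..} (half_gauss_integrand z)"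

lemma norm_square_plus_ge:
  assumes "0 \<le> Re z"
  shows "2 * cmod z \<le> cmod (of_real (y\<^sup>2) + 2 * z)" and "y\<^sup>2 \<le> cmod (of_real (y\<^sup>2) + 2 * z)"
proof -
  have eq: "(cmod (of_real (y\<^sup>2) + 2 * z))\<^sup>2 = (y\<^sup>2)\<^sup>2 + 4 * y\<^sup>2 * Re z + (2 * cmod z)\<^sup>2"
    unfolding power_mult_distrib cmod_power2 by (simp add: power2_eq_square algebra_simps)
  show "2 * cmod z \<le> cmod (of_real (y\<^sup>2) + 2 * z)"
    by (rule power2_le_imp_le) (use assms eq in simp_all)
  show "y\<^sup>2 \<le> cmod (of_real (y\<^sup>2) + 2 * z)"
    by (rule power2_le_imp_le) (use assms eq in simp_all)
qed

lemma square_plus_notin_nonpos_Reals: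
  assumes "0 \<le> Re z" "z \<noteq> 0"
  shows "of_real (y\<^sup>2) + 2 * z \<notin> \<real>\<^sub>\<le>\<^sub>0"
proof
  assume "of_real (y\<^sup>2) + 2 * z \<in> \<real>\<^sub>\<le>\<^sub>0"
  then have "Im z = 0" "y\<^sup>2 + 2 * Re z \<le> 0" by (auto simp: complex_nonpos_Reals_iff simp del: of_real_power)
  with assms have "Re z = 0" by (smt (verit) zero_le_power2)
  with \<open>Im z = 0\<close> assms show False by (simp add: complex_eq_iff)
qed

lemma continuous_on_half_gauss_integrand [continuous_intros]:
  assumes "continuous_on A f" "continuous_on A g" "\<And>x. x \<in> A \<Longrightarrow> 0 \<le> Re (f x) \<and> f x \<noteq> 0"
  shows "continuous_on A (\<lambda>x. half_gauss_integrand (f x) (g x))"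
proof -
  have "continuous_on A (\<lambda>x. csqrt (of_real ((g x)\<^sup>2) + 2 * f x))"
    by (rule continuous_on_compose2[OF continuous_on_csqrt])
       (use assms square_plus_notin_nonpos_Reals in \<open>auto intro!: continuous_intros simp del: of_real_power\<close>)
  moreover have "csqrt (of_real ((g x)\<^sup>2) + 2 * f x) \<noteq> 0" if "x \<in> A" for x
    using square_plus_notin_nonpos_Reals[of "f x" "g x"] assms(3)[OF that] by (auto simp del: of_real_power)
  ultimately show ?thesis unfolding half_gauss_integrand_def
    by (intro continuous_intros assms) auto
qed

text \<open>From \<open>(y - 1)\<^sup>2 \<ge> 0\<close>; an exponential tail can be integrated in closed form.\<close>

lemma exp_minus_square_le: "exp (- y\<^sup>2) \<le> exp (1 - 2 * y)" for y :: real
proof -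
  have "0 \<le> (y - 1)\<^sup>2" by simp
  then have "- y\<^sup>2 \<le> 1 - 2 * y" by (simp add: power2_eq_square algebra_simps)
  then show ?thesis by simp
qed

lemma norm_half_gauss_integrand_le:
  assumes "0 \<le> Re z" "z \<noteq> 0"
  shows "cmod (half_gauss_integrand z y) \<le> exp (1 - 2 * y) / sqrt (2 * cmod z)"
proof -
  have "sqrt (2 * cmod z) \<le> sqrt (cmod (of_real (y\<^sup>2) + 2 * z))"
    using norm_square_plus_ge(1)[OF assms(1)] by simp
  moreover have "0 < sqrt (2 * cmod z)" using assms by simp
  ultimately show ?thesis unfolding half_gauss_integrand_def
    using exp_minus_square_le[of y] by (simp add: norm_divide frac_le del: of_real_power)
qed

lemma has_integral_exp_tail: "((\<lambda>y. exp (1 - 2 * y) * c) has_integral exp (1 - 2 * N) / 2 * c) {N..}" for N c :: real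
proof -
  have "((\<lambda>y. exp (- 2 * y)) has_integral exp (- 2 * N) / 2) {N..}"
    by (rule has_integral_exp_minus_to_infinity) simp
  then have "((\<lambda>y. (exp 1 * c) * exp (- 2 * y)) has_integral (exp 1 * c) * (exp (- 2 * N) / 2)) {N..}"
    by (rule has_integral_mult_right)
  then show ?thesis by (simp add: exp_diff exp_minus field_simps)
qed

lemma half_gauss_integrand_integrable:
  assumes "0 \<le> Re z" "z \<noteq> 0"
  shows "half_gauss_integrand z integrable_on {N..}"
    and "cmod (integral {N..} (half_gauss_integrand z)) \<le> exp (1 - 2 * N) / 2 / sqrt (2 * cmod z)"
proof -
  have c: "continuous_on {N..} (half_gauss_integrand z)"
    using assms continuous_on_half_gauss_integrand[of "{N..}" "\<lambda>_. z" "\<lambda>y. y"] by (auto intro: continuous_intros)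
  have d: "((\<lambda>y. exp (1 - 2 * y) / sqrt (2 * cmod z)) has_integral exp (1 - 2 * N) / 2 / sqrt (2 * cmod z)) {N..}"
    using has_integral_exp_tail[of "1 / sqrt (2 * cmod z)" N] by simp
  show i: "half_gauss_integrand z integrable_on {N..}"
    by (rule measurable_bounded_by_integrable_imp_integrable[OF continuous_imp_measurable_on_sets_lebesgue[OF c]
          has_integral_integrable[OF d] norm_half_gauss_integrand_le[OF assms]]) auto
  show "cmod (integral {N..} (half_gauss_integrand z)) \<le> exp (1 - 2 * N) / 2 / sqrt (2 * cmod z)"
    using integral_norm_bound_integral[OF i has_integral_integrable[OF d] norm_half_gauss_integrand_le[OF assms]]
    unfolding integral_unique[OF d] by simp
qed

lemma half_gauss_integrand_uniform_limit:
  assumes "\<And>z. z \<in> S \<Longrightarrow> 0 \<le> Re z \<and> \<delta> \<le> cmod z" "0 < \<delta>"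
  shows "uniform_limit S (\<lambda>N z. integral {0..real N} (half_gauss_integrand z))
           (\<lambda>z. integral {0..} (half_gauss_integrand z)) sequentially"
proof (rule uniform_limitI)
  fix e :: real assume "0 < e"
  have "(\<lambda>N::nat. exp (1 - 2 * real N) / 2) \<longlonglongrightarrow> 0" by real_asymp
  then have "(\<lambda>N::nat. exp (1 - 2 * real N) / 2 / sqrt (2 * \<delta>)) \<longlonglongrightarrow> 0"
    by (rule tendsto_divide_zero)
  then have "\<forall>\<^sub>F N in sequentially. exp (1 - 2 * real N) / 2 / sqrt (2 * \<delta>) < e"
    using \<open>0 < e\<close> by (rule order_tendstoD)
  then show "\<forall>\<^sub>F N in sequentially. \<forall>z\<in>S. dist (integral {0..real N} (half_gauss_integrand z))
      (integral {0..} (half_gauss_integrand z)) < e"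
  proof eventually_elim
    case (elim N)
    show ?case
    proof
      fix z assume "z \<in> S"
      then have z: "0 \<le> Re z" "\<delta> \<le> cmod z" "z \<noteq> 0" using assms by force+
      have "((half_gauss_integrand z) has_integral
         integral {0..real N} (half_gauss_integrand z) + integral {real N..} (half_gauss_integrand z)) ({0..real N} \<union> {real N..})"
      proof (rule has_integral_Un)
        show "(half_gauss_integrand z has_integral integral {0..real N} (half_gauss_integrand z)) {0..real N}"
          by (rule integrable_integral, rule integrable_on_subinterval[OF half_gauss_integrand_integrable(1)[OF z(1,3), of 0]]) auto
        show "(half_gauss_integrand z has_integral integral {real N..} (half_gauss_integrand z)) {real N..}"
          by (rule integrable_integral, rule half_gauss_integrand_integrable(1)[OF z(1,3)])
        have "{0..real N} \<inter> {real N..} = {real N}" by auto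
        then show "negligible ({0..real N} \<inter> {real N..})" by simp
      qed
      moreover have "{0..real N} \<union> {real N..} = {0..}" by auto
      ultimately have "integral {0..} (half_gauss_integrand z) =
        integral {0..real N} (half_gauss_integrand z) + integral {real N..} (half_gauss_integrand z)"
        by (simp add: integral_unique)
      then have "dist (integral {0..real N} (half_gauss_integrand z)) (integral {0..} (half_gauss_integrand z))
         = cmod (integral {real N..} (half_gauss_integrand z))" by (simp add: dist_norm)
      also have "\<dots> \<le> exp (1 - 2 * real N) / 2 / sqrt (2 * cmod z)"
        by (rule half_gauss_integrand_integrable(2)[OF z(1,3)])
      also have "\<dots> \<le> exp (1 - 2 * real N) / 2 / sqrt (2 * \<delta>)"
        using z assms(2) by (intro divide_left_mono) auto
      also have "\<dots> < e" by fact
      finally show "dist (integral {0..real N} (half_gauss_integrand z)) (integral {0..} (half_gauss_integrand z)) < e" .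
    qed
  qed
qed

lemma continuous_on_macdonald0: "continuous_on {z. 0 \<le> Re z \<and> z \<noteq> 0} macdonald0"
proof -
  have "continuous_on {z. 0 \<le> Re z \<and> \<delta> \<le> cmod z} (\<lambda>z. integral {0..} (half_gauss_integrand z))" if "\<delta> > 0" for \<delta>
  proof (rule uniform_limit_theorem)
    show "uniform_limit {z. 0 \<le> Re z \<and> \<delta> \<le> cmod z} (\<lambda>N z. integral {0..real N} (half_gauss_integrand z))
           (\<lambda>z. integral {0..} (half_gauss_integrand z)) sequentially"
      by (rule half_gauss_integrand_uniform_limit[OF _ that]) auto
    have "continuous_on {z. 0 \<le> Re z \<and> \<delta> \<le> cmod z} (\<lambda>z. integral (cbox 0 (real N)) (half_gauss_integrand z))" for N
      by (rule integral_continuous_on_param) (use that in \<open>auto intro!: continuous_intros simp: case_prod_unfold\<close>)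
    then show "\<forall>\<^sub>F N in sequentially. continuous_on {z. 0 \<le> Re z \<and> \<delta> \<le> cmod z} (\<lambda>z. integral {0..real N} (half_gauss_integrand z))"
      by simp
  qed simp
  then have *: "continuous_on {z. 0 \<le> Re z \<and> \<delta> \<le> cmod z} macdonald0" if "\<delta> > 0" for \<delta>
    unfolding macdonald0_def[abs_def] using that by (intro continuous_intros) auto
  show ?thesis unfolding continuous_on_eq_continuous_within
  proof
    fix z assume z: "z \<in> {z. 0 \<le> Re z \<and> z \<noteq> 0}"
    have "continuous (at z within {w. 0 \<le> Re w \<and> cmod z / 2 \<le> cmod w}) macdonald0"
      using *[of "cmod z / 2"] z by (auto simp: continuous_on_eq_continuous_within)
    moreover have "at z within {w. 0 \<le> Re w \<and> cmod z / 2 \<le> cmod w} = at z within {z. 0 \<le> Re z \<and> z \<noteq> 0}"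
    proof (rule at_within_nhd[of _ "{w. cmod w > cmod z / 2}"])
      show "open {w. cmod w > cmod z / 2}" by (intro open_Collect_less continuous_intros)
    qed (use z in auto)
    ultimately show "continuous (at z within {z. 0 \<le> Re z \<and> z \<noteq> 0}) macdonald0" by simp
  qed
qed

text \<open>Locally uniform limit of integrals over bounded intervals, each of which may be differentiated under the integral sign.\<close>

lemma macdonald0_holomorphic: "macdonald0 holomorphic_on {z. 0 < Re z}"
proof -
  have "(\<lambda>z. integral {0..} (half_gauss_integrand z)) holomorphic_on {z. 0 < Re z}"
  proof (rule holomorphic_uniform_sequence)
    show "open {z. 0 < Re z}" by (rule open_halfspace_Re_gt)
    fix N :: nat
    have "(\<lambda>z. integral (cbox 0 (real N)) (half_gauss_integrand z)) holomorphic_on {z. 0 < Re z}"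
    proof (rule leibniz_rule_holomorphic)
      fix z y assume z: "z \<in> {z. 0 < Re z}"
      have "z \<noteq> 0" "0 \<le> Re z" using z by auto
      then have nz: "csqrt (of_real (y\<^sup>2) + 2 * z) \<noteq> 0" and nn: "of_real (y\<^sup>2) + 2 * z \<notin> \<real>\<^sub>\<le>\<^sub>0"
        using square_plus_notin_nonpos_Reals[of z y] by (auto simp del: of_real_power)
      have "((\<lambda>z. of_real (exp (- y\<^sup>2)) / csqrt (of_real (y\<^sup>2) + 2 * z)) has_field_derivative
        of_real (exp (- y\<^sup>2)) * (- (2 / (2 * csqrt (of_real (y\<^sup>2) + 2 * z))) / (csqrt (of_real (y\<^sup>2) + 2 * z))\<^sup>2)) (at z within {z. 0 < Re z})"
        by (rule derivative_eq_intros refl nn nz | simp add: power2_eq_square del: of_real_power power2_csqrt)+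
      then show "((\<lambda>z. half_gauss_integrand z y) has_field_derivative
          - (half_gauss_integrand z y / (of_real (y\<^sup>2) + 2 * z))) (at z within {z. 0 < Re z})"
        unfolding half_gauss_integrand_def by (simp del: of_real_power)
    next
      fix z assume "z \<in> {z. 0 < Re z}"
      then show "half_gauss_integrand z integrable_on cbox 0 (real N)"
        by (intro integrable_continuous continuous_on_half_gauss_integrand[of _ "\<lambda>_. z" "\<lambda>y. y"]) (auto intro: continuous_intros)
    next
      have "of_real (y\<^sup>2) + 2 * z \<noteq> 0" if "0 < Re z" for z y
      proof -
        have "z \<noteq> 0" "0 \<le> Re z" using that by auto
        then show ?thesis using square_plus_notin_nonpos_Reals[of z y] by (auto simp del: of_real_power)
      qed
      then show "continuous_on ({z. 0 < Re z} \<times> cbox 0 (real N))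
         (\<lambda>(z, y). - (half_gauss_integrand z y / (of_real (y\<^sup>2) + 2 * z)))"
        unfolding case_prod_unfold
        by (intro continuous_intros) (auto simp del: of_real_power)
    next
      show "convex {z. 0 < Re z}" by (rule convex_halfspace_Re_gt)
    qed
    then show "(\<lambda>z. integral {0..real N} (half_gauss_integrand z)) holomorphic_on {z. 0 < Re z}" by simp
  next
    fix z assume z: "z \<in> {z. 0 < Re z}"
    obtain d where d: "d > 0" "cball z d \<subseteq> {z. 0 < Re z}"
      using open_contains_cball open_halfspace_Re_gt z by blast
    have "compact (cball z d)" by simp
    have "cball z (min d (Re z / 2)) \<subseteq> cball z d" by auto
    moreover have "Re z / 2 \<le> cmod w" if "w \<in> cball z (min d (Re z / 2))" for w
    proof -
      have "\<bar>Re z - Re w\<bar> \<le> Re z / 2" using that abs_Re_le_cmod[of "z - w"] by (auto simp: dist_norm)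
      then have "Re z / 2 \<le> Re w" by linarith
      then show ?thesis using complex_Re_le_cmod[of w] by linarith
    qed
    ultimately have "uniform_limit (cball z (min d (Re z / 2))) (\<lambda>N z. integral {0..real N} (half_gauss_integrand z))
           (\<lambda>z. integral {0..} (half_gauss_integrand z)) sequentially"
      using d z by (intro half_gauss_integrand_uniform_limit[of _ "Re z / 2"]) force+
    then show "\<exists>d>0. cball z d \<subseteq> {z. 0 < Re z} \<and> uniform_limit (cball z d) (\<lambda>N z. integral {0..real N} (half_gauss_integrand z))
           (\<lambda>z. integral {0..} (half_gauss_integrand z)) sequentially"
      using d z by (intro exI[of _ "min d (Re z / 2)"]) force
  qed
  then show ?thesis unfolding macdonald0_def[abs_def] by (intro holomorphic_intros)
qed

text \<open>Both \<open>y\<^sup>2\<close> and \<open>2 * cmod z\<close> are lower bounds of \<open>cmod (y\<^sup>2 + 2 * z)\<close>, and the bound interpolates between them: \<open>\<epsilon> = 1/2\<close> gives the decay at infinity, while a small \<open>\<epsilon>\<close> replaces the logarithmic singularity at \<open>0\<close> by an arbitrarily weak power.\<close>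

lemma macdonald0_bound:
  assumes "0 < \<epsilon>" "\<epsilon> \<le> 1/2"
  obtains C where "C > 0" "\<And>z. 0 \<le> Re z \<Longrightarrow> z \<noteq> 0 \<Longrightarrow> cmod (macdonald0 z) \<le> C * exp (- Re z) * cmod z powr (- \<epsilon>)"
proof
  define C where "C = 2 * exp 1 * Gamma (2 * \<epsilon>)"
  show "C > 0" using assms by (auto simp: C_def intro: Gamma_real_pos)
  fix z :: complex assume z: "0 \<le> Re z" "z \<noteq> 0"
  let ?g = "\<lambda>y. if y = 0 then 0 else half_gauss_integrand z y"
  let ?h = "\<lambda>y. y powr (2 * \<epsilon> - 1) / exp y * (exp 1 * cmod z powr (- \<epsilon>))"
  have eq: "integral {0..} (half_gauss_integrand z) = integral {0..} ?g"
    by (rule integral_spike[of "{0}"]) auto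
  have gi: "?g integrable_on {0..}"
    by (rule integrable_spike[OF half_gauss_integrand_integrable(1)[OF z], of "{0}"]) auto
  have hi: "(?h has_integral Gamma (2 * \<epsilon>) * (exp 1 * cmod z powr (- \<epsilon>))) {0..}"
    using assms by (intro has_integral_mult_left Gamma_integral_real) auto
  have "cmod (integral {0..} ?g) \<le> integral {0..} ?h"
  proof (rule integral_norm_bound_integral[OF gi has_integral_integrable[OF hi]])
    fix y :: real assume y: "y \<in> {0..}"
    show "norm (?g y) \<le> ?h y"
    proof (cases "y = 0")
      case False
      with y have "y > 0" by simp
      let ?m = "cmod (of_real (y\<^sup>2) + 2 * z)"
      have m: "2 * cmod z \<le> ?m" "y\<^sup>2 \<le> ?m" using norm_square_plus_ge[OF z(1)] by auto
      have m0: "?m > 0" using m z by (smt (verit) zero_less_norm_iff)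
      have "(y\<^sup>2) powr (1/2 - \<epsilon>) = (y powr 2) powr (1/2 - \<epsilon>)"
        using \<open>y > 0\<close> by (simp add: powr_numeral)
      then have "y powr (1 - 2 * \<epsilon>) * cmod z powr \<epsilon> = (y\<^sup>2) powr (1/2 - \<epsilon>) * cmod z powr \<epsilon>"
        unfolding powr_powr by (simp add: algebra_simps)
      also have "\<dots> \<le> ?m powr (1/2 - \<epsilon>) * ?m powr \<epsilon>"
        using m assms z by (intro mult_mono powr_mono2) (auto simp del: of_real_power intro: order_trans[of _ "2 * cmod z"])
      also have "\<dots> = sqrt ?m" using m0 by (simp add: powr_add[symmetric] powr_half_sqrt del: of_real_power)
      finally have "y powr (1 - 2 * \<epsilon>) * cmod z powr \<epsilon> \<le> sqrt ?m" .
      moreover have "exp (- y\<^sup>2) \<le> exp 1 / exp y"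
        using exp_minus_square_le[of y] \<open>y > 0\<close> by (smt (verit) exp_diff exp_le_cancel_iff)
      ultimately have "exp (- y\<^sup>2) / sqrt ?m \<le> exp 1 / exp y / (y powr (1 - 2 * \<epsilon>) * cmod z powr \<epsilon>)"
        using z \<open>y > 0\<close> by (intro frac_le) auto
      also have "\<dots> = ?h y" using z \<open>y > 0\<close> by (simp add: powr_minus powr_diff field_simps)
      finally show ?thesis using False by (simp add: half_gauss_integrand_def norm_divide del: of_real_power)
    qed simp
  qed
  also have "integral {0..} ?h = Gamma (2 * \<epsilon>) * (exp 1 * cmod z powr (- \<epsilon>))"
    using hi by (simp add: integral_unique)
  finally show "cmod (macdonald0 z) \<le> C * exp (- Re z) * cmod z powr (- \<epsilon>)"
    unfolding macdonald0_def eq C_def by (simp add: norm_mult mult_left_mono algebra_simps)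
qed

lemma half_gauss_integrand_cnj:
  assumes "0 \<le> Re z" "z \<noteq> 0"
  shows "half_gauss_integrand (cnj z) y = cnj (half_gauss_integrand z y)"
  using cnj_csqrt[OF square_plus_notin_nonpos_Reals[OF assms, of y]]
  by (simp add: half_gauss_integrand_def)

lemma macdonald0_cnj:
  assumes "0 \<le> Re z" "z \<noteq> 0"
  shows "macdonald0 (cnj z) = cnj (macdonald0 z)"
proof -
  have "integral {0..} (half_gauss_integrand (cnj z)) = cnj (integral {0..} (half_gauss_integrand z))"
    unfolding half_gauss_integrand_cnj[OF assms] by (simp add: integral_cnj)
  then show ?thesis by (simp add: macdonald0_def exp_cnj)
qed

lemma macdonald0_of_real:
  assumes "\<tau> > 0"
  shows "macdonald0 (of_real \<tau>) = of_real (Re (macdonald0 (of_real \<tau>)))"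
  using macdonald0_cnj[of "of_real \<tau>"] assms by (simp add: complex_eq_iff)

text \<open>Restrict the integral to \<open>y \<le> 1\<close>.\<close>

lemma macdonald0_lower_bound:
  assumes "\<tau> \<ge> 1"
  shows "exp (-1) * exp (- \<tau>) / sqrt \<tau> \<le> Re (macdonald0 (of_real \<tau>))"
proof -
  have "half_gauss_integrand (of_real \<tau>) = (\<lambda>y. of_real (exp (- y\<^sup>2) / sqrt (y\<^sup>2 + 2 * \<tau>)))"
    using assms by (auto simp: half_gauss_integrand_def fun_eq_iff)
  moreover have "half_gauss_integrand (of_real \<tau>) integrable_on {0..}"
    using assms by (intro half_gauss_integrand_integrable) auto
  ultimately have i: "(\<lambda>y. complex_of_real (exp (- y\<^sup>2) / sqrt (y\<^sup>2 + 2 * \<tau>))) integrable_on {0..}"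
     and e: "integral {0..} (half_gauss_integrand (of_real \<tau>)) = integral {0..} (\<lambda>y. complex_of_real (exp (- y\<^sup>2) / sqrt (y\<^sup>2 + 2 * \<tau>)))"
    by simp_all
  let ?f = "\<lambda>y. exp (- y\<^sup>2) / sqrt (y\<^sup>2 + 2 * \<tau>)"
  have i': "?f integrable_on {0..}"
    using integrable_linear[OF i bounded_linear_Re] by (simp add: o_def)
  have "exp (-1) / sqrt (1 + 2 * \<tau>) = integral {0..1::real} (\<lambda>y. exp (-1) / sqrt (1 + 2 * \<tau>))" by simp
  also have "\<dots> \<le> integral {0..1} ?f"
  proof (rule integral_le)
    show "?f integrable_on {0..1}" by (rule integrable_on_subinterval[OF i']) auto
    fix y :: real assume "y \<in> {0..1}"
    then have "y\<^sup>2 \<le> 1" by (simp add: power_le_one)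
    then show "exp (-1) / sqrt (1 + 2 * \<tau>) \<le> ?f y" using assms by (intro frac_le) (auto simp: add_nonneg_pos)
  qed (rule integrable_const_ivl)
  also have "\<dots> \<le> integral {0..} ?f"
    by (rule integral_subset_le[OF _ integrable_on_subinterval[OF i'] i']) (use assms in auto)
  finally have *: "exp (-1) / sqrt (1 + 2 * \<tau>) \<le> integral {0..} ?f" .
  have "sqrt (1 + 2 * \<tau>) \<le> sqrt (4 * \<tau>)" using assms by simp
  then have "exp (-1) / (2 * sqrt \<tau>) \<le> exp (-1) / sqrt (1 + 2 * \<tau>)"
    using assms by (intro divide_left_mono) (auto simp: real_sqrt_mult)
  with * have "exp (-1) / (2 * sqrt \<tau>) \<le> integral {0..} ?f" by simp
  then have "(2 * exp (- \<tau>)) * (exp (-1) / (2 * sqrt \<tau>)) \<le> (2 * exp (- \<tau>)) * integral {0..} ?f"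
    by (intro mult_left_mono) auto
  moreover have "macdonald0 (of_real \<tau>) = of_real (2 * exp (- \<tau>) * integral {0..} ?f)"
    unfolding macdonald0_def e using has_integral_of_real[OF integrable_integral[OF i'], where 'b = complex]
    by (simp add: exp_of_real integral_unique flip: of_real_minus)
  ultimately show ?thesis by (simp add: mult_ac)
qed

section \<open>J0 in terms of K0, and its decay\<close>

lemma csqrt_scaled: "r > 0 \<Longrightarrow> csqrt (of_real (r\<^sup>2) * w) = of_real r * csqrt w"
  by (rule csqrt_unique) (use csqrt_principal[of w] in \<open>auto simp: power_mult_distrib\<close>)

lemma one_minus_square_notin_nonpos_Reals:
  assumes "0 < Im u" shows "1 - u\<^sup>2 \<notin> \<real>\<^sub>\<le>\<^sub>0"
proof
  assume "1 - u\<^sup>2 \<in> \<real>\<^sub>\<le>\<^sub>0"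
  then have "Im (u\<^sup>2) = 0" "Re (u\<^sup>2) \<ge> 1" by (auto simp: complex_nonpos_Reals_iff)
  then have "Re u = 0" using assms by (auto simp: power2_eq_square)
  with \<open>Re (u\<^sup>2) \<ge> 1\<close> show False by (simp add: power2_eq_square) (smt (verit) zero_le_square)
qed

lemma norm_one_minus_square_ge:
  "\<bar>Im u\<bar>\<^sup>2 \<le> cmod (1 - u\<^sup>2)" "\<bar>1 - (Re u)\<^sup>2\<bar> \<le> cmod (1 - u\<^sup>2)"
proof -
  have "1 - u\<^sup>2 = (1 - u) * (1 + u)" by (simp add: power2_eq_square algebra_simps)
  then have e: "cmod (1 - u\<^sup>2) = cmod (1 - u) * cmod (1 + u)" by (simp add: norm_mult)
  have "\<bar>Im u\<bar> * \<bar>Im u\<bar> \<le> cmod (1 - u) * cmod (1 + u)"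
    using abs_Im_le_cmod[of "1 - u"] abs_Im_le_cmod[of "1 + u"] by (intro mult_mono) auto
  then show "\<bar>Im u\<bar>\<^sup>2 \<le> cmod (1 - u\<^sup>2)" unfolding e power2_eq_square[of "\<bar>Im u\<bar>"] .
  have "\<bar>1 - Re u\<bar> * \<bar>1 + Re u\<bar> \<le> cmod (1 - u) * cmod (1 + u)"
    using abs_Re_le_cmod[of "1 - u"] abs_Re_le_cmod[of "1 + u"] by (intro mult_mono) auto
  then show "\<bar>1 - (Re u)\<^sup>2\<bar> \<le> cmod (1 - u\<^sup>2)" unfolding e abs_mult[symmetric]
    by (simp add: power2_eq_square algebra_simps)
qed

text \<open>The integrand \<open>exp (\<i> * t * u) / csqrt (1 - u\<^sup>2)\<close> is holomorphic on the upper half-plane, hence has a primitive \<open>F\<close> there.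
The increment \<open>D v\<close> of \<open>F\<close> over the segment from \<open>- 1 + \<i> * v\<close> to \<open>1 + \<i> * v\<close> tends to \<open>pi * J0 t\<close> as \<open>v\<close> tends to \<open>0\<close> and to \<open>0\<close> as \<open>v\<close> grows, and
what is lost in between is the difference of the increments along the two vertical half-lines over \<open>1\<close> and \<open>- 1\<close>, which are multiples of \<open>K0\<close> at \<open>- \<i> * t\<close> and \<open>\<i> * t\<close>.
Working with a primitive above the real axis avoids the branch points \<open>1\<close> and \<open>- 1\<close>.\<close>

lemma bessel_J0_eq_macdonald0:
  assumes "t > 0"
  shows "bessel_J0 t = 2 / pi * Im (macdonald0 (- \<i> * of_real t))"
proof -
  define f where "f u = exp (\<i> * of_real t * u) / csqrt (1 - u\<^sup>2)" for u
  have "f holomorphic_on {u. 0 < Im u}"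
    unfolding f_def using one_minus_square_notin_nonpos_Reals
    by (intro holomorphic_intros) force+
  then obtain F where F: "\<And>u. u \<in> {u. 0 < Im u} \<Longrightarrow> (F has_field_derivative f u) (at u within {u. 0 < Im u})"
    using holomorphic_convex_primitive'[of "{u. 0 < Im u}" f]
    by (auto simp: convex_halfspace_Im_gt open_halfspace_Im_gt)
  have F: "(F has_field_derivative f u) (at u)" if "0 < Im u" for u
  proof -
    have "at u within {u. 0 < Im u} = at u"
      using that by (intro at_within_open) (auto simp: open_halfspace_Im_gt)
    then show ?thesis using F[of u] that by simp
  qed
  define z where "z = - \<i> * complex_of_real t"
  have z: "0 \<le> Re z" "z \<noteq> 0" "0 \<le> Re (cnj z)" "cnj z \<noteq> 0" using assms by (auto simp: z_def)
  define D where "D v = F (1 + \<i> * of_real v) - F (-1 + \<i> * of_real v)" for v :: real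
  have bottom: "((\<lambda>\<theta>. f (of_real (- cos \<theta>) + \<i> * of_real v) * of_real (sin \<theta>)) has_integral D v) {0..pi}"
    if "v > 0" for v
  proof -
    have "((\<lambda>\<theta>. f (of_real (- cos \<theta>) + \<i> * of_real v) * of_real (sin \<theta>)) has_integral
      F (of_real (- cos pi) + \<i> * of_real v) - F (of_real (- cos 0) + \<i> * of_real v)) {0..pi}"
    proof (rule fundamental_theorem_of_calculus)
      fix \<theta> :: real
      have "((\<lambda>\<theta>. of_real (- cos \<theta>) + \<i> * of_real v) has_vector_derivative of_real (sin \<theta>)) (at \<theta> within {0..pi})"
        by (auto intro!: derivative_eq_intros simp: has_vector_derivative_complex_iff)
      moreover have "(F has_field_derivative f (of_real (- cos \<theta>) + \<i> * of_real v)) (at (of_real (- cos \<theta>) + \<i> * of_real v))"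
        by (rule F) (use that in simp)
      ultimately show "((\<lambda>\<theta>. F (of_real (- cos \<theta>) + \<i> * of_real v)) has_vector_derivative
         f (of_real (- cos \<theta>) + \<i> * of_real v) * of_real (sin \<theta>)) (at \<theta> within {0..pi})"
        using field_vector_diff_chain_within[OF _ has_field_derivative_at_within] unfolding o_def mult.commute[of "f _"] by blast
    qed simp
    then show ?thesis by (simp add: D_def)
  qed
  \<comment> \<open>The height is parametrised by \<open>y\<^sup>2 / t\<close>, which turns the vertical integral into the integral over \<open>y\<close> that defines \<open>K0\<close>.\<close>
  have side: "((\<lambda>y. 2 * \<i> * exp (- (s * z)) * half_gauss_integrand (s * z) y) has_integral
       F (s + \<i> * of_real (b\<^sup>2 / t)) - F (s + \<i> * of_real (a\<^sup>2 / t))) {a..b}"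
    if "0 < a" "a \<le> b" "s = 1 \<or> s = -1" for a b and s :: complex
  proof (rule fundamental_theorem_of_calculus)
    fix y assume y: "y \<in> {a..b}"
    then have "y > 0" using that by simp
    let ?u = "s + \<i> * of_real (y\<^sup>2 / t)"
    have "((\<lambda>y. s + \<i> * of_real (y\<^sup>2 / t)) has_vector_derivative \<i> * of_real (2 * y / t)) (at y within {a..b})"
      using assms by (auto intro!: derivative_eq_intros simp: has_vector_derivative_complex_iff)
    moreover have "(F has_field_derivative f ?u) (at ?u)"
      by (rule F) (use assms \<open>y > 0\<close> that in auto)
    ultimately have "((\<lambda>y. F (s + \<i> * of_real (y\<^sup>2 / t))) has_vector_derivative
         \<i> * of_real (2 * y / t) * f ?u) (at y within {a..b})"
      using field_vector_diff_chain_within[OF _ has_field_derivative_at_within] unfolding o_def by blast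
    moreover have "\<i> * of_real (2 * y / t) * f ?u = 2 * \<i> * exp (- (s * z)) * half_gauss_integrand (s * z) y"
    proof -
      have "1 - ?u\<^sup>2 = of_real ((y / t)\<^sup>2) * (of_real (y\<^sup>2) + 2 * (s * z))"
        using that(3) assms by (auto simp: z_def power2_eq_square field_simps)
      then have "csqrt (1 - ?u\<^sup>2) = of_real (y / t) * csqrt (of_real (y\<^sup>2) + 2 * (s * z))"
        using csqrt_scaled[of "y / t"] \<open>y > 0\<close> assms by simp
      moreover have "\<i> * of_real t * ?u = - (s * z) + of_real (- y\<^sup>2)"
        using assms by (simp add: z_def algebra_simps)
      then have "exp (\<i> * of_real t * ?u) = exp (- (s * z)) * of_real (exp (- y\<^sup>2))"
        by (simp only: exp_add exp_of_real)
      ultimately have "f ?u = exp (- (s * z)) * of_real (exp (- y\<^sup>2)) / (of_real (y / t) * csqrt (of_real (y\<^sup>2) + 2 * (s * z)))"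
        unfolding f_def by (simp only:)
      then show ?thesis
        using \<open>y > 0\<close> assms by (simp add: half_gauss_integrand_def del: of_real_power)
    qed
    ultimately show "((\<lambda>y. F (s + \<i> * of_real (y\<^sup>2 / t))) has_vector_derivative
         2 * \<i> * exp (- (s * z)) * half_gauss_integrand (s * z) y) (at y within {a..b})" by simp
  qed (rule that)
  have integr: "half_gauss_integrand w integrable_on {c..d}" if "w = z \<or> w = cnj z" "0 \<le> c" for w c d
    by (rule integrable_on_subinterval[OF half_gauss_integrand_integrable(1)[of w 0]]) (use z that in auto)
  have side': "D (b\<^sup>2 / t) - D (a\<^sup>2 / t) = 2 * \<i> * exp (- z) * integral {a..b} (half_gauss_integrand z)
       - 2 * \<i> * exp (- cnj z) * integral {a..b} (half_gauss_integrand (cnj z))" if "0 < a" "a \<le> b" for a b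
  proof -
    have "cnj z = - z" by (simp add: z_def)
    have "F (1 + \<i> * of_real (b\<^sup>2 / t)) - F (1 + \<i> * of_real (a\<^sup>2 / t)) = 2 * \<i> * exp (- z) * integral {a..b} (half_gauss_integrand z)"
      using integral_unique[OF side[OF that, of 1]] by simp
    moreover have "F (-1 + \<i> * of_real (b\<^sup>2 / t)) - F (-1 + \<i> * of_real (a\<^sup>2 / t)) = 2 * \<i> * exp (- cnj z) * integral {a..b} (half_gauss_integrand (cnj z))"
      using integral_unique[OF side[OF that, of "-1"]] unfolding \<open>cnj z = - z\<close> by simp
    ultimately show ?thesis unfolding D_def by (simp add: algebra_simps)
  qed
  have top: "cmod (D v) \<le> pi / v" if "v > 0" for v
  proof -
    have "cmod (f (of_real (- cos \<theta>) + \<i> * of_real v) * of_real (sin \<theta>)) \<le> 1 / v" for \<theta>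
    proof -
      let ?u = "of_real (- cos \<theta>) + \<i> * of_real v"
      have "v = sqrt (\<bar>Im ?u\<bar>\<^sup>2)" using that by simp
      also have "\<dots> \<le> sqrt (cmod (1 - ?u\<^sup>2))" by (intro real_sqrt_le_mono norm_one_minus_square_ge)
      finally have "v \<le> sqrt (cmod (1 - ?u\<^sup>2))" .
      moreover have "exp (- (t * v)) \<le> 1" using that assms by simp
      ultimately have "cmod (f ?u) \<le> 1 / v" using that
        unfolding f_def norm_divide norm_csqrt by (intro frac_le) auto
      then have "cmod (f ?u) * \<bar>sin \<theta>\<bar> \<le> 1 / v * 1" using that by (intro mult_mono) auto
      then show ?thesis by (simp add: norm_mult)
    qed
    then have "cmod (D v) \<le> (1 / v) * measure lborel (cbox 0 pi)"
      by (intro has_integral_bound[OF _ bottom[OF that, folded cbox_interval]]) (use that in auto)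
    then show ?thesis by simp
  qed
  define a where "a n = 1 / real (n + 1)" for n
  define b where "b n = real (n + 1)" for n
  have ab: "0 < a n" "a n \<le> b n" "0 < b n" for n by (auto simp: a_def b_def field_simps)
  have lim_int: "(\<lambda>n. integral {a n..b n} (half_gauss_integrand w)) \<longlonglongrightarrow> integral {0..} (half_gauss_integrand w)"
    if "w = z \<or> w = cnj z" for w
  proof -
    have w: "0 \<le> Re w" "w \<noteq> 0" using that z by auto
    have "(\<lambda>n. integral {0..} (\<lambda>y. if y \<in> {a n..b n} then half_gauss_integrand w y else 0)) \<longlonglongrightarrow>
       integral {0..} (\<lambda>y. if y = 0 then 0 else half_gauss_integrand w y)"
    proof (rule dominated_convergence)
      show "(\<lambda>y. exp (1 - 2 * y) / sqrt (2 * cmod w)) integrable_on {0..}"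
        using has_integral_exp_tail[of "1 / sqrt (2 * cmod w)" 0] by auto
      fix n
      have "half_gauss_integrand w integrable_on {a n..b n}" using integr[OF that] ab(1)[of n] by simp
      then have "(\<lambda>y. if y \<in> {a n..b n} then half_gauss_integrand w y else 0) integrable_on {a n..b n}"
        by (rule integrable_eq) simp
      then show "(\<lambda>y. if y \<in> {a n..b n} then half_gauss_integrand w y else 0) integrable_on {0..}"
        by (rule integrable_on_superset) (use ab(1)[of n] in auto)
      fix y :: real
      show "norm (if y \<in> {a n..b n} then half_gauss_integrand w y else 0) \<le> exp (1 - 2 * y) / sqrt (2 * cmod w)"
        using norm_half_gauss_integrand_le[OF w, of y] by auto
    next
      fix y :: real assume y: "y \<in> {0..}"
      show "(\<lambda>n. if y \<in> {a n..b n} then half_gauss_integrand w y else 0) \<longlonglongrightarrow> (if y = 0 then 0 else half_gauss_integrand w y)"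
      proof (cases "y = 0")
        case True
        then have "y \<notin> {a n..b n}" for n using ab(1)[of n] by auto
        then show ?thesis using True by (simp only: if_False if_True simp_thms) simp
      next
        case False
        with y have "y > 0" by simp
        have "a \<longlonglongrightarrow> 0" unfolding a_def[abs_def] by real_asymp
        then have "\<forall>\<^sub>F n in sequentially. a n < y" using \<open>y > 0\<close> by (rule order_tendstoD)
        moreover have "filterlim b at_top sequentially" unfolding b_def[abs_def] by real_asymp
        then have "\<forall>\<^sub>F n in sequentially. y \<le> b n" by (simp add: filterlim_at_top)
        ultimately have "\<forall>\<^sub>F n in sequentially. (if y \<in> {a n..b n} then half_gauss_integrand w y else 0) = half_gauss_integrand w y"
          by eventually_elim simp
        then show ?thesis using False by (simp add: tendsto_eventually)
      qed
    qed
    moreover have "integral {0..} (\<lambda>y. if y \<in> {a n..b n} then half_gauss_integrand w y else 0) = integral {a n..b n} (half_gauss_integrand w)" for n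
    proof -
      have e: "{0..} \<inter> {a n..b n} = {a n..b n}" using ab(1)[of n] by auto
      show ?thesis by (subst integral_restrict_Int) (simp only: e Int_commute[of "{a n..b n}"])
    qed
    moreover have "integral {0..} (\<lambda>y. if y = 0 then 0 else half_gauss_integrand w y) = integral {0..} (half_gauss_integrand w)"
      by (rule integral_spike[of "{0}"]) auto
    ultimately show ?thesis by simp
  qed
  have "(\<lambda>n. D ((b n)\<^sup>2 / t) - (2 * \<i> * exp (- z) * integral {a n..b n} (half_gauss_integrand z)
       - 2 * \<i> * exp (- cnj z) * integral {a n..b n} (half_gauss_integrand (cnj z)))) \<longlonglongrightarrow>
     0 - (2 * \<i> * exp (- z) * integral {0..} (half_gauss_integrand z)
       - 2 * \<i> * exp (- cnj z) * integral {0..} (half_gauss_integrand (cnj z)))"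
  proof (intro tendsto_intros lim_int)
    show "(\<lambda>n. D ((b n)\<^sup>2 / t)) \<longlonglongrightarrow> 0"
    proof (rule Lim_null_comparison)
      show "\<forall>\<^sub>F n in sequentially. norm (D ((b n)\<^sup>2 / t)) \<le> pi / ((b n)\<^sup>2 / t)"
        using assms ab(3) by (intro always_eventually allI top divide_pos_pos zero_less_power)
      have "(\<lambda>n. pi * t / (real (n + 1))\<^sup>2) \<longlonglongrightarrow> 0" by real_asymp
      then show "(\<lambda>n. pi / ((b n)\<^sup>2 / t)) \<longlonglongrightarrow> 0" by (simp add: b_def)
    qed
  qed auto
  then have "(\<lambda>n. D ((a n)\<^sup>2 / t)) \<longlonglongrightarrow> - (2 * \<i> * exp (- z) * integral {0..} (half_gauss_integrand z)
       - 2 * \<i> * exp (- cnj z) * integral {0..} (half_gauss_integrand (cnj z)))"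
    using side'[OF ab(1,2)] by (simp add: algebra_simps)
  also have "- (2 * \<i> * exp (- z) * integral {0..} (half_gauss_integrand z)
       - 2 * \<i> * exp (- cnj z) * integral {0..} (half_gauss_integrand (cnj z))) = - \<i> * (macdonald0 z - macdonald0 (cnj z))"
    by (simp add: macdonald0_def algebra_simps)
  also have "\<dots> = of_real (2 * Im (macdonald0 z))"
    unfolding macdonald0_cnj[OF z(1,2)] by (simp add: complex_eq_iff)
  finally have lim1: "(\<lambda>n. D ((a n)\<^sup>2 / t)) \<longlonglongrightarrow> of_real (2 * Im (macdonald0 z))" .
  let ?h = "\<lambda>\<theta>. if \<theta> = 0 \<or> \<theta> = pi then 0 else exp (\<i> * of_real t * of_real (- cos \<theta>))"
  have "(\<lambda>n. integral {0..pi} (\<lambda>\<theta>. f (of_real (- cos \<theta>) + \<i> * of_real ((a n)\<^sup>2 / t)) * of_real (sin \<theta>)))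
      \<longlonglongrightarrow> integral {0..pi} ?h"
  proof (rule dominated_convergence)
    show "(\<lambda>\<theta>. 1::real) integrable_on {0..pi}" by (rule integrable_const_ivl)
    fix n
    have v: "(a n)\<^sup>2 / t > 0" using ab(1)[of n] assms by simp
    show "(\<lambda>\<theta>. f (of_real (- cos \<theta>) + \<i> * of_real ((a n)\<^sup>2 / t)) * of_real (sin \<theta>)) integrable_on {0..pi}"
      using bottom[OF v] by blast
    fix \<theta> :: real assume \<theta>: "\<theta> \<in> {0..pi}"
    show "norm (f (of_real (- cos \<theta>) + \<i> * of_real ((a n)\<^sup>2 / t)) * of_real (sin \<theta>)) \<le> 1"
    proof -
      let ?u = "of_real (- cos \<theta>) + \<i> * of_real ((a n)\<^sup>2 / t)"
      have s: "sin \<theta> \<ge> 0" using \<theta> by (simp add: sin_ge_zero)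
      have "sin \<theta> = sqrt (\<bar>1 - (Re ?u)\<^sup>2\<bar>)" using s by (simp add: sin_squared_eq[symmetric])
      also have "\<dots> \<le> sqrt (cmod (1 - ?u\<^sup>2))" by (intro real_sqrt_le_mono norm_one_minus_square_ge)
      finally have l: "sin \<theta> \<le> sqrt (cmod (1 - ?u\<^sup>2))" .
      have "cmod (exp (\<i> * of_real t * ?u)) \<le> 1" using v assms ab(1)[of n] by simp
      then have "cmod (exp (\<i> * of_real t * ?u)) * sin \<theta> \<le> 1 * sqrt (cmod (1 - ?u\<^sup>2))"
        using s l by (intro mult_mono) auto
      then show ?thesis unfolding f_def using s
        by (simp add: norm_mult norm_divide divide_le_eq_1 zero_le_mult_iff)
    qed
  next
    fix \<theta> :: real assume \<theta>: "\<theta> \<in> {0..pi}"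
    show "(\<lambda>n. f (of_real (- cos \<theta>) + \<i> * of_real ((a n)\<^sup>2 / t)) * of_real (sin \<theta>)) \<longlonglongrightarrow> ?h \<theta>"
    proof (cases "\<theta> = 0 \<or> \<theta> = pi")
      case False
      then have s: "sin \<theta> > 0" using \<theta> by (intro sin_gt_zero) auto
      have "(\<lambda>n. (a n)\<^sup>2) \<longlonglongrightarrow> 0" unfolding a_def by real_asymp
      then have "(\<lambda>n. (a n)\<^sup>2 / t) \<longlonglongrightarrow> 0" by (rule tendsto_divide_zero)
      then have "(\<lambda>n. of_real (- cos \<theta>) + \<i> * of_real ((a n)\<^sup>2 / t)) \<longlonglongrightarrow> of_real (- cos \<theta>) + \<i> * of_real 0"
        by (intro tendsto_intros)
      moreover have "isCont f (of_real (- cos \<theta>))"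
      proof -
        have e: "1 - (of_real (- cos \<theta>))\<^sup>2 = complex_of_real ((sin \<theta>)\<^sup>2)" by (simp add: sin_squared_eq)
        show ?thesis unfolding f_def
        proof (intro continuous_intros)
          show "isCont (\<lambda>u. csqrt (1 - u\<^sup>2)) (of_real (- cos \<theta>))"
          proof (rule isCont_o2[of _ _ csqrt])
            show "isCont csqrt (1 - (of_real (- cos \<theta>))\<^sup>2)"
              unfolding e using s by (intro continuous_at_csqrt) (auto simp: complex_nonpos_Reals_iff simp del: of_real_power)
          qed (intro continuous_intros)
          show "csqrt (1 - (of_real (- cos \<theta>))\<^sup>2) \<noteq> 0" unfolding e using s by simp
        qed
      qed
      ultimately have "(\<lambda>n. f (of_real (- cos \<theta>) + \<i> * of_real ((a n)\<^sup>2 / t))) \<longlonglongrightarrow> f (of_real (- cos \<theta>))"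
        using isCont_tendsto_compose by fastforce
      then have "(\<lambda>n. f (of_real (- cos \<theta>) + \<i> * of_real ((a n)\<^sup>2 / t)) * of_real (sin \<theta>)) \<longlonglongrightarrow> f (of_real (- cos \<theta>)) * of_real (sin \<theta>)"
        by (intro tendsto_intros)
      moreover have "f (of_real (- cos \<theta>)) * of_real (sin \<theta>) = ?h \<theta>"
      proof -
        have e: "1 - (of_real (- cos \<theta>))\<^sup>2 = complex_of_real ((sin \<theta>)\<^sup>2)" by (simp add: sin_squared_eq)
        have "csqrt (complex_of_real ((sin \<theta>)\<^sup>2)) = of_real (sin \<theta>)" using s by (simp del: of_real_power)
        then show ?thesis unfolding f_def e using s False by simp
      qed
      ultimately show ?thesis by simp
    qed auto
  qed
  moreover have "integral {0..pi} ?h = integral {0..pi} (\<lambda>\<theta>. exp ((- \<i> * of_real t) * of_real (cos \<theta>)))"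
    by (rule integral_spike[of "{0, pi}"]) auto
  moreover have "\<dots> = of_real (pi * bessel_J0 t)"
  proof -
    have "integral {0..pi} (\<lambda>\<theta>. exp ((- \<i> * of_real t) * of_real (cos \<theta>))) = of_real pi * mbessel0 (- (\<i> * of_real t))"
      by (simp add: mbessel0_def)
    also have "\<dots> = of_real (pi * bessel_J0 t)" unfolding mbessel0_minus mbessel0_imaginary by simp
    finally show ?thesis .
  qed
  moreover have "integral {0..pi} (\<lambda>\<theta>. f (of_real (- cos \<theta>) + \<i> * of_real ((a n)\<^sup>2 / t)) * of_real (sin \<theta>)) = D ((a n)\<^sup>2 / t)" for n
    by (rule integral_unique[OF bottom]) (use ab(1)[of n] assms in simp)
  ultimately have "(\<lambda>n. D ((a n)\<^sup>2 / t)) \<longlonglongrightarrow> of_real (pi * bessel_J0 t)" by simp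
  with lim1 have "complex_of_real (2 * Im (macdonald0 z)) = of_real (pi * bessel_J0 t)"
    by (rule LIMSEQ_unique)
  then have "2 * Im (macdonald0 z) = pi * bessel_J0 t" unfolding of_real_eq_iff .
  then show ?thesis by (simp add: z_def field_simps)
qed

lemma bessel_J0_decay:
  obtains C where "C > 0" "\<And>t. t > 0 \<Longrightarrow> \<bar>bessel_J0 t\<bar> \<le> C / sqrt t"
proof -
  obtain C where C: "C > 0" "\<And>z. 0 \<le> Re z \<Longrightarrow> z \<noteq> 0 \<Longrightarrow> cmod (macdonald0 z) \<le> C * exp (- Re z) * cmod z powr (- (1/2))"
    using macdonald0_bound[of "1/2"] by auto
  show ?thesis
  proof
    show "2 / pi * C > 0" using C(1) by simp
    fix t :: real assume t: "t > 0"
    have "\<bar>Im (macdonald0 (- \<i> * of_real t))\<bar> \<le> C * exp (- Re (- \<i> * of_real t)) * cmod (- \<i> * of_real t) powr (- (1/2))"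
      by (rule order_trans[OF abs_Im_le_cmod C(2)]) (use t in auto)
    also have "\<dots> = C / sqrt t" using t by (simp add: norm_mult powr_minus powr_half_sqrt field_simps)
    finally have "2 / pi * \<bar>Im (macdonald0 (- \<i> * of_real t))\<bar> \<le> 2 / pi * (C / sqrt t)"
      by (intro mult_left_mono) auto
    then show "\<bar>bessel_J0 t\<bar> \<le> (2 / pi * C) / sqrt t"
      unfolding bessel_J0_eq_macdonald0[OF t] abs_mult by simp
  qed
qed

lemma exp_minus_square_moments_integrable:
  "(\<lambda>y::real. exp (- y\<^sup>2)) integrable_on {0..}" "(\<lambda>y::real. exp (- y\<^sup>2) * y\<^sup>2) integrable_on {0..}"
proof -
  have i: "(\<lambda>y. exp (1 - 2 * y) * c) integrable_on {0..}" for c :: real using has_integral_exp_tail[of c 0] by blast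
  show "(\<lambda>y::real. exp (- y\<^sup>2)) integrable_on {0..}"
    by (rule measurable_bounded_by_integrable_imp_integrable[OF continuous_imp_measurable_on_sets_lebesgue i[of 1]])
       (use exp_minus_square_le in \<open>auto intro!: continuous_intros\<close>)
  have j: "(\<lambda>y. exp (- 1 * y) * (2 * exp (1/2))) integrable_on {0::real..}"
    by (intro integrable_on_mult_left integrable_on_exp_minus_to_infinity) simp
  show "(\<lambda>y::real. exp (- y\<^sup>2) * y\<^sup>2) integrable_on {0..}"
  proof (rule measurable_bounded_by_integrable_imp_integrable[OF continuous_imp_measurable_on_sets_lebesgue j])
    fix y :: real
    have "y\<^sup>2 / 2 \<le> exp (y\<^sup>2 / 2)" using exp_ge_add_one_self[of "y\<^sup>2 / 2"] by linarith
    then have "exp (- y\<^sup>2) * y\<^sup>2 \<le> exp (- y\<^sup>2) * (2 * exp (y\<^sup>2 / 2))" by (intro mult_left_mono) auto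
    also have "\<dots> = 2 * exp (- y\<^sup>2 / 2)" by (simp add: exp_add[symmetric])
    also have "\<dots> \<le> 2 * exp (1/2 - y)"
    proof -
      have "0 \<le> (y - 1)\<^sup>2" by simp
      then have "- y\<^sup>2 / 2 \<le> 1/2 - y" by (simp add: power2_eq_square algebra_simps)
      then show ?thesis by simp
    qed
    also have "exp (1/2 - y) = exp (- 1 * y) * exp (1/2)" by (subst exp_add[symmetric]) simp
    also have "2 * (exp (- 1 * y) * exp (1/2)) = exp (- 1 * y) * (2 * exp (1/2))" by (rule mult.left_commute)
    finally show "norm (exp (- y\<^sup>2) * y\<^sup>2) \<le> exp (- 1 * y) * (2 * exp (1/2))" by simp
  qed (auto intro!: continuous_intros)
qed

text \<open>Replacing \<open>sqrt (y\<^sup>2 + 2 * z)\<close> by \<open>sqrt (2 * z)\<close> in the integral for \<open>K0\<close> leaves a Gaussian integral; the error is smaller by a factor \<open>t\<close>, since the difference of the two roots is \<open>y\<^sup>2\<close> divided by their sum.\<close>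

lemma bessel_J0_asymptotic:
  obtains c C where "C > 0" "\<And>t. t > 0 \<Longrightarrow> \<bar>bessel_J0 t - Re (c * cis t) / sqrt t\<bar> \<le> C / (t * sqrt t)"
proof -
  define g0 where "g0 = integral {0..} (\<lambda>y::real. exp (- y\<^sup>2))"
  define g2 where "g2 = integral {0..} (\<lambda>y::real. exp (- y\<^sup>2) * y\<^sup>2)"
  define c where "c = 4 / of_real pi * (- \<i>) * of_real g0 / (1 - \<i>)"
  show ?thesis
  proof
    have "g2 \<ge> 0" unfolding g2_def by (rule integral_nonneg[OF exp_minus_square_moments_integrable(2)]) auto
    then show "2 / pi * g2 + 1 > 0" by (simp add: add_nonneg_pos)
    fix t :: real assume t: "t > 0"
    define z where "z = - \<i> * complex_of_real t"
    have z: "0 \<le> Re z" "z \<noteq> 0" using t by (auto simp: z_def)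
    have s0: "csqrt (2 * z) = of_real (sqrt t) * (1 - \<i>)"
      by (rule csqrt_unique) (use t in \<open>auto simp: z_def power_mult_distrib power2_eq_square algebra_simps simp flip: of_real_mult\<close>)
    have n1: "cmod (1 - \<i>) = sqrt 2" by (simp add: cmod_def)
    have diff: "cmod (half_gauss_integrand z y - of_real (exp (- y\<^sup>2)) / csqrt (2 * z)) \<le> exp (- y\<^sup>2) * y\<^sup>2 * (1 / (2 * t * sqrt t))" for y
    proof -
      define s where "s = csqrt (of_real (y\<^sup>2) + 2 * z)"
      define s' where "s' = csqrt (2 * z)"
      have nz: "s \<noteq> 0" "s' \<noteq> 0"
        using square_plus_notin_nonpos_Reals[OF z, of y] z by (auto simp: s_def s'_def simp del: of_real_power)
      have cs: "cmod s' = sqrt 2 * sqrt t" using t z by (simp add: s'_def s0 norm_mult n1)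
      have cs2: "cmod s' \<le> cmod s"
        using norm_square_plus_ge(1)[OF z(1), of y] by (simp add: s_def s'_def norm_mult del: of_real_power)
      have "Re s' = sqrt t" by (simp add: s'_def s0)
      moreover have "Re s \<ge> 0" unfolding s_def by (rule Re_csqrt)
      ultimately have ge: "sqrt t \<le> cmod (s + s')"
        using complex_Re_le_cmod[of "s + s'"] by simp
      have "(s' - s) * (s + s') = - of_real (y\<^sup>2)"
        by (simp add: algebra_simps s_def s'_def flip: power2_eq_square del: of_real_power)
      then have "cmod (s' - s) * cmod (s + s') = y\<^sup>2"
        by (metis norm_minus_cancel norm_mult norm_of_real abs_power2)
      moreover have pos: "0 < cmod (s + s')" using ge t by (meson less_le_trans real_sqrt_gt_zero)
      ultimately have "cmod (s' - s) = y\<^sup>2 / cmod (s + s')" by (metis nonzero_eq_divide_eq less_irrefl)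
      also have "\<dots> \<le> y\<^sup>2 / sqrt t" using ge t pos by (intro divide_left_mono mult_pos_pos) auto
      finally have d: "cmod (s' - s) \<le> y\<^sup>2 / sqrt t" .
      have "1 / s - 1 / s' = (s' - s) / (s * s')" using nz by (simp add: field_simps)
      then have "cmod (1 / s - 1 / s') = cmod (s' - s) / (cmod s * cmod s')" by (simp add: norm_divide norm_mult)
      also have "\<dots> \<le> (y\<^sup>2 / sqrt t) / (cmod s' * cmod s')"
        using d cs2 nz t by (intro frac_le mult_mono) auto
      also have "\<dots> = y\<^sup>2 * (1 / (2 * t * sqrt t))" unfolding cs using t by (simp add: field_simps)
      finally have e: "cmod (1 / s - 1 / s') \<le> y\<^sup>2 * (1 / (2 * t * sqrt t))" .
      have "half_gauss_integrand z y - of_real (exp (- y\<^sup>2)) / csqrt (2 * z) = of_real (exp (- y\<^sup>2)) * (1 / s - 1 / s')"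
        by (simp add: half_gauss_integrand_def s_def s'_def algebra_simps)
      then have "cmod (half_gauss_integrand z y - of_real (exp (- y\<^sup>2)) / csqrt (2 * z)) = exp (- y\<^sup>2) * cmod (1 / s - 1 / s')"
        by (simp add: norm_mult)
      also have "\<dots> \<le> exp (- y\<^sup>2) * (y\<^sup>2 * (1 / (2 * t * sqrt t)))" using e by (intro mult_left_mono) auto
      finally show ?thesis by (simp add: mult_ac)
    qed
    have hg: "(half_gauss_integrand z has_integral integral {0..} (half_gauss_integrand z)) {0..}"
      by (intro integrable_integral half_gauss_integrand_integrable z)
    have hc: "((\<lambda>y. complex_of_real (exp (- y\<^sup>2)) / csqrt (2 * z)) has_integral (of_real g0 / csqrt (2 * z))) {0..}"
      unfolding g0_def by (intro has_integral_divide has_integral_of_real integrable_integral exp_minus_square_moments_integrable)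
    have h2: "((\<lambda>y. exp (- y\<^sup>2) * y\<^sup>2 * (1 / (2 * t * sqrt t))) has_integral g2 * (1 / (2 * t * sqrt t))) {0..}"
      unfolding g2_def by (intro has_integral_mult_left integrable_integral exp_minus_square_moments_integrable)
    have "cmod (integral {0..} (half_gauss_integrand z) - of_real g0 / csqrt (2 * z)) \<le> g2 * (1 / (2 * t * sqrt t))"
      using integral_norm_bound_integral[OF has_integral_integrable[OF has_integral_diff[OF hg hc]] has_integral_integrable[OF h2] diff]
      unfolding integral_unique[OF has_integral_diff[OF hg hc]] integral_unique[OF h2] .
    then have "4 / pi * cmod (integral {0..} (half_gauss_integrand z) - of_real g0 / csqrt (2 * z)) \<le> 4 / pi * (g2 * (1 / (2 * t * sqrt t)))"
      by (intro mult_left_mono) auto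
    moreover have "cmod (2 / of_real pi * (- \<i>) * 2 * exp (- z) * w) = 4 / pi * cmod w" for w
      by (simp add: norm_mult norm_divide z_def)
    ultimately have "cmod (2 / of_real pi * (- \<i>) * 2 * exp (- z) * (integral {0..} (half_gauss_integrand z) - of_real g0 / csqrt (2 * z)))
       \<le> 4 / pi * (g2 * (1 / (2 * t * sqrt t)))"
      by (simp only:)
    also have "2 / of_real pi * (- \<i>) * 2 * exp (- z) * (integral {0..} (half_gauss_integrand z) - of_real g0 / csqrt (2 * z))
       = 2 / of_real pi * (- \<i>) * macdonald0 z - c * cis t / of_real (sqrt t)"
      unfolding macdonald0_def c_def s0 using t by (simp add: z_def cis_conv_exp field_simps)
    finally have "\<bar>Re (2 / of_real pi * (- \<i>) * macdonald0 z - c * cis t / of_real (sqrt t))\<bar> \<le> 4 / pi * (g2 * (1 / (2 * t * sqrt t)))"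
      using abs_Re_le_cmod order_trans by blast
    moreover have "Re (2 / of_real pi * (- \<i>) * macdonald0 z - c * cis t / of_real (sqrt t)) = bessel_J0 t - Re (c * cis t) / sqrt t"
    proof -
      have "Re (2 / of_real pi * (- \<i>) * macdonald0 z) = 2 / pi * Im (macdonald0 z)"
      proof -
        have e: "2 / of_real pi * (- \<i>) * macdonald0 z = of_real (2 / pi) * (- \<i> * macdonald0 z)" by simp
        show ?thesis unfolding e times_complex.sel by simp
      qed
      then show ?thesis unfolding bessel_J0_eq_macdonald0[OF t] z_def by (simp only: minus_complex.sel Re_divide_of_real)
    qed
    ultimately have "\<bar>bessel_J0 t - Re (c * cis t) / sqrt t\<bar> \<le> 4 / pi * (g2 * (1 / (2 * t * sqrt t)))" by simp
    also have "\<dots> = (2 / pi * g2) / (t * sqrt t)" by simp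
    also have "\<dots> \<le> (2 / pi * g2 + 1) / (t * sqrt t)" using t by (intro divide_right_mono) auto
    finally show "\<bar>bessel_J0 t - Re (c * cis t) / sqrt t\<bar> \<le> (2 / pi * g2 + 1) / (t * sqrt t)" .
  qed
qed

section \<open>Growth of I0 on the positive axis\<close>

lemma mbessel0_of_real_has_integral:
  "((\<lambda>\<theta>. exp (\<tau> * cos \<theta>)) has_integral pi * Re (mbessel0 (of_real \<tau>))) {0..pi}"
proof -
  have "((\<lambda>\<theta>. exp (\<tau> * cos \<theta>)) has_integral integral {0..pi} (\<lambda>\<theta>. exp (\<tau> * cos \<theta>))) {0..pi}"
    by (intro integrable_integral integrable_continuous_interval continuous_intros)
  moreover from has_integral_of_real[OF this, where 'b = complex]
  have "mbessel0 (of_real \<tau>) = of_real (integral {0..pi} (\<lambda>\<theta>. exp (\<tau> * cos \<theta>)) / pi)"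
    by (simp add: mbessel0_def integral_unique exp_of_real flip: of_real_mult)
  ultimately show ?thesis by simp
qed

lemma mbessel0_ge_1: "1 \<le> Re (mbessel0 (of_real \<tau>))"
proof -
  have "(\<lambda>k. Re ((of_real \<tau> / 2) ^ (2 * k) / (fact k)\<^sup>2)) sums Re (mbessel0 (of_real \<tau>))"
    by (rule sums_Re[OF mbessel0_sums])
  moreover have "Re ((of_real \<tau> / 2) ^ (2 * k) / (fact k)\<^sup>2) = (\<tau> / 2) ^ (2 * k) / (fact k)\<^sup>2" for k
  proof -
    have "(of_real \<tau> / 2) ^ (2 * k) / (fact k)\<^sup>2 = complex_of_real ((\<tau> / 2) ^ (2 * k) / (fact k)\<^sup>2)" by simp
    then show ?thesis by (simp only: Re_complex_of_real)
  qed
  ultimately have s: "(\<lambda>k. (\<tau> / 2) ^ (2 * k) / (fact k)\<^sup>2) sums Re (mbessel0 (of_real \<tau>))" by simp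
  have "(\<Sum>k<1. (\<tau> / 2) ^ (2 * k) / (fact k)\<^sup>2) \<le> Re (mbessel0 (of_real \<tau>))"
    using s by (intro sum_le_suminf[of _ "{..<1}", OF sums_summable[OF s], unfolded sums_unique[OF s, symmetric]]) auto
  then show ?thesis by simp
qed

lemma cos_le_quadratic:
  assumes "0 \<le> \<theta>" "\<theta> \<le> pi" shows "cos \<theta> \<le> 1 - \<theta>\<^sup>2 / 8"
proof -
  have conv: "convex_on {0..pi/2} (\<lambda>x. - sin x)"
    by (rule f''_ge0_imp_convex[where f' = "\<lambda>x. - cos x" and f'' = sin])
       (auto intro!: derivative_eq_intros sin_ge_zero)
  define s where "s = \<theta> / pi"
  have s: "0 \<le> s" "s \<le> 1" "s * (pi / 2) = \<theta> / 2" using assms by (auto simp: s_def)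
  have "- sin ((1 - s) *\<^sub>R 0 + s *\<^sub>R (pi / 2)) \<le> (1 - s) * (- sin 0) + s * (- sin (pi / 2))"
    using s by (intro convex_onD[OF conv]) auto
  then have "s \<le> sin (\<theta> / 2)" using s by simp
  moreover have "\<theta> / 4 \<le> s" unfolding s_def using assms pi_less_4 by (intro divide_left_mono) auto
  ultimately have "(\<theta> / 4)\<^sup>2 \<le> (sin (\<theta> / 2))\<^sup>2" using assms by (intro power_mono) auto
  then show ?thesis using cos_double_sin[of "\<theta> / 2"] by (simp add: power_divide)
qed

text \<open>With \<open>cos \<theta> \<le> 1 - \<theta>\<^sup>2 / 8\<close> the integral is dominated by a Gaussian of width of order \<open>1 / sqrt \<tau>\<close>, and that in turn by an exponential function of \<open>\<theta>\<close>.\<close>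

lemma mbessel0_real_upper:
  obtains C where "C > 0" "\<And>\<tau>. \<tau> > 0 \<Longrightarrow> Re (mbessel0 (of_real \<tau>)) \<le> C * exp \<tau> / sqrt \<tau>"
proof
  show "exp (1::real) > 0" by simp
  fix \<tau> :: real assume \<tau>: "\<tau> > 0"
  define a where "a = 2 * sqrt (\<tau> / 8)"
  have a: "a > 0" using \<tau> by (simp add: a_def)
  have "pi * Re (mbessel0 (of_real \<tau>)) \<le> integral {0..pi} (\<lambda>\<theta>. exp \<tau> * exp (1 - a * \<theta>))"
  proof (rule has_integral_le[OF mbessel0_of_real_has_integral integrable_integral])
    show "(\<lambda>\<theta>. exp \<tau> * exp (1 - a * \<theta>)) integrable_on {0..pi}"
      by (intro integrable_continuous_interval continuous_intros)
    fix \<theta> assume \<theta>: "\<theta> \<in> {0..pi}"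
    have c: "cos \<theta> \<le> 1 - \<theta>\<^sup>2 / 8" using \<theta> by (intro cos_le_quadratic) auto
    have "\<tau> * cos \<theta> \<le> \<tau> * (1 - \<theta>\<^sup>2 / 8)" using c \<tau> by (intro mult_left_mono) auto
    also have "\<dots> = \<tau> - (sqrt (\<tau> / 8) * \<theta>)\<^sup>2" using \<tau> by (simp add: power_mult_distrib algebra_simps)
    also have "\<dots> \<le> \<tau> + (1 - a * \<theta>)"
    proof -
      have "0 \<le> (sqrt (\<tau> / 8) * \<theta> - 1)\<^sup>2" by simp
      then show ?thesis by (simp add: a_def power2_eq_square algebra_simps)
    qed
    finally show "exp (\<tau> * cos \<theta>) \<le> exp \<tau> * exp (1 - a * \<theta>)" by (simp add: exp_add[symmetric])
  qed
  also have "\<dots> \<le> exp \<tau> * exp 1 / a"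
  proof -
    have "((\<lambda>\<theta>. exp \<tau> * exp (1 - a * \<theta>)) has_integral (- (exp \<tau> * exp (1 - a * pi) / a)) - (- (exp \<tau> * exp (1 - a * 0) / a))) {0..pi}"
      by (rule fundamental_theorem_of_calculus)
         (use a in \<open>auto intro!: derivative_eq_intros simp: has_real_derivative_iff_has_vector_derivative[symmetric]\<close>)
    from integral_unique[OF this] show ?thesis using a by simp
  qed
  also have "\<dots> \<le> pi * (exp 1 * exp \<tau> / sqrt \<tau>)"
  proof -
    have "sqrt (\<tau> / 8) \<ge> sqrt \<tau> / 3"
      unfolding real_sqrt_divide using \<tau> by (intro divide_left_mono) (auto intro!: real_le_lsqrt)
    then have "a \<ge> 2 / 3 * sqrt \<tau>" by (simp add: a_def)
    then have "exp \<tau> * exp 1 / a \<le> exp \<tau> * exp 1 / (2 / 3 * sqrt \<tau>)" using \<tau> a by (intro divide_left_mono) auto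
    also have "\<dots> = 3 / 2 * (exp 1 * exp \<tau> / sqrt \<tau>)" by (simp add: field_simps)
    also have "\<dots> \<le> pi * (exp 1 * exp \<tau> / sqrt \<tau>)" using pi_gt3 \<tau> by (intro mult_right_mono) auto
    finally show ?thesis .
  qed
  finally show "Re (mbessel0 (of_real \<tau>)) \<le> exp 1 * exp \<tau> / sqrt \<tau>"
    by (rule mult_left_le_imp_le) simp
qed

text \<open>On \<open>\<theta> \<le> 1 / sqrt \<tau>\<close> the exponent \<open>\<tau> * cos \<theta>\<close> stays above \<open>\<tau> - 1/2\<close>.\<close>

lemma mbessel0_real_lower:
  assumes "\<tau> \<ge> 1"
  shows "exp (- (1/2)) / pi * exp \<tau> / sqrt \<tau> \<le> Re (mbessel0 (of_real \<tau>))"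
proof -
  define b where "b = 1 / sqrt \<tau>"
  have b: "0 < b" "b \<le> 1" "\<tau> * b\<^sup>2 = 1" using assms by (auto simp: b_def power_divide)
  have sub: "{0..b} \<subseteq> {0..pi}" using b pi_gt3 by auto
  let ?f = "\<lambda>\<theta>. exp (\<tau> * cos \<theta>)"
  have i: "?f integrable_on {0..b}" "?f integrable_on {0..pi}"
    by (intro integrable_continuous_interval continuous_intros)+
  have "b * exp (\<tau> - 1/2) = integral {0..b} (\<lambda>_. exp (\<tau> - 1/2))" using b by simp
  also have "\<dots> \<le> integral {0..b} ?f"
  proof (rule integral_le[OF integrable_const_ivl i(1)])
    fix \<theta> assume \<theta>: "\<theta> \<in> {0..b}"
    have "\<theta>\<^sup>2 \<le> b\<^sup>2" using \<theta> by (intro power_mono) auto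
    then have "\<tau> * \<theta>\<^sup>2 \<le> \<tau> * b\<^sup>2" using assms by (intro mult_left_mono) auto
    then have "\<tau> * \<theta>\<^sup>2 \<le> 1" using b by simp
    moreover have "1 - \<theta>\<^sup>2 / 2 \<le> cos \<theta>"
    proof -
      have "(sin (\<theta> / 2))\<^sup>2 \<le> (\<theta> / 2)\<^sup>2" using abs_sin_x_le_abs_x[of "\<theta> / 2"] by (metis power2_abs power_mono abs_ge_zero)
      then show ?thesis using cos_double_sin[of "\<theta> / 2"] by (simp add: power_divide)
    qed
    then have "\<tau> * (1 - \<theta>\<^sup>2 / 2) \<le> \<tau> * cos \<theta>" using assms by (intro mult_left_mono) auto
    ultimately show "exp (\<tau> - 1/2) \<le> ?f \<theta>" by (simp add: algebra_simps)
  qed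
  also have "\<dots> \<le> integral {0..pi} ?f" by (rule integral_subset_le[OF sub i]) auto
  also have "\<dots> = pi * Re (mbessel0 (of_real \<tau>))" by (rule integral_unique[OF mbessel0_of_real_has_integral])
  finally have "b * exp (\<tau> - 1/2) / pi \<le> Re (mbessel0 (of_real \<tau>))" by (simp add: field_simps)
  moreover have "exp (\<tau> - 1/2) = exp (- (1/2)) * exp \<tau>" by (simp flip: exp_add)
  then have "b * exp (\<tau> - 1/2) / pi = exp (- (1/2)) / pi * exp \<tau> / sqrt \<tau>"
    by (simp add: b_def)
  ultimately show ?thesis by simp
qed

section \<open>Kluyver's integrals and their truncations\<close>

text \<open>Kluyver's formula for the distribution function of the distance from the origin after \<open>n\<close> steps. That it is the distribution function is established later; at first it serves as an absolutely convergent primitive of the density.\<close>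

definition kluyver_cdf :: "nat \<Rightarrow> real \<Rightarrow> real" where
  "kluyver_cdf n x = integral {0..} (\<lambda>t. x * bessel_J1 (x * t) * bessel_J0 t ^ n)"

text \<open>An integrable majorant for the third power of \<open>J0\<close>, by \<open>J0 t = O (1 / sqrt t)\<close>.\<close>

definition decay_weight :: "real \<Rightarrow> real" where
  "decay_weight t = (if t \<le> 1 then 1 else t powr (-3/2))"

lemma decay_weight_has_integral: "(decay_weight has_integral 3) {0..}"
proof -
  have "((\<lambda>t. 1::real) has_integral 1) {0..1::real}" using has_integral_const_real[of "1::real" 0 1] by simp
  then have 1: "(decay_weight has_integral 1) {0..1}"
    by (rule has_integral_eq[rotated]) (simp add: decay_weight_def)
  have "((\<lambda>t. t powr (-3/2)) has_integral - (1 powr (-3/2 + 1)) / (-3/2 + 1)) {1::real..}"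
    by (rule has_integral_powr_to_inf) auto
  then have "((\<lambda>t. t powr (-3/2)) has_integral 2) {1::real..}" by simp
  then have 2: "(decay_weight has_integral 2) {1..}"
    by (rule has_integral_eq[rotated]) (auto simp: decay_weight_def)
  have "(decay_weight has_integral 1 + 2) ({0..1} \<union> {1..})"
  proof (rule has_integral_Un[OF 1 2])
    have "{0..1} \<inter> {1..} = {1::real}" by auto
    then show "negligible ({0..1} \<inter> {1::real..})" by simp
  qed
  moreover have "{0..1} \<union> {1..} = {0::real..}" by auto
  ultimately show ?thesis by simp
qed

lemma bessel_J0_power_bound:
  obtains C where "C \<ge> 1" "\<And>n t. 3 \<le> n \<Longrightarrow> 0 \<le> t \<Longrightarrow> \<bar>bessel_J0 t ^ n\<bar> \<le> C * decay_weight t"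
proof -
  obtain D where D: "D > 0" "\<And>t. t > 0 \<Longrightarrow> \<bar>bessel_J0 t\<bar> \<le> D / sqrt t" using bessel_J0_decay by blast
  show ?thesis
  proof
    show "D ^ 3 + 1 \<ge> 1" using D(1) by simp
    fix n :: nat and t :: real assume n: "3 \<le> n" and t: "0 \<le> t"
    have "\<bar>bessel_J0 t ^ n\<bar> = \<bar>bessel_J0 t\<bar> ^ n" by (rule power_abs)
    also have "\<dots> \<le> \<bar>bessel_J0 t\<bar> ^ 3" by (rule power_decreasing[OF n]) (simp_all add: abs_bessel_J0_le)
    finally have le: "\<bar>bessel_J0 t ^ n\<bar> \<le> \<bar>bessel_J0 t\<bar> ^ 3" .
    show "\<bar>bessel_J0 t ^ n\<bar> \<le> (D ^ 3 + 1) * decay_weight t"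
    proof (cases "t \<le> 1")
      case True
      have "\<bar>bessel_J0 t\<bar> ^ 3 \<le> 1" using abs_bessel_J0_le by (intro power_le_one) auto
      also have "1 \<le> D ^ 3 + 1" using D(1) by simp
      finally show ?thesis using le True by (simp add: decay_weight_def)
    next
      case False
      have "\<bar>bessel_J0 t\<bar> ^ 3 \<le> (D / sqrt t) ^ 3" using D(2)[of t] False by (intro power_mono) auto
      also have "\<dots> = D ^ 3 * t powr (-3/2)"
      proof -
        have "sqrt t ^ 3 = (t powr (1/2)) powr (real 3)"
          using False by (subst powr_realpow) (auto simp: powr_half_sqrt)
        also have "\<dots> = t powr (3/2)" by (simp add: powr_powr)
        finally show ?thesis by (simp add: power_divide powr_minus field_simps)
      qed
      also have "\<dots> \<le> (D ^ 3 + 1) * t powr (-3/2)" by (intro mult_right_mono) auto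
      finally show ?thesis using le False by (simp add: decay_weight_def)
    qed
  qed
qed

lemma kluyver_cdf_integrand_integrable:
  assumes "3 \<le> n"
  shows "(\<lambda>t. x * bessel_J1 (x * t) * bessel_J0 t ^ n) integrable_on {0..}"
proof -
  obtain C where C: "C \<ge> 1" "\<And>n t. 3 \<le> n \<Longrightarrow> 0 \<le> t \<Longrightarrow> \<bar>bessel_J0 t ^ n\<bar> \<le> C * decay_weight t"
    using bessel_J0_power_bound by blast
  have i: "((\<lambda>t. (\<bar>x\<bar> * C) * decay_weight t) has_integral (\<bar>x\<bar> * C) * 3) {0..}"
    by (intro has_integral_mult_right decay_weight_has_integral)
  show ?thesis
  proof (rule measurable_bounded_by_integrable_imp_integrable[OF continuous_imp_measurable_on_sets_lebesgue has_integral_integrable[OF i]])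
    fix t :: real assume t: "t \<in> {0..}"
    have "\<bar>x\<bar> * \<bar>bessel_J1 (x * t)\<bar> * \<bar>bessel_J0 t ^ n\<bar> \<le> \<bar>x\<bar> * 1 * (C * decay_weight t)"
      using abs_bessel_J1_le C(2)[OF assms, of t] t by (intro mult_mono) auto
    then show "norm (x * bessel_J1 (x * t) * bessel_J0 t ^ n) \<le> (\<bar>x\<bar> * C) * decay_weight t"
      by (simp add: abs_mult mult_ac)
  qed (auto intro!: continuous_intros)
qed

lemma kluyver_cdf_bound:
  assumes "3 \<le> n"
  obtains C where "C > 0" "\<And>x. \<bar>kluyver_cdf n x\<bar> \<le> C * \<bar>x\<bar>"
proof -
  obtain C where C: "C \<ge> 1" "\<And>n t. 3 \<le> n \<Longrightarrow> 0 \<le> t \<Longrightarrow> \<bar>bessel_J0 t ^ n\<bar> \<le> C * decay_weight t"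
    using bessel_J0_power_bound by blast
  show ?thesis
  proof
    show "C * 3 > 0" using C(1) by simp
    fix x :: real
    have i: "((\<lambda>t. (\<bar>x\<bar> * C) * decay_weight t) has_integral (\<bar>x\<bar> * C) * 3) {0..}"
      by (intro has_integral_mult_right decay_weight_has_integral)
    have "norm (kluyver_cdf n x) \<le> integral {0..} (\<lambda>t. (\<bar>x\<bar> * C) * decay_weight t)" unfolding kluyver_cdf_def
    proof (rule integral_norm_bound_integral[OF kluyver_cdf_integrand_integrable[OF assms] has_integral_integrable[OF i]])
      fix t :: real assume t: "t \<in> {0..}"
      have "\<bar>x\<bar> * \<bar>bessel_J1 (x * t)\<bar> * \<bar>bessel_J0 t ^ n\<bar> \<le> \<bar>x\<bar> * 1 * (C * decay_weight t)"
        using abs_bessel_J1_le C(2)[OF assms, of t] t by (intro mult_mono) auto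
      then show "norm (x * bessel_J1 (x * t) * bessel_J0 t ^ n) \<le> (\<bar>x\<bar> * C) * decay_weight t"
        by (simp add: abs_mult mult_ac)
    qed
    then show "\<bar>kluyver_cdf n x\<bar> \<le> C * 3 * \<bar>x\<bar>" unfolding integral_unique[OF i] by (simp add: mult_ac)
  qed
qed

definition trunc_density :: "nat \<Rightarrow> real \<Rightarrow> real \<Rightarrow> real" where
  "trunc_density n T x = integral {0..T} (\<lambda>t. bessel_J0 (x * t) * bessel_J0 t ^ n * (x * t))"

definition trunc_cdf :: "nat \<Rightarrow> real \<Rightarrow> real \<Rightarrow> real" where
  "trunc_cdf n T x = integral {0..T} (\<lambda>t. x * bessel_J1 (x * t) * bessel_J0 t ^ n)"

lemma trunc_cdf_has_real_derivative:
  "(trunc_cdf n T has_real_derivative trunc_density n T x) (at x within A)"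
proof -
  have "((\<lambda>x. integral (cbox 0 T) (\<lambda>t. x * bessel_J1 (x * t) * bessel_J0 t ^ n)) has_field_derivative
     integral (cbox 0 T) (\<lambda>t. bessel_J0 (x * t) * bessel_J0 t ^ n * (x * t))) (at x within UNIV)"
  proof (rule leibniz_rule_field_derivative)
    fix y t :: real
    show "((\<lambda>x. x * bessel_J1 (x * t) * bessel_J0 t ^ n) has_field_derivative
        bessel_J0 (y * t) * bessel_J0 t ^ n * (y * t)) (at y within UNIV)"
      using DERIV_cmult_right[OF x_bessel_J1_has_real_derivative[of t y UNIV], of "bessel_J0 t ^ n"] by (simp add: mult_ac)
  qed (auto intro!: integrable_continuous_interval continuous_intros simp: case_prod_unfold)
  then show ?thesis unfolding trunc_cdf_def[abs_def] trunc_density_def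
    by (auto intro: has_field_derivative_at_within)
qed

lemma continuous_on_trunc_density: "continuous_on A (trunc_density n T)"
proof -
  have "continuous_on A (\<lambda>x. integral (cbox 0 T) (\<lambda>t. bessel_J0 (x * t) * bessel_J0 t ^ n * (x * t)))"
    by (rule integral_continuous_on_param) (auto intro!: continuous_intros simp: case_prod_unfold)
  then show ?thesis by (simp add: trunc_density_def[abs_def])
qed

text \<open>Selects the case of an unbounded domain in the definition of the Henstock-Kurzweil integral.\<close>

lemma atLeast_not_cbox: "\<not> (\<exists>a b. {0::real..} = cbox a b)"
proof
  assume "\<exists>a b. {0::real..} = cbox a b"
  then obtain a b where e: "{0::real..} = {a..b}" by auto
  have "max 0 b + 1 \<in> {0::real..}" by auto
  then show False unfolding e by auto
qed

text \<open>The half of Hake's theorem that produces an integral: \<open>B\<close> is chosen so large that every interval containing the ball reaches past the point from which the truncated integrals stay close to \<open>L\<close>.\<close>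

lemma has_integral_improper_at_top:
  fixes f :: "real \<Rightarrow> 'a::banach"
  assumes "\<And>T. f integrable_on {0..T}" "((\<lambda>T. integral {0..T} f) \<longlongrightarrow> L) at_top"
  shows "(f has_integral L) {0..}"
proof -
  have "\<forall>e>0. \<exists>B>0. \<forall>a b. ball 0 B \<subseteq> cbox a b \<longrightarrow>
      (\<exists>z. ((\<lambda>x. if x \<in> {0..} then f x else 0) has_integral z) (cbox a b) \<and> norm (z - L) < e)"
  proof (simp, intro allI impI)
    fix e :: real assume e: "0 < e"
    then have "\<forall>\<^sub>F T in at_top. dist (integral {0..T} f) L < e" using assms(2) tendstoD by blast
    then obtain M where M: "\<And>T. T \<ge> M \<Longrightarrow> dist (integral {0..T} f) L < e" by (auto simp: eventually_at_top_linorder)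
    show "\<exists>B>0. \<forall>a b. ball 0 B \<subseteq> {a..b} \<longrightarrow> (\<exists>z. ((\<lambda>x. if 0 \<le> x then f x else 0) has_integral z) {a..b} \<and> norm (z - L) < e)"
    proof (intro exI[of _ "max M 1"] conjI allI impI)
      fix a b :: real assume sub: "ball 0 (max M 1) \<subseteq> {a..b}"
      have ab: "a \<le> 0" "M \<le> b" "0 \<le> b"
      proof -
        show "a \<le> 0" "0 \<le> b" using sub by (auto simp: subset_iff dist_norm)
        show "M \<le> b"
        proof (rule ccontr)
          assume "\<not> M \<le> b"
          then have "(M + b) / 2 \<in> ball 0 (max M 1)" "(M + b) / 2 \<notin> {a..b}" using \<open>0 \<le> b\<close> by (auto simp: dist_norm)
          with sub show False by blast
        qed
      qed
      have "(f has_integral integral {0..b} f) {0..b}" using assms(1) by (rule integrable_integral)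
      then have "((\<lambda>x. if x \<in> {0..b} then f x else 0) has_integral integral {0..b} f) {a..b}"
        using ab by (subst has_integral_restrict) auto
      then have "((\<lambda>x. if 0 \<le> x then f x else 0) has_integral integral {0..b} f) {a..b}"
        by (rule has_integral_eq[rotated]) auto
      then show "\<exists>z. ((\<lambda>x. if 0 \<le> x then f x else 0) has_integral z) {a..b} \<and> norm (z - L) < e"
        using M[OF ab(2)] by (auto simp: dist_norm)
    qed simp
  qed
  then show ?thesis using atLeast_not_cbox by (subst has_integral_alt) simp
qed

text \<open>Integration by parts; this is the gain from oscillation, and it is lost as the frequency tends to \<open>0\<close>.\<close>

lemma norm_integral_cis_over_t_le:
  assumes "\<omega> \<noteq> 0" "1 \<le> S" "S \<le> T"
  shows "cmod (integral {S..T} (\<lambda>t. cis (\<omega> * t) / of_real t)) \<le> 2 / (\<bar>\<omega>\<bar> * S)"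
proof -
  let ?F = "\<lambda>t. cis (\<omega> * t) / (\<i> * of_real \<omega> * of_real t)"
  have FTC: "((\<lambda>t. cis (\<omega> * t) / of_real t - cis (\<omega> * t) / (\<i> * of_real \<omega> * (of_real t)\<^sup>2)) has_integral ?F T - ?F S) {S..T}"
  proof (rule fundamental_theorem_of_calculus[OF assms(3)])
    fix t assume t: "t \<in> {S..T}"
    then have "t \<noteq> 0" using assms by auto
    then have "((\<lambda>t. exp (\<i> * of_real \<omega> * t) / (\<i> * of_real \<omega> * t)) has_field_derivative
        exp (\<i> * of_real \<omega> * of_real t) / of_real t - exp (\<i> * of_real \<omega> * of_real t) / (\<i> * of_real \<omega> * (of_real t)\<^sup>2)) (at (of_real t))"
      using assms(1) by (auto intro!: derivative_eq_intros simp: field_simps power2_eq_square)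
    from has_vector_derivative_real_field[OF this, of "{S..T}"]
    show "(?F has_vector_derivative cis (\<omega> * t) / of_real t - cis (\<omega> * t) / (\<i> * of_real \<omega> * (of_real t)\<^sup>2)) (at t within {S..T})"
      by (simp add: cis_conv_exp mult_ac)
  qed
  have i1: "((\<lambda>t. 1 / \<bar>\<omega>\<bar> * (1 / t\<^sup>2)) has_integral 1 / \<bar>\<omega>\<bar> * (- 1 / T - (- 1 / S))) {S..T}"
    by (intro has_integral_mult_right fundamental_theorem_of_calculus[OF assms(3)])
       (use assms in \<open>auto intro!: derivative_eq_intros simp: has_real_derivative_iff_has_vector_derivative[symmetric] field_simps power2_eq_square\<close>)
  have i2: "(\<lambda>t. cis (\<omega> * t) / (\<i> * of_real \<omega> * (of_real t)\<^sup>2)) integrable_on {S..T}"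
    using assms by (intro integrable_continuous_interval continuous_intros) auto
  have "((\<lambda>t. cis (\<omega> * t) / of_real t) has_integral
      ?F T - ?F S + integral {S..T} (\<lambda>t. cis (\<omega> * t) / (\<i> * of_real \<omega> * (of_real t)\<^sup>2))) {S..T}"
    using has_integral_add[OF FTC integrable_integral[OF i2]] by simp
  then have "integral {S..T} (\<lambda>t. cis (\<omega> * t) / of_real t) =
      ?F T - ?F S + integral {S..T} (\<lambda>t. cis (\<omega> * t) / (\<i> * of_real \<omega> * (of_real t)\<^sup>2))" by (rule integral_unique)
  also have "cmod \<dots> \<le> cmod (?F T) + cmod (?F S) + cmod (integral {S..T} (\<lambda>t. cis (\<omega> * t) / (\<i> * of_real \<omega> * (of_real t)\<^sup>2)))"
    by (meson norm_triangle_le norm_triangle_ineq4 add_mono order_refl order_trans norm_triangle_ineq)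
  also have "\<dots> \<le> 1 / \<bar>\<omega>\<bar> * (1 / T) + 1 / \<bar>\<omega>\<bar> * (1 / S) + 1 / \<bar>\<omega>\<bar> * (- 1 / T - (- 1 / S))"
  proof (intro add_mono)
    show "cmod (integral {S..T} (\<lambda>t. cis (\<omega> * t) / (\<i> * of_real \<omega> * (of_real t)\<^sup>2))) \<le> 1 / \<bar>\<omega>\<bar> * (- 1 / T - (- 1 / S))"
      using integral_norm_bound_integral[OF i2 has_integral_integrable[OF i1]] unfolding integral_unique[OF i1]
      by (simp add: norm_divide norm_mult norm_power)
  qed (use assms in \<open>auto simp: norm_divide norm_mult\<close>)
  also have "\<dots> = 2 / (\<bar>\<omega>\<bar> * S)" using assms by (simp add: field_simps)
  finally show ?thesis .
qed

lemma integral_inverse_square_le: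
  assumes "1 \<le> S" "S \<le> T"
  shows "((\<lambda>t. 1 / t\<^sup>2) has_integral 1 / S - 1 / T) {S..T::real}"
proof -
  have "((\<lambda>t. 1 / t\<^sup>2) has_integral (- 1 / T - (- 1 / S))) {S..T}"
    by (intro fundamental_theorem_of_calculus[OF assms(2)])
       (use assms in \<open>auto intro!: derivative_eq_intros simp: has_real_derivative_iff_has_vector_derivative[symmetric] field_simps power2_eq_square\<close>)
  then show ?thesis by simp
qed

text \<open>The product of four cosines as a sum of cosines of \<open>x + 3\<close>, \<open>x - 3\<close>, \<open>x + 1\<close> and \<open>x - 1\<close>, once \<open>v\<close> and \<open>u\<close> have the phases \<open>x * t\<close> and \<open>t\<close>.\<close>

lemma Re_mult_Re_power3:
  "Re v * Re u ^ 3 = Re (v * u ^ 3 + v * cnj u ^ 3 + 3 * of_real ((cmod u)\<^sup>2) * (v * u + v * cnj u)) / 8"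
  unfolding cmod_power2 by (simp add: power3_eq_cube power2_eq_square algebra_simps)

text \<open>For \<open>n = 3\<close> the leading oscillation of Kluyver's integrand has frequencies \<open>x \<plusminus> 1\<close> and \<open>x \<plusminus> 3\<close>, and the tail converges only if none of them vanishes; for \<open>n \<ge> 5\<close> it converges absolutely.\<close>

definition regular_points :: "nat \<Rightarrow> real set" where
  "regular_points n = {x. 0 < x \<and> (5 \<le> n \<or> x \<noteq> 1 \<and> x \<noteq> 3)}"

lemma open_regular_points: "open (regular_points n)"
proof (cases "5 \<le> n")
  case True
  then have "regular_points n = {0<..}" by (auto simp: regular_points_def)
  then show ?thesis by (simp add: open_greaterThan)
next
  case False
  then have "regular_points n = {0<..} - {1, 3}" by (auto simp: regular_points_def)
  then show ?thesis by (simp add: open_Diff open_greaterThan finite_imp_closed)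
qed

lemma tail_bound_ge_5:
  assumes "5 \<le> n"
  obtains C where "C > 0" "\<And>x S T. 0 < x \<Longrightarrow> 1 \<le> S \<Longrightarrow> S \<le> T \<Longrightarrow>
     \<bar>integral {S..T} (\<lambda>t. bessel_J0 (x * t) * bessel_J0 t ^ n * (x * t))\<bar> \<le> C * x / sqrt S"
proof -
  obtain D where D: "D > 0" "\<And>t. t > 0 \<Longrightarrow> \<bar>bessel_J0 t\<bar> \<le> D / sqrt t" using bessel_J0_decay by blast
  show ?thesis
  proof
    show "2 * D ^ 5 > 0" using D(1) by simp
    fix x S T :: real assume x: "0 < x" "1 \<le> S" "S \<le> T"
    have i: "((\<lambda>t. D ^ 5 * x * t powr (-3/2)) has_integral (D ^ 5 * x) * (- 2 * T powr (-1/2) - (- 2 * S powr (-1/2)))) {S..T}"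
      by (intro has_integral_mult_right fundamental_theorem_of_calculus x)
         (use x in \<open>auto intro!: derivative_eq_intros simp: has_real_derivative_iff_has_vector_derivative[symmetric]\<close>)
    have "norm (integral {S..T} (\<lambda>t. bessel_J0 (x * t) * bessel_J0 t ^ n * (x * t))) \<le> integral {S..T} (\<lambda>t. D ^ 5 * x * t powr (-3/2))"
    proof (rule integral_norm_bound_integral[OF _ has_integral_integrable[OF i]])
      show "(\<lambda>t. bessel_J0 (x * t) * bessel_J0 t ^ n * (x * t)) integrable_on {S..T}"
        by (intro integrable_continuous_interval continuous_intros)
      fix t assume "t \<in> {S..T}"
      then have t: "t > 0" using x by auto
      have "\<bar>bessel_J0 t ^ n\<bar> = \<bar>bessel_J0 t\<bar> ^ n" by (rule power_abs)
      also have "\<dots> \<le> \<bar>bessel_J0 t\<bar> ^ 5" by (rule power_decreasing[OF assms]) (simp_all add: abs_bessel_J0_le)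
      also have "\<dots> \<le> (D / sqrt t) ^ 5" using D(2)[OF t] by (intro power_mono) auto
      also have "\<dots> = D ^ 5 * t powr (-5/2)"
      proof -
        have "sqrt t ^ 5 = (t powr (1/2)) powr (real 5)"
          using t by (subst powr_realpow) (auto simp: powr_half_sqrt)
        also have "\<dots> = t powr (5/2)" by (simp add: powr_powr)
        finally show ?thesis by (simp add: power_divide powr_minus field_simps)
      qed
      finally have "\<bar>bessel_J0 (x * t)\<bar> * \<bar>bessel_J0 t ^ n\<bar> * (x * t) \<le> 1 * (D ^ 5 * t powr (-5/2)) * (x * t)"
        using x t by (intro mult_mono abs_bessel_J0_le) auto
      also have "\<dots> = D ^ 5 * x * (t powr (-5/2) * t powr 1)" using t by (simp add: mult_ac)
      also have "t powr (-5/2) * t powr 1 = t powr (-3/2)" unfolding powr_add[symmetric] by simp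
      finally show "norm (bessel_J0 (x * t) * bessel_J0 t ^ n * (x * t)) \<le> D ^ 5 * x * t powr (-3/2)"
        using x t by (simp add: abs_mult)
    qed
    also have "\<dots> = (D ^ 5 * x) * (- 2 * T powr (-1/2) - (- 2 * S powr (-1/2)))" by (rule integral_unique[OF i])
    also have "\<dots> \<le> (D ^ 5 * x) * (2 * S powr (-1/2))" using D(1) x by (intro mult_left_mono) auto
    also have "\<dots> = 2 * D ^ 5 * x / sqrt S" using x by (simp add: powr_minus powr_half_sqrt field_simps)
    finally show "\<bar>integral {S..T} (\<lambda>t. bessel_J0 (x * t) * bessel_J0 t ^ n * (x * t))\<bar> \<le> 2 * D ^ 5 * x / sqrt S" by simp
  qed
qed

text \<open>Bookkeeping of powers for the next lemma, with \<open>p\<close> and \<open>q\<close> standing for \<open>sqrt x\<close> and \<open>sqrt t\<close>.\<close>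

lemma asymptotic_scaling:
  fixes p q D g h :: real
  assumes "p > 0" "q > 0"
  shows "D / (p\<^sup>2 * q\<^sup>2 * (p * q)) * (D / q) ^ 3 * (p\<^sup>2 * q\<^sup>2) = D ^ 4 * (1 / p) * (1 / (q\<^sup>2)\<^sup>2)"
    and "D / (p * q) * (D / (q\<^sup>2 * q) * (3 * (D / q)\<^sup>2)) * (p\<^sup>2 * q\<^sup>2) = D ^ 4 * (3 * p) * (1 / (q\<^sup>2)\<^sup>2)"
    and "(g / (p * q)) * (h / q) ^ 3 * (p\<^sup>2 * q\<^sup>2) = p * (g * h ^ 3 / q\<^sup>2)"
  using assms by (simp_all add: field_simps eval_nat_numeral)

text \<open>Telescoping: \<open>A * B ^ 3 - a * b ^ 3 = (A - a) * B ^ 3 + a * (B ^ 3 - b ^ 3)\<close>. After multiplication by \<open>x * t\<close> each part is of order \<open>1 / t\<^sup>2\<close>, so replacing Bessel functions by their leading terms costs only an integrable error.\<close>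

lemma product_asymptotic_error:
  fixes A B a b :: real
  assumes D: "D > 0" and t: "t > 0" and x: "x > 0"
    and "\<bar>B\<bar> \<le> D / sqrt t" "\<bar>b\<bar> \<le> D / sqrt t" "\<bar>B - b\<bar> \<le> D / (t * sqrt t)"
    and "\<bar>a\<bar> \<le> D / sqrt (x * t)" "\<bar>A - a\<bar> \<le> D / (x * t * sqrt (x * t))"
  shows "\<bar>A * B ^ 3 - a * b ^ 3\<bar> * (x * t) \<le> D ^ 4 * (1 / sqrt x + 3 * sqrt x) * (1 / t\<^sup>2)"
proof -
  have cube: "\<bar>B ^ 3\<bar> \<le> (D / sqrt t) ^ 3" unfolding power_abs using assms by (intro power_mono) auto
  have e1: "\<bar>(A - a) * B ^ 3\<bar> \<le> D / (x * t * sqrt (x * t)) * (D / sqrt t) ^ 3"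
    unfolding abs_mult using D t x by (intro mult_mono assms cube) (simp_all add: zero_le_divide_iff)
  have "\<bar>B\<^sup>2 + B * b + b\<^sup>2\<bar> \<le> \<bar>B\<bar>\<^sup>2 + \<bar>B\<bar> * \<bar>b\<bar> + \<bar>b\<bar>\<^sup>2"
  proof -
    have "\<bar>p + q + r\<bar> \<le> p + \<bar>q\<bar> + r" if "0 \<le> p" "0 \<le> r" for p q r :: real using that by linarith
    from this[of "B\<^sup>2" "b\<^sup>2" "B * b"] show ?thesis by (simp add: abs_mult)
  qed
  also have "\<dots> \<le> (D / sqrt t)\<^sup>2 + (D / sqrt t) * (D / sqrt t) + (D / sqrt t)\<^sup>2"
    using assms by (intro add_mono power_mono mult_mono) auto
  finally have q: "\<bar>B\<^sup>2 + B * b + b\<^sup>2\<bar> \<le> 3 * (D / sqrt t)\<^sup>2" by (simp add: power2_eq_square)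
  have f: "B ^ 3 - b ^ 3 = (B - b) * (B\<^sup>2 + B * b + b\<^sup>2)" by (simp add: power2_eq_square power3_eq_cube algebra_simps)
  have e2: "\<bar>a * (B ^ 3 - b ^ 3)\<bar> \<le> D / sqrt (x * t) * (D / (t * sqrt t) * (3 * (D / sqrt t)\<^sup>2))"
    unfolding f abs_mult using D t x by (intro mult_mono assms q) (simp_all add: zero_le_divide_iff)
  have "A * B ^ 3 - a * b ^ 3 = (A - a) * B ^ 3 + a * (B ^ 3 - b ^ 3)" by (simp add: algebra_simps)
  then have "\<bar>A * B ^ 3 - a * b ^ 3\<bar> \<le> D / (x * t * sqrt (x * t)) * (D / sqrt t) ^ 3 + D / sqrt (x * t) * (D / (t * sqrt t) * (3 * (D / sqrt t)\<^sup>2))"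
    using e1 e2 by linarith
  then have "\<bar>A * B ^ 3 - a * b ^ 3\<bar> * (x * t) \<le>
      (D / (x * t * sqrt (x * t)) * (D / sqrt t) ^ 3 + D / sqrt (x * t) * (D / (t * sqrt t) * (3 * (D / sqrt t)\<^sup>2))) * (x * t)"
    using x t by (intro mult_right_mono) auto
  also have "\<dots> = D ^ 4 * (1 / sqrt x + 3 * sqrt x) * (1 / t\<^sup>2)"
  proof -
    have r: "sqrt (x * t) = sqrt x * sqrt t" by (simp add: real_sqrt_mult)
    show ?thesis using asymptotic_scaling(1,2)[of "sqrt x" "sqrt t" D] x t
      unfolding r by (simp add: distrib_left distrib_right add_divide_distrib)
  qed
  finally show ?thesis .
qed

text \<open>The leading term of the integrand is \<open>1 / t\<close> times a trigonometric sum, whose four terms are integrated by parts; the remainder is integrable.\<close>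

lemma tail_bound_3:
  obtains C where "C > 0" "\<And>x S T. 0 < x \<Longrightarrow> x \<noteq> 1 \<Longrightarrow> x \<noteq> 3 \<Longrightarrow> 1 \<le> S \<Longrightarrow> S \<le> T \<Longrightarrow>
     \<bar>integral {S..T} (\<lambda>t. bessel_J0 (x * t) * bessel_J0 t ^ 3 * (x * t))\<bar>
       \<le> C * (1 / sqrt x + 3 * sqrt x + sqrt x * (1 / \<bar>x + 3\<bar> + 1 / \<bar>x - 3\<bar> + 1 / \<bar>x + 1\<bar> + 1 / \<bar>x - 1\<bar>)) / S"
proof -
  obtain c C where C: "C > 0" "\<And>t. t > 0 \<Longrightarrow> \<bar>bessel_J0 t - Re (c * cis t) / sqrt t\<bar> \<le> C / (t * sqrt t)"
    by (rule bessel_J0_asymptotic) (rule that)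
  obtain D0 where D0: "D0 > 0" "\<And>t. t > 0 \<Longrightarrow> \<bar>bessel_J0 t\<bar> \<le> D0 / sqrt t" using bessel_J0_decay by blast
  define D where "D = D0 + C + cmod c"
  have D: "D > 0" "D0 \<le> D" "C \<le> D" "cmod c \<le> D" using C(1) D0(1) by (auto simp: D_def add_pos_nonneg)
  show ?thesis
  proof
    show "2 * D ^ 4 > 0" using D by simp
    fix x S T :: real assume x: "0 < x" "x \<noteq> 1" "x \<noteq> 3" and S: "1 \<le> S" "S \<le> T"
    define g where "g t = Re (c * cis t)" for t
    have gb: "\<bar>g t\<bar> \<le> D" for t
      unfolding g_def using abs_Re_le_cmod[of "c * cis t"] D(4) by (simp add: norm_mult)
    \<comment> \<open>The amplitudes belonging to the frequencies \<open>x + 3\<close>, \<open>x - 3\<close>, \<open>x + 1\<close> and \<open>x - 1\<close>.\<close>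
    define k1 k2 k3 k4 where "k1 = c * c ^ 3" and "k2 = c * cnj c ^ 3"
      and "k3 = 3 * of_real ((cmod c)\<^sup>2) * (c * c)" and "k4 = 3 * of_real ((cmod c)\<^sup>2) * (c * cnj c)"
    let ?m = "\<lambda>t. k1 * (cis ((x + 3) * t) / of_real t) + k2 * (cis ((x - 3) * t) / of_real t)
              + k3 * (cis ((x + 1) * t) / of_real t) + k4 * (cis ((x - 1) * t) / of_real t)"
    have ggg: "g (x * t) * g t ^ 3 / t = Re (?m t) / 8" for t
    proof -
      have cnj3: "cnj (cis t) = cis (- t)" by (simp add: cis_cnj)
      have p3: "cis t ^ 3 = cis (3 * t)" using Complex.DeMoivre[of t 3] by simp
      have p3': "cis (- t) ^ 3 = cis (- (3 * t))" using Complex.DeMoivre[of "- t" 3] by simp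
      have "c * cis (x * t) * (c * cis t) ^ 3 + c * cis (x * t) * cnj (c * cis t) ^ 3
         + 3 * of_real ((cmod (c * cis t))\<^sup>2) * (c * cis (x * t) * (c * cis t) + c * cis (x * t) * cnj (c * cis t))
         = k1 * (cis (x * t) * cis (3 * t)) + k2 * (cis (x * t) * cis (- (3 * t))) + k3 * (cis (x * t) * cis t) + k4 * (cis (x * t) * cis (- t))"
        by (simp add: k1_def k2_def k3_def k4_def power_mult_distrib p3 p3' cnj3 norm_mult algebra_simps del: cis_cnj)
      also have "\<dots> = k1 * cis ((x + 3) * t) + k2 * cis ((x - 3) * t) + k3 * cis ((x + 1) * t) + k4 * cis ((x - 1) * t)"
        unfolding cis_mult by (simp add: algebra_simps)
      finally have "g (x * t) * g t ^ 3 = Re (k1 * cis ((x + 3) * t) + k2 * cis ((x - 3) * t) + k3 * cis ((x + 1) * t) + k4 * cis ((x - 1) * t)) / 8"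
        unfolding g_def Re_mult_Re_power3 by simp
      moreover have "?m t = (k1 * cis ((x + 3) * t) + k2 * cis ((x - 3) * t) + k3 * cis ((x + 1) * t) + k4 * cis ((x - 1) * t)) / of_real t"
        by (simp add: add_divide_distrib)
      ultimately show ?thesis by (simp only: Re_divide_of_real) simp
    qed
    have kb: "cmod k1 \<le> 4 * D ^ 4" "cmod k2 \<le> 4 * D ^ 4" "cmod k3 \<le> 4 * D ^ 4" "cmod k4 \<le> 4 * D ^ 4"
    proof -
      have "cmod c ^ 4 \<le> D ^ 4" using D(4) by (intro power_mono) auto
      moreover have "cmod k1 = cmod c ^ 4" "cmod k2 = cmod c ^ 4" "cmod k3 = 3 * cmod c ^ 4" "cmod k4 = 3 * cmod c ^ 4"
        by (simp_all add: k1_def k2_def k3_def k4_def norm_mult norm_power power2_eq_square power3_eq_cube power4_eq_xxxx mult_ac)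
      ultimately show "cmod k1 \<le> 4 * D ^ 4" "cmod k2 \<le> 4 * D ^ 4" "cmod k3 \<le> 4 * D ^ 4" "cmod k4 \<le> 4 * D ^ 4"
        using zero_le_power[OF norm_ge_zero[of c], of 4] by linarith+
    qed
    have im: "((\<lambda>t. cis (\<omega> * t) / of_real t) has_integral integral {S..T} (\<lambda>t. cis (\<omega> * t) / of_real t)) {S..T}" for \<omega>
      using S by (intro integrable_integral integrable_continuous_interval continuous_intros) auto
    let ?I = "\<lambda>\<omega>. integral {S..T} (\<lambda>t. cis (\<omega> * t) / of_real t)"
    have mi: "(?m has_integral k1 * ?I (x + 3) + k2 * ?I (x - 3) + k3 * ?I (x + 1) + k4 * ?I (x - 1)) {S..T}"
      by (intro has_integral_add has_integral_mult_right im)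
    have kI: "cmod (k * ?I \<omega>) \<le> 4 * D ^ 4 * (2 / (\<bar>\<omega>\<bar> * S))" if "cmod k \<le> 4 * D ^ 4" "\<omega> \<noteq> 0" for k \<omega>
      unfolding norm_mult using that norm_integral_cis_over_t_le[OF that(2) S] by (intro mult_mono) auto
    have mb: "cmod (integral {S..T} ?m) \<le> 4 * D ^ 4 * (2 / (\<bar>x + 3\<bar> * S)) + 4 * D ^ 4 * (2 / (\<bar>x - 3\<bar> * S))
        + 4 * D ^ 4 * (2 / (\<bar>x + 1\<bar> * S)) + 4 * D ^ 4 * (2 / (\<bar>x - 1\<bar> * S))"
      unfolding integral_unique[OF mi] using x kb by (intro norm_triangle_le add_mono kI) auto
    define err where "err t = bessel_J0 (x * t) * bessel_J0 t ^ 3 * (x * t) - sqrt x * (g (x * t) * g t ^ 3 / t)" for t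
    have errb: "\<bar>err t\<bar> \<le> D ^ 4 * (1 / sqrt x + 3 * sqrt x) * (1 / t\<^sup>2)" if "t \<in> {S..T}" for t
    proof -
      have t: "t > 0" using that S by auto
      have xt: "x * t > 0" using x t by simp
      have "\<bar>bessel_J0 (x * t) * bessel_J0 t ^ 3 - (g (x * t) / sqrt (x * t)) * (g t / sqrt t) ^ 3\<bar> * (x * t)
         \<le> D ^ 4 * (1 / sqrt x + 3 * sqrt x) * (1 / t\<^sup>2)"
      proof (rule product_asymptotic_error[OF D(1) t x(1)])
        show "\<bar>bessel_J0 t\<bar> \<le> D / sqrt t" using D0(2)[OF t] D t by (elim order_trans) (auto intro: divide_right_mono)
        show "\<bar>g t / sqrt t\<bar> \<le> D / sqrt t" "\<bar>g (x * t) / sqrt (x * t)\<bar> \<le> D / sqrt (x * t)"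
          using gb[of t] gb[of "x * t"] t xt by (auto simp: abs_divide intro!: divide_right_mono)
        show "\<bar>bessel_J0 t - g t / sqrt t\<bar> \<le> D / (t * sqrt t)"
          using C(2)[OF t] D t unfolding g_def by (elim order_trans) (auto intro: divide_right_mono)
        show "\<bar>bessel_J0 (x * t) - g (x * t) / sqrt (x * t)\<bar> \<le> D / (x * t * sqrt (x * t))"
          using C(2)[OF xt] D xt unfolding g_def by (elim order_trans) (auto intro!: divide_right_mono mult_nonneg_nonneg less_imp_le[OF xt])
      qed
      moreover have "(g (x * t) / sqrt (x * t)) * (g t / sqrt t) ^ 3 * (x * t) = sqrt x * (g (x * t) * g t ^ 3 / t)"
      proof -
        have r: "sqrt (x * t) = sqrt x * sqrt t" by (simp add: real_sqrt_mult)
        show ?thesis using asymptotic_scaling(3)[of "sqrt x" "sqrt t" "g (x * t)" "g t"] x t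
          unfolding r by simp
      qed
      ultimately have "\<bar>(bessel_J0 (x * t) * bessel_J0 t ^ 3 - (g (x * t) / sqrt (x * t)) * (g t / sqrt t) ^ 3) * (x * t)\<bar>
         \<le> D ^ 4 * (1 / sqrt x + 3 * sqrt x) * (1 / t\<^sup>2)"
        using abs_of_pos[OF xt] unfolding abs_mult[of _ "x * t"] by simp
      then show ?thesis
        using \<open>(g (x * t) / sqrt (x * t)) * (g t / sqrt t) ^ 3 * (x * t) = sqrt x * (g (x * t) * g t ^ 3 / t)\<close>
        unfolding err_def left_diff_distrib by simp
    qed
    have gi: "((\<lambda>t. sqrt x * (g (x * t) * g t ^ 3 / t)) has_integral sqrt x * (Re (integral {S..T} ?m) / 8)) {S..T}"
      unfolding ggg
      by (intro has_integral_mult_right has_integral_divide has_integral_Re integrable_integral[OF has_integral_integrable[OF mi]])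
    have fi: "((\<lambda>t. bessel_J0 (x * t) * bessel_J0 t ^ 3 * (x * t)) has_integral integral {S..T} (\<lambda>t. bessel_J0 (x * t) * bessel_J0 t ^ 3 * (x * t))) {S..T}"
      by (intro integrable_integral integrable_continuous_interval continuous_intros)
    have ei: "(err has_integral integral {S..T} (\<lambda>t. bessel_J0 (x * t) * bessel_J0 t ^ 3 * (x * t)) - sqrt x * (Re (integral {S..T} ?m) / 8)) {S..T}"
      unfolding err_def[abs_def] by (rule has_integral_diff[OF fi gi])
    have bi: "((\<lambda>t. D ^ 4 * (1 / sqrt x + 3 * sqrt x) * (1 / t\<^sup>2)) has_integral D ^ 4 * (1 / sqrt x + 3 * sqrt x) * (1 / S - 1 / T)) {S..T}"
      by (intro has_integral_mult_right integral_inverse_square_le S)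
    have "\<bar>integral {S..T} (\<lambda>t. bessel_J0 (x * t) * bessel_J0 t ^ 3 * (x * t)) - sqrt x * (Re (integral {S..T} ?m) / 8)\<bar>
       \<le> D ^ 4 * (1 / sqrt x + 3 * sqrt x) * (1 / S - 1 / T)"
      using integral_norm_bound_integral[OF has_integral_integrable[OF ei] has_integral_integrable[OF bi]] errb
      unfolding integral_unique[OF ei] integral_unique[OF bi] by simp
    also have "\<dots> \<le> D ^ 4 * (1 / sqrt x + 3 * sqrt x) * (1 / S)"
      using D x S by (intro mult_left_mono) auto
    finally have b1: "\<bar>integral {S..T} (\<lambda>t. bessel_J0 (x * t) * bessel_J0 t ^ 3 * (x * t)) - sqrt x * (Re (integral {S..T} ?m) / 8)\<bar>
       \<le> D ^ 4 * (1 / sqrt x + 3 * sqrt x) * (1 / S)" .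
    have b2: "\<bar>sqrt x * (Re (integral {S..T} ?m) / 8)\<bar> \<le> sqrt x * (cmod (integral {S..T} ?m) / 8)"
      unfolding abs_mult using abs_Re_le_cmod[of "integral {S..T} ?m"] x by (intro mult_mono) auto
    also have "\<dots> \<le> sqrt x * ((4 * D ^ 4 * (2 / (\<bar>x + 3\<bar> * S)) + 4 * D ^ 4 * (2 / (\<bar>x - 3\<bar> * S))
        + 4 * D ^ 4 * (2 / (\<bar>x + 1\<bar> * S)) + 4 * D ^ 4 * (2 / (\<bar>x - 1\<bar> * S))) / 8)"
      using mb x by (intro mult_left_mono divide_right_mono) auto
    also have "\<dots> = D ^ 4 * (sqrt x * (1 / \<bar>x + 3\<bar> + 1 / \<bar>x - 3\<bar> + 1 / \<bar>x + 1\<bar> + 1 / \<bar>x - 1\<bar>)) * (1 / S)"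
      by (simp add: divide_simps) (simp add: algebra_simps)
    finally have b3: "\<bar>sqrt x * (Re (integral {S..T} ?m) / 8)\<bar> \<le> D ^ 4 * (sqrt x * (1 / \<bar>x + 3\<bar> + 1 / \<bar>x - 3\<bar> + 1 / \<bar>x + 1\<bar> + 1 / \<bar>x - 1\<bar>)) * (1 / S)" .
    have "\<bar>integral {S..T} (\<lambda>t. bessel_J0 (x * t) * bessel_J0 t ^ 3 * (x * t))\<bar> \<le>
        D ^ 4 * (1 / sqrt x + 3 * sqrt x) * (1 / S) + D ^ 4 * (sqrt x * (1 / \<bar>x + 3\<bar> + 1 / \<bar>x - 3\<bar> + 1 / \<bar>x + 1\<bar> + 1 / \<bar>x - 1\<bar>)) * (1 / S)"
      using b1 b3 by linarith
    also have "\<dots> = D ^ 4 * ((1 / sqrt x + 3 * sqrt x + sqrt x * (1 / \<bar>x + 3\<bar> + 1 / \<bar>x - 3\<bar> + 1 / \<bar>x + 1\<bar> + 1 / \<bar>x - 1\<bar>)) / S)"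
      by (simp add: algebra_simps add_divide_distrib)
    also have "\<dots> \<le> 2 * D ^ 4 * ((1 / sqrt x + 3 * sqrt x + sqrt x * (1 / \<bar>x + 3\<bar> + 1 / \<bar>x - 3\<bar> + 1 / \<bar>x + 1\<bar> + 1 / \<bar>x - 1\<bar>)) / S)"
      using D x S by (intro mult_right_mono divide_nonneg_nonneg add_nonneg_nonneg mult_nonneg_nonneg) auto
    finally show "\<bar>integral {S..T} (\<lambda>t. bessel_J0 (x * t) * bessel_J0 t ^ 3 * (x * t))\<bar>
       \<le> 2 * D ^ 4 * (1 / sqrt x + 3 * sqrt x + sqrt x * (1 / \<bar>x + 3\<bar> + 1 / \<bar>x - 3\<bar> + 1 / \<bar>x + 1\<bar> + 1 / \<bar>x - 1\<bar>)) / S"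
      by simp
  qed
qed

lemma kluyver_tail_bound:
  assumes "n = 3 \<or> 5 \<le> n"
  obtains K where "continuous_on (regular_points n) K"
    "\<And>x S T. x \<in> regular_points n \<Longrightarrow> 1 \<le> S \<Longrightarrow> S \<le> T \<Longrightarrow>
     \<bar>integral {S..T} (\<lambda>t. bessel_J0 (x * t) * bessel_J0 t ^ n * (x * t))\<bar> \<le> K x / sqrt S"
proof (cases "5 \<le> n")
  case True
  obtain C where C: "C > 0" "\<And>x S T. 0 < x \<Longrightarrow> 1 \<le> S \<Longrightarrow> S \<le> T \<Longrightarrow>
     \<bar>integral {S..T} (\<lambda>t. bessel_J0 (x * t) * bessel_J0 t ^ n * (x * t))\<bar> \<le> C * x / sqrt S"
    by (rule tail_bound_ge_5[OF True]) (rule that)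
  show ?thesis
    by (rule that[of "\<lambda>x. C * x"]) (use C(2) in \<open>auto simp: regular_points_def intro!: continuous_intros\<close>)
next
  case False
  with assms have n: "n = 3" by simp
  let ?K = "\<lambda>x. 1 / sqrt x + 3 * sqrt x + sqrt x * (1 / \<bar>x + 3\<bar> + 1 / \<bar>x - 3\<bar> + 1 / \<bar>x + 1\<bar> + 1 / \<bar>x - 1\<bar>)"
  obtain C where C: "C > 0" "\<And>x S T. 0 < x \<Longrightarrow> x \<noteq> 1 \<Longrightarrow> x \<noteq> 3 \<Longrightarrow> 1 \<le> S \<Longrightarrow> S \<le> T \<Longrightarrow>
     \<bar>integral {S..T} (\<lambda>t. bessel_J0 (x * t) * bessel_J0 t ^ 3 * (x * t))\<bar> \<le> C * ?K x / S"
    by (rule tail_bound_3) (rule that)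
  show ?thesis
  proof (rule that[of "\<lambda>x. C * ?K x"])
    show "continuous_on (regular_points n) (\<lambda>x. C * ?K x)"
      by (intro continuous_intros) (auto simp: regular_points_def n)
    fix x S T :: real assume x: "x \<in> regular_points n" "1 \<le> S" "S \<le> T"
    then have x': "0 < x" "x \<noteq> 1" "x \<noteq> 3" by (auto simp: regular_points_def n)
    have K0: "0 \<le> C * ?K x" using C(1) x' by (intro mult_nonneg_nonneg add_nonneg_nonneg) auto
    have "sqrt S \<le> S" using x(2) real_sqrt_le_mono[of S "S\<^sup>2"] by (simp add: power2_eq_square)
    then have "C * ?K x / S \<le> C * ?K x / sqrt S" using K0 x(2) by (intro divide_left_mono) auto
    then show "\<bar>integral {S..T} (\<lambda>t. bessel_J0 (x * t) * bessel_J0 t ^ n * (x * t))\<bar> \<le> C * ?K x / sqrt S"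
      using C(2)[OF x' x(2,3)] unfolding n by linarith
  qed
qed

text \<open>The tail bound is a Cauchy criterion for the truncated integrals, with a rate that is locally uniform in \<open>x\<close>.\<close>

lemma kluyver_density_approx:
  assumes "n = 3 \<or> 5 \<le> n"
  obtains K where "continuous_on (regular_points n) K"
    "\<And>x T. x \<in> regular_points n \<Longrightarrow> 1 \<le> T \<Longrightarrow> \<bar>trunc_density n T x - kluyver_density n x\<bar> \<le> K x / sqrt T"
proof -
  obtain K where K: "continuous_on (regular_points n) K"
    "\<And>x S T. x \<in> regular_points n \<Longrightarrow> 1 \<le> S \<Longrightarrow> S \<le> T \<Longrightarrow>
     \<bar>integral {S..T} (\<lambda>t. bessel_J0 (x * t) * bessel_J0 t ^ n * (x * t))\<bar> \<le> K x / sqrt S"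
    by (rule kluyver_tail_bound[OF assms]) (rule that)
  show ?thesis
  proof (rule that[OF K(1)])
    fix x T :: real assume x: "x \<in> regular_points n" and T: "1 \<le> T"
    let ?f = "\<lambda>t. bessel_J0 (x * t) * bessel_J0 t ^ n * (x * t)"
    have i: "?f integrable_on {a..b}" for a b by (intro integrable_continuous_interval continuous_intros)
    have d: "\<bar>trunc_density n b x - trunc_density n a x\<bar> \<le> K x / sqrt a" if "1 \<le> a" "a \<le> b" for a b
      using K(2)[OF x that] Henstock_Kurzweil_Integration.integral_combine[of 0 a b ?f] i that unfolding trunc_density_def by simp
    have K0: "0 \<le> K x" using d[of 1 1] by simp
    define X where "X m = trunc_density n (real (m + 1)) x" for m
    have "((\<lambda>a. 1 / sqrt a) \<longlongrightarrow> 0) at_top" by real_asymp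
    then have lim0: "((\<lambda>a. K x / sqrt a) \<longlongrightarrow> 0) at_top"
      using tendsto_mult_right_zero[of "\<lambda>a. 1 / sqrt a" at_top "K x"] by simp
    have "Cauchy X"
    proof (rule CauchyI')
      fix e :: real assume "0 < e"
      with lim0 have "\<forall>\<^sub>F a in at_top. K x / sqrt a < e" by (rule order_tendstoD)
      then obtain M where M: "\<And>a. a \<ge> M \<Longrightarrow> K x / sqrt a < e" by (auto simp: eventually_at_top_linorder)
      show "\<exists>M. \<forall>m\<ge>M. \<forall>n>m. dist (X m) (X n) < e"
      proof (intro exI[of _ "nat \<lceil>M\<rceil>"] allI impI)
        fix m k assume m: "nat \<lceil>M\<rceil> \<le> m" "m < k"
        then have "M \<le> real (m + 1)" by linarith
        then have "K x / sqrt (real (m + 1)) < e" by (rule M)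
        then show "dist (X m) (X k) < e" using d[of "real (m + 1)" "real (k + 1)"] m(2)
          by (simp add: X_def abs_minus_commute dist_real_def)
      qed
    qed
    then obtain L where L: "X \<longlonglongrightarrow> L" using Cauchy_convergent convergent_def by blast
    have dL: "\<bar>trunc_density n a x - L\<bar> \<le> K x / sqrt a" if "1 \<le> a" for a
    proof (rule tendsto_upperbound)
      show "(\<lambda>m. \<bar>trunc_density n a x - X m\<bar>) \<longlonglongrightarrow> \<bar>trunc_density n a x - L\<bar>"
        by (intro tendsto_intros L)
      show "\<forall>\<^sub>F m in sequentially. \<bar>trunc_density n a x - X m\<bar> \<le> K x / sqrt a"
        using eventually_ge_at_top[of "nat \<lceil>a\<rceil>"]
      proof eventually_elim
        case (elim m)
        then have "a \<le> real (m + 1)" by linarith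
        then show ?case using d[OF that, of "real (m + 1)"] by (simp add: X_def abs_minus_commute dist_real_def)
      qed
    qed simp
    have "((\<lambda>a. trunc_density n a x - L) \<longlongrightarrow> 0) at_top"
    proof (rule Lim_null_comparison[OF _ lim0])
      show "\<forall>\<^sub>F a in at_top. norm (trunc_density n a x - L) \<le> K x / sqrt a"
        using eventually_ge_at_top[of 1] by eventually_elim (simp only: real_norm_def dL)
    qed
    then have "((\<lambda>a. integral {0..a} ?f) \<longlongrightarrow> L) at_top"
      unfolding trunc_density_def by (rule LIM_zero_cancel)
    then have "(?f has_integral L) {0..}" by (intro has_integral_improper_at_top i)
    then have "kluyver_density n x = L" unfolding kluyver_density_def by (rule integral_unique)
    then show "\<bar>trunc_density n T x - kluyver_density n x\<bar> \<le> K x / sqrt T" using dL[OF T] by simp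
  qed
qed

lemma trunc_density_locally_uniform:
  assumes "n = 3 \<or> 5 \<le> n" "x \<in> regular_points n"
  obtains r where "r > 0" "cball x r \<subseteq> regular_points n"
    "uniform_limit (cball x r) (\<lambda>m. trunc_density n (real (m + 1))) (kluyver_density n) sequentially"
proof -
  obtain K where K: "continuous_on (regular_points n) K"
    "\<And>x T. x \<in> regular_points n \<Longrightarrow> 1 \<le> T \<Longrightarrow> \<bar>trunc_density n T x - kluyver_density n x\<bar> \<le> K x / sqrt T"
    by (rule kluyver_density_approx[OF assms(1)]) (rule that)
  obtain r where r: "r > 0" "cball x r \<subseteq> regular_points n"
    using open_contains_cball open_regular_points assms(2) by blast
  have "compact (K ` cball x r)" using r K(1) by (intro compact_continuous_image) (auto intro: continuous_on_subset)
  then obtain B where B: "\<And>y. y \<in> cball x r \<Longrightarrow> \<bar>K y\<bar> \<le> B"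
    by (metis bounded_iff compact_imp_bounded imageI real_norm_def)
  have "uniform_limit (cball x r) (\<lambda>m. trunc_density n (real (m + 1))) (kluyver_density n) sequentially"
  proof (rule uniform_limitI)
    fix e :: real assume e: "0 < e"
    have "(\<lambda>m. 1 / sqrt (real (m + 1))) \<longlonglongrightarrow> 0" by real_asymp
    then have "(\<lambda>m. B / sqrt (real (m + 1))) \<longlonglongrightarrow> 0"
      using tendsto_mult_right_zero[of "\<lambda>m. 1 / sqrt (real (m + 1))" sequentially B] by simp
    then have "\<forall>\<^sub>F m in sequentially. B / sqrt (real (m + 1)) < e" using e by (rule order_tendstoD)
    then show "\<forall>\<^sub>F m in sequentially. \<forall>y\<in>cball x r. dist (trunc_density n (real (m + 1)) y) (kluyver_density n y) < e"
    proof eventually_elim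
      case (elim m)
      show ?case
      proof
        fix y assume y: "y \<in> cball x r"
        then have "\<bar>trunc_density n (real (m + 1)) y - kluyver_density n y\<bar> \<le> K y / sqrt (real (m + 1))"
          using r by (intro K(2)) auto
        also have "\<dots> \<le> B / sqrt (real (m + 1))" using B[OF y] by (intro divide_right_mono) auto
        also have "\<dots> < e" by fact
        finally show "dist (trunc_density n (real (m + 1)) y) (kluyver_density n y) < e" by (simp add: dist_real_def)
      qed
    qed
  qed
  with r show ?thesis by (rule that)
qed

lemma continuous_on_kluyver_density:
  assumes "n = 3 \<or> 5 \<le> n"
  shows "continuous_on (regular_points n) (kluyver_density n)"
proof (rule continuous_at_imp_continuous_on, rule)
  fix x assume "x \<in> regular_points n"
  then obtain r where r: "r > 0" 
    "uniform_limit (cball x r) (\<lambda>m. trunc_density n (real (m + 1))) (kluyver_density n) sequentially"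
    by (rule trunc_density_locally_uniform[OF assms]) (rule that)
  have "continuous_on (cball x r) (kluyver_density n)"
    by (rule uniform_limit_theorem[OF _ r(2)]) (simp_all add: continuous_on_trunc_density)
  then show "isCont (kluyver_density n) x"
    using r(1) by (intro continuous_on_interior[of "cball x r"]) auto
qed

lemma integral_truncation_tendsto:
  fixes f :: "real \<Rightarrow> 'a::banach"
  assumes "(f has_integral L) {0..}"
  shows "(\<lambda>m. integral {0..real (m + 1)} f) \<longlonglongrightarrow> L"
proof (rule LIMSEQ_I)
  fix e :: real assume "0 < e"
  obtain B where B: "B > 0" "\<forall>a b. ball 0 B \<subseteq> cbox a b \<longrightarrow>
    (\<exists>z. ((\<lambda>t. if t \<in> {0..} then f t else 0) has_integral z) (cbox a b) \<and> norm (z - L) < e)"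
    by (rule has_integral_altD[OF assms atLeast_not_cbox \<open>0 < e\<close>]) (rule that)
  show "\<exists>M. \<forall>m\<ge>M. norm (integral {0..real (m + 1)} f - L) < e"
  proof (intro exI[of _ "nat \<lceil>B\<rceil>"] allI impI)
    fix m assume m: "nat \<lceil>B\<rceil> \<le> m"
    then have m': "B \<le> real (m + 1)" by linarith
    then have "ball 0 B \<subseteq> cbox (- B) (real (m + 1))" by (auto simp: dist_norm)
    with B(2) obtain z where z: "((\<lambda>t. if t \<in> {0..} then f t else 0) has_integral z) (cbox (- B) (real (m + 1)))" "norm (z - L) < e"
      by blast
    note z(1)[unfolded cbox_interval]
    then have "((\<lambda>t. if t \<in> {0..real (m + 1)} then f t else 0) has_integral z) {- B..real (m + 1)}"
      by (elim has_integral_eq[rotated]) auto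
    then have "(f has_integral z) {0..real (m + 1)}"
      using B(1) by (subst (asm) has_integral_restrict) auto
    then have "z = integral {0..real (m + 1)} f" by (simp add: integral_unique)
    with z(2) show "norm (integral {0..real (m + 1)} f - L) < e" by simp
  qed
qed

lemma trunc_cdf_tendsto:
  assumes "3 \<le> n"
  shows "(\<lambda>m. trunc_cdf n (real (m + 1)) x) \<longlonglongrightarrow> kluyver_cdf n x"
  unfolding kluyver_cdf_def trunc_cdf_def
  by (rule integral_truncation_tendsto[OF integrable_integral[OF kluyver_cdf_integrand_integrable[OF assms]]])

text \<open>The truncated integrals converge, and their derivatives converge locally uniformly.\<close>

lemma kluyver_cdf_has_real_derivative:
  assumes "n = 3 \<or> 5 \<le> n" "x \<in> regular_points n"
  shows "(kluyver_cdf n has_real_derivative kluyver_density n x) (at x)"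
proof -
  obtain r where r: "r > 0" "cball x r \<subseteq> regular_points n"
    "uniform_limit (cball x r) (\<lambda>m. trunc_density n (real (m + 1))) (kluyver_density n) sequentially"
    by (rule trunc_density_locally_uniform[OF assms]) (rule that)
  have "\<exists>g. \<forall>y\<in>cball x r. (\<lambda>m. trunc_cdf n (real (m + 1)) y) \<longlonglongrightarrow> g y \<and>
      (g has_derivative (*) (kluyver_density n y)) (at y within cball x r)"
  proof (rule has_derivative_sequence)
    show "convex (cball x r)" by simp
    show "x \<in> cball x r" using r(1) by simp
    show "(\<lambda>m. trunc_cdf n (real (m + 1)) x) \<longlonglongrightarrow> kluyver_cdf n x" using assms by (intro trunc_cdf_tendsto) auto
    show "(trunc_cdf n (real (m + 1)) has_derivative (*) (trunc_density n (real (m + 1)) y)) (at y within cball x r)" for m y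
      using trunc_cdf_has_real_derivative by (simp add: has_field_derivative_def)
    fix e :: real assume "e > 0"
    with r(3) have "\<forall>\<^sub>F m in sequentially. \<forall>y\<in>cball x r. dist (trunc_density n (real (m + 1)) y) (kluyver_density n y) < e"
      by (rule uniform_limitD)
    then show "\<forall>\<^sub>F m in sequentially. \<forall>y\<in>cball x r. \<forall>h. norm (trunc_density n (real (m + 1)) y * h - kluyver_density n y * h) \<le> e * norm h"
    proof eventually_elim
      case (elim m)
      show ?case
      proof (intro ballI allI)
        fix y h :: real assume "y \<in> cball x r"
        with elim have "\<bar>trunc_density n (real (m + 1)) y - kluyver_density n y\<bar> \<le> e"
          unfolding dist_real_def using less_imp_le by blast
        then have "\<bar>trunc_density n (real (m + 1)) y - kluyver_density n y\<bar> * \<bar>h\<bar> \<le> e * \<bar>h\<bar>" by (rule mult_right_mono) simp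
        then show "norm (trunc_density n (real (m + 1)) y * h - kluyver_density n y * h) \<le> e * norm h"
          by (simp add: left_diff_distrib[symmetric] abs_mult)
      qed
    qed
  qed
  then obtain g where g: "\<forall>y\<in>cball x r. (\<lambda>m. trunc_cdf n (real (m + 1)) y) \<longlonglongrightarrow> g y \<and>
      (g has_derivative (*) (kluyver_density n y)) (at y within cball x r)" ..
  have eq: "kluyver_cdf n y = g y" if "y \<in> cball x r" for y
    using LIMSEQ_unique[OF trunc_cdf_tendsto conjunct1[OF bspec[OF g that]]] assms(1) by auto
  have xin: "x \<in> cball x r" using r(1) by simp
  have "(kluyver_cdf n has_derivative (*) (kluyver_density n x)) (at x within cball x r)"
    by (rule has_derivative_transform[OF xin eq conjunct2[OF bspec[OF g xin]]])
  moreover have "at x within cball x r = at x"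
    using r(1) by (intro at_within_interior) auto
  ultimately show ?thesis by (simp add: has_field_derivative_def)
qed

section \<open>Odd powers of J0 in the right half-plane\<close>

text \<open>On the ray \<open>z = - \<i> * t\<close> this is a Hankel function of \<open>t\<close>, with real part \<open>J0 t\<close>.\<close>

definition hankel0 :: "complex \<Rightarrow> complex" where
  "hankel0 z = - (2 * \<i> / of_real pi) * macdonald0 z"

text \<open>The terms of the binomial expansion of \<open>(H + (2 * I0 - H)) ^ (2 * j + 1)\<close> in which \<open>H\<close> has the majority, divided by \<open>2 ^ (2 * j)\<close>.\<close>

definition rotated_power :: "nat \<Rightarrow> complex \<Rightarrow> complex" where
  "rotated_power j z = (\<Sum>k=j+1..2*j+1. of_nat ((2*j+1) choose k) * (hankel0 z ^ k * (2 * mbessel0 z - hankel0 z) ^ (2*j+1-k))) / 2 ^ (2 * j)"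

text \<open>An odd exponent allows no tie, so complex conjugation exchanges the upper and the lower half of the binomial expansion of \<open>(h + cnj h) ^ (2 * j + 1)\<close>.\<close>

lemma Re_half_binomial_sum:
  "Re (\<Sum>k=j+1..2*j+1. of_nat ((2*j+1) choose k) * (h ^ k * cnj h ^ (2*j+1-k))) = 2 ^ (2 * j) * Re h ^ (2 * j + 1)"
proof -
  let ?n = "2 * j + 1"
  let ?f = "\<lambda>k. of_nat (?n choose k) * (h ^ k * cnj h ^ (?n - k))"
  have "(h + cnj h) ^ ?n = (\<Sum>k\<le>?n. ?f k)" by (subst binomial_ring) (simp add: mult_ac)
  also have "{..?n} = {..j} \<union> {j+1..?n}" by auto
  also have "(\<Sum>k\<in>\<dots>. ?f k) = (\<Sum>k\<le>j. ?f k) + (\<Sum>k=j+1..?n. ?f k)"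
    by (rule sum.union_disjoint) auto
  also have "(\<Sum>k\<le>j. ?f k) = cnj (\<Sum>k=j+1..?n. ?f k)"
  proof -
    have "(\<Sum>k\<le>j. ?f k) = (\<Sum>k=j+1..?n. ?f (?n - k))"
      by (rule sum.reindex_bij_witness[of _ "\<lambda>k. ?n - k" "\<lambda>k. ?n - k"]) auto
    also have "\<dots> = cnj (\<Sum>k=j+1..?n. ?f k)"
      unfolding cnj_sum
    proof (rule sum.cong)
      fix k assume "k \<in> {j+1..?n}"
      then have k: "k \<le> ?n" by simp
      have "?n - (?n - k) = k" using k by simp
      moreover have "?n choose (?n - k) = ?n choose k" using binomial_symmetric[OF k] by simp
      ultimately show "?f (?n - k) = cnj (?f k)" by (simp add: mult_ac)
    qed simp
    finally show ?thesis .
  qed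
  finally have e: "(h + cnj h) ^ ?n = cnj (\<Sum>k=j+1..?n. ?f k) + (\<Sum>k=j+1..?n. ?f k)" .
  have "Re (cnj S + S) = 2 * Re S" for S by simp
  then have "Re ((h + cnj h) ^ ?n) = 2 * Re (\<Sum>k=j+1..?n. ?f k)" unfolding e by (simp only:)
  moreover have "(h + cnj h) ^ ?n = of_real ((2 * Re h) ^ ?n)" by (simp add: complex_add_cnj)
  ultimately have "(2 * Re h) ^ ?n = 2 * Re (\<Sum>k=j+1..?n. ?f k)" by (simp only: Re_complex_of_real)
  moreover have "(2 * Re h) ^ ?n = 2 * (2 ^ (2 * j) * Re h ^ ?n)" by (simp add: power_mult_distrib)
  ultimately show ?thesis by linarith
qed

lemma Re_rotated_power_imaginary:
  assumes "t > 0"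
  shows "Re (rotated_power j (- \<i> * of_real t)) = bessel_J0 t ^ (2 * j + 1)"
proof -
  let ?z = "- \<i> * complex_of_real t"
  have r: "Re (hankel0 ?z) = bessel_J0 t"
    unfolding hankel0_def bessel_J0_eq_macdonald0[OF assms] by simp
  have "mbessel0 ?z = of_real (bessel_J0 t)"
    using mbessel0_minus[of "\<i> * of_real t"] by (simp add: mbessel0_imaginary)
  then have "2 * mbessel0 ?z - hankel0 ?z = cnj (hankel0 ?z)"
    using r by (simp add: complex_eq_iff)
  then have "rotated_power j ?z = (\<Sum>k=j+1..2*j+1. of_nat ((2*j+1) choose k) * (hankel0 ?z ^ k * cnj (hankel0 ?z) ^ (2*j+1-k))) / of_real (2 ^ (2 * j))"
    unfolding rotated_power_def by simp
  then show ?thesis by (simp only: Re_divide_of_real Re_half_binomial_sum r) simp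
qed

lemma continuous_on_hankel0: "continuous_on {z. 0 \<le> Re z \<and> z \<noteq> 0} hankel0"
  unfolding hankel0_def[abs_def] by (intro continuous_intros continuous_on_macdonald0)

lemma continuous_on_rotated_power: "continuous_on {z. 0 \<le> Re z \<and> z \<noteq> 0} (rotated_power j)"
  unfolding rotated_power_def[abs_def]
  by (intro continuous_intros continuous_on_hankel0) auto

lemma rotated_power_holomorphic: "rotated_power j holomorphic_on {z. 0 < Re z}"
  unfolding rotated_power_def[abs_def] hankel0_def
  by (intro holomorphic_intros macdonald0_holomorphic mbessel0_holomorphic) auto

text \<open>Here the majority counts: \<open>k\<close> factors \<open>exp (- u)\<close> against fewer factors \<open>exp u\<close> leave at least one \<open>exp (- u)\<close>.\<close>

lemma norm_mixed_power_le:
  fixes h g :: complex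
  assumes "cmod h \<le> B * p * exp (- u)" "cmod g \<le> B * q * exp u" "0 \<le> u" "0 \<le> p" "0 \<le> q" "0 \<le> B"
    and "k \<in> {j+1..2*j+1}"
  shows "cmod (h ^ k * g ^ (2*j+1-k)) \<le> B ^ (2*j+1) * (p ^ k * q ^ (2*j+1-k)) * exp (- u)"
proof -
  define m where "m = 2*j+1-k"
  have km: "k + m = 2 * j + 1" "m + 1 \<le> k" using assms(7) by (auto simp: m_def)
  have "cmod (h ^ k * g ^ m) \<le> (B * p * exp (- u)) ^ k * (B * q * exp u) ^ m"
    unfolding norm_mult norm_power using assms by (intro mult_mono power_mono) auto
  also have "\<dots> = B ^ (k + m) * (p ^ k * q ^ m) * (exp (- u) ^ k * exp u ^ m)"
    by (simp add: power_mult_distrib power_add)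
  also have "exp (- u) ^ k * exp u ^ m = exp (- (real k - real m) * u)"
    by (simp add: exp_of_nat_mult[symmetric] exp_add[symmetric] algebra_simps)
  also have "B ^ (k + m) * (p ^ k * q ^ m) * exp (- (real k - real m) * u) \<le> B ^ (k + m) * (p ^ k * q ^ m) * exp (- u)"
  proof (intro mult_left_mono)
    have "1 * u \<le> (real k - real m) * u" using km assms(3) by (intro mult_right_mono) auto
    then show "exp (- (real k - real m) * u) \<le> exp (- u)" by (simp add: algebra_simps)
  qed (use assms in auto)
  finally show ?thesis unfolding km(1) by (simp only: m_def)
qed

text \<open>The binomial coefficients sum to at most \<open>2 ^ (2 * j + 1)\<close>.\<close>

lemma norm_rotated_power_le:
  assumes "\<And>k. k \<in> {j+1..2*j+1} \<Longrightarrow> cmod (hankel0 z ^ k * (2 * mbessel0 z - hankel0 z) ^ (2*j+1-k)) \<le> M"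
  shows "cmod (rotated_power j z) \<le> 2 * M"
proof -
  let ?n = "2 * j + 1"
  have "?n \<in> {j+1..?n}" by simp
  from order_trans[OF norm_ge_zero assms[OF this]] have M0: "0 \<le> M" .
  have "cmod (\<Sum>k=j+1..?n. of_nat (?n choose k) * (hankel0 z ^ k * (2 * mbessel0 z - hankel0 z) ^ (?n-k)))
     \<le> (\<Sum>k=j+1..?n. of_nat (?n choose k) * M)"
    using assms by (intro sum_norm_le) (simp add: norm_mult mult_left_mono)
  also have "\<dots> \<le> (\<Sum>k\<le>?n. of_nat (?n choose k) * M)"
    using M0 by (intro sum_mono2) auto
  also have "\<dots> = 2 ^ ?n * M"
    unfolding sum_distrib_right[symmetric] of_nat_sum[symmetric] choose_row_sum by simp
  finally show ?thesis unfolding rotated_power_def by (simp add: norm_divide norm_power divide_le_eq mult_ac)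
qed

lemma norm_hankel0_le: "cmod (hankel0 z) \<le> cmod (macdonald0 z)"
proof -
  have "2 / pi \<le> 1" using pi_gt3 by simp
  then have "2 / pi * cmod (macdonald0 z) \<le> 1 * cmod (macdonald0 z)" by (intro mult_right_mono) auto
  then show ?thesis by (simp add: hankel0_def norm_mult norm_divide)
qed

text \<open>Near \<open>0\<close> every factor is bounded by a small negative power of \<open>cmod z\<close>; for \<open>cmod z > 1\<close> one factor \<open>H\<close> supplies \<open>cmod z powr (- 1/2)\<close> and the others only their exponentials.\<close>

lemma rotated_power_bound:
  obtains C where "C > 0" "\<And>z. 0 \<le> Re z \<Longrightarrow> z \<noteq> 0 \<Longrightarrow> cmod (rotated_power j z) \<le> C * exp (- Re z) * cmod z powr (-1/2)"
proof -
  \<comment> \<open>Chosen so that the \<open>2 * j + 1\<close> logarithmic singularities at \<open>0\<close> together cost no more than \<open>cmod z powr (- 1/2)\<close>.\<close>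
  define \<epsilon> where "\<epsilon> = 1 / (2 * real (2 * j + 1))"
  have \<epsilon>: "0 < \<epsilon>" "\<epsilon> \<le> 1/2" by (auto simp: \<epsilon>_def field_simps)
  obtain C1 where C1: "C1 > 0" "\<And>z. 0 \<le> Re z \<Longrightarrow> z \<noteq> 0 \<Longrightarrow> cmod (macdonald0 z) \<le> C1 * exp (- Re z) * cmod z powr (- (1/2))"
    by (rule macdonald0_bound[of "1/2"]) (simp_all add: that)
  obtain C2 where C2: "C2 > 0" "\<And>z. 0 \<le> Re z \<Longrightarrow> z \<noteq> 0 \<Longrightarrow> cmod (macdonald0 z) \<le> C2 * exp (- Re z) * cmod z powr (- \<epsilon>)"
    by (rule macdonald0_bound[OF \<epsilon>]) (rule that)
  define B where "B = 2 + C1 + C2"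
  have B: "B \<ge> 1" "B \<ge> 0" using C1(1) C2(1) by (auto simp: B_def)
  show ?thesis
  proof
    show "2 * B ^ (2 * j + 1) > 0" using B by simp
    fix z :: complex assume z: "0 \<le> Re z" "z \<noteq> 0"
    let ?u = "Re z"
    have eu: "exp (- ?u) \<le> exp ?u" using z by simp
    have g: "cmod (2 * mbessel0 z - hankel0 z) \<le> (2 + c) * q * exp ?u"
      if "cmod (hankel0 z) \<le> c * q * exp (- ?u)" "1 \<le> q" "0 \<le> c" for c q
    proof -
      have "cmod (2 * mbessel0 z - hankel0 z) \<le> 2 * cmod (mbessel0 z) + cmod (hankel0 z)"
        by (metis norm_triangle_ineq4 norm_mult norm_numeral)
      also have "\<dots> \<le> 2 * exp ?u + c * q * exp (- ?u)"
        using norm_mbessel0_le[of z] z that(1) by (intro add_mono mult_left_mono) auto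
      also have "\<dots> \<le> 2 * q * exp ?u + c * q * exp ?u"
        using that eu by (intro add_mono mult_left_mono mult_right_mono) auto
      finally show ?thesis by (simp add: algebra_simps)
    qed
    have "cmod (hankel0 z ^ k * (2 * mbessel0 z - hankel0 z) ^ (2*j+1-k)) \<le> B ^ (2 * j + 1) * cmod z powr (-1/2) * exp (- ?u)"
      if k: "k \<in> {j+1..2*j+1}" for k
    proof (cases "cmod z \<le> 1")
      case True
      let ?q = "cmod z powr (- \<epsilon>)"
      have q: "1 \<le> ?q" using True z \<epsilon> by (simp add: powr_minus one_le_inverse_iff powr_le_one_le powr_mono_both powr_le1)
      have h: "cmod (hankel0 z) \<le> C2 * ?q * exp (- ?u)"
        using norm_hankel0_le[of z] C2(2)[OF z] by (simp add: mult_ac)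
      have h': "cmod (hankel0 z) \<le> B * ?q * exp (- ?u)"
        using h C1(1) q by (elim order_trans) (intro mult_right_mono, auto simp: B_def)
      have g': "cmod (2 * mbessel0 z - hankel0 z) \<le> B * ?q * exp ?u"
        using C2(1) C1(1) q by (intro order_trans[OF g[OF h q]] mult_right_mono) (auto simp: B_def)
      have "?q ^ k * ?q ^ (2*j+1-k) = ?q ^ (2 * j + 1)" using k by (simp add: power_add[symmetric])
      also have "\<dots> = ?q powr real (2 * j + 1)" by (rule powr_realpow[symmetric]) (use z in simp)
      also have "\<dots> = cmod z powr (- \<epsilon> * real (2 * j + 1))" by (rule powr_powr)
      also have "- \<epsilon> * real (2 * j + 1) = -1/2" by (simp add: \<epsilon>_def)
      finally show ?thesis using norm_mixed_power_le[OF h' g' z(1) _ _ B(2) k] by simp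
    next
      case False
      let ?s = "cmod z powr (- (1/2))"
      have s: "0 \<le> ?s" "?s \<le> 1" using False by (auto simp: powr_minus inverse_le_1_iff ge_one_powr_ge_zero)
      have h: "cmod (hankel0 z) \<le> C1 * ?s * exp (- ?u)"
        using norm_hankel0_le[of z] C1(2)[OF z] by (simp add: mult_ac)
      have h1: "cmod (hankel0 z) \<le> C1 * 1 * exp (- ?u)"
        using h s C1(1) by (elim order_trans) (intro mult_right_mono mult_left_mono, auto)
      have h': "cmod (hankel0 z) \<le> B * ?s * exp (- ?u)"
        using h C2(1) s by (elim order_trans) (intro mult_right_mono, auto simp: B_def)
      have g': "cmod (2 * mbessel0 z - hankel0 z) \<le> B * 1 * exp ?u"
        using C2(1) C1(1) by (intro order_trans[OF g[OF h1]] mult_right_mono) (auto simp: B_def)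
      have "?s ^ k \<le> ?s ^ 1" using k s by (intro power_decreasing) auto
      then have le: "?s ^ k * 1 ^ (2*j+1-k) \<le> cmod z powr (-1/2)" by simp
      have "cmod (hankel0 z ^ k * (2 * mbessel0 z - hankel0 z) ^ (2*j+1-k)) \<le> B ^ (2*j+1) * (?s ^ k * 1 ^ (2*j+1-k)) * exp (- ?u)"
        by (rule norm_mixed_power_le[OF h' g' z(1) s(1) _ B(2) k]) simp
      also have "\<dots> \<le> B ^ (2*j+1) * cmod z powr (-1/2) * exp (- ?u)"
        using le B by (intro mult_right_mono mult_left_mono) auto
      finally show ?thesis .
    qed
    from norm_rotated_power_le[OF this] show "cmod (rotated_power j z) \<le> 2 * B ^ (2 * j + 1) * exp (- Re z) * cmod z powr (-1/2)"
      by (simp add: mult_ac)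
  qed
qed

text \<open>On the positive axis \<open>I0\<close> also gains a factor \<open>1 / sqrt \<tau>\<close>, so all \<open>2 * j + 1\<close> factors do. This faster decay is what separates \<open>j \<ge> 2\<close> from \<open>j = 1\<close>.\<close>

lemma rotated_power_real_bound:
  obtains C where "C > 0" "\<And>\<tau>. 0 < \<tau> \<Longrightarrow> cmod (rotated_power j (of_real \<tau>)) \<le> C * exp (- \<tau>) * (1 / sqrt \<tau>) ^ (2 * j + 1)"
proof -
  obtain C1 where C1: "C1 > 0" "\<And>z. 0 \<le> Re z \<Longrightarrow> z \<noteq> 0 \<Longrightarrow> cmod (macdonald0 z) \<le> C1 * exp (- Re z) * cmod z powr (- (1/2))"
    by (rule macdonald0_bound[of "1/2"]) (simp_all add: that)
  obtain C2 where C2: "C2 > 0" "\<And>\<tau>. \<tau> > 0 \<Longrightarrow> Re (mbessel0 (of_real \<tau>)) \<le> C2 * exp \<tau> / sqrt \<tau>"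
    by (rule mbessel0_real_upper) (rule that)
  define B where "B = C1 + 2 * C2"
  have B: "B > 0" "B \<ge> 0" using C1(1) C2(1) by (auto simp: B_def)
  show ?thesis
  proof
    show "2 * B ^ (2 * j + 1) > 0" using B by simp
    fix \<tau> :: real assume t: "0 < \<tau>"
    let ?z = "complex_of_real \<tau>" and ?q = "1 / sqrt \<tau>"
    have h: "cmod (hankel0 ?z) \<le> C1 * ?q * exp (- \<tau>)"
    proof -
      have "cmod ?z powr (- (1/2)) = ?q" using t by (simp add: powr_minus_divide powr_half_sqrt)
      then have "cmod (macdonald0 ?z) \<le> C1 * exp (- \<tau>) * ?q" using C1(2)[of ?z] t by simp
      then have "cmod (hankel0 ?z) \<le> C1 * exp (- \<tau>) * ?q" by (rule order_trans[OF norm_hankel0_le])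
      then show ?thesis by (simp only: mult_ac)
    qed
    have h': "cmod (hankel0 ?z) \<le> B * ?q * exp (- \<tau>)"
      using C2(1) t by (intro order_trans[OF h] mult_right_mono) (auto simp: B_def)
    have "cmod (mbessel0 ?z) = \<bar>Re (mbessel0 ?z)\<bar>" by (subst mbessel0_of_real) (rule norm_of_real)
    also have "\<dots> = Re (mbessel0 ?z)" using mbessel0_ge_1[of \<tau>] by simp
    finally have i: "cmod (mbessel0 ?z) \<le> C2 * ?q * exp \<tau>" using C2(2)[OF t] by (simp add: mult_ac)
    have "cmod (2 * mbessel0 ?z - hankel0 ?z) \<le> 2 * cmod (mbessel0 ?z) + cmod (hankel0 ?z)"
      by (metis norm_triangle_ineq4 norm_mult norm_numeral)
    also have "\<dots> \<le> 2 * (C2 * ?q * exp \<tau>) + C1 * ?q * exp \<tau>"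
      using i h t C1(1) by (intro add_mono mult_left_mono order_trans[OF h] mult_left_mono) auto
    finally have g: "cmod (2 * mbessel0 ?z - hankel0 ?z) \<le> B * ?q * exp \<tau>" by (simp add: B_def algebra_simps)
    have "cmod (hankel0 ?z ^ k * (2 * mbessel0 ?z - hankel0 ?z) ^ (2*j+1-k)) \<le> B ^ (2 * j + 1) * ?q ^ (2 * j + 1) * exp (- \<tau>)"
      if k: "k \<in> {j+1..2*j+1}" for k
    proof -
      have "?q ^ k * ?q ^ (2*j+1-k) = ?q ^ (2 * j + 1)" using k by (simp only: power_add[symmetric]) simp
      then show ?thesis using norm_mixed_power_le[OF h' g _ _ _ B(2) k] t by simp
    qed
    from norm_rotated_power_le[OF this] show "cmod (rotated_power j ?z) \<le> 2 * B ^ (2 * j + 1) * exp (- \<tau>) * ?q ^ (2 * j + 1)"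
      by (simp add: mult_ac)
  qed
qed

lemma mbessel1_minus: "mbessel1 (- z) = - mbessel1 z"
proof -
  have "(\<lambda>k. - ((z / 2) ^ (2 * k + 1) / (fact k * fact (Suc k)))) sums (- mbessel1 z)"
    by (intro sums_minus mbessel1_sums)
  moreover have "- ((z / 2) ^ (2 * k + 1) / (fact k * fact (Suc k))) = (- z / 2) ^ (2 * k + 1) / (fact k * fact (Suc k))" for k
    by (simp add: power_mult)
  ultimately show ?thesis using mbessel1_sums[of "- z"] sums_unique2 by (simp only:)
qed

lemma norm_mbessel1_le_linear: "cmod (mbessel1 z) \<le> cmod z * exp \<bar>Re z\<bar>"
proof (cases "z = 0")
  case True
  then show ?thesis using mbessel1_sums[of 0] by (simp add: sums_iff)
next
  case False
  have "cmod (z * mbessel1 z - 0 * mbessel1 0) \<le> (cmod z * exp \<bar>Re z\<bar>) * cmod (z - 0)"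
  proof (rule field_differentiable_bound[of "closed_segment 0 z"])
    fix w assume w: "w \<in> closed_segment 0 z"
    show "((\<lambda>z. z * mbessel1 z) has_field_derivative w * mbessel0 w) (at w within closed_segment 0 z)"
      by (rule has_field_derivative_at_within[OF z_mbessel1_has_field_derivative])
    from w obtain s where s: "0 \<le> s" "s \<le> 1" "w = s *\<^sub>R z" by (auto simp: in_segment)
    have 1: "cmod w \<le> cmod z" using s by (simp add: mult_left_le_one_le)
    have 2: "\<bar>Re w\<bar> \<le> \<bar>Re z\<bar>" using s by (simp add: abs_mult mult_left_le_one_le)
    have "cmod (mbessel0 w) \<le> exp \<bar>Re z\<bar>" using norm_mbessel0_le[of w] 2 by (meson exp_le_cancel_iff order_trans)
    then show "cmod (w * mbessel0 w) \<le> cmod z * exp \<bar>Re z\<bar>" unfolding norm_mult using 1 by (intro mult_mono) auto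
  qed auto
  then have "cmod z * cmod (mbessel1 z) \<le> cmod z * (cmod z * exp \<bar>Re z\<bar>)" by (simp add: norm_mult mult_ac)
  then show ?thesis using False by simp
qed

text \<open>The value at \<open>0\<close> is the limit there, since \<open>I1\<close> has a zero at \<open>0\<close> that outweighs the singularity of \<open>rotated_power\<close>; it makes the function continuous on the closed half-plane.\<close>

definition rotated_integrand :: "nat \<Rightarrow> real \<Rightarrow> complex \<Rightarrow> complex" where
  "rotated_integrand j x z = (if z = 0 then 0 else of_real x * mbessel1 (of_real x * z) * rotated_power j z)"

text \<open>Near \<open>0\<close> the bound with \<open>cmod z powr (1/2)\<close> is the good one, far out the one with \<open>cmod z powr (- 1/2)\<close>; the third follows from both.\<close>

lemma rotated_integrand_bound:
  obtains C where "C > 0"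
    "\<And>x z. 0 \<le> x \<Longrightarrow> x \<le> 1 \<Longrightarrow> 0 \<le> Re z \<Longrightarrow> cmod (rotated_integrand j x z) \<le> C * exp (- (1 - x) * Re z) * cmod z powr (-1/2)"
    "\<And>x z. 0 \<le> x \<Longrightarrow> x \<le> 1 \<Longrightarrow> 0 \<le> Re z \<Longrightarrow> cmod (rotated_integrand j x z) \<le> C * exp (- (1 - x) * Re z) * cmod z powr (1/2)"
    "\<And>x z. 0 \<le> x \<Longrightarrow> x \<le> 1 \<Longrightarrow> 0 \<le> Re z \<Longrightarrow> cmod (rotated_integrand j x z) \<le> C * exp (- (1 - x) * Re z)"
proof -
  obtain C where C: "C > 0" "\<And>z. 0 \<le> Re z \<Longrightarrow> z \<noteq> 0 \<Longrightarrow> cmod (rotated_power j z) \<le> C * exp (- Re z) * cmod z powr (-1/2)"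
    by (rule rotated_power_bound) (rule that)
  have gen: "cmod (rotated_integrand j x z) \<le> C * exp (- (1 - x) * Re z) * (q * cmod z powr (-1/2))"
    if "0 \<le> x" "x \<le> 1" "0 \<le> Re z" "z \<noteq> 0" "cmod (of_real x * mbessel1 (of_real x * z)) \<le> q * exp (x * Re z)" for x z q
  proof -
    have "cmod (rotated_integrand j x z) \<le> (q * exp (x * Re z)) * (C * exp (- Re z) * cmod z powr (-1/2))"
      using that C by (simp add: rotated_integrand_def norm_mult[of _ "rotated_power j z"] mult_mono')
    also have "\<dots> = C * (exp (x * Re z) * exp (- Re z)) * (q * cmod z powr (-1/2))" by (simp only: mult_ac)
    also have "exp (x * Re z) * exp (- Re z) = exp (- (1 - x) * Re z)" by (simp add: exp_add[symmetric] algebra_simps)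
    finally show ?thesis .
  qed
  have b1: "cmod (rotated_integrand j x z) \<le> C * exp (- (1 - x) * Re z) * cmod z powr (-1/2)"
    if "0 \<le> x" "x \<le> 1" "0 \<le> Re z" for x z
  proof (cases "z = 0")
    case False
    have "cmod (mbessel1 (of_real x * z)) \<le> exp (x * Re z)" using norm_mbessel1_le[of "of_real x * z"] that by simp
    then have "x * cmod (mbessel1 (of_real x * z)) \<le> 1 * exp (x * Re z)" using that by (intro mult_mono) auto
    then have "cmod (of_real x * mbessel1 (of_real x * z)) \<le> 1 * exp (x * Re z)" using that by (simp add: norm_mult)
    from gen[OF that False this] show ?thesis by simp
  qed (simp add: rotated_integrand_def)
  have b2: "cmod (rotated_integrand j x z) \<le> C * exp (- (1 - x) * Re z) * cmod z powr (1/2)"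
    if "0 \<le> x" "x \<le> 1" "0 \<le> Re z" for x z
  proof (cases "z = 0")
    case False
    have "cmod (mbessel1 (of_real x * z)) \<le> (x * cmod z) * exp (x * Re z)" using norm_mbessel1_le_linear[of "of_real x * z"] that by (simp add: norm_mult)
    also have "\<dots> \<le> (1 * cmod z) * exp (x * Re z)" using that by (intro mult_right_mono) auto
    finally have "x * cmod (mbessel1 (of_real x * z)) \<le> 1 * (cmod z * exp (x * Re z))" using that by (intro mult_mono) auto
    then have "cmod (of_real x * mbessel1 (of_real x * z)) \<le> cmod z * exp (x * Re z)" using that by (simp add: norm_mult)
    from gen[OF that False this] 
    have "cmod (rotated_integrand j x z) \<le> C * exp (- (1 - x) * Re z) * (cmod z powr 1 * cmod z powr (-1/2))" by simp
    then show ?thesis unfolding powr_add[symmetric] by simp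
  qed (simp add: rotated_integrand_def)
  show ?thesis
  proof (rule that[OF C(1) b1 b2])
    fix x :: real and z :: complex assume xz: "0 \<le> x" "x \<le> 1" "0 \<le> Re z"
    show "cmod (rotated_integrand j x z) \<le> C * exp (- (1 - x) * Re z)"
    proof (cases "cmod z \<le> 1")
      case True
      then have "cmod z powr (1/2) \<le> 1" by (intro powr_le1) auto
      then have "C * exp (- (1 - x) * Re z) * cmod z powr (1/2) \<le> C * exp (- (1 - x) * Re z) * 1" using C(1) by (intro mult_left_mono) auto
      then show ?thesis using b2[OF xz] by linarith
    next
      case False
      then have "cmod z powr (-1/2) \<le> 1" using powr_mono[of "-1/2" 0 "cmod z"] by (cases "z = 0") auto
      then have "C * exp (- (1 - x) * Re z) * cmod z powr (-1/2) \<le> C * exp (- (1 - x) * Re z) * 1" using C(1) by (intro mult_left_mono) auto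
      then show ?thesis using b1[OF xz] by linarith
    qed
  qed
qed

lemma continuous_on_rotated_integrand:
  assumes "0 \<le> x" "x \<le> 1"
  shows "continuous_on {z. 0 \<le> Re z} (rotated_integrand j x)"
  unfolding continuous_on_eq_continuous_within
proof
  fix z assume z: "z \<in> {z. 0 \<le> Re z}"
  show "continuous (at z within {z. 0 \<le> Re z}) (rotated_integrand j x)"
  proof (cases "z = 0")
    case True
    obtain C where C: "C > 0" "\<And>x z. 0 \<le> (x::real) \<Longrightarrow> x \<le> 1 \<Longrightarrow> 0 \<le> Re z \<Longrightarrow> cmod (rotated_integrand j x z) \<le> C * exp (- (1 - x) * Re z) * cmod z powr (1/2)"
      by (rule rotated_integrand_bound[of j]) (rule that)
    have "((\<lambda>w. C * cmod w powr (1/2)) \<longlongrightarrow> C * cmod 0 powr (1/2)) (at (0::complex) within {z. 0 \<le> Re z})"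
      by (intro tendsto_intros tendsto_powr') (auto intro: tendsto_intros)
    then have lim: "((\<lambda>w. C * cmod w powr (1/2)) \<longlongrightarrow> 0) (at (0::complex) within {z. 0 \<le> Re z})" by simp
    have "(rotated_integrand j x \<longlongrightarrow> 0) (at 0 within {z. 0 \<le> Re z})"
    proof (rule Lim_null_comparison[OF _ lim])
      have "cmod (rotated_integrand j x w) \<le> C * cmod w powr (1/2)" if "0 \<le> Re w" for w
      proof -
        have "- (1 - x) * Re w \<le> 0" using assms that by (intro mult_nonpos_nonneg) auto
        then have "exp (- (1 - x) * Re w) \<le> 1" by (simp only: exp_le_one_iff)
        then have "C * exp (- (1 - x) * Re w) * cmod w powr (1/2) \<le> C * 1 * cmod w powr (1/2)"
          using C(1) by (intro mult_right_mono mult_left_mono) auto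
        then show ?thesis using C(2)[OF assms that] by linarith
      qed
      then show "\<forall>\<^sub>F w in at 0 within {z. 0 \<le> Re z}. norm (rotated_integrand j x w) \<le> C * cmod w powr (1/2)"
        by (simp add: eventually_at_topological) (use open_UNIV in blast)
    qed
    then show ?thesis using True by (simp add: continuous_within rotated_integrand_def)
  next
    case False
    have "continuous_on {z. 0 \<le> Re z \<and> z \<noteq> 0} (\<lambda>z. of_real x * mbessel1 (of_real x * z) * rotated_power j z)"
      by (intro continuous_intros continuous_on_rotated_power)
    then have "continuous_on {z. 0 \<le> Re z \<and> z \<noteq> 0} (rotated_integrand j x)"
      by (rule continuous_on_eq) (simp add: rotated_integrand_def)
    then have "continuous (at z within {z. 0 \<le> Re z \<and> z \<noteq> 0}) (rotated_integrand j x)"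
      using z False by (simp add: continuous_on_eq_continuous_within)
    moreover have "at z within {z. 0 \<le> Re z \<and> z \<noteq> 0} = at z within {z. 0 \<le> Re z}"
      by (rule at_within_nhd[of _ "- {0}"]) (use False in auto)
    ultimately show ?thesis by simp
  qed
qed

lemma rotated_integrand_holomorphic: "rotated_integrand j x holomorphic_on {z. 0 < Re z}"
proof -
  have "(\<lambda>z. of_real x * mbessel1 (of_real x * z) * rotated_power j z) holomorphic_on {z. 0 < Re z}"
    by (intro holomorphic_intros rotated_power_holomorphic
        holomorphic_on_compose_gen[OF _ mbessel1_holomorphic[of UNIV], unfolded o_def]) auto
  then show ?thesis by (rule holomorphic_transform) (auto simp: rotated_integrand_def)
qed

text \<open>Cauchy's theorem on the triangle with vertices \<open>0\<close>, \<open>- \<i> * R\<close> and \<open>R\<close>, holomorphic inside and continuous up to the boundary.\<close>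

lemma rotated_integrand_triangle:
  assumes "0 \<le> x" "x \<le> 1" "R > 0"
  shows "integral {0..R} (\<lambda>\<tau>. rotated_integrand j x (of_real \<tau>)) + \<i> * integral {0..R} (\<lambda>t. rotated_integrand j x (- \<i> * of_real t))
     = contour_integral (linepath (- \<i> * of_real R) (of_real R)) (rotated_integrand j x)"
proof -
  let ?f = "rotated_integrand j x" and ?a = "- \<i> * complex_of_real R" and ?b = "complex_of_real R"
  have "convex {z. 0 \<le> Re z}" by (rule convex_halfspace_Re_ge)
  then have hull: "convex hull {0, ?a, ?b} \<subseteq> {z. 0 \<le> Re z}"
    using assms by (intro hull_minimal) auto
  have cont: "continuous_on (convex hull {0, ?a, ?b}) ?f"
    by (rule continuous_on_subset[OF continuous_on_rotated_integrand hull]) fact+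
  have "interior (convex hull {0, ?a, ?b}) \<subseteq> interior {z. 0 \<le> Re z}" by (rule interior_mono[OF hull])
  also have "\<dots> = {z. 0 < Re z}" using interior_halfspace_ge[of "1::complex" 0] by (simp add: inner_complex_def)
  finally have hol: "?f holomorphic_on interior (convex hull {0, ?a, ?b})"
    by (rule holomorphic_on_subset[OF rotated_integrand_holomorphic])
  have zero: "(?f has_contour_integral 0) (linepath 0 ?a +++ linepath ?a ?b +++ linepath ?b 0)"
    by (rule Cauchy_theorem_triangle_interior[OF cont hol])
  have ci: "?f contour_integrable_on linepath u v" if "{u, v} \<subseteq> {0, ?a, ?b}" for u v
  proof (rule contour_integrable_continuous_linepath, rule continuous_on_subset[OF cont])
    show "closed_segment u v \<subseteq> convex hull {0, ?a, ?b}"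
      unfolding segment_convex_hull by (rule hull_mono[OF that])
  qed
  have "contour_integral (linepath 0 ?a) ?f + (contour_integral (linepath ?a ?b) ?f + contour_integral (linepath ?b 0) ?f) = 0"
    using contour_integral_unique[OF zero] ci by (subst (asm) contour_integral_join; (subst (asm) contour_integral_join)?) (auto intro!: valid_path_join contour_integrable_joinI)
  moreover have "contour_integral (linepath ?b 0) ?f = - contour_integral (linepath 0 ?b) ?f"
    by (rule contour_integral_reverse_linepath) (rule continuous_on_subset[OF cont], simp add: segment_convex_hull hull_mono)
  moreover have "contour_integral (linepath 0 ?b) ?f = integral {0..R} (\<lambda>\<tau>. ?f (of_real \<tau>))"
    using contour_integral_linepath_Reals_eq[of 0 ?b ?f] assms by simp
  moreover have "contour_integral (linepath 0 ?a) ?f = - \<i> * integral {0..R} (\<lambda>t. ?f (- \<i> * of_real t))"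
  proof -
    have "contour_integral (linepath 0 ?b) (\<lambda>z. ?f (- \<i> * z)) = integral {0..R} (\<lambda>t. ?f (- \<i> * of_real t))"
      using contour_integral_linepath_Reals_eq[of 0 ?b "\<lambda>z. ?f (- \<i> * z)"] assms by simp
    moreover have "contour_integral (linepath 0 ?a) ?f = - \<i> * contour_integral (linepath 0 ?b) (\<lambda>z. ?f (- \<i> * z))"
    proof -
      have "contour_integral (linepath 0 ?a) ?f = integral {0..1} (\<lambda>s. - \<i> * (?f (- \<i> * linepath 0 ?b s) * ?b))"
        unfolding contour_integral_integral by (simp add: linepath_def vector_derivative_linepath_at mult_ac scaleR_conv_of_real)
      also have "\<dots> = - \<i> * integral {0..1} (\<lambda>s. ?f (- \<i> * linepath 0 ?b s) * ?b)" by (rule integral_mult_right)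
      finally show ?thesis unfolding contour_integral_integral by simp
    qed
    ultimately show ?thesis by simp
  qed
  ultimately show ?thesis by (simp add: algebra_simps)
qed

section \<open>Rotation of the contour and the Maclaurin series\<close>

lemma has_integral_greaterThan_iff:
  fixes f :: "real \<Rightarrow> 'a::banach"
  shows "(f has_integral y) {0<..} \<longleftrightarrow> (f has_integral y) {0..}"
proof (rule has_integral_spike_set_eq)
  have "{x \<in> {0<..} - {0..}. f x \<noteq> 0} = {}" by auto
  then show "negligible {x \<in> {0<..} - {0..}. f x \<noteq> 0}" by (simp only: negligible_empty)
  have "{x \<in> {0..} - {0<..}. f x \<noteq> 0} \<subseteq> {0}" by auto
  then show "negligible {x \<in> {0..} - {0<..}. f x \<noteq> 0}" by (rule negligible_subset[OF negligible_sing])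
qed

lemma integral_exp_decay: "c > 0 \<Longrightarrow> ((\<lambda>\<tau>. C * exp (- c * \<tau>)) has_integral C * (1 / c)) {0..}" for c C :: real
  using has_integral_exp_minus_to_infinity[of c 0] by (intro has_integral_mult_right) auto

text \<open>On the hypotenuse \<open>cmod z \<ge> R / 2\<close>, and the factor \<open>exp (- (1 - x) * Re z)\<close> makes the length irrelevant, as \<open>Re z\<close> grows linearly along it. The remaining factor \<open>cmod z powr (- 1/2)\<close> gives the limit.\<close>

lemma hypotenuse_integral_tendsto_0:
  assumes "0 \<le> x" "x < 1"
  shows "(\<lambda>m. contour_integral (linepath (- \<i> * of_real (real (m + 1))) (of_real (real (m + 1)))) (rotated_integrand j x)) \<longlonglongrightarrow> 0"
proof -
  obtain C where C: "C > 0" "\<And>x z. 0 \<le> x \<Longrightarrow> x \<le> 1 \<Longrightarrow> 0 \<le> Re z \<Longrightarrow>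
      cmod (rotated_integrand j x z) \<le> C * exp (- (1 - x) * Re z) * cmod z powr (-1/2)"
    by (rule rotated_integrand_bound[of j]) (rule that)
  have bound: "cmod (contour_integral (linepath (- \<i> * of_real R) (of_real R)) (rotated_integrand j x))
      \<le> 2 * C / (1 - x) * (R / 2) powr (-1/2)" if R: "R > 0" for R
  proof -
    let ?a = "- \<i> * complex_of_real R" and ?b = "complex_of_real R" and ?f = "rotated_integrand j x"
    have seg: "closed_segment ?a ?b \<subseteq> {z. 0 \<le> Re z}"
      unfolding segment_convex_hull using R by (intro hull_minimal convex_halfspace_Re_ge) auto
    have "?f contour_integrable_on linepath ?a ?b"
      by (rule contour_integrable_continuous_linepath, rule continuous_on_subset[OF continuous_on_rotated_integrand seg])
         (use assms in auto)
    then have hi: "((\<lambda>s. ?f (linepath ?a ?b s) * (?b - ?a)) has_integral contour_integral (linepath ?a ?b) ?f) {0..1}"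
      using has_contour_integral_integral has_contour_integral_linepath by blast
    have wi: "((\<lambda>s. (2 * R * C * (R / 2) powr (-1/2)) * exp (- ((1 - x) * R) * s)) has_integral
       (2 * R * C * (R / 2) powr (-1/2)) * ((- exp (- ((1 - x) * R) * 1) / ((1 - x) * R)) - (- exp (- ((1 - x) * R) * 0) / ((1 - x) * R)))) {0..1}"
      by (intro has_integral_mult_right fundamental_theorem_of_calculus)
         (use assms R in \<open>auto intro!: derivative_eq_intros simp: has_real_derivative_iff_has_vector_derivative[symmetric]\<close>)
    have "cmod (contour_integral (linepath ?a ?b) ?f) \<le> integral {0..1} (\<lambda>s. (2 * R * C * (R / 2) powr (-1/2)) * exp (- ((1 - x) * R) * s))"
      unfolding integral_unique[OF hi, symmetric]
    proof (rule integral_norm_bound_integral[OF has_integral_integrable[OF hi] has_integral_integrable[OF wi]])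
      fix s :: real assume s: "s \<in> {0..1}"
      let ?z = "linepath ?a ?b s"
      have z: "?z = of_real (s * R) - \<i> * of_real ((1 - s) * R)" by (simp add: linepath_def scaleR_conv_of_real algebra_simps)
      have re: "Re ?z = s * R" and im: "Im ?z = - ((1 - s) * R)" unfolding z by simp_all
      have "R / 2 \<le> cmod ?z"
      proof (cases "s \<ge> 1/2")
        case True
        then have "1/2 * R \<le> s * R" using R by (intro mult_right_mono) auto
        then show ?thesis using complex_Re_le_cmod[of ?z] re by simp
      next
        case False
        then have "1/2 * R \<le> (1 - s) * R" using R by (intro mult_right_mono) auto
        then show ?thesis using abs_Im_le_cmod[of ?z] im by simp
      qed
      then have p: "cmod ?z powr (-1/2) \<le> (R / 2) powr (-1/2)" using R by (intro powr_mono2') auto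
      have "cmod (?f ?z) \<le> C * exp (- (1 - x) * Re ?z) * cmod ?z powr (-1/2)"
        using assms s R re by (intro C(2)) auto
      also have "\<dots> \<le> C * exp (- (1 - x) * Re ?z) * (R / 2) powr (-1/2)" using C(1) p by (intro mult_left_mono) auto
      finally have f: "cmod (?f ?z) \<le> C * exp (- (1 - x) * (s * R)) * (R / 2) powr (-1/2)" unfolding re .
      have "cmod (?b - ?a) \<le> cmod ?b + cmod ?a" by (rule norm_triangle_ineq4)
      then have ba: "cmod (?b - ?a) \<le> 2 * R" using R by (simp add: norm_mult)
      have "cmod (?f ?z * (?b - ?a)) \<le> (C * exp (- (1 - x) * (s * R)) * (R / 2) powr (-1/2)) * (2 * R)"
        unfolding norm_mult using f ba C(1) by (intro mult_mono) auto
      also have "- (1 - x) * (s * R) = - ((1 - x) * R) * s" by (simp add: algebra_simps)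
      finally show "cmod (?f ?z * (?b - ?a)) \<le> (2 * R * C * (R / 2) powr (-1/2)) * exp (- ((1 - x) * R) * s)"
        by (simp only: mult_ac)
    qed
    also have "\<dots> = (2 * R * C * (R / 2) powr (-1/2)) * ((1 - exp (- ((1 - x) * R))) / ((1 - x) * R))"
      unfolding integral_unique[OF wi] by (simp add: diff_divide_distrib)
    also have "\<dots> \<le> (2 * R * C * (R / 2) powr (-1/2)) * (1 / ((1 - x) * R))"
      using R C(1) assms by (intro mult_left_mono divide_right_mono) auto
    also have "\<dots> = 2 * C / (1 - x) * (R / 2) powr (-1/2)" using R by simp
    finally show ?thesis .
  qed
  show ?thesis
  proof (rule Lim_null_comparison)
    show "\<forall>\<^sub>F m in sequentially. norm (contour_integral (linepath (- \<i> * of_real (real (m + 1))) (of_real (real (m + 1)))) (rotated_integrand j x))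
       \<le> 2 * C / (1 - x) * (real (m + 1) / 2) powr (-1/2)"
      by (intro always_eventually allI bound) simp
    have "(\<lambda>m. (real (m + 1) / 2) powr (-1/2)) \<longlonglongrightarrow> 0" by real_asymp
    then show "(\<lambda>m. 2 * C / (1 - x) * (real (m + 1) / 2) powr (-1/2)) \<longlonglongrightarrow> 0" by (rule tendsto_mult_right_zero)
  qed
qed

lemma rotated_integrand_real_integrable:
  assumes "0 \<le> x" "x < 1"
  shows "(\<lambda>\<tau>. rotated_integrand j x (of_real \<tau>)) absolutely_integrable_on {0..}"
proof -
  obtain C where C: "C > 0" "\<And>x z. 0 \<le> x \<Longrightarrow> x \<le> 1 \<Longrightarrow> 0 \<le> Re z \<Longrightarrow> cmod (rotated_integrand j x z) \<le> C * exp (- (1 - x) * Re z)"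
    by (rule rotated_integrand_bound[of j]) (rule that)
  show ?thesis
  proof (rule measurable_bounded_by_integrable_imp_absolutely_integrable)
    show "(\<lambda>\<tau>. rotated_integrand j x (of_real \<tau>)) \<in> borel_measurable (lebesgue_on {0..})"
      by (rule continuous_imp_measurable_on_sets_lebesgue)
         (use assms in \<open>auto intro!: continuous_on_compose2[OF continuous_on_rotated_integrand] continuous_intros\<close>)
    show "(\<lambda>\<tau>. C * exp (- (1 - x) * \<tau>)) integrable_on {0..}"
      using integral_exp_decay[of "1 - x" C] assms by auto
    show "norm (rotated_integrand j x (of_real \<tau>)) \<le> C * exp (- (1 - x) * \<tau>)" if "\<tau> \<in> {0..}" for \<tau>
      using C(2)[of x "of_real \<tau>"] assms that by simp
  qed auto
qed

text \<open>The sign absorbs the factor \<open>\<i>\<^sup>2\<close> that arises from \<open>dz = - \<i> dt\<close> and \<open>I1 (- \<i> * x * t) = - \<i> * J1 (x * t)\<close>.\<close>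

definition rotated_weight :: "nat \<Rightarrow> real \<Rightarrow> real" where
  "rotated_weight j \<tau> = - Re (rotated_power j (of_real \<tau>))"

lemma mbessel1_real_sums:
  "(\<lambda>k. (\<tau> / 2) ^ (2 * k + 1) / (fact k * fact (Suc k))) sums Re (mbessel1 (of_real \<tau>))"
  and mbessel1_of_real: "mbessel1 (of_real \<tau>) = of_real (Re (mbessel1 (of_real \<tau>)))"
proof -
  have e: "(of_real \<tau> / 2) ^ (2 * k + 1) / (fact k * fact (Suc k)) = complex_of_real ((\<tau> / 2) ^ (2 * k + 1) / (fact k * fact (Suc k)))" for k by simp
  have s: "(\<lambda>k. complex_of_real ((\<tau> / 2) ^ (2 * k + 1) / (fact k * fact (Suc k)))) sums mbessel1 (of_real \<tau>)"
    using mbessel1_sums[of "of_real \<tau>"] unfolding e .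
  from sums_Re[OF s] show "(\<lambda>k. (\<tau> / 2) ^ (2 * k + 1) / (fact k * fact (Suc k))) sums Re (mbessel1 (of_real \<tau>))"
    by (simp only: Re_complex_of_real)
  from sums_Im[OF s] have "Im (mbessel1 (of_real \<tau>)) = 0" unfolding Im_complex_of_real by (simp add: sums_iff)
  then show "mbessel1 (of_real \<tau>) = of_real (Re (mbessel1 (of_real \<tau>)))" by (simp add: complex_eq_iff)
qed

lemma mbessel0_real_sums:
  "(\<lambda>k. (\<tau> / 2) ^ (2 * k) / (fact k)\<^sup>2) sums Re (mbessel0 (of_real \<tau>))"
proof -
  have e: "(of_real \<tau> / 2) ^ (2 * k) / (fact k)\<^sup>2 = complex_of_real ((\<tau> / 2) ^ (2 * k) / (fact k)\<^sup>2)" for k by simp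
  have "(\<lambda>k. complex_of_real ((\<tau> / 2) ^ (2 * k) / (fact k)\<^sup>2)) sums mbessel0 (of_real \<tau>)"
    using mbessel0_sums[of "of_real \<tau>"] unfolding e .
  from sums_Re[OF this] show ?thesis by (simp only: Re_complex_of_real)
qed

lemma rotated_integrand_on_reals:
  assumes "\<tau> > 0"
  shows "Re (rotated_integrand j x (of_real \<tau>)) = - (x * Re (mbessel1 (of_real (x * \<tau>))) * rotated_weight j \<tau>)"
proof -
  have "rotated_integrand j x (of_real \<tau>) = of_real (x * Re (mbessel1 (of_real (x * \<tau>)))) * rotated_power j (of_real \<tau>)"
    using assms mbessel1_of_real[of "x * \<tau>"] by (simp add: rotated_integrand_def)
  then show ?thesis by (simp add: rotated_weight_def)
qed

text \<open>Take real parts in the triangle identity and let \<open>R\<close> tend to infinity: the leg on the imaginary axis converges to \<open>F\<close>, the hypotenuse disappears, and the leg on the real axis remains.\<close>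

lemma kluyver_cdf_rotation:
  assumes "1 \<le> j" "0 \<le> x" "x < 1"
  shows "((\<lambda>\<tau>. x * Re (mbessel1 (of_real (x * \<tau>))) * rotated_weight j \<tau>) has_integral kluyver_cdf (2 * j + 1) x) {0<..}"
proof -
  let ?f = "rotated_integrand j x"
  define L where "L = integral {0..} (\<lambda>\<tau>. ?f (of_real \<tau>))"
  have fi: "((\<lambda>\<tau>. ?f (of_real \<tau>)) has_integral L) {0..}"
    unfolding L_def using rotated_integrand_real_integrable[OF assms(2,3)] 
    by (intro integrable_integral) (rule set_lebesgue_integral_eq_integral(1))
  have lim1: "(\<lambda>m. integral {0..real (m + 1)} (\<lambda>\<tau>. ?f (of_real \<tau>))) \<longlonglongrightarrow> L"
    by (rule integral_truncation_tendsto[OF fi])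
  let ?h = "\<lambda>m. contour_integral (linepath (- \<i> * of_real (real (m + 1))) (of_real (real (m + 1)))) ?f"
  have re: "Re (integral {0..R} (\<lambda>\<tau>. ?f (of_real \<tau>))) = Re (contour_integral (linepath (- \<i> * of_real R) (of_real R)) ?f) - trunc_cdf (2 * j + 1) R x"
    if R: "R > 0" for R
  proof -
    have ii: "(\<lambda>t. ?f (- \<i> * of_real t)) integrable_on {0..R}"
      by (intro integrable_continuous_interval continuous_on_compose2[OF continuous_on_rotated_integrand])
         (use assms in \<open>auto intro!: continuous_intros\<close>)
    have "Re (\<i> * integral {0..R} (\<lambda>t. ?f (- \<i> * of_real t))) = Re (integral {0..R} (\<lambda>t. \<i> * ?f (- \<i> * of_real t)))"
      by (simp only: integral_mult_right)
    also have "\<dots> = integral {0..R} (\<lambda>t. Re (\<i> * ?f (- \<i> * of_real t)))"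
      using integral_linear[OF integrable_on_mult_right[OF ii, of \<i>] bounded_linear_Re] by (simp add: o_def)
    also have "\<dots> = trunc_cdf (2 * j + 1) R x"
      unfolding trunc_cdf_def
    proof (rule integral_cong)
      fix t assume t: "t \<in> {0..R}"
      show "Re (\<i> * ?f (- \<i> * of_real t)) = x * bessel_J1 (x * t) * bessel_J0 t ^ (2 * j + 1)"
      proof (cases "t = 0")
        case True
        have "mbessel1 0 = 0" using norm_mbessel1_le_linear[of 0] by simp
        then show ?thesis using True by (simp add: rotated_integrand_def bessel_J1_def)
      next
        case False
        then have t0: "t > 0" using t by simp
        have "of_real x * (- \<i> * of_real t) = - (\<i> * of_real (x * t))" by simp
        then have e: "mbessel1 (of_real x * (- \<i> * of_real t)) = - \<i> * of_real (bessel_J1 (x * t))"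
          by (simp only: mbessel1_minus mbessel1_imaginary) simp
        have "\<i> * (of_real x * (- \<i> * of_real (bessel_J1 (x * t))) * r) = of_real (x * bessel_J1 (x * t)) * r" for r
          by (simp add: algebra_simps)
        then have "\<i> * ?f (- \<i> * of_real t) = of_real (x * bessel_J1 (x * t)) * rotated_power j (- \<i> * of_real t)"
          using False unfolding rotated_integrand_def e by simp
        moreover have "Re (of_real y * w) = y * Re w" for y w by simp
        ultimately have "Re (\<i> * ?f (- \<i> * of_real t)) = (x * bessel_J1 (x * t)) * Re (rotated_power j (- \<i> * of_real t))"
          by (simp only:)
        then show ?thesis unfolding Re_rotated_power_imaginary[OF t0] .
      qed
    qed
    finally show ?thesis using arg_cong[OF rotated_integrand_triangle[of x R j], of Re] assms R
      unfolding plus_complex.sel by simp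
  qed
  have "(\<lambda>m. Re (?h m) - trunc_cdf (2 * j + 1) (real (m + 1)) x) \<longlonglongrightarrow> Re 0 - kluyver_cdf (2 * j + 1) x"
    by (intro tendsto_diff tendsto_Re hypotenuse_integral_tendsto_0 trunc_cdf_tendsto) (use assms in auto)
  then have "(\<lambda>m. Re (integral {0..real (m + 1)} (\<lambda>\<tau>. ?f (of_real \<tau>)))) \<longlonglongrightarrow> - kluyver_cdf (2 * j + 1) x"
    by (subst re) simp_all
  with tendsto_Re[OF lim1] have "Re L = - kluyver_cdf (2 * j + 1) x" by (rule LIMSEQ_unique)
  then have "((\<lambda>\<tau>. - Re (?f (of_real \<tau>))) has_integral kluyver_cdf (2 * j + 1) x) {0..}"
    using has_integral_neg[OF has_integral_Re[OF fi]] by simp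
  then have "((\<lambda>\<tau>. - Re (?f (of_real \<tau>))) has_integral kluyver_cdf (2 * j + 1) x) {0<..}"
    by (simp only: has_integral_greaterThan_iff)
  then show ?thesis by (rule has_integral_eq[rotated]) (simp add: rotated_integrand_on_reals)
qed

lemma rotated_weight_bound:
  obtains C where "C > 0" "\<And>\<tau>. \<tau> > 0 \<Longrightarrow> \<bar>rotated_weight j \<tau>\<bar> \<le> C * exp (- \<tau>) * \<tau> powr (-1/2)"
proof -
  obtain C where C: "C > 0" "\<And>z. 0 \<le> Re z \<Longrightarrow> z \<noteq> 0 \<Longrightarrow> cmod (rotated_power j z) \<le> C * exp (- Re z) * cmod z powr (-1/2)"
    by (rule rotated_power_bound) (rule that)
  show ?thesis
  proof (rule that[OF C(1)])
    fix \<tau> :: real assume "\<tau> > 0"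
    then show "\<bar>rotated_weight j \<tau>\<bar> \<le> C * exp (- \<tau>) * \<tau> powr (-1/2)"
      using C(2)[of "of_real \<tau>"] abs_Re_le_cmod[of "rotated_power j (of_real \<tau>)"] by (simp add: rotated_weight_def)
  qed
qed

lemma continuous_on_rotated_weight: "continuous_on {0<..} (rotated_weight j)"
  unfolding rotated_weight_def[abs_def]
  by (intro continuous_intros continuous_on_compose2[OF continuous_on_rotated_power]) (auto intro!: continuous_intros)

text \<open>The terms of the power series of \<open>\<tau> * I0 \<tau>\<close>, which is the derivative of \<open>x * I1 (x * \<tau>)\<close> with respect to \<open>x\<close> at \<open>x = 1\<close>.\<close>

definition maclaurin_kernel :: "nat \<Rightarrow> real \<Rightarrow> real" where
  "maclaurin_kernel k \<tau> = \<tau> * (\<tau> / 2) ^ (2 * k) / (fact k)\<^sup>2"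

definition maclaurin_coeff :: "nat \<Rightarrow> nat \<Rightarrow> real" where
  "maclaurin_coeff j k = integral {0<..} (\<lambda>\<tau>. maclaurin_kernel k \<tau> * rotated_weight j \<tau>)"

lemma continuous_on_maclaurin_kernel [continuous_intros]:
  "continuous_on A f \<Longrightarrow> continuous_on A (\<lambda>x. maclaurin_kernel k (f x))"
  unfolding maclaurin_kernel_def by (intro continuous_intros) auto

lemma maclaurin_kernel_nonneg: "0 \<le> \<tau> \<Longrightarrow> 0 \<le> maclaurin_kernel k \<tau>"
  by (simp add: maclaurin_kernel_def)

lemma maclaurin_kernel_sums: "(\<lambda>k. maclaurin_kernel k \<tau>) sums (\<tau> * Re (mbessel0 (of_real \<tau>)))"
  using sums_mult[OF mbessel0_real_sums[of \<tau>], of \<tau>] by (simp add: maclaurin_kernel_def)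

lemma maclaurin_integrand_absolutely_integrable:
  "(\<lambda>\<tau>. maclaurin_kernel k \<tau> * rotated_weight j \<tau>) absolutely_integrable_on {0<..}"
proof -
  obtain C where C: "C > 0" "\<And>\<tau>. \<tau> > 0 \<Longrightarrow> \<bar>rotated_weight j \<tau>\<bar> \<le> C * exp (- \<tau>) * \<tau> powr (-1/2)"
    by (rule rotated_weight_bound) (rule that)
  let ?p = "real (2 * k) + 3/2"
  show ?thesis
  proof (rule measurable_bounded_by_integrable_imp_absolutely_integrable)
    show "(\<lambda>\<tau>. maclaurin_kernel k \<tau> * rotated_weight j \<tau>) \<in> borel_measurable (lebesgue_on {0<..})"
      by (rule continuous_imp_measurable_on_sets_lebesgue) (auto intro!: continuous_intros continuous_on_rotated_weight)
    have "((\<lambda>\<tau>. C * (\<tau> powr (?p - 1) / exp \<tau>)) has_integral C * Gamma ?p) {0..}"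
      by (intro has_integral_mult_right Gamma_integral_real) simp
    then have "((\<lambda>\<tau>. C * (\<tau> powr (?p - 1) / exp \<tau>)) has_integral C * Gamma ?p) {0<..}"
      by (simp only: has_integral_greaterThan_iff)
    then show "(\<lambda>\<tau>. C * (\<tau> powr (?p - 1) / exp \<tau>)) integrable_on {0<..}" by blast
    fix \<tau> :: real assume "\<tau> \<in> {0<..}"
    then have t: "\<tau> > 0" by simp
    have f1: "(1::real) \<le> (fact k)\<^sup>2" using fact_ge_1[of k, where 'a = real] by (simp add: one_le_power)
    have "(\<tau> / 2) ^ (2 * k) / (fact k)\<^sup>2 \<le> \<tau> ^ (2 * k) / 1"
      using t f1 by (intro frac_le power_mono) auto
    then have "\<tau> * ((\<tau> / 2) ^ (2 * k) / (fact k)\<^sup>2) \<le> \<tau> * \<tau> ^ (2 * k)" using t by (intro mult_left_mono) auto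
    then have "\<bar>maclaurin_kernel k \<tau>\<bar> \<le> \<tau> * \<tau> ^ (2 * k)" using t by (simp add: maclaurin_kernel_def)
    then have "\<bar>maclaurin_kernel k \<tau>\<bar> * \<bar>rotated_weight j \<tau>\<bar> \<le> (\<tau> * \<tau> ^ (2 * k)) * (C * exp (- \<tau>) * \<tau> powr (-1/2))"
      using C(2)[OF t] t by (intro mult_mono) auto
    also have "\<dots> = C * exp (- \<tau>) * (\<tau> powr 1 * \<tau> powr real (2 * k) * \<tau> powr (-1/2))"
      using t by (subst powr_realpow) (simp_all add: mult_ac)
    also have "\<tau> powr 1 * \<tau> powr real (2 * k) * \<tau> powr (-1/2) = \<tau> powr (?p - 1)"
      unfolding powr_add[symmetric] by simp
    finally show "norm (maclaurin_kernel k \<tau> * rotated_weight j \<tau>) \<le> C * (\<tau> powr (?p - 1) / exp \<tau>)"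
      by (simp add: abs_mult exp_minus field_simps)
  qed auto
qed

lemma maclaurin_integrand_has_integral:
  "((\<lambda>\<tau>. maclaurin_kernel k \<tau> * rotated_weight j \<tau>) has_integral maclaurin_coeff j k) {0<..}"
  unfolding maclaurin_coeff_def
  by (intro integrable_integral set_lebesgue_integral_eq_integral(1) maclaurin_integrand_absolutely_integrable)

text \<open>Integrate the power series of \<open>I1\<close> term by term. Its partial sums are dominated by the full sum, because all terms are nonnegative, and the full sum is integrable against \<open>\<bar>w\<bar>\<close> for \<open>x < 1\<close>.\<close>

lemma kluyver_cdf_sums:
  assumes "1 \<le> j" "0 \<le> x" "x < 1"
  shows "(\<lambda>k. maclaurin_coeff j k * (x ^ (2 * k + 2) / real (2 * k + 2))) sums kluyver_cdf (2 * j + 1) x"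
proof -
  let ?w = "rotated_weight j"
  let ?t = "\<lambda>k \<tau>. maclaurin_kernel k \<tau> * (x ^ (2 * k + 2) / real (2 * k + 2))"
  have kernel_term: "?t k \<tau> = x * ((x * \<tau> / 2) ^ (2 * k + 1) / (fact k * fact (Suc k)))" for k \<tau>
    by (simp add: maclaurin_kernel_def power_mult_distrib power_divide divide_simps power2_eq_square del: of_nat_Suc) (simp add: algebra_simps)
  have tsums: "(\<lambda>k. ?t k \<tau>) sums (x * Re (mbessel1 (of_real (x * \<tau>))))" for \<tau>
    unfolding kernel_term by (intro sums_mult mbessel1_real_sums)
  have hi: "(\<lambda>\<tau>. x * Re (mbessel1 (of_real (x * \<tau>))) * \<bar>?w \<tau>\<bar>) integrable_on {0<..}"
  proof -
    have "(\<lambda>\<tau>. Re (rotated_integrand j x (of_real \<tau>))) absolutely_integrable_on {0..}"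
      using absolutely_integrable_linear[OF rotated_integrand_real_integrable[OF assms(2,3)] bounded_linear_Re] by (simp add: o_def)
    then have "(\<lambda>\<tau>. norm (Re (rotated_integrand j x (of_real \<tau>)))) integrable_on {0..}"
      by (simp add: absolutely_integrable_on_def)
    then have "(\<lambda>\<tau>. norm (Re (rotated_integrand j x (of_real \<tau>)))) integrable_on {0<..}"
      by (simp only: integrable_on_def has_integral_greaterThan_iff)
    then show ?thesis
    proof (rule integrable_eq)
      fix \<tau> :: real assume "\<tau> \<in> {0<..}"
      then have t: "\<tau> > 0" by simp
      have "0 \<le> x * Re (mbessel1 (of_real (x * \<tau>)))"
      proof -
        have "0 \<le> (\<Sum>k. ?t k \<tau>)" using t assms
          by (intro suminf_nonneg sums_summable[OF tsums]) (auto simp: maclaurin_kernel_nonneg)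
        then show ?thesis using sums_unique[OF tsums[of \<tau>]] by simp
      qed
      then show "norm (Re (rotated_integrand j x (of_real \<tau>))) = x * Re (mbessel1 (of_real (x * \<tau>))) * \<bar>?w \<tau>\<bar>"
        unfolding rotated_integrand_on_reals[OF t] real_norm_def abs_minus_cancel abs_mult[of _ "?w \<tau>"] by simp
    qed
  qed
  have pi: "((\<lambda>\<tau>. \<Sum>k<n. ?t k \<tau> * ?w \<tau>) has_integral (\<Sum>k<n. maclaurin_coeff j k * (x ^ (2 * k + 2) / real (2 * k + 2)))) {0<..}" for n
  proof (rule has_integral_sum)
    fix k
    have "((\<lambda>\<tau>. (maclaurin_kernel k \<tau> * ?w \<tau>) * (x ^ (2 * k + 2) / real (2 * k + 2))) has_integral
       maclaurin_coeff j k * (x ^ (2 * k + 2) / real (2 * k + 2))) {0<..}"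
      by (intro has_integral_mult_left maclaurin_integrand_has_integral)
    then show "((\<lambda>\<tau>. ?t k \<tau> * ?w \<tau>) has_integral maclaurin_coeff j k * (x ^ (2 * k + 2) / real (2 * k + 2))) {0<..}"
      by (simp only: mult_ac)
  qed simp
  have "(\<lambda>n. integral {0<..} (\<lambda>\<tau>. \<Sum>k<n. ?t k \<tau> * ?w \<tau>)) \<longlonglongrightarrow> integral {0<..} (\<lambda>\<tau>. x * Re (mbessel1 (of_real (x * \<tau>))) * ?w \<tau>)"
  proof (rule dominated_convergence[OF has_integral_integrable[OF pi] hi])
    fix n and \<tau> :: real assume "\<tau> \<in> {0<..}"
    then have t: "\<tau> > 0" by simp
    have n0: "0 \<le> ?t k \<tau>" for k using t assms by (simp add: maclaurin_kernel_nonneg)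
    have "(\<Sum>k<n. ?t k \<tau>) \<le> x * Re (mbessel1 (of_real (x * \<tau>)))"
      unfolding sums_unique[OF tsums[of \<tau>]] by (intro sum_le_suminf sums_summable[OF tsums]) (use n0 in auto)
    moreover have "0 \<le> (\<Sum>k<n. ?t k \<tau>)" using n0 by (intro sum_nonneg) auto
    ultimately have "\<bar>\<Sum>k<n. ?t k \<tau>\<bar> * \<bar>?w \<tau>\<bar> \<le> x * Re (mbessel1 (of_real (x * \<tau>))) * \<bar>?w \<tau>\<bar>"
      by (intro mult_right_mono) auto
    then show "norm (\<Sum>k<n. ?t k \<tau> * ?w \<tau>) \<le> x * Re (mbessel1 (of_real (x * \<tau>))) * \<bar>?w \<tau>\<bar>"
      by (simp only: real_norm_def abs_mult sum_distrib_right[symmetric])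
  next
    fix \<tau> :: real
    show "(\<lambda>n. \<Sum>k<n. ?t k \<tau> * ?w \<tau>) \<longlonglongrightarrow> x * Re (mbessel1 (of_real (x * \<tau>))) * ?w \<tau>"
      using sums_mult2[OF tsums[of \<tau>], of "?w \<tau>"] unfolding sums_def .
  qed
  then show ?thesis unfolding integral_unique[OF pi] integral_unique[OF kluyver_cdf_rotation[OF assms]] sums_def .
qed

text \<open>For large \<open>\<tau>\<close> the exponentials of \<open>I0\<close> and of the weight cancel, and the powers leave \<open>\<tau> * \<tau> powr (- 1/2) * \<tau> powr (- 5/2) = \<tau> powr (- 2)\<close>. For \<open>j = 1\<close> the same count gives \<open>1 / \<tau>\<close>.\<close>

lemma kernel_weight_integrable:
  assumes "2 \<le> j"
  shows "(\<lambda>\<tau>. \<tau> * Re (mbessel0 (of_real \<tau>)) * \<bar>rotated_weight j \<tau>\<bar>) integrable_on {0<..}"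
proof -
  obtain C1 where C1: "C1 > 0" "\<And>\<tau>. \<tau> > 0 \<Longrightarrow> \<bar>rotated_weight j \<tau>\<bar> \<le> C1 * exp (- \<tau>) * \<tau> powr (-1/2)"
    by (rule rotated_weight_bound) (rule that)
  obtain C2 where C2: "C2 > 0" "\<And>\<tau>. 0 < \<tau> \<Longrightarrow> cmod (rotated_power j (of_real \<tau>)) \<le> C2 * exp (- \<tau>) * (1 / sqrt \<tau>) ^ (2 * j + 1)"
    by (rule rotated_power_real_bound) (rule that)
  obtain C3 where C3: "C3 > 0" "\<And>\<tau>. \<tau> > 0 \<Longrightarrow> Re (mbessel0 (of_real \<tau>)) \<le> C3 * exp \<tau> / sqrt \<tau>"
    by (rule mbessel0_real_upper) (rule that)
  define C where "C = C1 + C2 * C3"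
  have C: "C1 \<le> C" "C3 * C2 \<le> C" "0 < C" using C1(1) C2(1) C3(1) by (auto simp: C_def add_pos_pos)
  let ?W = "\<lambda>\<tau>. \<tau> * Re (mbessel0 (of_real \<tau>)) * \<bar>rotated_weight j \<tau>\<bar>"
  show ?thesis
  proof (rule measurable_bounded_by_integrable_imp_integrable)
    show "?W \<in> borel_measurable (lebesgue_on {0<..})"
      by (rule continuous_imp_measurable_on_sets_lebesgue) (auto intro!: continuous_intros continuous_on_rotated_weight)
    have "((\<lambda>\<tau>. C * decay_weight \<tau>) has_integral C * 3) {0..}"
      by (intro has_integral_mult_right decay_weight_has_integral)
    then have "((\<lambda>\<tau>. C * decay_weight \<tau>) has_integral C * 3) {0<..}"
      by (simp only: has_integral_greaterThan_iff)
    then show "(\<lambda>\<tau>. C * decay_weight \<tau>) integrable_on {0<..}" by blast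
    fix \<tau> :: real assume "\<tau> \<in> {0<..}"
    then have t: "\<tau> > 0" by simp
    have I0: "0 \<le> Re (mbessel0 (of_real \<tau>))" using mbessel0_ge_1[of \<tau>] by linarith
    show "norm (?W \<tau>) \<le> C * decay_weight \<tau>"
    proof (cases "\<tau> \<le> 1")
      case True
      have "Re (mbessel0 (of_real \<tau>)) \<le> exp \<tau>"
        using norm_mbessel0_le[of "of_real \<tau>"] complex_Re_le_cmod[of "mbessel0 (of_real \<tau>)"] t by simp
      then have "?W \<tau> \<le> (\<tau> * exp \<tau>) * (C1 * exp (- \<tau>) * \<tau> powr (-1/2))"
        using C1(2)[OF t] t I0 by (intro mult_mono) auto
      also have "\<dots> = C1 * (\<tau> powr 1 * \<tau> powr (-1/2))" using t by (simp add: exp_minus field_simps)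
      also have "\<tau> powr 1 * \<tau> powr (-1/2) = \<tau> powr (1/2)" unfolding powr_add[symmetric] by simp
      also have "C1 * \<tau> powr (1/2) \<le> C * 1" using t True C C1(1) by (intro mult_mono powr_le1) auto
      finally show ?thesis using True t I0 by (simp add: decay_weight_def abs_mult)
    next
      case False
      have "\<bar>rotated_weight j \<tau>\<bar> \<le> C2 * exp (- \<tau>) * (1 / sqrt \<tau>) ^ (2 * j + 1)"
        using C2(2)[OF t] abs_Re_le_cmod[of "rotated_power j (of_real \<tau>)"] by (simp add: rotated_weight_def)
      also have "\<dots> \<le> C2 * exp (- \<tau>) * (1 / sqrt \<tau>) ^ 5"
        using False assms C2(1) by (intro mult_left_mono power_decreasing) auto
      finally have "?W \<tau> \<le> (\<tau> * (C3 * exp \<tau> / sqrt \<tau>)) * (C2 * exp (- \<tau>) * (1 / sqrt \<tau>) ^ 5)"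
        using C3(2)[OF t] t C3(1) I0 by (intro mult_mono) auto
      also have "\<dots> = C3 * C2 * (exp \<tau> * exp (- \<tau>)) * (\<tau> * (1 / sqrt \<tau>) ^ 6)"
        by (simp add: eval_nat_numeral)
      also have "exp \<tau> * exp (- \<tau>) = 1" by (simp add: exp_minus)
      also have "\<tau> * (1 / sqrt \<tau>) ^ 6 = \<tau> powr (-2)"
      proof -
        have "sqrt \<tau> ^ 6 = (sqrt \<tau> ^ 2) ^ 3" by (simp only: power_mult[symmetric]) simp
        also have "\<dots> = \<tau> ^ 3" using t by simp
        finally have "(1 / sqrt \<tau>) ^ 6 = 1 / \<tau> ^ 3" by (simp add: power_divide)
        then show ?thesis using t by (simp add: powr_minus_divide powr_numeral power3_eq_cube power2_eq_square)
      qed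
      also have "C3 * C2 * 1 * \<tau> powr (-2) \<le> C * \<tau> powr (-3/2)"
        using C False C2(1) C3(1) unfolding mult_1_right by (intro mult_mono powr_mono) auto
      finally show ?thesis using False t I0 by (simp add: decay_weight_def abs_mult)
    qed
  qed auto
qed

text \<open>Monotone interchange of sum and integral with \<open>\<bar>w\<bar>\<close> in place of \<open>w\<close>.\<close>

lemma maclaurin_coeff_summable:
  assumes "2 \<le> j"
  shows "summable (\<lambda>k. \<bar>maclaurin_coeff j k\<bar>)"
proof -
  let ?w = "rotated_weight j"
  let ?W = "\<lambda>\<tau>. \<tau> * Re (mbessel0 (of_real \<tau>)) * \<bar>?w \<tau>\<bar>"
  have ki: "(\<lambda>\<tau>. maclaurin_kernel k \<tau> * \<bar>?w \<tau>\<bar>) integrable_on {0<..}" for k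
  proof -
    have "(\<lambda>\<tau>. norm (maclaurin_kernel k \<tau> * ?w \<tau>)) integrable_on {0<..}"
      using maclaurin_integrand_absolutely_integrable by (simp add: absolutely_integrable_on_def)
    then show ?thesis by (rule integrable_eq) (simp add: abs_mult maclaurin_kernel_nonneg)
  qed
  have "(\<Sum>k<n. \<bar>maclaurin_coeff j k\<bar>) \<le> integral {0<..} ?W" for n
  proof -
    have "(\<Sum>k<n. \<bar>maclaurin_coeff j k\<bar>) \<le> (\<Sum>k<n. integral {0<..} (\<lambda>\<tau>. maclaurin_kernel k \<tau> * \<bar>?w \<tau>\<bar>))"
    proof (rule sum_mono)
      fix k
      have "norm (maclaurin_coeff j k) \<le> integral {0<..} (\<lambda>\<tau>. maclaurin_kernel k \<tau> * \<bar>?w \<tau>\<bar>)"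
        unfolding maclaurin_coeff_def
        by (rule integral_norm_bound_integral[OF has_integral_integrable[OF maclaurin_integrand_has_integral] ki])
           (simp add: abs_mult maclaurin_kernel_nonneg)
      then show "\<bar>maclaurin_coeff j k\<bar> \<le> integral {0<..} (\<lambda>\<tau>. maclaurin_kernel k \<tau> * \<bar>?w \<tau>\<bar>)" by simp
    qed
    also have "\<dots> = integral {0<..} (\<lambda>\<tau>. \<Sum>k<n. maclaurin_kernel k \<tau> * \<bar>?w \<tau>\<bar>)"
      by (rule integral_sum[symmetric]) (use ki in auto)
    also have "\<dots> \<le> integral {0<..} ?W"
    proof (rule integral_le[OF integrable_sum kernel_weight_integrable[OF assms]])
      fix \<tau> :: real assume t: "\<tau> \<in> {0<..}"
      have "(\<Sum>k<n. maclaurin_kernel k \<tau>) \<le> \<tau> * Re (mbessel0 (of_real \<tau>))"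
        unfolding sums_unique[OF maclaurin_kernel_sums[of \<tau>]]
        by (intro sum_le_suminf sums_summable[OF maclaurin_kernel_sums]) (use t in \<open>auto simp: maclaurin_kernel_nonneg\<close>)
      then show "(\<Sum>k<n. maclaurin_kernel k \<tau> * \<bar>?w \<tau>\<bar>) \<le> ?W \<tau>"
        unfolding sum_distrib_right[symmetric] by (intro mult_right_mono) auto
    qed (use ki in auto)
    finally show ?thesis .
  qed
  then show ?thesis by (intro summableI_nonneg_bounded) auto
qed

text \<open>On the positive axis \<open>H\<close> is purely imaginary and \<open>I0\<close> is real, so only the term \<open>3 * H\<^sup>2 * 2 * I0\<close> has a real part.\<close>

lemma rotated_weight_1:
  assumes "\<tau> > 0"
  shows "rotated_weight 1 \<tau> = 6 / pi\<^sup>2 * Re (mbessel0 (of_real \<tau>)) * (Re (macdonald0 (of_real \<tau>)))\<^sup>2"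
proof -
  define a b where "a = Re (mbessel0 (of_real \<tau>))" and "b = Re (macdonald0 (of_real \<tau>))"
  define c where "c = 2 / pi * b"
  have h: "hankel0 (of_real \<tau>) = - \<i> * of_real c"
    unfolding hankel0_def using macdonald0_of_real[OF assms] by (simp add: c_def b_def)
  have I: "mbessel0 (of_real \<tau>) = of_real a" using mbessel0_of_real[of \<tau>] by (simp add: a_def)
  have "rotated_power 1 (of_real \<tau>) = (3 * ((- \<i> * of_real c) ^ 2 * (2 * of_real a - (- \<i> * of_real c))) + (- \<i> * of_real c) ^ 3) / 4"
    unfolding rotated_power_def h I by (simp add: eval_nat_numeral)
  also have "\<dots> = of_real (- (3/2) * a * c\<^sup>2) - \<i> * of_real (c ^ 3 / 2)"
    by (simp add: power2_eq_square power3_eq_cube field_simps)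
  finally have "rotated_weight 1 \<tau> = 3/2 * a * c\<^sup>2" by (simp add: rotated_weight_def)
  also have "\<dots> = 6 / pi\<^sup>2 * a * b\<^sup>2" by (simp add: c_def power_mult_distrib power_divide)
  finally show ?thesis by (simp add: a_def b_def)
qed

lemma rotated_weight_1_nonneg: "\<tau> > 0 \<Longrightarrow> 0 \<le> rotated_weight 1 \<tau>"
  using mbessel0_ge_1[of \<tau>] by (subst rotated_weight_1) auto

lemma maclaurin_coeff_1_nonneg: "0 \<le> maclaurin_coeff 1 k"
  unfolding maclaurin_coeff_def
  by (rule integral_nonneg[OF has_integral_integrable[OF maclaurin_integrand_has_integral]])
     (intro mult_nonneg_nonneg maclaurin_kernel_nonneg rotated_weight_1_nonneg, auto)

text \<open>The sum of all coefficients would be \<open>\<integral> \<tau> * I0 \<tau> * w \<tau> d\<tau>\<close>, and its integrand is at least a constant times \<open>1 / \<tau>\<close>. The proof cuts the integral at a large \<open>T\<close> so that everything stays finite.\<close>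

lemma maclaurin_coeff_1_unbounded: "\<exists>n. Z < (\<Sum>k<n. maclaurin_coeff 1 k)"
proof -
  let ?w = "rotated_weight 1"
  define a b c where "a = exp (- (1/2)) / pi" and "b = exp (- 1 :: real)" and "c = 6 / pi\<^sup>2 * (a\<^sup>2 * b\<^sup>2)"
  have abc: "a > 0" "b > 0" "c > 0" by (auto simp: a_def b_def c_def)
  have low: "c / \<tau> \<le> \<tau> * Re (mbessel0 (of_real \<tau>)) * ?w \<tau>" if "\<tau> \<ge> 1" for \<tau>
  proof -
    have "(a * exp \<tau> / sqrt \<tau>)\<^sup>2 \<le> (Re (mbessel0 (of_real \<tau>)))\<^sup>2"
      unfolding a_def using mbessel0_real_lower[OF that] that by (intro power_mono) auto
    moreover have "(b * exp (- \<tau>) / sqrt \<tau>)\<^sup>2 \<le> (Re (macdonald0 (of_real \<tau>)))\<^sup>2"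
      unfolding b_def using macdonald0_lower_bound[OF that] that by (intro power_mono) auto
    ultimately have "(a * exp \<tau> / sqrt \<tau>)\<^sup>2 * (b * exp (- \<tau>) / sqrt \<tau>)\<^sup>2 \<le> (Re (mbessel0 (of_real \<tau>)))\<^sup>2 * (Re (macdonald0 (of_real \<tau>)))\<^sup>2"
      by (intro mult_mono) auto
    moreover have "(a * exp \<tau> / sqrt \<tau>)\<^sup>2 * (b * exp (- \<tau>) / sqrt \<tau>)\<^sup>2 = a\<^sup>2 * b\<^sup>2 / \<tau>\<^sup>2"
    proof -
      have "(a * exp \<tau> / sqrt \<tau>)\<^sup>2 * (b * exp (- \<tau>) / sqrt \<tau>)\<^sup>2 = a\<^sup>2 * b\<^sup>2 * (exp \<tau> * exp (- \<tau>))\<^sup>2 / (sqrt \<tau>)\<^sup>2 / (sqrt \<tau>)\<^sup>2"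
        by (simp add: power_mult_distrib power_divide)
      also have "exp \<tau> * exp (- \<tau>) = 1" by (simp add: exp_minus)
      finally show ?thesis using that by (simp add: power2_eq_square)
    qed
    ultimately have "6 / pi\<^sup>2 * \<tau> * (a\<^sup>2 * b\<^sup>2 / \<tau>\<^sup>2) \<le> 6 / pi\<^sup>2 * \<tau> * ((Re (mbessel0 (of_real \<tau>)))\<^sup>2 * (Re (macdonald0 (of_real \<tau>)))\<^sup>2)"
      using that by (intro mult_left_mono) auto
    moreover have "6 / pi\<^sup>2 * \<tau> * (a\<^sup>2 * b\<^sup>2 / \<tau>\<^sup>2) = c / \<tau>" using that by (simp add: c_def power2_eq_square)
    moreover have "\<tau> * Re (mbessel0 (of_real \<tau>)) * ?w \<tau> = 6 / pi\<^sup>2 * \<tau> * ((Re (mbessel0 (of_real \<tau>)))\<^sup>2 * (Re (macdonald0 (of_real \<tau>)))\<^sup>2)"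
      using that by (subst rotated_weight_1) (auto simp: power2_eq_square)
    ultimately show ?thesis by linarith
  qed
  \<comment> \<open>\<open>c * ln T\<close> is the integral of \<open>c / \<tau>\<close> over \<open>{1..T}\<close>.\<close>
  define T where "T = exp ((\<bar>Z\<bar> + 1) / c)"
  have T: "T \<ge> 1" "c * ln T = \<bar>Z\<bar> + 1" using abc by (auto simp: T_def)
  have cont: "continuous_on {1..T} ?w" by (rule continuous_on_subset[OF continuous_on_rotated_weight]) auto
  have fi: "(\<lambda>\<tau>. \<tau> * Re (mbessel0 (of_real \<tau>)) * ?w \<tau>) integrable_on {1..T}"
    by (intro integrable_continuous_interval continuous_intros cont)
  have "((\<lambda>\<tau>. c * (1 / \<tau>)) has_integral c * (ln T - ln 1)) {1..T}"
    by (intro has_integral_mult_right fundamental_theorem_of_calculus T)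
       (auto intro!: derivative_eq_intros simp: has_real_derivative_iff_has_vector_derivative[symmetric])
  then have "((\<lambda>\<tau>. c / \<tau>) has_integral \<bar>Z\<bar> + 1) {1..T}" using T(2) by simp
  then have "\<bar>Z\<bar> + 1 \<le> integral {1..T} (\<lambda>\<tau>. \<tau> * Re (mbessel0 (of_real \<tau>)) * ?w \<tau>)"
    by (rule has_integral_le[OF _ integrable_integral[OF fi]]) (use low in auto)
  then have big: "Z < integral {1..T} (\<lambda>\<tau>. \<tau> * Re (mbessel0 (of_real \<tau>)) * ?w \<tau>)" by linarith
  have pi: "(\<lambda>\<tau>. \<Sum>k<n. maclaurin_kernel k \<tau> * ?w \<tau>) integrable_on {1..T}" for n
    by (intro integrable_continuous_interval continuous_intros cont)
  have "(\<lambda>n. integral {1..T} (\<lambda>\<tau>. \<Sum>k<n. maclaurin_kernel k \<tau> * ?w \<tau>)) \<longlonglongrightarrow> integral {1..T} (\<lambda>\<tau>. \<tau> * Re (mbessel0 (of_real \<tau>)) * ?w \<tau>)"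
  proof (rule dominated_convergence[OF pi fi])
    fix n \<tau> assume "\<tau> \<in> {1..T}"
    then have t: "\<tau> \<ge> 1" "\<tau> > 0" by auto
    have "(\<Sum>k<n. maclaurin_kernel k \<tau>) \<le> \<tau> * Re (mbessel0 (of_real \<tau>))"
      unfolding sums_unique[OF maclaurin_kernel_sums[of \<tau>]]
      by (intro sum_le_suminf sums_summable[OF maclaurin_kernel_sums]) (use t in \<open>auto simp: maclaurin_kernel_nonneg\<close>)
    then have "(\<Sum>k<n. maclaurin_kernel k \<tau>) * ?w \<tau> \<le> \<tau> * Re (mbessel0 (of_real \<tau>)) * ?w \<tau>"
      using rotated_weight_1_nonneg[OF t(2)] by (rule mult_right_mono)
    moreover have "0 \<le> (\<Sum>k<n. maclaurin_kernel k \<tau>) * ?w \<tau>"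
      using t rotated_weight_1_nonneg[OF t(2)] by (intro mult_nonneg_nonneg sum_nonneg maclaurin_kernel_nonneg) auto
    ultimately show "norm (\<Sum>k<n. maclaurin_kernel k \<tau> * ?w \<tau>) \<le> \<tau> * Re (mbessel0 (of_real \<tau>)) * ?w \<tau>"
      unfolding sum_distrib_right[symmetric] by simp
  next
    fix \<tau> :: real
    show "(\<lambda>n. \<Sum>k<n. maclaurin_kernel k \<tau> * ?w \<tau>) \<longlonglongrightarrow> \<tau> * Re (mbessel0 (of_real \<tau>)) * ?w \<tau>"
      using sums_mult2[OF maclaurin_kernel_sums[of \<tau>], of "?w \<tau>"] unfolding sums_def .
  qed
  from eventually_happens'[OF sequentially_bot order_tendstoD(1)[OF this big]]
  obtain n where n: "Z < integral {1..T} (\<lambda>\<tau>. \<Sum>k<n. maclaurin_kernel k \<tau> * ?w \<tau>)" ..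
  have hs: "((\<lambda>\<tau>. \<Sum>k<n. maclaurin_kernel k \<tau> * ?w \<tau>) has_integral (\<Sum>k<n. maclaurin_coeff 1 k)) {0<..}"
    by (intro has_integral_sum maclaurin_integrand_has_integral) auto
  have "integral {1..T} (\<lambda>\<tau>. \<Sum>k<n. maclaurin_kernel k \<tau> * ?w \<tau>) \<le> integral {0<..} (\<lambda>\<tau>. \<Sum>k<n. maclaurin_kernel k \<tau> * ?w \<tau>)"
    by (rule integral_subset_le[OF _ pi has_integral_integrable[OF hs]])
       (auto intro!: sum_nonneg mult_nonneg_nonneg maclaurin_kernel_nonneg rotated_weight_1_nonneg[simplified])
  also have "\<dots> = (\<Sum>k<n. maclaurin_coeff 1 k)" by (rule integral_unique[OF hs])
  finally show ?thesis using n by (intro exI[of _ n]) linarith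
qed

section \<open>Weber's integrals\<close>

text \<open>Fubini's theorem is applied to Lebesgue integrals over this measure; \<open>integral_halfline\<close> leads back to the Henstock-Kurzweil integral.\<close>

definition halfline :: "real measure" where "halfline = restrict_space lborel {0..}"

lemma space_halfline [simp]: "space halfline = {0..}"
  by (simp add: halfline_def space_restrict_space)

lemma sets_halfline [measurable_cong]: "sets halfline = sets (restrict_space borel {0..})"
  unfolding halfline_def by (simp add: sets_restrict_space)

lemma sigma_finite_halfline: "sigma_finite_measure halfline"
  unfolding halfline_def by (rule sigma_finite_measure_restrict_space) (auto intro: sigma_finite_lborel)

lemma integrable_halfline_iff: "integrable halfline f \<longleftrightarrow> set_integrable lborel {0..} (f :: real \<Rightarrow> 'a::{banach, second_countable_topology})"
  unfolding halfline_def set_integrable_def by (subst integrable_restrict_space) auto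

lemma integral_halfline:
  fixes f :: "real \<Rightarrow> 'a::euclidean_space"
  assumes "integrable halfline f"
  shows "(f has_integral (LINT x|halfline. f x)) {0..}"
proof -
  have "(LINT x|halfline. f x) = (LINT x:{0..}|lborel. f x)"
    unfolding halfline_def set_lebesgue_integral_def by (subst integral_restrict_space) auto
  then show ?thesis using set_borel_integral_eq_integral[of "{0..}" f] assms by (metis integrable_halfline_iff integrable_integral)
qed

lemma continuous_measurable_halfline:
  fixes f :: "real \<Rightarrow> real"
  assumes "continuous_on {0..} f"
  shows "f \<in> borel_measurable halfline"
  unfolding halfline_def using borel_measurable_continuous_on_restrict[OF assms]
  by (simp cong: measurable_cong_sets sets_restrict_space_cong)

lemma gauss_odd_moment:
  assumes "b > 0"
  shows "has_bochner_integral halfline (\<lambda>t. t ^ (2 * k + 1) * exp (- b * t\<^sup>2)) (fact k / (2 * b ^ (k + 1)))"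
proof -
  define c where "c = sqrt b"
  have c: "c > 0" "c\<^sup>2 = b" using assms by (auto simp: c_def)
  have "has_bochner_integral lborel (\<lambda>x. indicator {0..} (0 + c * x) *\<^sub>R (exp (- (0 + c * x)\<^sup>2) * (0 + c * x) ^ (2 * k + 1))) ((fact k / 2) /\<^sub>R \<bar>c\<bar>)"
    using gaussian_moment_odd_pos[of k] c(1)
    by (subst (asm) lborel_has_bochner_integral_real_affine_iff[of c _ _ 0]) auto
  then have "has_bochner_integral lborel (\<lambda>x. (1 / c ^ (2 * k + 1)) * (indicator {0..} (0 + c * x) *\<^sub>R (exp (- (0 + c * x)\<^sup>2) * (0 + c * x) ^ (2 * k + 1))))
     ((1 / c ^ (2 * k + 1)) * ((fact k / 2) /\<^sub>R \<bar>c\<bar>))"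
    by (rule has_bochner_integral_mult_right)
  moreover have "(1 / c ^ (2 * k + 1)) * (indicator {0..} (0 + c * x) *\<^sub>R (exp (- (0 + c * x)\<^sup>2) * (0 + c * x) ^ (2 * k + 1)))
     = indicator {0..} x *\<^sub>R (x ^ (2 * k + 1) * exp (- b * x\<^sup>2))" for x
  proof -
    have "indicator {0..} (0 + c * x) = (indicator {0..} x :: real)" using c(1) by (simp add: indicator_def zero_le_mult_iff)
    moreover have "(0 + c * x)\<^sup>2 = b * x\<^sup>2" using c(2) by (simp add: power_mult_distrib)
    moreover have "(0 + c * x) ^ (2 * k + 1) = c ^ (2 * k + 1) * x ^ (2 * k + 1)" by (simp add: power_mult_distrib)
    moreover have "c ^ (2 * k + 1) \<noteq> 0" using c(1) by simp
    ultimately show ?thesis by (simp only:) (simp add: mult_ac)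
  qed
  moreover have "(1 / c ^ (2 * k + 1)) * ((fact k / 2) /\<^sub>R \<bar>c\<bar>) = fact k / (2 * b ^ (k + 1))"
  proof -
    have e: "b ^ (k + 1) = c ^ (2 * k + 1) * c"
      unfolding c(2)[symmetric] by (simp only: power_mult[symmetric] power_Suc2[symmetric]) simp
    have "(1 / p) * ((q / 2) /\<^sub>R \<bar>c\<bar>) = q / (2 * (p * c))" for p q using c(1) by (simp add: field_simps)
    then show ?thesis unfolding e .
  qed
  ultimately have "has_bochner_integral lborel (\<lambda>x. indicator {0..} x *\<^sub>R (x ^ (2 * k + 1) * exp (- b * x\<^sup>2))) (fact k / (2 * b ^ (k + 1)))"
    by simp
  then show ?thesis unfolding halfline_def has_bochner_integral_iff
    by (subst integrable_restrict_space, simp, subst integral_restrict_space) auto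
qed

text \<open>The Gaussian transform of an odd power series, by the odd moments of the Gaussian; both of Weber's integrals are instances.\<close>

lemma gauss_transform_termwise:
  fixes f :: "real \<Rightarrow> real"
  assumes b: "b > 0" and f: "\<And>t. 0 \<le> t \<Longrightarrow> (\<lambda>k. c k * t ^ (2 * k + 1)) sums f t"
    and sm: "\<And>t. 0 \<le> t \<Longrightarrow> summable (\<lambda>k. \<bar>c k\<bar> * t ^ (2 * k + 1))"
    and s: "summable (\<lambda>k. \<bar>c k\<bar> * (fact k / (2 * b ^ (k + 1))))"
  shows "integrable halfline (\<lambda>t. f t * exp (- b * t\<^sup>2))"
    and "(LINT t|halfline. f t * exp (- b * t\<^sup>2)) = (\<Sum>k. c k * (fact k / (2 * b ^ (k + 1))))"
proof -
  let ?g = "\<lambda>k t. c k * (t ^ (2 * k + 1) * exp (- b * t\<^sup>2))"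
  have i: "integrable halfline (?g k)" and v: "(LINT t|halfline. ?g k t) = c k * (fact k / (2 * b ^ (k + 1)))" for k
    using has_bochner_integral_mult_right[OF gauss_odd_moment[OF b, of k], of "c k"] by (auto simp: has_bochner_integral_iff)
  have n: "(LINT t|halfline. norm (?g k t)) = \<bar>c k\<bar> * (fact k / (2 * b ^ (k + 1)))" for k
  proof -
    have "(LINT t|halfline. norm (?g k t)) = (LINT t|halfline. \<bar>c k\<bar> * (t ^ (2 * k + 1) * exp (- b * t\<^sup>2)))"
      by (rule Bochner_Integration.integral_cong) (auto simp: abs_mult)
    then show ?thesis using has_bochner_integral_mult_right[OF gauss_odd_moment[OF b, of k], of "\<bar>c k\<bar>"] by (simp add: has_bochner_integral_iff)
  qed
  have ae: "AE t in halfline. summable (\<lambda>k. norm (?g k t))"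
  proof (rule AE_I2)
    fix t :: real assume "t \<in> space halfline"
    then have "summable (\<lambda>k. (\<bar>c k\<bar> * t ^ (2 * k + 1)) * exp (- b * t\<^sup>2))" using sm by (intro summable_mult2) auto
    then show "summable (\<lambda>k. norm (?g k t))" using \<open>t \<in> space halfline\<close> by (simp add: abs_mult mult_ac)
  qed
  have sn: "summable (\<lambda>k. LINT t|halfline. norm (?g k t))" unfolding n by (rule s)
  have eq: "(\<Sum>k. ?g k t) = f t * exp (- b * t\<^sup>2)" if "t \<in> space halfline" for t
    using sums_mult2[OF f[of t], of "exp (- b * t\<^sup>2)"] that by (simp add: sums_iff mult_ac)
  have "integrable halfline (\<lambda>t. \<Sum>k. ?g k t)" by (rule integrable_suminf[OF i ae sn])
  then show "integrable halfline (\<lambda>t. f t * exp (- b * t\<^sup>2))"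
    by (rule Bochner_Integration.integrable_cong[OF refl eq, THEN iffD1, rotated]) 
  have "(LINT t|halfline. f t * exp (- b * t\<^sup>2)) = (LINT t|halfline. (\<Sum>k. ?g k t))"
    by (rule Bochner_Integration.integral_cong[OF refl eq[symmetric]])
  also have "\<dots> = (\<Sum>k. (LINT t|halfline. ?g k t))" by (rule integral_suminf[OF i ae sn])
  finally show "(LINT t|halfline. f t * exp (- b * t\<^sup>2)) = (\<Sum>k. c k * (fact k / (2 * b ^ (k + 1))))" unfolding v .
qed

lemma bessel_J0_sums: "(\<lambda>k. (-1) ^ k * (t / 2) ^ (2 * k) / (fact k)\<^sup>2) sums bessel_J0 t"
proof -
  have "(\<lambda>k. complex_of_real ((-1) ^ k * (t / 2) ^ (2 * k) / (fact k)\<^sup>2)) sums mbessel0 (\<i> * of_real t)"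
    using mbessel0_sums[of "\<i> * of_real t"] unfolding imaginary_half_power_even by simp
  from sums_Re[OF this] show ?thesis by (simp only: Re_complex_of_real mbessel0_imaginary)
qed

lemma bessel_J1_sums: "(\<lambda>k. (-1) ^ k * (t / 2) ^ (2 * k + 1) / (fact k * fact (Suc k))) sums bessel_J1 t"
proof -
  have e: "(\<i> * of_real t / 2) ^ (2 * k + 1) / (fact k * fact (Suc k)) = \<i> * complex_of_real ((-1) ^ k * (t / 2) ^ (2 * k + 1) / (fact k * fact (Suc k)))" for k
    unfolding power_add imaginary_half_power_even by simp
  have "(\<lambda>k. \<i> * complex_of_real ((-1) ^ k * (t / 2) ^ (2 * k + 1) / (fact k * fact (Suc k)))) sums (\<i> * of_real (bessel_J1 t))"
    using mbessel1_sums[of "\<i> * of_real t"] unfolding e mbessel1_imaginary .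
  note sums = sums_Im[OF this]
  have im: "Im (\<i> * of_real y) = y" for y by simp
  show ?thesis using sums unfolding im .
qed

lemma summable_power_over_fact: "summable (\<lambda>k. x ^ k / fact k :: real)"
  using summable_exp[of x] by (simp add: field_simps)

lemma weber_J0:
  assumes a: "a > 0"
  shows "integrable halfline (\<lambda>t. t * bessel_J0 (r * t) * exp (- (1 / (4 * a)) * t\<^sup>2))"
    and "(LINT t|halfline. t * bessel_J0 (r * t) * exp (- (1 / (4 * a)) * t\<^sup>2)) = 2 * a * exp (- a * r\<^sup>2)"
proof -
  let ?b = "1 / (4 * a)"
  let ?c = "\<lambda>k. (-1) ^ k * (r / 2) ^ (2 * k) / (fact k)\<^sup>2 :: real"
  have b: "?b > 0" using a by simp
  have t1: "?c k * t ^ (2 * k + 1) = t * ((-1) ^ k * (r * t / 2) ^ (2 * k) / (fact k)\<^sup>2)" for k t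
    by (simp add: power_mult_distrib power_divide)
  have f: "(\<lambda>k. ?c k * t ^ (2 * k + 1)) sums (t * bessel_J0 (r * t))" for t
    unfolding t1 by (intro sums_mult bessel_J0_sums)
  have sm: "summable (\<lambda>k. \<bar>?c k\<bar> * t ^ (2 * k + 1))" if "0 \<le> t" for t
  proof -
    have e: "\<bar>?c k\<bar> * t ^ (2 * k + 1) = t * ((r * t / 2) ^ (2 * k) / (fact k)\<^sup>2)" for k
      by (simp add: abs_mult power_mult_distrib power_divide power_abs power_mult)
    show ?thesis unfolding e by (intro summable_mult sums_summable[OF mbessel0_real_sums])
  qed
  have c: "x * (fact k / (2 * ?b ^ (k + 1))) = 2 * a * (x * fact k * (4 * a) ^ k)" for x k
    using a by (simp add: power_divide field_simps)
  have cv: "?c k * (fact k / (2 * ?b ^ (k + 1))) = 2 * a * ((- a * r\<^sup>2) ^ k / fact k)" for k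
    unfolding c by (simp add: power_mult power_divide power_mult_distrib power2_eq_square power_minus' divide_simps)
  have s: "summable (\<lambda>k. \<bar>?c k\<bar> * (fact k / (2 * ?b ^ (k + 1))))"
  proof -
    have "\<bar>?c k\<bar> * (fact k / (2 * ?b ^ (k + 1))) = 2 * a * ((a * r\<^sup>2) ^ k / fact k)" for k
    proof -
      have "\<bar>?c k\<bar> * (fact k / (2 * ?b ^ (k + 1))) = \<bar>?c k * (fact k / (2 * ?b ^ (k + 1)))\<bar>" using a by (simp add: abs_mult)
      also have "\<dots> = 2 * a * ((a * r\<^sup>2) ^ k / fact k)" unfolding cv using a by (simp add: abs_mult power_abs)
      finally show ?thesis .
    qed
    then show ?thesis using summable_mult[OF summable_power_over_fact[of "a * r\<^sup>2"], of "2 * a"] by simp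
  qed
  show "integrable halfline (\<lambda>t. t * bessel_J0 (r * t) * exp (- ?b * t\<^sup>2))"
    by (rule gauss_transform_termwise(1)[OF b f sm s])
  have "(LINT t|halfline. t * bessel_J0 (r * t) * exp (- ?b * t\<^sup>2)) = (\<Sum>k. 2 * a * ((- a * r\<^sup>2) ^ k / fact k))"
    unfolding cv[symmetric] by (rule gauss_transform_termwise(2)[OF b f sm s])
  also have "\<dots> = 2 * a * exp (- a * r\<^sup>2)"
    using sums_mult[OF exp_converges[of "- a * r\<^sup>2"], of "2 * a"] by (simp add: sums_iff field_simps)
  finally show "(LINT t|halfline. t * bessel_J0 (r * t) * exp (- ?b * t\<^sup>2)) = 2 * a * exp (- a * r\<^sup>2)" .
qed

text \<open>The series is shifted by one index, with a zero coefficient in front, to have the odd powers of \<open>gauss_transform_termwise\<close>.\<close>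

lemma weber_J1:
  assumes a: "a > 0"
  shows "integrable halfline (\<lambda>x. x * (x * bessel_J1 (x * t)) * exp (- a * x\<^sup>2))"
    and "(LINT x|halfline. x * (x * bessel_J1 (x * t)) * exp (- a * x\<^sup>2)) = t / (4 * a\<^sup>2) * exp (- (1 / (4 * a)) * t\<^sup>2)"
proof -
  let ?d = "\<lambda>k. (-1) ^ k * (t / 2) ^ (2 * k + 1) / (fact k * fact (Suc k)) :: real"
  let ?c = "\<lambda>k. case k of 0 \<Rightarrow> 0 | Suc k \<Rightarrow> ?d k"
  have t1: "?d k * x ^ (2 * Suc k + 1) = x * (x * ((-1) ^ k * (x * t / 2) ^ (2 * k + 1) / (fact k * fact (Suc k))))" for k x
    by (simp add: power_mult_distrib power_divide)
  have f: "(\<lambda>k. ?c k * x ^ (2 * k + 1)) sums (x * (x * bessel_J1 (x * t)))" for x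
  proof -
    have "(\<lambda>k. ?c (Suc k) * x ^ (2 * Suc k + 1)) sums (x * (x * bessel_J1 (x * t)))"
      unfolding nat.case t1 by (intro sums_mult bessel_J1_sums)
    then show ?thesis by (subst (asm) sums_Suc_iff) simp
  qed
  have sm: "summable (\<lambda>k. \<bar>?c k\<bar> * x ^ (2 * k + 1))" if "0 \<le> x" for x
  proof -
    have e: "\<bar>?d k\<bar> * x ^ (2 * Suc k + 1) = x * (x * ((x * \<bar>t\<bar> / 2) ^ (2 * k + 1) / (fact k * fact (Suc k))))" for k
      by (simp add: abs_mult power_mult_distrib power_divide power_abs)
    have "summable (\<lambda>k. \<bar>?c (Suc k)\<bar> * x ^ (2 * Suc k + 1))"
      unfolding nat.case e by (intro summable_mult sums_summable[OF mbessel1_real_sums])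
    then show ?thesis by (subst (asm) summable_Suc_iff)
  qed
  have cv: "?d k * (fact (Suc k) / (2 * a ^ (Suc k + 1))) = t / (4 * a\<^sup>2) * ((- (1 / (4 * a)) * t\<^sup>2) ^ k / fact k)" for k
    using a by (simp add: power_mult power_divide power_mult_distrib power2_eq_square power_minus' divide_simps del: of_nat_Suc fact_Suc)
  have s: "summable (\<lambda>k. \<bar>?c k\<bar> * (fact k / (2 * a ^ (k + 1))))"
  proof -
    have "\<bar>?d k\<bar> * (fact (Suc k) / (2 * a ^ (Suc k + 1))) = \<bar>t\<bar> / (4 * a\<^sup>2) * ((1 / (4 * a) * t\<^sup>2) ^ k / fact k)" for k
    proof -
      have "\<bar>?d k\<bar> * (fact (Suc k) / (2 * a ^ (Suc k + 1))) = \<bar>?d k * (fact (Suc k) / (2 * a ^ (Suc k + 1)))\<bar>"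
        using a by (simp add: abs_mult del: fact_Suc)
      also have "\<dots> = \<bar>t\<bar> / (4 * a\<^sup>2) * ((1 / (4 * a) * t\<^sup>2) ^ k / fact k)"
        unfolding cv using a by (simp add: abs_mult power_abs)
      finally show ?thesis .
    qed
    then have "summable (\<lambda>k. \<bar>?c (Suc k)\<bar> * (fact (Suc k) / (2 * a ^ (Suc k + 1))))"
      using summable_mult[OF summable_power_over_fact[of "1 / (4 * a) * t\<^sup>2"], of "\<bar>t\<bar> / (4 * a\<^sup>2)"] by (simp only: nat.case)
    then show ?thesis by (subst (asm) summable_Suc_iff)
  qed
  show "integrable halfline (\<lambda>x. x * (x * bessel_J1 (x * t)) * exp (- a * x\<^sup>2))"
    by (rule gauss_transform_termwise(1)[OF a f sm s])
  have "(\<lambda>k. ?c (Suc k) * (fact (Suc k) / (2 * a ^ (Suc k + 1)))) sums (t / (4 * a\<^sup>2) * exp (- (1 / (4 * a)) * t\<^sup>2))"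
    unfolding nat.case cv
    using sums_mult[OF exp_converges[of "- (1 / (4 * a)) * t\<^sup>2"], of "t / (4 * a\<^sup>2)"] by (simp add: field_simps)
  then have "(\<lambda>k. ?c k * (fact k / (2 * a ^ (k + 1)))) sums (t / (4 * a\<^sup>2) * exp (- (1 / (4 * a)) * t\<^sup>2))"
    by (subst (asm) sums_Suc_iff) simp
  then show "(LINT x|halfline. x * (x * bessel_J1 (x * t)) * exp (- a * x\<^sup>2)) = t / (4 * a\<^sup>2) * exp (- (1 / (4 * a)) * t\<^sup>2)"
    using gauss_transform_termwise(2)[OF a f sm s] by (simp add: sums_iff)
qed

lemma (in pair_sigma_finite) integrable_product_bound:
  fixes f :: "'a \<times> 'b \<Rightarrow> real"
  assumes "f \<in> borel_measurable (M1 \<Otimes>\<^sub>M M2)" "integrable M1 g" "integrable M2 h"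
    and "\<And>x y. x \<in> space M1 \<Longrightarrow> y \<in> space M2 \<Longrightarrow> \<bar>f (x, y)\<bar> \<le> g x * h y"
  shows "integrable (M1 \<Otimes>\<^sub>M M2) f"
proof (rule Bochner_Integration.integrable_bound)
  have [measurable]: "g \<in> borel_measurable M1" "h \<in> borel_measurable M2" using assms(2,3) by auto
  show "integrable (M1 \<Otimes>\<^sub>M M2) (\<lambda>p. g (fst p) * h (snd p))"
  proof (rule Fubini_integrable)
    have "integrable M1 (\<lambda>x. \<bar>g x\<bar> * (LINT y|M2. \<bar>h y\<bar>))" using assms(2) by (intro integrable_mult_left integrable_abs)
    then show "integrable M1 (\<lambda>x. LINT y|M2. norm (g (fst (x, y)) * h (snd (x, y))))" by (simp add: abs_mult)
    show "AE x in M1. integrable M2 (\<lambda>y. g (fst (x, y)) * h (snd (x, y)))" using assms(3) by simp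
  qed measurable
  show "f \<in> borel_measurable (M1 \<Otimes>\<^sub>M M2)" by fact
  show "AE p in M1 \<Otimes>\<^sub>M M2. norm (f p) \<le> norm (g (fst p) * h (snd p))"
  proof (rule AE_I2)
    fix p assume "p \<in> space (M1 \<Otimes>\<^sub>M M2)"
    then have "\<bar>f (fst p, snd p)\<bar> \<le> g (fst p) * h (snd p)" by (intro assms(4)) (auto simp: space_pair_measure)
    then show "norm (f p) \<le> norm (g (fst p) * h (snd p))" by simp
  qed
qed

lemma has_vector_derivative_angle:
  assumes "\<And>z. (F has_field_derivative g z) (at z)"
  shows "((\<lambda>\<phi>. F (of_real (c * \<phi> + d))) has_vector_derivative of_real c * g (of_real (c * \<phi> + d))) (at \<phi> within A)"
proof -
  have "((\<lambda>z. F (of_real c * z + of_real d)) has_field_derivative g (of_real c * of_real \<phi> + of_real d) * of_real c) (at (of_real \<phi>))"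
    by (rule DERIV_chain2[OF assms]) (auto intro!: derivative_eq_intros)
  from has_vector_derivative_real_field[OF this] show ?thesis by (simp add: mult_ac)
qed

section \<open>The random walk and its Gaussian transform\<close>

text \<open>Bessel's integral over a full turn with arbitrary starting angle \<open>\<alpha>\<close>. A primitive \<open>F\<close> of the entire integrand reduces the change of interval to the reflection and the periodicity of the cosine.\<close>

lemma bessel_J0_circle_average:
  "((\<lambda>\<phi>. exp (\<i> * of_real (r * cos (2 * pi * \<phi> + \<alpha>)))) has_integral of_real (bessel_J0 r)) {0..1}"
proof -
  define g where "g z = exp (\<i> * of_real r * cos z)" for z :: complex
  have "g holomorphic_on UNIV" unfolding g_def by (intro holomorphic_intros)
  then obtain F where F: "\<And>z. (F has_field_derivative g z) (at z)"
    using holomorphic_convex_primitive'[of UNIV g] by auto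
  have "((\<lambda>z. F (2 * of_real pi - z) + F z) has_field_derivative 0) (at z)" for z
  proof -
    have "((\<lambda>z. F (2 * of_real pi - z) + F z) has_field_derivative g (2 * of_real pi - z) * (- 1) + g z) (at z)"
      by (intro DERIV_add F DERIV_chain2[OF F]) (auto intro!: derivative_eq_intros)
    moreover have "g (2 * of_real pi - z) = g z" by (simp add: g_def cos_diff)
    ultimately show ?thesis by simp
  qed
  then have "F (2 * of_real pi - z) + F z = F (2 * of_real pi - w) + F w" for z w
    using has_field_derivative_zero_constant[of UNIV "\<lambda>z. F (2 * of_real pi - z) + F z"] by (metis UNIV_I convex_UNIV)
  from this[of 0 "of_real pi"] have e1: "F (2 * of_real pi) + F 0 = 2 * F (of_real pi)" by simp
  have "((\<lambda>z. F (z + 2 * of_real pi) - F z) has_field_derivative 0) (at z)" for z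
  proof -
    have "((\<lambda>z. F (z + 2 * of_real pi) - F z) has_field_derivative g (z + 2 * of_real pi) * 1 - g z) (at z)"
      by (intro DERIV_diff F DERIV_chain2[OF F]) (auto intro!: derivative_eq_intros)
    moreover have "g (z + 2 * of_real pi) = g z" by (simp add: g_def cos_add)
    ultimately show ?thesis by simp
  qed
  then have "F (z + 2 * of_real pi) - F z = F (w + 2 * of_real pi) - F w" for z w
    using has_field_derivative_zero_constant[of UNIV "\<lambda>z. F (z + 2 * of_real pi) - F z"] by (metis UNIV_I convex_UNIV)
  from this[of "of_real \<alpha>" 0] have e2: "F (of_real \<alpha> + 2 * of_real pi) - F (of_real \<alpha>) = F (2 * of_real pi) - F 0" by simp
  have "((\<lambda>\<theta>. of_real 1 * g (of_real (1 * \<theta> + 0))) has_integral F (of_real (1 * pi + 0)) - F (of_real (1 * 0 + 0))) {0..pi}"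
    by (intro fundamental_theorem_of_calculus has_vector_derivative_angle[OF F]) simp
  then have "F (of_real pi) - F 0 = integral {0..pi} (\<lambda>\<theta>. exp ((\<i> * of_real r) * of_real (cos \<theta>)))"
    by (simp add: integral_unique g_def cos_of_real mult_ac)
  also have "\<dots> = of_real (pi * bessel_J0 r)"
    using mbessel0_imaginary[of r] by (simp add: mbessel0_def field_simps)
  finally have e3: "F (of_real pi) - F 0 = of_real (pi * bessel_J0 r)" .
  have "((\<lambda>\<phi>. of_real (2 * pi) * g (of_real (2 * pi * \<phi> + \<alpha>))) has_integral F (of_real (2 * pi * 1 + \<alpha>)) - F (of_real (2 * pi * 0 + \<alpha>))) {0..1}"
    by (intro fundamental_theorem_of_calculus has_vector_derivative_angle[OF F]) simp
  moreover have "F (of_real (2 * pi * 1 + \<alpha>)) - F (of_real (2 * pi * 0 + \<alpha>)) = of_real (2 * pi * bessel_J0 r)"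
    using e1 e2 e3 by (simp add: algebra_simps) 
  ultimately have "((\<lambda>\<phi>. of_real (2 * pi) * g (of_real (2 * pi * \<phi> + \<alpha>)) / of_real (2 * pi)) has_integral of_real (2 * pi * bessel_J0 r) / of_real (2 * pi)) {0..1}"
    by (intro has_integral_divide) simp
  moreover have "g (of_real \<theta>) = exp (\<i> * of_real (r * cos \<theta>))" for \<theta> by (simp add: g_def cos_of_real mult_ac)
  ultimately show ?thesis by (simp only: of_real_mult[symmetric] of_real_eq_0_iff) simp
qed

text \<open>The uniform distribution of the \<open>n\<close> directions, measured in full turns.\<close>

definition walk_measure :: "nat \<Rightarrow> (nat \<Rightarrow> real) measure" where
  "walk_measure n = restrict_space (\<Pi>\<^sub>M k\<in>{1..n}. lborel) (\<Pi>\<^sub>E k\<in>{1..n}. {0..1})"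

definition walk_end :: "nat \<Rightarrow> (nat \<Rightarrow> real) \<Rightarrow> complex" where
  "walk_end n t = (\<Sum>k=1..n. exp (2 * of_real pi * \<i> * of_real (t k)))"

lemma cube_in_sets: "(\<Pi>\<^sub>E k\<in>{1..n::nat}. {0..1}) \<in> sets (\<Pi>\<^sub>M k\<in>{1..n}. (lborel :: real measure))"
  by (rule sets_PiM_I_finite) auto

lemma prob_space_walk_measure: "prob_space (walk_measure n)"
proof -
  interpret product_sigma_finite "\<lambda>_::nat. lborel :: real measure" by standard
  show ?thesis unfolding walk_measure_def
    by (rule prob_space_restrict_space[OF cube_in_sets]) (simp add: emeasure_PiM)
qed

lemma walk_end_measurable [measurable]: "walk_end n \<in> borel_measurable (walk_measure n)"
proof -
  have "walk_end n \<in> borel_measurable (\<Pi>\<^sub>M k\<in>{1..n}. lborel)"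
    unfolding walk_end_def by measurable
  then show ?thesis unfolding walk_measure_def by (rule measurable_restrict_space1)
qed

lemma norm_walk_end_le: "cmod (walk_end n t) \<le> real n"
proof -
  have "cmod (walk_end n t) \<le> (\<Sum>k=1..n. 1)" unfolding walk_end_def
    by (rule sum_norm_le) (simp add: norm_exp_eq_Re)
  then show ?thesis by simp
qed

lemma ramble_integral_eq:
  "ramble_integral n s = (LINT t|walk_measure n. of_real (cmod (walk_end n t)) powr s)"
  unfolding ramble_integral_def walk_measure_def walk_end_def set_lebesgue_integral_def
  by (subst integral_restrict_space) (use cube_in_sets[of n] in \<open>auto simp: space_PiM intro: sets.Int\<close>)

text \<open>The characteristic function of the walk in the direction \<open>- 2 * pi * \<phi>\<close>; independence of the steps makes it a product.\<close>

lemma walk_character: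
  "(LINT t|walk_measure n. exp (\<i> * of_real (\<tau> * Re (walk_end n t * cis (2 * pi * \<phi>))))) = of_real (bessel_J0 \<tau> ^ n)"
proof -
  interpret product_sigma_finite "\<lambda>_::nat. lborel :: real measure" by standard
  let ?g = "\<lambda>x. exp (\<i> * of_real (\<tau> * cos (2 * pi * x + 2 * pi * \<phi>)))"
  have gi: "set_integrable lborel {0..1} ?g"
    by (rule borel_integrable_atLeastAtMost') (auto intro!: continuous_intros)
  have gv: "(LINT x|lborel. indicator {0..1} x *\<^sub>R ?g x) = of_real (bessel_J0 \<tau>)"
    using set_borel_integral_eq_integral(2)[OF gi] integral_unique[OF bessel_J0_circle_average]
    by (simp add: set_lebesgue_integral_def)
  have "(LINT t|walk_measure n. exp (\<i> * of_real (\<tau> * Re (walk_end n t * cis (2 * pi * \<phi>)))))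
     = (LINT t|(\<Pi>\<^sub>M k\<in>{1..n}. lborel). indicator (\<Pi>\<^sub>E k\<in>{1..n}. {0..1}) t *\<^sub>R exp (\<i> * of_real (\<tau> * Re (walk_end n t * cis (2 * pi * \<phi>)))))"
    unfolding walk_measure_def by (subst integral_restrict_space) (use cube_in_sets[of n] in \<open>auto intro: sets.Int\<close>)
  also have "\<dots> = (LINT t|(\<Pi>\<^sub>M k\<in>{1..n}. lborel). (\<Prod>k\<in>{1..n}. indicator {0..1} (t k) *\<^sub>R ?g (t k)))"
  proof (rule Bochner_Integration.integral_cong[OF refl])
    fix t :: "nat \<Rightarrow> real" assume t: "t \<in> space (\<Pi>\<^sub>M k\<in>{1..n}. lborel)"
    have "Re (walk_end n t * cis (2 * pi * \<phi>)) = (\<Sum>k=1..n. cos (2 * pi * t k + 2 * pi * \<phi>))"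
    proof -
      have "walk_end n t * cis (2 * pi * \<phi>) = (\<Sum>k=1..n. cis (2 * pi * t k + 2 * pi * \<phi>))"
        unfolding walk_end_def sum_distrib_right
        by (intro sum.cong refl) (simp add: cis_conv_exp exp_add[symmetric] algebra_simps)
      then show ?thesis by simp
    qed
    then have e: "exp (\<i> * of_real (\<tau> * Re (walk_end n t * cis (2 * pi * \<phi>)))) = (\<Prod>k\<in>{1..n}. ?g (t k))"
      by (simp add: exp_sum[symmetric] sum_distrib_left)
    show "indicator (\<Pi>\<^sub>E k\<in>{1..n}. {0..1}) t *\<^sub>R exp (\<i> * of_real (\<tau> * Re (walk_end n t * cis (2 * pi * \<phi>))))
       = (\<Prod>k\<in>{1..n}. indicator {0..1} (t k) *\<^sub>R ?g (t k))"
    proof (cases "t \<in> (\<Pi>\<^sub>E k\<in>{1..n}. {0..1})")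
      case True
      then have "(\<Prod>k\<in>{1..n}. indicator {0..1} (t k) *\<^sub>R ?g (t k)) = (\<Prod>k\<in>{1..n}. ?g (t k))"
        by (intro prod.cong) (auto simp: PiE_iff)
      then show ?thesis using True e by simp
    next
      case False
      then obtain k where "k \<in> {1..n}" "t k \<notin> {0..1}" using t by (auto simp: space_PiM PiE_iff)
      then have "(\<Prod>k\<in>{1..n}. indicator {0..1} (t k) *\<^sub>R ?g (t k)) = 0" by (intro prod_zero bexI[of _ k]) auto
      then show ?thesis using False by simp
    qed
  qed
  also have "\<dots> = (\<Prod>k\<in>{1..n}. (LINT x|lborel. indicator {0..1} x *\<^sub>R ?g x))"
    by (rule product_integral_prod) (use gi in \<open>auto simp: set_integrable_def\<close>)
  finally show ?thesis unfolding gv by simp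
qed

text \<open>Averaging the characteristic function over all directions \<open>\<phi>\<close> turns the exponential into \<open>J0\<close> of the distance, by \<open>bessel_J0_circle_average\<close>.\<close>

lemma expectation_bessel_J0:
  "(LINT t|walk_measure n. bessel_J0 (cmod (walk_end n t) * \<tau>)) = bessel_J0 \<tau> ^ n"
proof -
  define U where "U = restrict_space lborel {0..1::real}"
  interpret W: prob_space "walk_measure n" by (rule prob_space_walk_measure)
  interpret U: prob_space U unfolding U_def by (rule prob_space_restrict_space) auto
  interpret P: pair_prob_space "walk_measure n" U ..
  let ?f = "\<lambda>t \<phi>. exp (\<i> * of_real (\<tau> * Re (walk_end n t * cis (2 * pi * \<phi>))))"
  have "(\<lambda>\<phi>::real. cis (2 * pi * \<phi>)) \<in> borel_measurable borel"
    by (intro borel_measurable_continuous_onI continuous_intros)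
  then have [measurable]: "(\<lambda>\<phi>. cis (2 * pi * \<phi>)) \<in> borel_measurable U"
    unfolding U_def by (intro measurable_restrict_space1) simp
  have fm: "case_prod ?f \<in> borel_measurable (walk_measure n \<Otimes>\<^sub>M U)" by measurable
  have fi: "integrable (walk_measure n \<Otimes>\<^sub>M U) (case_prod ?f)"
    by (rule P.P.integrable_const_bound[where B = 1]) (use fm in \<open>auto simp: norm_exp_eq_Re\<close>)
  have inner: "(LINT \<phi>|U. ?f t \<phi>) = of_real (bessel_J0 (cmod (walk_end n t) * \<tau>))" for t
  proof -
    define r \<beta> where "r = cmod (walk_end n t)" and "\<beta> = Arg (walk_end n t)"
    have w: "walk_end n t = of_real r * cis \<beta>"
      unfolding r_def \<beta>_def by (metis rcis_cmod_Arg rcis_def)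
    have re: "\<tau> * Re (walk_end n t * cis (2 * pi * \<phi>)) = (r * \<tau>) * cos (2 * pi * \<phi> + \<beta>)" for \<phi>
      unfolding w by (simp add: mult.assoc cis_mult add.commute)
    have gi: "set_integrable lborel {0..1} (\<lambda>\<phi>. exp (\<i> * of_real ((r * \<tau>) * cos (2 * pi * \<phi> + \<beta>))))"
      by (rule borel_integrable_atLeastAtMost') (auto intro!: continuous_intros)
    have "(LINT \<phi>|U. ?f t \<phi>) = (LINT \<phi>:{0..1}|lborel. exp (\<i> * of_real ((r * \<tau>) * cos (2 * pi * \<phi> + \<beta>))))"
      unfolding U_def re set_lebesgue_integral_def by (subst integral_restrict_space) auto
    also have "\<dots> = of_real (bessel_J0 (r * \<tau>))"
      unfolding set_borel_integral_eq_integral(2)[OF gi] by (rule integral_unique[OF bessel_J0_circle_average])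
    finally show ?thesis by (simp add: r_def)
  qed
  have "(LINT t|walk_measure n. (LINT \<phi>|U. ?f t \<phi>)) = (LINT \<phi>|U. (LINT t|walk_measure n. ?f t \<phi>))"
    by (rule P.Fubini_integral[OF fi, symmetric])
  also have "\<dots> = of_real (bessel_J0 \<tau> ^ n)"
    unfolding walk_character by (simp add: U.prob_space)
  finally have "complex_of_real (LINT t|walk_measure n. bessel_J0 (cmod (walk_end n t) * \<tau>)) = of_real (bessel_J0 \<tau> ^ n)"
    unfolding inner by simp
  then show ?thesis by (simp only: of_real_eq_iff)
qed

lemma decay_weight_nonneg: "0 \<le> decay_weight t" by (simp add: decay_weight_def)

lemma integrable_decay_weight: "integrable halfline decay_weight"
proof -
  have "decay_weight \<in> borel_measurable borel" unfolding decay_weight_def[abs_def] by measurable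
  then have m: "set_borel_measurable borel {0..} decay_weight" by (simp add: set_borel_measurable_def)
  have "decay_weight absolutely_integrable_on {0..}"
    using decay_weight_has_integral by (intro nonnegative_absolutely_integrable_1) (auto simp: decay_weight_nonneg)
  then have "set_integrable lborel {0..} decay_weight"
    using m by (simp add: set_integrable_def integrable_completion set_borel_measurable_def)
  then show ?thesis by (simp add: integrable_halfline_iff)
qed

lemma continuous_pair_measurable:
  fixes f :: "real \<times> real \<Rightarrow> real"
  assumes "continuous_on UNIV f"
  shows "f \<in> borel_measurable (halfline \<Otimes>\<^sub>M halfline)"
proof -
  have id: "(\<lambda>x. x) \<in> borel_measurable halfline" by (intro continuous_measurable_halfline continuous_intros)
  have "f \<in> borel_measurable borel" by (rule borel_measurable_continuous_onI[OF assms])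
  moreover have "(\<lambda>p. (fst p, snd p)) \<in> halfline \<Otimes>\<^sub>M halfline \<rightarrow>\<^sub>M borel"
    by (rule borel_measurable_Pair) (use id in \<open>auto intro: measurable_compose[OF measurable_fst] measurable_compose[OF measurable_snd]\<close>)
  ultimately show ?thesis using measurable_compose by fastforce
qed

lemma integrable_gauss_quadratic:
  assumes "a > 0" shows "integrable halfline (\<lambda>x. x\<^sup>2 * exp (- a * x\<^sup>2))"
proof (rule Bochner_Integration.integrable_bound)
  show "integrable halfline (\<lambda>x. x ^ (2 * 0 + 1) * exp (- a * x\<^sup>2) + x ^ (2 * 1 + 1) * exp (- a * x\<^sup>2))"
    using gauss_odd_moment[OF assms, of 0] gauss_odd_moment[OF assms, of 1]
    by (intro Bochner_Integration.integrable_add) (auto simp: has_bochner_integral_iff)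
  show "(\<lambda>x. x\<^sup>2 * exp (- a * x\<^sup>2)) \<in> borel_measurable halfline"
    by (intro continuous_measurable_halfline continuous_intros)
  show "AE x in halfline. norm (x\<^sup>2 * exp (- a * x\<^sup>2)) \<le> norm (x ^ (2 * 0 + 1) * exp (- a * x\<^sup>2) + x ^ (2 * 1 + 1) * exp (- a * x\<^sup>2))"
  proof (rule AE_I2)
    fix x :: real assume "x \<in> space halfline"
    then have x: "0 \<le> x" by simp
    have "x\<^sup>2 \<le> x + x ^ 3"
    proof -
      have "0 \<le> x * (x - 1)\<^sup>2" using x by simp
      moreover have "x * (x - 1)\<^sup>2 = x ^ 3 - 2 * x\<^sup>2 + x" by (simp add: power2_eq_square power3_eq_cube algebra_simps)
      ultimately show ?thesis using zero_le_power2[of x] by linarith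
    qed
    then have "x\<^sup>2 * exp (- a * x\<^sup>2) \<le> (x + x ^ 3) * exp (- a * x\<^sup>2)" by (intro mult_right_mono) auto
    then show "norm (x\<^sup>2 * exp (- a * x\<^sup>2)) \<le> norm (x ^ (2 * 0 + 1) * exp (- a * x\<^sup>2) + x ^ (2 * 1 + 1) * exp (- a * x\<^sup>2))"
      using x by (simp add: distrib_right)
  qed
qed

lemma kluyver_cdf_eq_Bochner:
  assumes "3 \<le> n"
  shows "integrable halfline (\<lambda>t. x * bessel_J1 (x * t) * bessel_J0 t ^ n)"
    and "(LINT t|halfline. x * bessel_J1 (x * t) * bessel_J0 t ^ n) = kluyver_cdf n x"
proof -
  obtain C where C: "C \<ge> 1" "\<And>n t. 3 \<le> n \<Longrightarrow> 0 \<le> t \<Longrightarrow> \<bar>bessel_J0 t ^ n\<bar> \<le> C * decay_weight t"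
    using bessel_J0_power_bound by blast
  show i: "integrable halfline (\<lambda>t. x * bessel_J1 (x * t) * bessel_J0 t ^ n)"
  proof (rule Bochner_Integration.integrable_bound)
    show "integrable halfline (\<lambda>t. (\<bar>x\<bar> * C) * decay_weight t)" by (intro integrable_mult_right integrable_decay_weight)
    show "(\<lambda>t. x * bessel_J1 (x * t) * bessel_J0 t ^ n) \<in> borel_measurable halfline"
      by (intro continuous_measurable_halfline continuous_intros)
    show "AE t in halfline. norm (x * bessel_J1 (x * t) * bessel_J0 t ^ n) \<le> norm ((\<bar>x\<bar> * C) * decay_weight t)"
    proof (rule AE_I2)
      fix t assume "t \<in> space halfline"
      then have "\<bar>x\<bar> * \<bar>bessel_J1 (x * t)\<bar> * \<bar>bessel_J0 t ^ n\<bar> \<le> \<bar>x\<bar> * 1 * (C * decay_weight t)"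
        using abs_bessel_J1_le C(2)[OF assms, of t] by (intro mult_mono) auto
      then show "norm (x * bessel_J1 (x * t) * bessel_J0 t ^ n) \<le> norm ((\<bar>x\<bar> * C) * decay_weight t)"
        using C(1) decay_weight_nonneg[of t] by (simp add: abs_mult mult_ac)
    qed
  qed
  show "(LINT t|halfline. x * bessel_J1 (x * t) * bessel_J0 t ^ n) = kluyver_cdf n x"
    unfolding kluyver_cdf_def by (rule integral_unique[symmetric, OF integral_halfline[OF i]])
qed

text \<open>Exchange the two integrals; the inner one is Weber's integral for \<open>J1\<close>. The majorant is a product of a Gaussian in \<open>x\<close> and the decay weight in \<open>t\<close>.\<close>

lemma gauss_transform_kluyver_cdf:
  assumes n: "3 \<le> n" and a: "a > 0"
  shows "integrable halfline (\<lambda>x. 2 * a * x * exp (- a * x\<^sup>2) * kluyver_cdf n x)"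
    and "(LINT x|halfline. 2 * a * x * exp (- a * x\<^sup>2) * kluyver_cdf n x) =
         (LINT t|halfline. bessel_J0 t ^ n * (t / (2 * a) * exp (- (1 / (4 * a)) * t\<^sup>2)))"
proof -
  obtain C where C: "C \<ge> 1" "\<And>n t. 3 \<le> n \<Longrightarrow> 0 \<le> t \<Longrightarrow> \<bar>bessel_J0 t ^ n\<bar> \<le> C * decay_weight t"
    using bessel_J0_power_bound by blast
  interpret H: sigma_finite_measure halfline by (rule sigma_finite_halfline)
  interpret P: pair_sigma_finite halfline halfline ..
  let ?f = "\<lambda>x t. 2 * a * x * exp (- a * x\<^sup>2) * (x * bessel_J1 (x * t) * bessel_J0 t ^ n)"
  have fi: "integrable (halfline \<Otimes>\<^sub>M halfline) (case_prod ?f)"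
  proof (rule P.integrable_product_bound)
    show "case_prod ?f \<in> borel_measurable (halfline \<Otimes>\<^sub>M halfline)"
      unfolding case_prod_unfold by (intro continuous_pair_measurable continuous_intros)
    show "integrable halfline (\<lambda>x. 2 * a * (x\<^sup>2 * exp (- a * x\<^sup>2)))" by (intro integrable_mult_right integrable_gauss_quadratic a)
    show "integrable halfline (\<lambda>t. C * decay_weight t)" by (intro integrable_mult_right integrable_decay_weight)
    fix x t assume "x \<in> space halfline" "t \<in> space halfline"
    then have x: "0 \<le> x" and t: "0 \<le> t" by auto
    have "(2 * a * x * exp (- a * x\<^sup>2)) * (x * \<bar>bessel_J1 (x * t)\<bar> * \<bar>bessel_J0 t ^ n\<bar>) \<le> (2 * a * x * exp (- a * x\<^sup>2)) * (x * 1 * (C * decay_weight t))"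
      using abs_bessel_J1_le C(2)[OF n t] x a by (intro mult_left_mono mult_mono) auto
    then show "\<bar>case_prod ?f (x, t)\<bar> \<le> 2 * a * (x\<^sup>2 * exp (- a * x\<^sup>2)) * (C * decay_weight t)"
      using x a by (simp add: abs_mult power2_eq_square mult_ac)
  qed
  have inner: "(LINT t|halfline. ?f x t) = 2 * a * x * exp (- a * x\<^sup>2) * kluyver_cdf n x" for x
    unfolding kluyver_cdf_eq_Bochner(2)[OF n, symmetric] by (rule integral_mult_right_zero)
  show "integrable halfline (\<lambda>x. 2 * a * x * exp (- a * x\<^sup>2) * kluyver_cdf n x)"
    using P.integrable_fst'[OF fi] unfolding split_conv inner .
  have inner2: "(LINT x|halfline. ?f x t) = bessel_J0 t ^ n * (t / (2 * a) * exp (- (1 / (4 * a)) * t\<^sup>2))" for t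
  proof -
    have "(LINT x|halfline. ?f x t) = (LINT x|halfline. (2 * a * bessel_J0 t ^ n) * (x * (x * bessel_J1 (x * t)) * exp (- a * x\<^sup>2)))"
      by (rule Bochner_Integration.integral_cong) auto
    also have "\<dots> = (2 * a * bessel_J0 t ^ n) * (t / (4 * a\<^sup>2) * exp (- (1 / (4 * a)) * t\<^sup>2))"
      unfolding weber_J1(2)[OF a, symmetric] by (rule integral_mult_right_zero)
    also have "\<dots> = bessel_J0 t ^ n * (t / (2 * a) * exp (- (1 / (4 * a)) * t\<^sup>2))"
      using a by (simp add: power2_eq_square)
    finally show ?thesis .
  qed
  show "(LINT x|halfline. 2 * a * x * exp (- a * x\<^sup>2) * kluyver_cdf n x) =
         (LINT t|halfline. bessel_J0 t ^ n * (t / (2 * a) * exp (- (1 / (4 * a)) * t\<^sup>2)))"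
    using P.Fubini_integral[OF fi] unfolding inner inner2 by simp
qed

text \<open>Weber's integral for \<open>J0\<close> writes the Gaussian of the distance as a mixture of \<open>J0 (R * t)\<close>, whose expectation is \<open>J0 t ^ n\<close>.\<close>

lemma gauss_transform_walk:
  assumes a: "a > 0"
  shows "(LINT \<omega>|walk_measure n. exp (- a * (cmod (walk_end n \<omega>))\<^sup>2)) =
         (LINT t|halfline. bessel_J0 t ^ n * (t / (2 * a) * exp (- (1 / (4 * a)) * t\<^sup>2)))"
proof -
  interpret W: prob_space "walk_measure n" by (rule prob_space_walk_measure)
  interpret H: sigma_finite_measure halfline by (rule sigma_finite_halfline)
  interpret P: pair_sigma_finite "walk_measure n" halfline ..
  let ?R = "\<lambda>\<omega>. cmod (walk_end n \<omega>)"
  let ?g = "\<lambda>t. t / (2 * a) * exp (- (1 / (4 * a)) * t\<^sup>2)"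
  let ?f = "\<lambda>\<omega> t. bessel_J0 (?R \<omega> * t) * ?g t"
  have b: "1 / (4 * a) > 0" using a by simp
  have fi: "integrable (walk_measure n \<Otimes>\<^sub>M halfline) (case_prod ?f)"
  proof (rule P.integrable_product_bound)
    have J[measurable]: "bessel_J0 \<in> borel_measurable borel"
      by (rule borel_measurable_continuous_onI) (intro continuous_intros)
    have [measurable]: "(\<lambda>x. x) \<in> borel_measurable halfline" by (intro continuous_measurable_halfline continuous_intros)
    show "case_prod ?f \<in> borel_measurable (walk_measure n \<Otimes>\<^sub>M halfline)" by measurable
    show "integrable (walk_measure n) (\<lambda>\<omega>. 1::real)" by simp
    show "integrable halfline ?g"
      using has_bochner_integral_mult_right[OF gauss_odd_moment[OF b, of 0], of "1 / (2 * a)"]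
      by (auto simp: has_bochner_integral_iff mult_ac)
    fix \<omega> t assume "\<omega> \<in> space (walk_measure n)" "t \<in> space halfline"
    then have "\<bar>bessel_J0 (?R \<omega> * t)\<bar> * ?g t \<le> 1 * ?g t" using a by (intro mult_right_mono abs_bessel_J0_le) auto
    then show "\<bar>case_prod ?f (\<omega>, t)\<bar> \<le> 1 * ?g t" using \<open>t \<in> space halfline\<close> a by (simp add: abs_mult)
  qed
  have inner: "(LINT t|halfline. ?f \<omega> t) = exp (- a * (?R \<omega>)\<^sup>2)" for \<omega>
  proof -
    have "(LINT t|halfline. ?f \<omega> t) = (LINT t|halfline. (1 / (2 * a)) * (t * bessel_J0 (?R \<omega> * t) * exp (- (1 / (4 * a)) * t\<^sup>2)))"
      by (rule Bochner_Integration.integral_cong) auto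
    also have "\<dots> = (1 / (2 * a)) * (2 * a * exp (- a * (?R \<omega>)\<^sup>2))"
      unfolding weber_J0(2)[OF a, symmetric] by (rule integral_mult_right_zero)
    finally show ?thesis using a by simp
  qed
  have inner2: "(LINT \<omega>|walk_measure n. ?f \<omega> t) = bessel_J0 t ^ n * ?g t" for t
    unfolding expectation_bessel_J0[symmetric] by (rule integral_mult_left_zero)
  show ?thesis using P.Fubini_integral[OF fi] unfolding inner inner2 by simp
qed

text \<open>For a random variable with distribution function \<open>F\<close> integration by parts gives exactly this relation.\<close>

lemma gauss_transforms_agree:
  assumes "3 \<le> n" "a > 0"
  shows "(LINT x|halfline. 2 * a * x * exp (- a * x\<^sup>2) * kluyver_cdf n x) = (LINT \<omega>|walk_measure n. exp (- a * (cmod (walk_end n \<omega>))\<^sup>2))"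
  using gauss_transform_kluyver_cdf(2)[OF assms] gauss_transform_walk[OF assms(2)] by simp

section \<open>The distribution function of the walk\<close>

lemma continuous_on_kluyver_cdf:
  assumes "3 \<le> n"
  shows "continuous_on UNIV (kluyver_cdf n)"
proof (rule continuous_at_imp_continuous_on, rule)
  fix x :: real
  obtain C where C: "C \<ge> 1" "\<And>n t. 3 \<le> n \<Longrightarrow> 0 \<le> t \<Longrightarrow> \<bar>bessel_J0 t ^ n\<bar> \<le> C * decay_weight t"
    using bessel_J0_power_bound by blast
  show "isCont (kluyver_cdf n) x"
    unfolding continuous_at_sequentially o_def
  proof (intro allI impI)
    fix X :: "nat \<Rightarrow> real" assume X: "X \<longlonglongrightarrow> x"
    then obtain B where B: "\<And>m. \<bar>X m\<bar> \<le> B" using convergent_imp_Bseq[of X] by (auto simp: convergent_def Bseq_def)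
    show "(\<lambda>m. kluyver_cdf n (X m)) \<longlonglongrightarrow> kluyver_cdf n x"
      unfolding kluyver_cdf_def
    proof (rule dominated_convergence)
      show "(\<lambda>t. X m * bessel_J1 (X m * t) * bessel_J0 t ^ n) integrable_on {0..}" for m
        by (rule kluyver_cdf_integrand_integrable[OF assms])
      show "(\<lambda>t. (B * C) * decay_weight t) integrable_on {0..}"
        using has_integral_mult_right[OF decay_weight_has_integral] by blast
      fix m and t :: real assume t: "t \<in> {0..}"
      have "\<bar>X m\<bar> * \<bar>bessel_J1 (X m * t)\<bar> * \<bar>bessel_J0 t ^ n\<bar> \<le> B * 1 * (C * decay_weight t)"
        using abs_bessel_J1_le C(2)[OF assms, of t] B[of m] t by (intro mult_mono) auto
      then show "norm (X m * bessel_J1 (X m * t) * bessel_J0 t ^ n) \<le> (B * C) * decay_weight t"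
        by (simp add: abs_mult mult_ac)
    next
      fix t :: real
      have "isCont (\<lambda>x. x * bessel_J1 (x * t) * bessel_J0 t ^ n) x"
        by (rule continuous_on_interior[of UNIV]) (auto intro!: continuous_intros)
      then show "(\<lambda>m. X m * bessel_J1 (X m * t) * bessel_J0 t ^ n) \<longlonglongrightarrow> x * bessel_J1 (x * t) * bessel_J0 t ^ n"
        using X by (rule isCont_tendsto_compose)
    qed
  qed
qed

text \<open>The case \<open>a = k + 1\<close> of \<open>gauss_transforms_agree\<close>, rewritten in the variable \<open>v = exp (- x\<^sup>2)\<close>, where it concerns the monomial \<open>v ^ k\<close> and its primitive.\<close>

lemma weierstrass_monomial:
  assumes n: "3 \<le> n"
  shows "integrable halfline (\<lambda>x. 2 * x * exp (- x\<^sup>2) * (exp (- x\<^sup>2)) ^ k * kluyver_cdf n x)"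
    and "(LINT x|halfline. 2 * x * exp (- x\<^sup>2) * (exp (- x\<^sup>2)) ^ k * kluyver_cdf n x) =
      (LINT \<omega>|walk_measure n. (exp (- (cmod (walk_end n \<omega>))\<^sup>2)) ^ (k + 1) / real (k + 1))"
proof -
  let ?a = "real (k + 1)"
  have a: "?a > 0" by simp
  have pw: "(exp (- y)) ^ (k + 1) = exp (- ?a * y)" for y :: real
    by (simp only: exp_of_nat_mult[symmetric]) (simp add: algebra_simps)
  have e: "2 * x * exp (- x\<^sup>2) * (exp (- x\<^sup>2)) ^ k * kluyver_cdf n x = (1 / ?a) * (2 * ?a * x * exp (- ?a * x\<^sup>2) * kluyver_cdf n x)" for x
  proof -
    have "2 * x * exp (- x\<^sup>2) * (exp (- x\<^sup>2)) ^ k * kluyver_cdf n x = 2 * x * (exp (- x\<^sup>2)) ^ (k + 1) * kluyver_cdf n x" by simp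
    also have "\<dots> = (1 / ?a) * (2 * ?a * x * exp (- ?a * x\<^sup>2) * kluyver_cdf n x)" unfolding pw by (simp add: field_simps)
    finally show ?thesis .
  qed
  show "integrable halfline (\<lambda>x. 2 * x * exp (- x\<^sup>2) * (exp (- x\<^sup>2)) ^ k * kluyver_cdf n x)"
    unfolding e by (intro integrable_mult_right gauss_transform_kluyver_cdf(1)[OF n a])
  have "(LINT x|halfline. 2 * x * exp (- x\<^sup>2) * (exp (- x\<^sup>2)) ^ k * kluyver_cdf n x) = (1 / ?a) * (LINT \<omega>|walk_measure n. exp (- ?a * (cmod (walk_end n \<omega>))\<^sup>2))"
    unfolding e gauss_transforms_agree[OF n a, symmetric] by (rule integral_mult_right_zero)
  also have "\<dots> = (LINT \<omega>|walk_measure n. (1 / ?a) * exp (- ?a * (cmod (walk_end n \<omega>))\<^sup>2))"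
    by (rule integral_mult_right_zero[symmetric])
  finally show "(LINT x|halfline. 2 * x * exp (- x\<^sup>2) * (exp (- x\<^sup>2)) ^ k * kluyver_cdf n x) =
      (LINT \<omega>|walk_measure n. (exp (- (cmod (walk_end n \<omega>))\<^sup>2)) ^ (k + 1) / real (k + 1))"
    unfolding pw by simp
qed

text \<open>Linear combinations of monomials are handled by \<open>weierstrass_monomial\<close>; a uniform approximation of \<open>q\<close> by a polynomial within \<open>e\<close> changes either side by at most a constant times \<open>e\<close>.\<close>

lemma weierstrass_transfer:
  assumes n: "3 \<le> n" and q: "continuous_on {0..1} q"
    and Q: "\<And>v. v \<in> {0..1} \<Longrightarrow> (Q has_real_derivative q v) (at v within {0..1})"
  shows "integrable halfline (\<lambda>x. 2 * x * exp (- x\<^sup>2) * q (exp (- x\<^sup>2)) * kluyver_cdf n x)"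
    and "(LINT x|halfline. 2 * x * exp (- x\<^sup>2) * q (exp (- x\<^sup>2)) * kluyver_cdf n x) =
      (LINT \<omega>|walk_measure n. Q (exp (- (cmod (walk_end n \<omega>))\<^sup>2)) - Q 0)"
proof -
  interpret W: prob_space "walk_measure n" by (rule prob_space_walk_measure)
  let ?V = "\<lambda>\<omega>. exp (- (cmod (walk_end n \<omega>))\<^sup>2)"
  have V: "?V \<omega> \<in> {0..1}" for \<omega> by simp
  have Vm[measurable]: "?V \<in> borel_measurable (walk_measure n)" by measurable
  obtain C where C: "C > 0" "\<And>x. \<bar>kluyver_cdf n x\<bar> \<le> C * \<bar>x\<bar>" by (rule kluyver_cdf_bound[OF n]) (rule that)
  let ?g = "\<lambda>x. (2 * C) * (x\<^sup>2 * exp (- 1 * x\<^sup>2))"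
  have gi: "integrable halfline ?g" by (intro integrable_mult_right integrable_gauss_quadratic) simp
  have ex: "exp (- x\<^sup>2) \<in> {0..1}" for x :: real by simp
  have dom: "\<bar>2 * x * exp (- x\<^sup>2) * c * kluyver_cdf n x\<bar> \<le> B * ?g x" if "\<bar>c\<bar> \<le> B" "0 \<le> x" for c B x
  proof -
    have "\<bar>2 * x * exp (- x\<^sup>2) * c * kluyver_cdf n x\<bar> = (2 * x * exp (- x\<^sup>2)) * (\<bar>c\<bar> * \<bar>kluyver_cdf n x\<bar>)"
      using that by (simp add: abs_mult)
    also have "\<dots> \<le> (2 * x * exp (- x\<^sup>2)) * (B * (C * x))"
      using that C(2)[of x] by (intro mult_left_mono mult_mono) auto
    finally show ?thesis by (simp add: power2_eq_square mult_ac)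
  qed
  have int: "integrable halfline (\<lambda>x. 2 * x * exp (- x\<^sup>2) * r (exp (- x\<^sup>2)) * kluyver_cdf n x)"
    if r: "continuous_on {0..1} r" for r
  proof -
    have "bounded (r ` {0..1})" by (intro compact_imp_bounded compact_continuous_image r) simp
    then obtain B where B: "\<And>v. v \<in> {0..1} \<Longrightarrow> \<bar>r v\<bar> \<le> B" unfolding bounded_iff by (metis imageI real_norm_def)
    show ?thesis
    proof (rule Bochner_Integration.integrable_bound[OF integrable_mult_right[OF gi, of B]])
      have "continuous_on {0..} (\<lambda>x::real. r (exp (- x\<^sup>2)))"
        by (rule continuous_on_compose2[OF r]) (auto intro!: continuous_intros)
      then show "(\<lambda>x. 2 * x * exp (- x\<^sup>2) * r (exp (- x\<^sup>2)) * kluyver_cdf n x) \<in> borel_measurable halfline"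
        by (intro continuous_measurable_halfline continuous_intros continuous_on_subset[OF continuous_on_kluyver_cdf[OF n]]) auto
      show "AE x in halfline. norm (2 * x * exp (- x\<^sup>2) * r (exp (- x\<^sup>2)) * kluyver_cdf n x) \<le> norm (B * ?g x)"
      proof (rule AE_I2)
        fix x assume "x \<in> space halfline"
        then have "\<bar>2 * x * exp (- x\<^sup>2) * r (exp (- x\<^sup>2)) * kluyver_cdf n x\<bar> \<le> B * ?g x"
          by (intro dom B ex) auto
        then show "norm (2 * x * exp (- x\<^sup>2) * r (exp (- x\<^sup>2)) * kluyver_cdf n x) \<le> norm (B * ?g x)" by simp
      qed
    qed
  qed
  show "integrable halfline (\<lambda>x. 2 * x * exp (- x\<^sup>2) * q (exp (- x\<^sup>2)) * kluyver_cdf n x)" by (rule int[OF q])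
  have Qc: "continuous_on {0..1} Q" by (rule DERIV_continuous_on) (rule Q)
  have QVi: "integrable (walk_measure n) (\<lambda>\<omega>. Q (?V \<omega>))"
  proof -
    have "continuous_on UNIV (\<lambda>v. Q (max 0 (min 1 v)))"
      by (rule continuous_on_compose2[OF Qc]) (auto intro!: continuous_intros)
    then have "(\<lambda>v. Q (max 0 (min 1 v))) \<in> borel_measurable borel" by (rule borel_measurable_continuous_onI)
    then have "(\<lambda>\<omega>. Q (max 0 (min 1 (?V \<omega>)))) \<in> borel_measurable (walk_measure n)" by (rule measurable_compose[OF Vm])
    moreover have "max 0 (min 1 (?V \<omega>)) = ?V \<omega>" for \<omega> using V[of \<omega>] by auto
    ultimately have m: "(\<lambda>\<omega>. Q (?V \<omega>)) \<in> borel_measurable (walk_measure n)" by simp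
    have "bounded (Q ` {0..1})" by (intro compact_imp_bounded compact_continuous_image Qc) simp
    then obtain B where B: "\<And>v. v \<in> {0..1} \<Longrightarrow> \<bar>Q v\<bar> \<le> B" unfolding bounded_iff by (metis imageI real_norm_def)
    show ?thesis by (rule W.integrable_const_bound[of _ B]) (use B V m in auto)
  qed
  define S where "S = (LINT x|halfline. ?g x)"
  have S0: "0 \<le> S" unfolding S_def using C(1) by (intro integral_nonneg_AE) auto
  let ?L = "LINT x|halfline. 2 * x * exp (- x\<^sup>2) * q (exp (- x\<^sup>2)) * kluyver_cdf n x"
  let ?E = "LINT \<omega>|walk_measure n. Q (?V \<omega>) - Q 0"
  have close: "\<bar>?L - ?E\<bar> \<le> e * (S + 1)" if e: "e > 0" for e
  proof -
    obtain p where "real_polynomial_function p" and p: "\<And>v. v \<in> {0..1} \<Longrightarrow> \<bar>q v - p v\<bar> < e"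
      using Stone_Weierstrass_real_polynomial_function[OF compact_Icc q e] by metis
    then obtain a N where pa: "p = (\<lambda>v. \<Sum>i\<le>N. a i * v ^ i)" unfolding real_polynomial_function_iff_sum by blast
    define P where "P v = (\<Sum>i\<le>N. a i * (v ^ (i + 1) / real (i + 1)))" for v :: real
    have Pd: "(P has_real_derivative p v) (at v within {0..1})" for v
    proof -
      have "((\<lambda>v. v ^ (i + 1) / real (i + 1)) has_real_derivative v ^ i) (at v within {0..1})" for i
        using DERIV_cdivide[OF DERIV_pow[of "i + 1" v "{0..1}"], of "real (i + 1)"] by simp
      then show ?thesis unfolding P_def[abs_def] pa by (intro DERIV_sum DERIV_cmult)
    qed
    have pc: "continuous_on {0..1} p" unfolding pa by (intro continuous_intros)
    have l1: "(LINT x|halfline. 2 * x * exp (- x\<^sup>2) * p (exp (- x\<^sup>2)) * kluyver_cdf n x) = (LINT \<omega>|walk_measure n. P (?V \<omega>))"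
    proof -
      have "(LINT x|halfline. 2 * x * exp (- x\<^sup>2) * p (exp (- x\<^sup>2)) * kluyver_cdf n x)
        = (LINT x|halfline. (\<Sum>i\<le>N. a i * (2 * x * exp (- x\<^sup>2) * (exp (- x\<^sup>2)) ^ i * kluyver_cdf n x)))"
        by (rule Bochner_Integration.integral_cong[OF refl]) (simp add: pa sum_distrib_left sum_distrib_right mult_ac)
      also have "\<dots> = (\<Sum>i\<le>N. a i * (LINT x|halfline. 2 * x * exp (- x\<^sup>2) * (exp (- x\<^sup>2)) ^ i * kluyver_cdf n x))"
        by (subst Bochner_Integration.integral_sum) (use weierstrass_monomial(1)[OF n] in \<open>auto simp only: integrable_mult_right integral_mult_right_zero\<close>)
      also have "\<dots> = (\<Sum>i\<le>N. (LINT \<omega>|walk_measure n. a i * ((?V \<omega>) ^ (i + 1) / real (i + 1))))"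
        unfolding weierstrass_monomial(2)[OF n] by (simp only: integral_mult_right_zero)
      also have "\<dots> = (LINT \<omega>|walk_measure n. P (?V \<omega>))"
        unfolding P_def
      proof (rule Bochner_Integration.integral_sum[symmetric])
        fix i
        have "integrable (walk_measure n) (\<lambda>\<omega>. (?V \<omega>) ^ (i + 1))"
          by (rule W.integrable_const_bound[of _ 1]) (auto intro!: AE_I2 power_le_one simp del: power_Suc)
        then show "integrable (walk_measure n) (\<lambda>\<omega>. a i * ((?V \<omega>) ^ (i + 1) / real (i + 1)))"
          by (intro integrable_mult_right integrable_divide_zero) auto
      qed
      finally show ?thesis .
    qed
    have Pi: "integrable (walk_measure n) (\<lambda>\<omega>. P (?V \<omega>))"
    proof -
      have "P \<in> borel_measurable borel" unfolding P_def[abs_def] by measurable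
      then have m: "(\<lambda>\<omega>. P (?V \<omega>)) \<in> borel_measurable (walk_measure n)" by (rule measurable_compose[OF Vm])
      have "continuous_on {0..1} P" unfolding P_def by (intro continuous_intros) auto
      then have "bounded (P ` {0..1})" by (intro compact_imp_bounded compact_continuous_image) simp_all
      then obtain B where B: "\<And>v. v \<in> {0..1} \<Longrightarrow> \<bar>P v\<bar> \<le> B" unfolding bounded_iff by (metis imageI real_norm_def)
      show ?thesis by (rule W.integrable_const_bound[of _ B]) (use B V m in auto)
    qed
    have d1: "\<bar>?L - (LINT x|halfline. 2 * x * exp (- x\<^sup>2) * p (exp (- x\<^sup>2)) * kluyver_cdf n x)\<bar> \<le> e * S"
    proof -
      have eq: "?L - (LINT x|halfline. 2 * x * exp (- x\<^sup>2) * p (exp (- x\<^sup>2)) * kluyver_cdf n x)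
         = (LINT x|halfline. 2 * x * exp (- x\<^sup>2) * q (exp (- x\<^sup>2)) * kluyver_cdf n x - 2 * x * exp (- x\<^sup>2) * p (exp (- x\<^sup>2)) * kluyver_cdf n x)"
        by (rule Bochner_Integration.integral_diff[symmetric]) (intro int q pc)+
      have "norm (LINT x|halfline. 2 * x * exp (- x\<^sup>2) * q (exp (- x\<^sup>2)) * kluyver_cdf n x - 2 * x * exp (- x\<^sup>2) * p (exp (- x\<^sup>2)) * kluyver_cdf n x)
         \<le> (LINT x|halfline. e * ?g x)"
      proof (rule Bochner_Integration.integral_norm_bound_integral)
        show "integrable halfline (\<lambda>x. e * ?g x)" by (intro integrable_mult_right gi)
        fix x assume "x \<in> space halfline"
        then have "\<bar>2 * x * exp (- x\<^sup>2) * (q (exp (- x\<^sup>2)) - p (exp (- x\<^sup>2))) * kluyver_cdf n x\<bar> \<le> e * ?g x"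
          using p[OF ex[of x]] by (intro dom) auto
        then show "norm (2 * x * exp (- x\<^sup>2) * q (exp (- x\<^sup>2)) * kluyver_cdf n x - 2 * x * exp (- x\<^sup>2) * p (exp (- x\<^sup>2)) * kluyver_cdf n x) \<le> e * ?g x"
          by (simp add: algebra_simps)
      qed (intro Bochner_Integration.integrable_diff int q pc)
      also have "\<dots> = e * S" unfolding S_def by (rule integral_mult_right_zero)
      finally show ?thesis unfolding eq real_norm_def .
    qed
    have d2: "\<bar>?E - (LINT \<omega>|walk_measure n. P (?V \<omega>))\<bar> \<le> e"
    proof -
      have eq: "?E - (LINT \<omega>|walk_measure n. P (?V \<omega>)) = (LINT \<omega>|walk_measure n. (Q (?V \<omega>) - Q 0) - P (?V \<omega>))"
        by (rule Bochner_Integration.integral_diff[symmetric]) (intro Bochner_Integration.integrable_diff QVi Pi; simp)+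
      have "norm (LINT \<omega>|walk_measure n. (Q (?V \<omega>) - Q 0) - P (?V \<omega>)) \<le> (LINT \<omega>|walk_measure n. e)"
      proof (rule order_trans[OF Bochner_Integration.integral_norm_bound Bochner_Integration.integral_mono])
        fix \<omega>
        have "norm ((Q (?V \<omega>) - P (?V \<omega>)) - (Q 0 - P 0)) \<le> e * norm (?V \<omega> - 0)"
        proof (rule field_differentiable_bound[of "{0..1}"])
          fix v :: real assume v: "v \<in> {0..1}"
          show "((\<lambda>v. Q v - P v) has_field_derivative q v - p v) (at v within {0..1})" by (intro DERIV_diff Q Pd v)
          show "norm (q v - p v) \<le> e" using p[OF v] by simp
        qed (use V in auto)
        also have "\<dots> \<le> e * 1" using e V[of \<omega>] by (intro mult_left_mono) auto
        finally show "norm ((Q (?V \<omega>) - Q 0) - P (?V \<omega>)) \<le> e" by (simp add: P_def algebra_simps)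
      qed (intro integrable_norm Bochner_Integration.integrable_diff QVi Pi W.integrable_const)+
      also have "\<dots> = e" by (simp add: W.prob_space)
      finally show ?thesis unfolding eq real_norm_def .
    qed
    have "\<bar>?L - ?E\<bar> \<le> e * S + e" using d1 d2 unfolding l1 by linarith
    then show ?thesis by (simp add: algebra_simps)
  qed
  have "\<bar>?L - ?E\<bar> \<le> 0"
  proof (rule field_le_epsilon)
    fix d :: real assume "d > 0"
    then have "\<bar>?L - ?E\<bar> \<le> (d / (S + 1)) * (S + 1)" using S0 by (intro close) auto
    then show "\<bar>?L - ?E\<bar> \<le> 0 + d" using S0 by simp
  qed
  then show "?L = ?E" by simp
qed

text \<open>In the variable \<open>v = exp (- x\<^sup>2)\<close> the test function becomes \<open>q v = u (sqrt (- ln v)) / (2 * v)\<close>, which vanishes for \<open>v < exp (- M\<^sup>2)\<close>. Hence the division by \<open>v\<close> is harmless and \<open>q\<close> is continuous on \<open>{0..1}\<close>.\<close>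

lemma kluyver_cdf_test_function:
  assumes n: "3 \<le> n" and M: "real n \<le> M" and u: "continuous_on {0..} u" "\<And>x. M \<le> x \<Longrightarrow> u x = 0"
  shows "((\<lambda>x. x * u x * kluyver_cdf n x) has_integral
            (LINT \<omega>|walk_measure n. integral {cmod (walk_end n \<omega>)..M} (\<lambda>x. x * u x))) {0..}"
proof -
  have M0: "M > 0" using n M by simp
  \<comment> \<open>The truncation by \<open>min v 1\<close> extends \<open>q\<close> continuously to the whole line, so that its primitive can be differentiated at the ends of \<open>{0..1}\<close>.\<close>
  define q where "q v = (if v \<le> 0 then 0 else u (sqrt (- ln (min v 1))) / (2 * min v 1))" for v :: real
  have q0: "q v = 0" if "v < exp (- M\<^sup>2)" for v
  proof (cases "v \<le> 0")
    case False
    then have "ln v < - M\<^sup>2" using that by (metis exp_less_mono ln_exp ln_less_cancel_iff exp_gt_zero not_le)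
    moreover have "v < 1" using that by (metis exp_le_one_iff less_le_trans neg_le_0_iff_le zero_le_power2)
    ultimately have "sqrt (M\<^sup>2) \<le> sqrt (- ln (min v 1))" by (intro real_sqrt_le_mono) (simp add: min_def)
    then show ?thesis using M0 u(2) by (simp add: q_def)
  qed (simp add: q_def)
  have qe: "q (exp (- x\<^sup>2)) = u x / (2 * exp (- x\<^sup>2))" if "0 \<le> x" for x
    using that by (simp add: q_def min_absorb1)
  have qc: "continuous_on UNIV q"
  proof -
    have "continuous_on {0<..} (\<lambda>v. u (sqrt (- ln (min v 1))) / (2 * min v 1))"
      by (intro continuous_intros continuous_on_compose2[OF u(1)]) (auto simp: min_def)
    then have 1: "continuous_on {0<..} q" by (rule continuous_on_eq) (simp add: q_def)
    have 2: "continuous_on {..<exp (- M\<^sup>2)} q" by (rule continuous_on_eq[OF continuous_on_const[of _ 0]]) (simp add: q0)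
    have "continuous_on ({0<..} \<union> {..<exp (- M\<^sup>2)}) q" by (intro continuous_on_open_Un 1 2) auto
    moreover have "{0<..} \<union> {..<exp (- M\<^sup>2)} = UNIV" by (auto simp: not_less intro: less_le_trans[OF exp_gt_zero])
    ultimately show ?thesis by simp
  qed
  define Q where "Q v = integral {-1..v} q" for v
  have Qd: "(Q has_real_derivative q v) (at v within {-1..2})" if "v \<in> {-1..2}" for v
    unfolding Q_def[abs_def] using that by (intro integral_has_real_derivative continuous_on_subset[OF qc]) auto
  have Qi: "(Q has_real_derivative q v) (at v)" if "v \<in> {-1<..<2}" for v
    using Qd[of v] that at_within_interior[of v "{-1..2}"] by auto
  have Q01: "(Q has_real_derivative q v) (at v within {0..1})" if "v \<in> {0..1}" for v
    using Qi[of v] that by (auto intro: has_field_derivative_at_within)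
  have ftc: "Q (exp (- r\<^sup>2)) - Q 0 = integral {r..M} (\<lambda>x. x * u x)" if r: "0 \<le> r" "r \<le> M" for r
  proof -
    have "((\<lambda>x. - (x * u x)) has_integral Q (exp (- M\<^sup>2)) - Q (exp (- r\<^sup>2))) {r..M}"
    proof (rule fundamental_theorem_of_calculus[OF r(2)])
      fix x assume x: "x \<in> {r..M}"
      have ee: "exp (- x\<^sup>2) \<le> 1" "0 < exp (- x\<^sup>2)" by auto
      have "((\<lambda>x. Q (exp (- x\<^sup>2))) has_real_derivative q (exp (- x\<^sup>2)) * (exp (- x\<^sup>2) * (- (2 * x)))) (at x)"
        by (rule DERIV_chain2[OF Qi]) (use ee in \<open>auto intro!: derivative_eq_intros simp del: exp_le_one_iff exp_gt_zero\<close>)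
      also have "q (exp (- x\<^sup>2)) * (exp (- x\<^sup>2) * (- (2 * x))) = - (x * u x)" using x r by (simp add: qe)
      finally show "((\<lambda>x. Q (exp (- x\<^sup>2))) has_vector_derivative - (x * u x)) (at x within {r..M})"
        by (simp add: has_real_derivative_iff_has_vector_derivative has_vector_derivative_at_within)
    qed
    from has_integral_neg[OF this] have "integral {r..M} (\<lambda>x. x * u x) = Q (exp (- r\<^sup>2)) - Q (exp (- M\<^sup>2))" by (simp add: integral_unique)
    moreover have "Q (exp (- M\<^sup>2)) = Q 0"
    proof -
      have 1: "(q has_integral Q (exp (- M\<^sup>2)) - Q 0) {0..exp (- M\<^sup>2)}"
      proof (rule fundamental_theorem_of_calculus)
        fix v assume v: "v \<in> {0..exp (- M\<^sup>2)}"
        have "exp (- M\<^sup>2) \<le> 1" by simp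
        with v have "0 \<le> v" "v \<le> 1" unfolding atLeastAtMost_iff by (blast intro: order_trans)+
        then have "v \<in> {-1<..<2}" by simp
        from Qi[OF this] show "(Q has_vector_derivative q v) (at v within {0..exp (- M\<^sup>2)})"
          by (simp add: has_real_derivative_iff_has_vector_derivative has_vector_derivative_at_within)
      qed simp
      have 2: "(q has_integral 0) {0..exp (- M\<^sup>2)}"
        by (rule has_integral_spike[of "{exp (- M\<^sup>2)}" _ q "\<lambda>_. 0"]) (auto simp: q0)
      show ?thesis using has_integral_unique[OF 1 2] by simp
    qed
    ultimately show ?thesis by simp
  qed
  have q01: "continuous_on {0..1} q" by (rule continuous_on_subset[OF qc]) simp
  have "((\<lambda>x. 2 * x * exp (- x\<^sup>2) * q (exp (- x\<^sup>2)) * kluyver_cdf n x) has_integral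
      (LINT \<omega>|walk_measure n. Q (exp (- (cmod (walk_end n \<omega>))\<^sup>2)) - Q 0)) {0..}"
  proof -
    have 1: "integrable halfline (\<lambda>x. 2 * x * exp (- x\<^sup>2) * q (exp (- x\<^sup>2)) * kluyver_cdf n x)"
      by (rule weierstrass_transfer(1)[OF n q01 Q01])
    have 2: "(LINT x|halfline. 2 * x * exp (- x\<^sup>2) * q (exp (- x\<^sup>2)) * kluyver_cdf n x)
        = (LINT \<omega>|walk_measure n. Q (exp (- (cmod (walk_end n \<omega>))\<^sup>2)) - Q 0)"
      by (rule weierstrass_transfer(2)[OF n q01 Q01])
    show ?thesis using integral_halfline[OF 1] unfolding 2 .
  qed
  moreover have "Q (exp (- (cmod (walk_end n \<omega>))\<^sup>2)) - Q 0 = integral {cmod (walk_end n \<omega>)..M} (\<lambda>x. x * u x)" for \<omega>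
    using norm_walk_end_le[of n \<omega>] M by (intro ftc) auto
  ultimately have "((\<lambda>x. 2 * x * exp (- x\<^sup>2) * q (exp (- x\<^sup>2)) * kluyver_cdf n x) has_integral
      (LINT \<omega>|walk_measure n. integral {cmod (walk_end n \<omega>)..M} (\<lambda>x. x * u x))) {0..}" by simp
  then show ?thesis by (rule has_integral_eq[rotated]) (simp add: qe)
qed

text \<open>Test with \<open>b * (F - 1)\<close>, where \<open>b\<close> is a bump supported on \<open>{n..M}\<close>. The distance never exceeds \<open>n\<close>, so the right-hand side is the integral of \<open>x * b * (F - 1)\<close>, and comparison with the left-hand side leaves \<open>\<integral> x * b * (F - 1)\<^sup>2 = 0\<close>.\<close>

lemma kluyver_cdf_eq_1:
  assumes n: "3 \<le> n" and x: "real n < x"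
  shows "kluyver_cdf n x = 1"
proof -
  interpret W: prob_space "walk_measure n" by (rule prob_space_walk_measure)
  define M where "M = x + 1"
  let ?F = "kluyver_cdf n"
  define b where "b y = max 0 ((y - real n) * (M - y))" for y
  let ?u = "\<lambda>y. b y * (?F y - 1)"
  have b0: "b y = 0" if "M \<le> y \<or> y \<le> real n" for y
  proof -
    have "(y - real n) * (M - y) \<le> 0" using that x by (auto simp: M_def mult_le_0_iff)
    then show ?thesis by (simp add: b_def)
  qed
  have bc: "continuous_on A b" for A unfolding b_def by (intro continuous_intros)
  have Fc: "continuous_on A ?F" for A by (rule continuous_on_subset[OF continuous_on_kluyver_cdf[OF n]]) simp
  have nM: "real n \<le> M" using x by (simp add: M_def)
  define K where "K = integral {real n..M} (\<lambda>y. y * ?u y)"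
  have hi: "((\<lambda>y. y * ?u y) has_integral K) {real n..M}"
    unfolding K_def by (intro integrable_integral integrable_continuous_interval continuous_intros bc Fc)
  have ext: "((\<lambda>y. g y * b y) has_integral I) S \<longleftrightarrow> ((\<lambda>y. g y * b y) has_integral I) {real n..M}" if "{real n..M} \<subseteq> S" for S I and g :: "real \<Rightarrow> real"
  proof
    assume "((\<lambda>y. g y * b y) has_integral I) {real n..M}"
    moreover have "g y * b y = 0" if "y \<notin> {real n..M}" for y using b0[of y] that by (auto simp: not_le)
    ultimately show "((\<lambda>y. g y * b y) has_integral I) S" by (rule has_integral_on_superset[OF _ _ that])
  next
    assume a: "((\<lambda>y. g y * b y) has_integral I) S"
    then have "((\<lambda>y. if y \<in> {real n..M} then g y * b y else 0) has_integral I) S"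
      by (rule has_integral_eq[rotated]) (auto simp: b0 not_le)
    then show "((\<lambda>y. g y * b y) has_integral I) {real n..M}" using that by (subst (asm) has_integral_restrict) auto
  qed
  have e1: "integral {cmod (walk_end n \<omega>)..M} (\<lambda>y. y * ?u y) = K" for \<omega>
  proof (rule integral_unique)
    have "((\<lambda>y. (y * (?F y - 1)) * b y) has_integral K) {real n..M}" using hi by (simp add: mult_ac)
    then have "((\<lambda>y. (y * (?F y - 1)) * b y) has_integral K) {cmod (walk_end n \<omega>)..M}"
      using norm_walk_end_le[of n \<omega>] by (subst ext) auto
    then show "((\<lambda>y. y * ?u y) has_integral K) {cmod (walk_end n \<omega>)..M}" by (simp add: mult_ac)
  qed
  have "((\<lambda>y. y * ?u y * ?F y) has_integral (LINT \<omega>|walk_measure n. integral {cmod (walk_end n \<omega>)..M} (\<lambda>y. y * ?u y))) {0..}"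
    by (rule kluyver_cdf_test_function[OF n nM]) (auto intro!: continuous_intros bc Fc simp: b0)
  then have "((\<lambda>y. y * ?u y * ?F y) has_integral K) {0..}" unfolding e1 by (simp add: W.prob_space)
  then have "((\<lambda>y. (y * (?F y - 1) * ?F y) * b y) has_integral K) {0..}" by (simp add: mult_ac)
  then have "((\<lambda>y. (y * (?F y - 1) * ?F y) * b y) has_integral K) {real n..M}" by (subst (asm) ext) auto
  from has_integral_diff[OF this hi]
  have z: "((\<lambda>y. y * b y * (?F y - 1)\<^sup>2) has_integral 0) {real n..M}" by (simp add: power2_eq_square algebra_simps)
  have zc: "continuous_on {real n..M} (\<lambda>y. y * b y * (?F y - 1)\<^sup>2)" by (intro continuous_intros bc Fc)
  have "\<forall>y\<in>{real n..M}. y * b y * (?F y - 1)\<^sup>2 = 0"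
    using integral_eq_0_iff[OF zc] integral_unique[OF z] x n by (auto simp: M_def b_def)
  moreover have "x \<in> {real n..M}" using x by (simp add: M_def)
  ultimately have "x * b x * (?F x - 1)\<^sup>2 = 0" by blast
  moreover have "x > 0" "b x > 0" using x n by (auto simp: b_def M_def)
  ultimately show ?thesis by simp
qed

text \<open>Test functions with an integrable singularity at \<open>0\<close>: cut them off near \<open>0\<close> and pass to the limit by dominated convergence. On the left the bound \<open>F x = O (x)\<close> tames the singularity; on the right \<open>x powr (\<rho> - 1)\<close> is integrable.\<close>

lemma kluyver_cdf_weighted:
  assumes n: "3 \<le> n" and M: "real n \<le> M" and g: "continuous_on {0<..} g"
    and g0: "\<And>x. x \<le> 0 \<or> M \<le> x \<Longrightarrow> g x = 0"
    and gB: "\<And>x. 0 < x \<Longrightarrow> \<bar>g x\<bar> \<le> B * x powr (\<rho> - 1)" and \<rho>: "0 < \<rho>"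
  shows "((\<lambda>x. g x * kluyver_cdf n x) has_integral
            (LINT \<omega>|walk_measure n. integral {cmod (walk_end n \<omega>)..M} g)) {0..}"
proof -
  interpret W: prob_space "walk_measure n" by (rule prob_space_walk_measure)
  let ?R = "\<lambda>\<omega>. cmod (walk_end n \<omega>)"
  have M0: "M > 0" using n M by simp
  have R: "0 \<le> ?R \<omega>" "?R \<omega> \<le> M" for \<omega> using norm_walk_end_le[of n \<omega>] M by auto
  have "0 \<le> B * 1 powr (\<rho> - 1)" using gB[of 1] abs_ge_zero order_trans by (metis zero_less_one)
  then have B0: "0 \<le> B" by simp
  \<comment> \<open>The cut-off vanishes on \<open>x \<le> 1 / (m + 1)\<close> and equals \<open>1\<close> from \<open>2 / (m + 1)\<close> on.\<close>
  define \<kappa> where "\<kappa> m x = max 0 (min 1 (real (m + 1) * x - 1))" for m x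
  have \<kappa>01: "0 \<le> \<kappa> m x" "\<kappa> m x \<le> 1" for m x by (auto simp: \<kappa>_def)
  have \<kappa>0: "\<kappa> m x = 0" if "x < 1 / real (m + 1)" for m x
  proof -
    have "real (m + 1) * x < 1" using that by (simp add: field_simps)
    then show ?thesis by (simp add: \<kappa>_def)
  qed
  have \<kappa>lim: "(\<lambda>m. \<kappa> m x * g x) \<longlonglongrightarrow> g x" for x
  proof (cases "x \<le> 0")
    case False
    have "\<forall>\<^sub>F m in sequentially. \<kappa> m x * g x = g x"
      using eventually_ge_at_top[of "nat \<lceil>2 / x\<rceil>"]
    proof eventually_elim
      case (elim m)
      then have "2 / x \<le> real (m + 1)" by linarith
      then have "2 \<le> real (m + 1) * x" using False by (simp add: field_simps)
      then show ?case by (simp add: \<kappa>_def)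
    qed
    then show ?thesis by (rule tendsto_eventually)
  qed (simp add: g0)
  have \<kappa>g: "continuous_on UNIV (\<lambda>x. \<kappa> m x * g x)" and \<kappa>gx: "continuous_on UNIV (\<lambda>x. \<kappa> m x * g x / x)" for m
  proof -
    have "0 < 1 / real (m + 1)" by simp
    then have "0 < x \<or> x < 1 / real (m + 1)" for x by linarith
    then have U: "{0<..} \<union> {..<1 / real (m + 1)} = (UNIV :: real set)"
      by (simp only: set_eq_iff Un_iff greaterThan_iff lessThan_iff UNIV_I simp_thms)
    have 1: "continuous_on {0<..} (\<lambda>x. \<kappa> m x * g x)" "continuous_on {0<..} (\<lambda>x. \<kappa> m x * g x / x)"
      unfolding \<kappa>_def by (intro continuous_intros g; simp)+
    have 2: "continuous_on {..<1 / real (m + 1)} (\<lambda>x. \<kappa> m x * g x)" "continuous_on {..<1 / real (m + 1)} (\<lambda>x. \<kappa> m x * g x / x)"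
      by (rule continuous_on_eq[OF continuous_on_const[of _ 0]], use \<kappa>0[of _ m] in simp)+
    show "continuous_on UNIV (\<lambda>x. \<kappa> m x * g x)" unfolding U[symmetric] by (intro continuous_on_open_Un 1 2) auto
    show "continuous_on UNIV (\<lambda>x. \<kappa> m x * g x / x)" unfolding U[symmetric] by (intro continuous_on_open_Un 1 2) auto
  qed
  have xe: "x * (\<kappa> m x * g x / x) = \<kappa> m x * g x" for m x by (cases "x = 0") (simp_all add: g0)
  define I where "I m \<omega> = integral {?R \<omega>..M} (\<lambda>x. \<kappa> m x * g x)" for m \<omega>
  have A: "((\<lambda>x. \<kappa> m x * g x * kluyver_cdf n x) has_integral (LINT \<omega>|walk_measure n. I m \<omega>)) {0..}" for m
  proof -
    have 1: "continuous_on {0..} (\<lambda>x. \<kappa> m x * g x / x)" by (rule continuous_on_subset[OF \<kappa>gx]) simp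
    have 2: "\<kappa> m x * g x / x = 0" if "M \<le> x" for x using g0[of x] that by simp
    show ?thesis using kluyver_cdf_test_function[OF n M 1 2] unfolding xe I_def .
  qed
  obtain C where C: "C > 0" "\<And>x. \<bar>kluyver_cdf n x\<bar> \<le> C * \<bar>x\<bar>" by (rule kluyver_cdf_bound[OF n]) (rule that)
  let ?D = "\<lambda>x. if x \<in> {0..M} then B * C * M powr \<rho> else 0"
  have Di: "?D integrable_on {0..}"
  proof -
    have "((\<lambda>x. B * C * M powr \<rho>) has_integral (M - 0) *\<^sub>R (B * C * M powr \<rho>)) {0..M}"
      using has_integral_const_real[of "B * C * M powr \<rho>" 0 M] M0 by simp
    then have "(?D has_integral (M - 0) *\<^sub>R (B * C * M powr \<rho>)) {0..}" by (subst has_integral_restrict) auto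
    then show ?thesis by blast
  qed
  have dom: "\<bar>g x * kluyver_cdf n x\<bar> \<le> ?D x" for x
  proof (cases "0 < x \<and> x \<le> M")
    case True
    have "\<bar>g x * kluyver_cdf n x\<bar> \<le> (B * x powr (\<rho> - 1)) * (C * x)"
      unfolding abs_mult using gB[of x] C(2)[of x] True B0 by (intro mult_mono) auto
    also have "\<dots> = B * C * (x powr (\<rho> - 1) * x powr 1)" using True by simp
    also have "x powr (\<rho> - 1) * x powr 1 = x powr \<rho>" unfolding powr_add[symmetric] by simp
    also have "B * C * x powr \<rho> \<le> B * C * M powr \<rho>" using True \<rho> B0 C(1) by (intro mult_left_mono powr_mono2) auto
    finally show ?thesis using True by simp
  next
    case False
    then have "g x = 0" by (intro g0) auto
    then show ?thesis using B0 C(1) by simp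
  qed
  have dom\<kappa>: "\<bar>\<kappa> m x * y\<bar> \<le> \<bar>y\<bar>" for m x y using \<kappa>01[of m x] by (simp add: abs_mult mult_left_le_one_le)
  have dom': "norm (\<kappa> m x * g x * kluyver_cdf n x) \<le> ?D x" for m x
    using dom\<kappa>[of m x "g x * kluyver_cdf n x"] dom[of x] by (simp add: mult.assoc)
  have lim': "(\<lambda>m. \<kappa> m x * g x * kluyver_cdf n x) \<longlonglongrightarrow> g x * kluyver_cdf n x" for x
    by (intro tendsto_mult \<kappa>lim tendsto_const)
  note L1 = dominated_convergence(1)[OF has_integral_integrable[OF A] Di dom' lim']
   and L2 = dominated_convergence(2)[OF has_integral_integrable[OF A] Di dom' lim']
  have pw: "((\<lambda>x. B * x powr (\<rho> - 1)) has_integral B * (M powr \<rho> / \<rho>)) {0..M}"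
    using has_integral_mult_right[OF has_integral_powr_from_0[of "\<rho> - 1" M], of B] \<rho> M0 by simp
  have gB': "\<bar>\<kappa> m x * g x\<bar> \<le> B * x powr (\<rho> - 1)" for m x
  proof (cases "x > 0")
    case True
    then show ?thesis using dom\<kappa>[of m x "g x"] gB[OF True] by linarith
  qed (use B0 g0[of x] in simp)
  have pwR: "(\<lambda>x. B * x powr (\<rho> - 1)) integrable_on {?R \<omega>..M}" for \<omega>
    by (rule integrable_on_subinterval[OF has_integral_integrable[OF pw]]) (use R[of \<omega>] in auto)
  have \<kappa>gi: "(\<lambda>x. \<kappa> m x * g x) integrable_on {a..b}" for m a b
    by (intro integrable_continuous_interval continuous_on_subset[OF \<kappa>g]) simp
  have Ilim: "(\<lambda>m. I m \<omega>) \<longlonglongrightarrow> integral {?R \<omega>..M} g" for \<omega>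
    unfolding I_def by (rule dominated_convergence[OF \<kappa>gi pwR]) (use gB' \<kappa>lim in simp_all)
  have Ib: "\<bar>I m \<omega>\<bar> \<le> B * (M powr \<rho> / \<rho>)" for m \<omega>
  proof -
    have "norm (I m \<omega>) \<le> integral {?R \<omega>..M} (\<lambda>x. B * x powr (\<rho> - 1))"
      unfolding I_def by (rule integral_norm_bound_integral[OF \<kappa>gi pwR]) (use gB' in simp)
    also have "\<dots> \<le> integral {0..M} (\<lambda>x. B * x powr (\<rho> - 1))"
      by (rule integral_subset_le[OF _ pwR has_integral_integrable[OF pw]]) (use R[of \<omega>] B0 in auto)
    finally show ?thesis using integral_unique[OF pw] by simp
  qed
  have Im: "I m \<in> borel_measurable (walk_measure n)" for m
  proof -
    have "continuous_on {0..M} (\<lambda>r. integral {r..M} (\<lambda>x. \<kappa> m x * g x))"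
      by (rule indefinite_integral_continuous_1'[OF \<kappa>gi])
    then have "continuous_on UNIV (\<lambda>r. integral {max 0 (min M r)..M} (\<lambda>x. \<kappa> m x * g x))"
      by (rule continuous_on_compose2) (use M0 in \<open>auto intro!: continuous_intros\<close>)
    then have "(\<lambda>r. integral {max 0 (min M r)..M} (\<lambda>x. \<kappa> m x * g x)) \<in> borel_measurable borel" by (rule borel_measurable_continuous_onI)
    moreover have "?R \<in> borel_measurable (walk_measure n)" by measurable
    ultimately have "(\<lambda>\<omega>. integral {max 0 (min M (?R \<omega>))..M} (\<lambda>x. \<kappa> m x * g x)) \<in> borel_measurable (walk_measure n)"
      using measurable_compose by blast
    moreover have "max 0 (min M (?R \<omega>)) = ?R \<omega>" for \<omega> using R[of \<omega>] by auto
    ultimately show ?thesis by (simp add: I_def[abs_def])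
  qed
  have "(\<lambda>m. LINT \<omega>|walk_measure n. I m \<omega>) \<longlonglongrightarrow> (LINT \<omega>|walk_measure n. integral {?R \<omega>..M} g)"
  proof (rule integral_dominated_convergence)
    show "(\<lambda>\<omega>. integral {?R \<omega>..M} g) \<in> borel_measurable (walk_measure n)"
      by (rule borel_measurable_LIMSEQ_real[OF Ilim Im])
    show "integrable (walk_measure n) (\<lambda>\<omega>. B * (M powr \<rho> / \<rho>))" by simp
  qed (use Im Ilim Ib in auto)
  moreover have "integral {0..} (\<lambda>x. \<kappa> m x * g x * kluyver_cdf n x) = (LINT \<omega>|walk_measure n. I m \<omega>)" for m
    by (rule integral_unique[OF A])
  ultimately have "integral {0..} (\<lambda>x. g x * kluyver_cdf n x) = (LINT \<omega>|walk_measure n. integral {?R \<omega>..M} g)"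
    using L2 LIMSEQ_unique by simp
  then show ?thesis using integrable_integral[OF L1] by simp
qed

lemma of_real_powr_has_integral:
  assumes "0 < Re s" "0 \<le> a" "a \<le> b"
  shows "((\<lambda>x. s * of_real x powr (s - 1)) has_integral of_real b powr s - of_real a powr s) {a..b}"
proof (rule fundamental_theorem_of_calculus_interior[OF assms(3)])
  show "continuous_on {a..b} (\<lambda>x. of_real x powr s)"
    using assms by (intro continuous_intros) auto
  fix x assume x: "x \<in> {a<..<b}"
  then have "((\<lambda>z. z powr s) has_field_derivative s * of_real x powr (s - 1)) (at (of_real x))"
    using assms by (intro has_field_derivative_powr) auto
  then show "((\<lambda>x. of_real x powr s) has_vector_derivative s * of_real x powr (s - 1)) (at x)"
    by (rule has_vector_derivative_real_field)
qed

text \<open>Take \<open>s * x powr (s - 1)\<close> as test function: its integral from \<open>R\<close> to \<open>N\<close> is \<open>N powr s - R powr s\<close>. To make it continuous with bounded support it is brought down to \<open>0\<close> between \<open>N\<close> and \<open>N + 1\<close>; there \<open>F = 1\<close>, and the same amount \<open>T\<close> is added on both sides.\<close>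

lemma ramble_integral_eq_cdf:
  assumes n: "3 \<le> n" and s: "0 < Re s"
  shows "((\<lambda>x. s * of_real x powr (s - 1) * of_real (kluyver_cdf n x)) has_integral
            of_real (real n + 1) powr s - ramble_integral n s) {0..real n + 1}"
proof -
  interpret W: prob_space "walk_measure n" by (rule prob_space_walk_measure)
  let ?F = "kluyver_cdf n" and ?N = "real n + 1" and ?M = "real n + 2"
  let ?R = "\<lambda>\<omega>. cmod (walk_end n \<omega>)"
  have R: "0 \<le> ?R \<omega>" "?R \<omega> \<le> ?N" for \<omega> using norm_walk_end_le[of n \<omega>] by auto
  define \<tau> where "\<tau> x = max 0 (min 1 (?M - x))" for x
  have \<tau>01: "0 \<le> \<tau> x" "\<tau> x \<le> 1" for x by (auto simp: \<tau>_def)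
  define g where "g x = (if x \<le> 0 then 0 else of_real (\<tau> x) * (s * of_real x powr (s - 1)))" for x
  have gc: "continuous_on {0<..} g"
  proof (rule continuous_on_eq)
    show "continuous_on {0<..} (\<lambda>x. of_real (\<tau> x) * (s * of_real x powr (s - 1)))"
      unfolding \<tau>_def by (intro continuous_intros) auto
  qed (simp add: g_def)
  have g0: "g x = 0" if "x \<le> 0 \<or> ?M \<le> x" for x using that by (auto simp: g_def \<tau>_def)
  have gB: "cmod (g x) \<le> cmod s * x powr (Re s - 1)" if "0 < x" for x
  proof -
    have "cmod (g x) = \<tau> x * (cmod s * x powr (Re s - 1))"
      using that \<tau>01[of x] by (simp add: g_def norm_mult norm_powr_real_powr)
    also have "\<dots> \<le> 1 * (cmod s * x powr (Re s - 1))" using \<tau>01[of x] by (intro mult_right_mono) auto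
    finally show ?thesis by simp
  qed
  define T where "T = integral {?N..?M} g"
  have gT: "(g has_integral T) {?N..?M}"
    unfolding T_def by (intro integrable_integral integrable_continuous_interval continuous_on_subset[OF gc]) auto
  have gI: "(g has_integral (of_real ?N powr s - of_real (?R \<omega>) powr s) + T) {?R \<omega>..?M}" for \<omega>
  proof (rule has_integral_combine[of _ ?N])
    show "(g has_integral of_real ?N powr s - of_real (?R \<omega>) powr s) {?R \<omega>..?N}"
      by (rule has_integral_spike[of "{0}", OF _ _ of_real_powr_has_integral[OF s R]])
         (auto simp: g_def \<tau>_def dest: order_trans[OF norm_ge_zero])
  qed (use R[of \<omega>] gT in auto)
  let ?I = "\<lambda>\<omega>. (of_real ?N powr s - of_real (?R \<omega>) powr s) + T"
  have re: "((\<lambda>x. Re (g x) * ?F x) has_integral (LINT \<omega>|walk_measure n. Re (?I \<omega>))) {0..}"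
  proof -
    have "((\<lambda>x. Re (g x) * ?F x) has_integral (LINT \<omega>|walk_measure n. integral {?R \<omega>..?M} (\<lambda>x. Re (g x)))) {0..}"
      by (rule kluyver_cdf_weighted[OF n, where B = "cmod s" and \<rho> = "Re s"])
         (use gc g0 gB s abs_Re_le_cmod order_trans in \<open>auto intro!: continuous_intros intro: order_trans[OF abs_Re_le_cmod]\<close>)
    then show ?thesis unfolding integral_unique[OF has_integral_Re[OF gI]] .
  qed
  have im: "((\<lambda>x. Im (g x) * ?F x) has_integral (LINT \<omega>|walk_measure n. Im (?I \<omega>))) {0..}"
  proof -
    have "((\<lambda>x. Im (g x) * ?F x) has_integral (LINT \<omega>|walk_measure n. integral {?R \<omega>..?M} (\<lambda>x. Im (g x)))) {0..}"
      by (rule kluyver_cdf_weighted[OF n, where B = "cmod s" and \<rho> = "Re s"])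
         (use gc g0 gB s in \<open>auto intro!: continuous_intros intro: order_trans[OF abs_Im_le_cmod]\<close>)
    then show ?thesis unfolding integral_unique[OF has_integral_Im[OF gI]] .
  qed
  have Ri: "integrable (walk_measure n) (\<lambda>\<omega>. of_real (?R \<omega>) powr s)"
  proof (rule W.integrable_const_bound[of _ "?N powr Re s"])
    show "AE \<omega> in walk_measure n. cmod (of_real (?R \<omega>) powr s) \<le> ?N powr Re s"
    proof (rule AE_I2)
      fix \<omega>
      have "cmod (of_real (?R \<omega>) powr s) = ?R \<omega> powr Re s" by (simp add: norm_powr_real_powr)
      also have "\<dots> \<le> ?N powr Re s" using R[of \<omega>] s by (intro powr_mono2) auto
      finally show "cmod (of_real (?R \<omega>) powr s) \<le> ?N powr Re s" .
    qed
  qed measurable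
  have Ii: "integrable (walk_measure n) ?I" by (intro Bochner_Integration.integrable_add Bochner_Integration.integrable_diff Ri) simp_all
  define X where "X = (LINT \<omega>|walk_measure n. ?I \<omega>)"
  have XI: "X = of_real ?N powr s - ramble_integral n s + T"
    unfolding X_def ramble_integral_eq using Ri
    by (subst Bochner_Integration.integral_add; (subst Bochner_Integration.integral_diff)?) (auto simp: W.prob_space)
  have X: "((\<lambda>x. g x * of_real (?F x)) has_integral X) {0..}"
  proof -
    have "((\<lambda>x. complex_of_real (Re (g x) * ?F x) + \<i> * complex_of_real (Im (g x) * ?F x)) has_integral
       complex_of_real (LINT \<omega>|walk_measure n. Re (?I \<omega>)) + \<i> * complex_of_real (LINT \<omega>|walk_measure n. Im (?I \<omega>))) {0..}"
      by (intro has_integral_add has_integral_mult_right has_integral_of_real re im)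
    moreover have "complex_of_real (Re (g x) * ?F x) + \<i> * complex_of_real (Im (g x) * ?F x) = g x * of_real (?F x)" for x
      by (simp add: complex_eq_iff)
    moreover have "complex_of_real (LINT \<omega>|walk_measure n. Re (?I \<omega>)) + \<i> * complex_of_real (LINT \<omega>|walk_measure n. Im (?I \<omega>)) = X"
      unfolding X_def integral_Re[OF Ii] integral_Im[OF Ii] by (simp add: complex_eq_iff)
    ultimately show ?thesis by (simp only:)
  qed
  have Ti: "((\<lambda>x. g x * of_real (?F x)) has_integral T) {?N..}"
  proof -
    have "((\<lambda>x. g x * of_real (?F x)) has_integral T) {?N..?M}"
      by (rule has_integral_eq[OF _ gT]) (simp add: kluyver_cdf_eq_1[OF n])
    then have "((\<lambda>x. if x \<in> {?N..?M} then g x * of_real (?F x) else 0) has_integral T) {?N..}"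
      by (subst has_integral_restrict) auto
    then show ?thesis by (rule has_integral_eq[rotated]) (auto simp: g0)
  qed
  have "(\<lambda>x. g x * of_real (?F x)) integrable_on {0..?N}"
    by (rule integrable_on_subinterval[OF has_integral_integrable[OF X]]) auto
  then obtain Y where Y: "((\<lambda>x. g x * of_real (?F x)) has_integral Y) {0..?N}" by blast
  have "((\<lambda>x. g x * of_real (?F x)) has_integral Y + T) ({0..?N} \<union> {?N..})"
  proof (rule has_integral_Un[OF Y Ti])
    have "{0..?N} \<inter> {?N..} = {?N}" by auto
    then show "negligible ({0..?N} \<inter> {?N..})" by simp
  qed
  moreover have "{0..?N} \<union> {?N..} = {0..}" by auto
  ultimately have "X = Y + T" using X has_integral_unique by metis
  then have "Y = of_real ?N powr s - ramble_integral n s" using XI by simp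
  with Y have Y': "((\<lambda>x. g x * of_real (?F x)) has_integral of_real ?N powr s - ramble_integral n s) {0..?N}" by simp
  show ?thesis
    by (rule has_integral_spike[of "{0}", OF _ _ Y']) (auto simp: g_def \<tau>_def)
qed

section \<open>The Maclaurin series of the density\<close>

text \<open>By induction all coefficients below \<open>m\<close> vanish; after substituting \<open>y = x\<^sup>2\<close> and dividing by \<open>y ^ m\<close>, the limit at \<open>0\<close> from the right is \<open>d m\<close>.\<close>

lemma odd_powser_cancel:
  fixes d :: "nat \<Rightarrow> real"
  assumes \<delta>: "0 < \<delta>" and d: "\<And>x. 0 \<le> x \<Longrightarrow> x < \<delta> \<Longrightarrow> (\<lambda>k. d k * x ^ (2 * k + 1)) sums 0"
  shows "d k = 0"
proof (induction k rule: less_induct)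
  case (less m)
  have S: "(\<lambda>i. d (i + m) * y ^ i) sums 0" if y: "0 < y" "y < \<delta>\<^sup>2" for y
  proof -
    have "sqrt y < \<delta>" using y \<delta> by (intro real_less_lsqrt) auto
    then have "(\<lambda>k. d k * sqrt y ^ (2 * k + 1)) sums 0" using y by (intro d) auto
    moreover have "d k * sqrt y ^ (2 * k + 1) = sqrt y * (d k * y ^ k)" for k
      using y by (simp add: power_mult)
    ultimately have "(\<lambda>k. sqrt y * (d k * y ^ k)) sums 0" by (simp only:)
    from sums_mult[OF this, of "inverse (sqrt y)"] have "(\<lambda>k. d k * y ^ k) sums 0"
      using y by (simp add: mult.assoc[symmetric])
    moreover have "(\<Sum>k<m. d k * y ^ k) = 0" using less by (intro sum.neutral) auto
    ultimately have "(\<lambda>i. d (i + m) * y ^ (i + m)) sums 0" using sums_split_initial_segment[of "\<lambda>k. d k * y ^ k" 0 m] by simp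
    from sums_mult[OF this, of "inverse (y ^ m)"]
    have "(\<lambda>i. inverse (y ^ m) * (d (i + m) * y ^ (i + m))) sums 0" by simp
    moreover have "inverse (y ^ m) * (d (i + m) * y ^ (i + m)) = d (i + m) * y ^ i" for i
      using y by (simp add: power_add)
    ultimately show ?thesis by (simp only:)
  qed
  define f where "f y = (\<Sum>i. d (i + m) * y ^ i)" for y
  have "(f \<longlongrightarrow> d (0 + m)) (at 0)"
  proof (rule powser_limit_0_strong)
    show "0 < \<delta>\<^sup>2 / 2" using \<delta> by simp
    fix y :: real assume y: "y \<noteq> 0" "norm y < \<delta>\<^sup>2 / 2"
    have "summable (\<lambda>i. d (i + m) * (\<delta>\<^sup>2 / 2) ^ i)" using S[of "\<delta>\<^sup>2 / 2"] \<delta> by (auto intro: sums_summable)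
    then have "summable (\<lambda>i. d (i + m) * y ^ i)" by (rule powser_inside) (use y in auto)
    then show "(\<lambda>i. d (i + m) * y ^ i) sums f y" unfolding f_def by (rule summable_sums)
  qed
  then have 1: "(f \<longlongrightarrow> d m) (at_right 0)" by (simp add: filterlim_at_split)
  have "eventually (\<lambda>y. f y = 0) (at_right 0)"
    unfolding eventually_at_right_field using S \<delta> by (intro exI[of _ "\<delta>\<^sup>2"]) (auto simp: f_def sums_iff)
  then have 2: "(f \<longlongrightarrow> 0) (at_right 0)" by (rule tendsto_eventually)
  show "d m = 0" by (rule tendsto_unique[OF _ 1 2]) simp
qed

text \<open>Differentiate the series of \<open>F\<close>. The density is only known for positive arguments, so the power series is matched with the even function \<open>F \<bar>z\<bar>\<close>, which has the same derivative at \<open>x > 0\<close>.\<close>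

lemma kluyver_density_sums:
  assumes j: "1 \<le> j" and x: "0 \<le> x" "x < 1"
  shows "(\<lambda>k. maclaurin_coeff j k * x ^ (2 * k + 1)) sums kluyver_density (2 * j + 1) x"
proof (cases "x = 0")
  case True
  then show ?thesis by (simp add: kluyver_density_def)
next
  case False
  let ?n = "2 * j + 1"
  define c where "c m = (if even m \<and> m > 0 then maclaurin_coeff j (m div 2 - 1) / real m else 0)" for m
  have S: "(\<lambda>m. c m * z ^ m) sums kluyver_cdf ?n \<bar>z\<bar>" if "norm z < 1" for z
  proof -
    have "(\<lambda>k. maclaurin_coeff j k * (\<bar>z\<bar> ^ (2 * k + 2) / real (2 * k + 2))) sums kluyver_cdf ?n \<bar>z\<bar>"
      using that by (intro kluyver_cdf_sums j) auto
    moreover have "maclaurin_coeff j k * (\<bar>z\<bar> ^ (2 * k + 2) / real (2 * k + 2)) = c (2 * Suc k) * z ^ (2 * Suc k)" for k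
      unfolding c_def by (simp add: power_even_abs)
    moreover have "(\<lambda>k. c (2 * Suc k) * z ^ (2 * Suc k)) sums s \<longleftrightarrow> (\<lambda>m. c m * z ^ m) sums s" for s
    proof (rule sums_mono_reindex[where g = "\<lambda>k. 2 * Suc k"])
      fix m :: nat assume m: "m \<notin> range (\<lambda>k. 2 * Suc k)"
      have "\<not> (even m \<and> m > 0)"
      proof
        assume "even m \<and> m > 0"
        then obtain k where "m = 2 * k" "k > 0" by auto
        then have "m = 2 * Suc (k - 1)" by simp
        then show False using m by blast
      qed
      then show "c m * z ^ m = 0" by (auto simp: c_def)
    qed (auto simp: strict_mono_def)
    ultimately show ?thesis by simp
  qed
  have "x \<in> regular_points ?n" using x False by (auto simp: regular_points_def)
  then have "(kluyver_cdf ?n has_real_derivative kluyver_density ?n x) (at x)"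
    using j by (intro kluyver_cdf_has_real_derivative) auto
  then have "((\<lambda>z. kluyver_cdf ?n \<bar>z\<bar>) has_real_derivative kluyver_density ?n x) (at x)"
    by (rule has_field_derivative_transform_within_open[of _ _ _ "{0<..}"]) (use x False in auto)
  from termdiffs_sums_strong[OF S this] have "(\<lambda>m. diffs c m * x ^ m) sums kluyver_density ?n x"
    using x by simp
  moreover have "diffs c (2 * k + 1) * x ^ (2 * k + 1) = maclaurin_coeff j k * x ^ (2 * k + 1)" for k
    by (simp add: diffs_def c_def)
  moreover have "(\<lambda>k. diffs c (2 * k + 1) * x ^ (2 * k + 1)) sums s \<longleftrightarrow> (\<lambda>m. diffs c m * x ^ m) sums s" for s
  proof (rule sums_mono_reindex[where g = "\<lambda>k. 2 * k + 1"])
    fix m :: nat assume "m \<notin> range (\<lambda>k. 2 * k + 1)"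
    then have "even m" by (metis oddE rangeI)
    then show "diffs c m * x ^ m = 0" by (simp add: diffs_def c_def)
  qed (auto simp: strict_mono_def)
  ultimately show ?thesis by (simp only:)
qed

lemma kluyver_coeff_eq:
  assumes j: "1 \<le> j"
  shows "kluyver_coeff (2 * j + 1) = maclaurin_coeff j"
  unfolding kluyver_coeff_def
proof (rule the_equality)
  show "\<exists>\<delta>>0. \<forall>x\<in>{0..<\<delta>}. (\<lambda>k. maclaurin_coeff j k * x ^ (2 * k + 1)) sums kluyver_density (2 * j + 1) x"
    using kluyver_density_sums[OF j] by (intro exI[of _ 1]) auto
  fix r assume "\<exists>\<delta>>0. \<forall>x\<in>{0..<\<delta>}. (\<lambda>k. r k * x ^ (2 * k + 1)) sums kluyver_density (2 * j + 1) x"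
  then obtain \<delta> where \<delta>: "\<delta> > 0" and r: "\<And>x. x \<in> {0..<\<delta>} \<Longrightarrow> (\<lambda>k. r k * x ^ (2 * k + 1)) sums kluyver_density (2 * j + 1) x"
    by blast
  have "r k - maclaurin_coeff j k = 0" for k
  proof (rule odd_powser_cancel[of "min \<delta> 1" "\<lambda>k. r k - maclaurin_coeff j k"])
    fix x :: real assume "0 \<le> x" "x < min \<delta> 1"
    then have "(\<lambda>k. r k * x ^ (2 * k + 1) - maclaurin_coeff j k * x ^ (2 * k + 1)) sums (kluyver_density (2 * j + 1) x - kluyver_density (2 * j + 1) x)"
      by (intro sums_diff r kluyver_density_sums j) auto
    then show "(\<lambda>k. (r k - maclaurin_coeff j k) * x ^ (2 * k + 1)) sums 0" by (simp add: left_diff_distrib)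
  qed (use \<delta> in simp)
  then show "r = maclaurin_coeff j" by auto
qed

text \<open>The M-test applies because the coefficients are absolutely summable. At \<open>x = 1\<close> the sum equals the density since both are continuous from the left.\<close>

lemma kluyver_density_uniform_maclaurin:
  assumes j: "2 \<le> j"
  shows "uniform_limit {0..1} (\<lambda>N x. \<Sum>k<N. kluyver_coeff (2 * j + 1) k * x ^ (2 * k + 1)) (kluyver_density (2 * j + 1)) sequentially"
proof -
  let ?n = "2 * j + 1"
  let ?S = "\<lambda>x. \<Sum>k. maclaurin_coeff j k * x ^ (2 * k + 1)"
  have j1: "1 \<le> j" using j by simp
  have U: "uniform_limit {0..1} (\<lambda>N x. \<Sum>k<N. maclaurin_coeff j k * x ^ (2 * k + 1)) ?S sequentially"
  proof (rule Weierstrass_m_test[OF _ maclaurin_coeff_summable[OF j]])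
    fix k and x :: real assume x: "x \<in> {0..1}"
    then have "\<bar>x ^ (2 * k + 1)\<bar> \<le> 1" by (simp add: power_le_one del: power_Suc)
    then show "norm (maclaurin_coeff j k * x ^ (2 * k + 1)) \<le> \<bar>maclaurin_coeff j k\<bar>"
      unfolding real_norm_def abs_mult by (rule mult_left_le) simp
  qed
  have c: "continuous_on {0..1} ?S" by (rule uniform_limit_theorem[OF _ U]) (auto intro!: always_eventually continuous_intros)
  have S: "?S x = kluyver_density ?n x" if "x \<in> {0..<1}" for x using kluyver_density_sums[OF j1, of x] that by (auto simp: sums_iff)
  have "?S 1 = kluyver_density ?n 1"
  proof (rule tendsto_unique)
    show "(?S \<longlongrightarrow> ?S 1) (at_left 1)"
      by (rule continuous_on_Icc_at_leftD[OF c]) simp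
    have "1 \<in> regular_points ?n" using j by (auto simp: regular_points_def)
    then have "isCont (kluyver_density ?n) 1"
      using continuous_on_kluyver_density[of ?n] j open_regular_points[of ?n] by (auto simp: continuous_on_eq_continuous_at)
    then have "(kluyver_density ?n \<longlongrightarrow> kluyver_density ?n 1) (at_left 1)" by (simp add: isCont_def filterlim_at_split)
    then show "(?S \<longlongrightarrow> kluyver_density ?n 1) (at_left 1)"
    proof (rule Lim_transform_eventually)
      show "eventually (\<lambda>x. kluyver_density ?n x = ?S x) (at_left 1)"
        unfolding eventually_at_left_field using S by (intro exI[of _ 0]) auto
    qed
  qed simp
  then have S: "?S x = kluyver_density ?n x" if "x \<in> {0..1}" for x using S[of x] that by (cases "x = 1") auto
  show ?thesis unfolding kluyver_coeff_eq[OF j1] by (rule uniform_limit_cong'[THEN iffD1, OF refl S U])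
qed

lemma kluyver_density_3_uniform_maclaurin:
  assumes \<delta>: "0 < \<delta>" "\<delta> < 1"
  shows "uniform_limit {0..\<delta>} (\<lambda>N x. \<Sum>k<N. kluyver_coeff 3 k * x ^ (2 * k + 1)) (kluyver_density 3) sequentially"
proof -
  have sums: "(\<lambda>k. maclaurin_coeff 1 k * x ^ (2 * k + 1)) sums kluyver_density 3 x" if "0 \<le> x" "x < 1" for x
    using kluyver_density_sums[of 1 x] that by simp
  have e: "kluyver_coeff 3 = maclaurin_coeff 1" using kluyver_coeff_eq[of 1] by simp
  have U: "uniform_limit {0..\<delta>} (\<lambda>N x. \<Sum>k<N. maclaurin_coeff 1 k * x ^ (2 * k + 1)) (\<lambda>x. \<Sum>k. maclaurin_coeff 1 k * x ^ (2 * k + 1)) sequentially"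
  proof (rule Weierstrass_m_test)
    show "summable (\<lambda>k. maclaurin_coeff 1 k * \<delta> ^ (2 * k + 1))" using sums[of \<delta>] \<delta> by (auto simp: sums_iff)
    fix k and x :: real assume x: "x \<in> {0..\<delta>}"
    then have "x ^ (2 * k + 1) \<le> \<delta> ^ (2 * k + 1)" by (intro power_mono) auto
    then show "norm (maclaurin_coeff 1 k * x ^ (2 * k + 1)) \<le> maclaurin_coeff 1 k * \<delta> ^ (2 * k + 1)"
      unfolding real_norm_def abs_mult using x maclaurin_coeff_1_nonneg[of k] by (simp add: mult_left_mono del: power_Suc)
  qed
  have S: "(\<Sum>k. maclaurin_coeff 1 k * x ^ (2 * k + 1)) = kluyver_density 3 x" if "x \<in> {0..\<delta>}" for x
    using sums[of x] that \<delta> by (auto simp: sums_iff)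
  show ?thesis unfolding e by (rule uniform_limit_cong'[THEN iffD1, OF refl S U])
qed

text \<open>As the coefficients are nonnegative, the density lies above each partial sum, and the partial sums have arbitrarily large values at \<open>1\<close>.\<close>

lemma kluyver_density_3_at_left_1: "filterlim (kluyver_density 3) at_top (at_left 1)"
  unfolding filterlim_at_top_dense
proof
  fix Z :: real
  obtain N where N: "Z < (\<Sum>k<N. maclaurin_coeff 1 k)" using maclaurin_coeff_1_unbounded by blast
  let ?p = "\<lambda>x. \<Sum>k<N. maclaurin_coeff 1 k * x ^ (2 * k + 1)"
  have "isCont ?p 1" by (intro continuous_intros)
  then have "(?p \<longlongrightarrow> (\<Sum>k<N. maclaurin_coeff 1 k)) (at_left 1)" by (simp add: isCont_def filterlim_at_split)
  then have "eventually (\<lambda>x. Z < ?p x) (at_left 1)" by (rule order_tendstoD(1)[OF _ N])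
  moreover have "eventually (\<lambda>x. x \<in> {0<..<1}) (at_left (1::real))" by (rule eventually_at_left_real) simp
  ultimately show "eventually (\<lambda>x. Z < kluyver_density 3 x) (at_left 1)"
  proof eventually_elim
    case (elim x)
    have "(\<lambda>k. maclaurin_coeff 1 k * x ^ (2 * k + 1)) sums kluyver_density 3 x"
      using kluyver_density_sums[of 1 x] elim by simp
    then have "?p x \<le> kluyver_density 3 x"
      using elim maclaurin_coeff_1_nonneg unfolding sums_iff
      by (elim conjE, hypsubst?) (metis (no_types, lifting) sum_le_suminf finite_lessThan greaterThanLessThan_iff less_imp_le mult_nonneg_nonneg zero_le_power)
    then show ?case using elim by simp
  qed
qed

section \<open>Partial fraction series and simple poles\<close>

text \<open>Poles far from the bounded set \<open>K\<close> have distance at least half of \<open>2 * k + 2\<close>; finitely many remain, and those are separated from \<open>K\<close> by compactness.\<close>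

lemma pole_distance_lower_bound:
  assumes K: "compact K" and I: "\<And>s k. s \<in> K \<Longrightarrow> k \<in> I \<Longrightarrow> s + 2 * of_nat k + 2 \<noteq> 0"
  obtains c where "0 < c" "\<And>s k. s \<in> K \<Longrightarrow> k \<in> I \<Longrightarrow> c * real (2 * k + 2) \<le> cmod (s + 2 * of_nat k + 2)"
proof -
  obtain B where B: "\<And>s. s \<in> K \<Longrightarrow> cmod s \<le> B" using compact_imp_bounded[OF K] bounded_iff by metis
  define N where "N = nat \<lceil>B\<rceil>"
  define P where "P = (\<lambda>k. - (2 * of_nat k + 2) :: complex) ` (I \<inter> {..N})"
  have "closed P" unfolding P_def by (intro finite_imp_closed finite_imageI) simp
  moreover have "K \<inter> P = {}"
  proof -
    have False if "s \<in> K" "k \<in> I" "s = - (2 * of_nat k + 2)" for s k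
      using I[OF that(1,2)] that(3) by simp
    then show ?thesis unfolding P_def by blast
  qed
  ultimately obtain d where d: "d > 0" "\<And>s p. s \<in> K \<Longrightarrow> p \<in> P \<Longrightarrow> d \<le> dist s p"
    using separate_compact_closed[OF K] by metis
  show thesis
  proof (rule that[of "min (1/2) (d / (2 * real N + 2))"])
    show "0 < min (1/2) (d / (2 * real N + 2))" using d(1) by simp
    fix s k assume s: "s \<in> K" and k: "k \<in> I"
    have cm: "cmod (2 * of_nat k + 2) = real (2 * k + 2)"
      using norm_of_nat[of "2 * k + 2", where 'a = complex] by (simp add: add.commute)
    show "min (1/2) (d / (2 * real N + 2)) * real (2 * k + 2) \<le> cmod (s + 2 * of_nat k + 2)"
    proof (cases "k \<le> N")
      case True
      then have "- (2 * of_nat k + 2) \<in> P" using k by (auto simp: P_def)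
      from d(2)[OF s this] have "d \<le> cmod (s - (- (2 * of_nat k + 2)))" by (simp only: dist_norm)
      also have "s - (- (2 * of_nat k + 2)) = s + 2 * of_nat k + 2" by (simp add: algebra_simps)
      finally have "d \<le> cmod (s + 2 * of_nat k + 2)" .
      moreover have "min (1/2) (d / (2 * real N + 2)) * real (2 * k + 2) \<le> (d / (2 * real N + 2)) * (2 * real N + 2)"
        using True d(1) by (intro mult_mono) auto
      moreover have "(d / (2 * real N + 2)) * (2 * real N + 2) = d"
        by (rule nonzero_eq_divide_eq[THEN iffD1]) simp_all
      ultimately show ?thesis by linarith
    next
      case False
      then have "B \<le> real k" unfolding N_def by linarith
      then have "cmod s \<le> real (2 * k + 2) / 2" using B[OF s] by simp
      moreover have "cmod (2 * of_nat k + 2) - cmod s \<le> cmod (s + 2 * of_nat k + 2)"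
        using norm_diff_ineq[of "2 * of_nat k + 2 :: complex" s] by (simp add: add_ac)
      moreover have "1/2 * u \<le> v" if "t \<le> u / 2" "u - t \<le> v" for t u v :: real using that by linarith
      ultimately have "1/2 * real (2 * k + 2) \<le> cmod (s + 2 * of_nat k + 2)" unfolding cm by blast
      moreover have "min (1/2) (d / (2 * real N + 2)) * real (2 * k + 2) \<le> 1/2 * real (2 * k + 2)"
        by (rule mult_right_mono) (rule min.cobounded1, simp)
      ultimately show ?thesis by (rule order_trans[rotated])
    qed
  qed
qed

lemma partial_fractions_bound:
  assumes b: "summable (\<lambda>k. \<bar>r k\<bar> / real (2 * k + 2))"
    and K: "compact K" and I: "\<And>s k. s \<in> K \<Longrightarrow> k \<in> I \<Longrightarrow> s + 2 * of_nat k + 2 \<noteq> 0"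
  obtains M where "summable M" "\<And>s k. s \<in> K \<Longrightarrow> cmod (if k \<in> I then of_real (r k) / (s + 2 * of_nat k + 2) else 0) \<le> M k"
proof -
  obtain c where c: "0 < c" "\<And>s k. s \<in> K \<Longrightarrow> k \<in> I \<Longrightarrow> c * real (2 * k + 2) \<le> cmod (s + 2 * of_nat k + 2)"
  proof (rule pole_distance_lower_bound[OF K, of I])
    show "s + 2 * of_nat k + 2 \<noteq> 0" if "s \<in> K" "k \<in> I" for s k using that by (rule I)
  qed (rule that)
  show thesis
  proof (rule that)
    show "summable (\<lambda>k. \<bar>r k\<bar> / real (2 * k + 2) / c)" by (rule summable_divide[OF b])
    fix s k assume s: "s \<in> K"
    show "cmod (if k \<in> I then of_real (r k) / (s + 2 * of_nat k + 2) else 0) \<le> \<bar>r k\<bar> / real (2 * k + 2) / c"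
    proof (cases "k \<in> I")
      case True
      have "\<bar>r k\<bar> / cmod (s + 2 * of_nat k + 2) \<le> \<bar>r k\<bar> / (c * real (2 * k + 2))"
        by (rule divide_left_mono[OF c(2)[OF s True]])
           (use c(1) c(2)[OF s True] I[OF s True] in \<open>simp_all add: mult_pos_pos\<close>)
      then show ?thesis using True by (simp add: norm_divide mult_ac)
    next
      case False
      have "0 \<le> \<bar>r k\<bar> / real (2 * k + 2) / c" using c(1) by simp
      then show ?thesis using False by simp
    qed
  qed
qed

text \<open>The index set makes it possible to leave out a pole.\<close>

definition partial_fractions :: "(nat \<Rightarrow> real) \<Rightarrow> nat set \<Rightarrow> complex \<Rightarrow> complex" where
  "partial_fractions r I s = (\<Sum>k. if k \<in> I then of_real (r k) / (s + 2 * of_nat k + 2) else 0)"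

lemma partial_fractions_holomorphic:
  assumes b: "summable (\<lambda>k. \<bar>r k\<bar> / real (2 * k + 2))"
  shows "partial_fractions r I holomorphic_on - (\<lambda>k. - (2 * of_nat k + 2)) ` I"
    and "open (- (\<lambda>k. - (2 * of_nat k + 2) :: complex) ` I)"
proof -
  have "(\<lambda>k. - (2 * of_nat k + 2) :: complex) ` I \<subseteq> \<int>" by auto
  then show op: "open (- (\<lambda>k. - (2 * of_nat k + 2) :: complex) ` I)" using closed_subset_Ints open_Compl by blast
  show "partial_fractions r I holomorphic_on - (\<lambda>k. - (2 * of_nat k + 2)) ` I"
  proof (rule holomorphic_uniform_sequence[OF op])
    have nz: "s + 2 * of_nat k + 2 \<noteq> 0" if "s \<in> - (\<lambda>k. - (2 * of_nat k + 2)) ` I" "k \<in> I" for s :: complex and k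
      using that by (auto simp: add.assoc add_eq_0_iff2)
    show "(\<lambda>s. \<Sum>k<n. if k \<in> I then of_real (r k) / (s + 2 * of_nat k + 2) else 0) holomorphic_on - (\<lambda>k. - (2 * of_nat k + 2)) ` I" for n
    proof (rule holomorphic_on_sum)
      fix k
      show "(\<lambda>s. if k \<in> I then of_real (r k) / (s + 2 * of_nat k + 2) else 0) holomorphic_on - (\<lambda>k. - (2 * of_nat k + 2)) ` I"
        by (cases "k \<in> I") (use nz in \<open>auto intro!: holomorphic_intros\<close>)
    qed
    fix z :: complex assume z: "z \<in> - (\<lambda>k. - (2 * of_nat k + 2)) ` I"
    obtain d where d: "0 < d" "cball z d \<subseteq> - (\<lambda>k. - (2 * of_nat k + 2)) ` I"
      using op z open_contains_cball by metis
    obtain M where M: "summable M" "\<And>s k. s \<in> cball z d \<Longrightarrow> cmod (if k \<in> I then of_real (r k) / (s + 2 * of_nat k + 2) else 0) \<le> M k"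
      by (rule partial_fractions_bound[OF b compact_cball[of z d], where I = I]) (use nz d in blast)+
    have "uniform_limit (cball z d) (\<lambda>n s. \<Sum>k<n. if k \<in> I then of_real (r k) / (s + 2 * of_nat k + 2) else 0) (partial_fractions r I) sequentially"
      unfolding partial_fractions_def[abs_def] by (rule Weierstrass_m_test[OF M(2) M(1)])
    then show "\<exists>d>0. cball z d \<subseteq> - (\<lambda>k. - (2 * of_nat k + 2)) ` I \<and>
       uniform_limit (cball z d) (\<lambda>n s. \<Sum>k<n. if k \<in> I then of_real (r k) / (s + 2 * of_nat k + 2) else 0) (partial_fractions r I) sequentially"
      using d by blast
  qed
qed

text \<open>Split off the term of the index \<open>m\<close> with \<open>z = - (2 * m + 2)\<close>, if there is one; the rest is holomorphic near \<open>z\<close>.\<close>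

lemma partial_fractions_at_pole:
  assumes b: "summable (\<lambda>k. \<bar>r k\<bar> / real (2 * k + 2))"
  obtains \<rho> g c where "0 < \<rho>" "g holomorphic_on ball z \<rho>"
    "\<And>w. w \<in> ball z \<rho> - {z} \<Longrightarrow> partial_fractions r UNIV w = g w + c / (w - z)"
proof -
  define I where "I = {k. z + 2 * of_nat k + 2 \<noteq> 0}"
  let ?t = "\<lambda>w k. of_real (r k) / (w + 2 * of_nat k + 2) :: complex"
  have "z \<in> - (\<lambda>k. - (2 * of_nat k + 2)) ` I" by (auto simp: I_def add.assoc)
  then obtain \<rho> where \<rho>: "0 < \<rho>" "ball z \<rho> \<subseteq> - (\<lambda>k. - (2 * of_nat k + 2)) ` I"
    using partial_fractions_holomorphic(2)[of r I, OF b] open_contains_ball by metis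
  have hol: "partial_fractions r I holomorphic_on ball z \<rho>"
    by (rule holomorphic_on_subset[OF partial_fractions_holomorphic(1)[OF b] \<rho>(2)])
  show thesis
  proof (cases "\<exists>m. z + 2 * of_nat m + 2 = 0")
    case True
    then obtain m where m: "z + 2 * of_nat m + 2 = 0" by blast
    have Im: "k \<in> I \<longleftrightarrow> k \<noteq> m" for k
    proof
      assume "k \<noteq> m"
      then have "2 * (of_nat k - of_nat m) \<noteq> (0 :: complex)" by simp
      moreover have "z + 2 * of_nat k + 2 = 2 * (of_nat k - of_nat m) + (z + 2 * of_nat m + 2)"
        by (simp add: algebra_simps)
      ultimately show "k \<in> I" unfolding I_def m mem_Collect_eq by (simp only: add_0_right not_False_eq_True)
    qed (use m I_def in auto)
    show thesis
    proof (rule that[OF \<rho>(1) hol, of "of_real (r m)"])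
      fix w assume w: "w \<in> ball z \<rho> - {z}"
      obtain M where M: "summable M" "\<And>s k. s \<in> {w} \<Longrightarrow> cmod (if k \<in> I then ?t s k else 0) \<le> M k"
      proof (rule partial_fractions_bound[OF b, where I = I and K = "{w}"])
        show "s + 2 * of_nat k + 2 \<noteq> 0" if "s \<in> {w}" "k \<in> I" for s k
          using that w \<rho>(2) by (auto simp: subset_iff image_iff add.assoc add_eq_0_iff2)
      qed auto
      then have "summable (\<lambda>k. if k \<in> I then ?t w k else 0)" by (intro summable_comparison_test'[OF M(1)]) auto
      then have "(\<lambda>k. if k \<in> I then ?t w k else 0) sums partial_fractions r I w"
        unfolding partial_fractions_def by (rule summable_sums)
      moreover have "(\<lambda>k. if k = m then ?t w m else 0) sums ?t w m" by (rule sums_single)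
      ultimately have "(\<lambda>k. (if k \<in> I then ?t w k else 0) + (if k = m then ?t w m else 0)) sums (partial_fractions r I w + ?t w m)"
        by (rule sums_add)
      moreover have "(if k \<in> I then ?t w k else 0) + (if k = m then ?t w m else 0) = (if k \<in> UNIV then ?t w k else 0)" for k
        by (simp add: Im)
      ultimately have "(\<lambda>k. if k \<in> UNIV then ?t w k else 0) sums (partial_fractions r I w + ?t w m)" by (simp only:)
      then have "partial_fractions r UNIV w = partial_fractions r I w + ?t w m" unfolding partial_fractions_def by (rule sums_unique[symmetric])
      moreover have "w + 2 * of_nat m + 2 = w - z"
      proof -
        have "w + 2 * of_nat m + 2 = (w - z) + (z + 2 * of_nat m + 2)" by (simp add: algebra_simps)
        then show ?thesis unfolding m by (simp only: add_0_right)
      qed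
      ultimately show "partial_fractions r UNIV w = partial_fractions r I w + of_real (r m) / (w - z)" by simp
    qed
  next
    case False
    then have "I = UNIV" by (auto simp: I_def)
    then show thesis using that[OF \<rho>(1) hol, of 0] by simp
  qed
qed

lemma simple_pole_form_zorder:
  assumes \<rho>: "0 < \<rho>" and h: "h holomorphic_on ball z \<rho>"
    and F: "eventually (\<lambda>w. F w = h w + c / (w - z)) (at z)" and pole: "is_pole F z"
  shows "zorder F z = -1"
proof -
  have c: "c \<noteq> 0"
  proof
    assume "c = 0"
    then have "eventually (\<lambda>w. F w = h w) (at z)" using F by simp
    then have "is_pole h z" using is_pole_cong[of F h z z] pole by simp
    moreover have "\<not> is_pole h z" using not_is_pole_holomorphic[OF open_ball _ h] \<rho> by simp
    ultimately show False by simp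
  qed
  from F obtain d where d: "d > 0" "\<And>w. w \<noteq> z \<Longrightarrow> dist w z < d \<Longrightarrow> F w = h w + c / (w - z)"
    unfolding eventually_at by auto
  show ?thesis
  proof (rule zorder_eqI[of "ball z (min \<rho> d)" z "\<lambda>w. h w * (w - z) + c"])
    show "(\<lambda>w. h w * (w - z) + c) holomorphic_on ball z (min \<rho> d)"
      by (intro holomorphic_intros holomorphic_on_subset[OF h]) auto
    fix w assume "w \<in> ball z (min \<rho> d)" "w \<noteq> z"
    then show "F w = (h w * (w - z) + c) * (w - z) powi - 1"
      using d(2)[of w] by (simp add: dist_commute field_simps)
  qed (use \<rho> d c in auto)
qed

lemma simple_pole_form_meromorphic:
  assumes \<rho>: "0 < \<rho>" and h: "h holomorphic_on ball z \<rho>"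
    and F: "eventually (\<lambda>w. F w = h w + c / (w - z)) (at z)"
  shows "F meromorphic_on {z}"
proof -
  have "h analytic_on {z}" using h \<rho> by (auto simp: analytic_at intro!: exI[of _ "ball z \<rho>"])
  then have "(\<lambda>w. h w + c / (w - z)) meromorphic_on {z}" by (intro meromorphic_intros analytic_on_imp_meromorphic_on)
  moreover have "F meromorphic_on {z} \<longleftrightarrow> (\<lambda>w. h w + c / (w - z)) meromorphic_on {z}"
    using F by (intro meromorphic_on_cong) auto
  ultimately show ?thesis by simp
qed

text \<open>The difference vanishes near \<open>1\<close>, so by the identity theorem it vanishes outside a discrete set. Hence all continuations have the same poles with the same orders.\<close>

lemma meromorphic_eventually_eq:
  assumes F: "F meromorphic_on UNIV" and G: "G meromorphic_on UNIV" and eq: "\<And>s. 0 < Re s \<Longrightarrow> F s = G s"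
  shows "eventually (\<lambda>w. F w = G w) (at z)"
proof -
  have "(\<lambda>w. F w - G w) meromorphic_on UNIV" by (intro meromorphic_intros F G)
  from meromorphic_imp_constant_or_avoid[OF this open_UNIV connected_UNIV, of 0]
  have "eventually (\<lambda>w. F w - G w = 0) (cosparse UNIV)"
  proof
    assume "eventually (\<lambda>w. F w - G w \<noteq> 0) (cosparse UNIV)"
    then have "eventually (\<lambda>w. F w - G w \<noteq> 0) (at 1)" by (rule eventually_cosparse_imp_eventually_at) simp
    moreover have "eventually (\<lambda>w. w \<in> {w. 0 < Re w}) (at (1 :: complex))"
      by (rule eventually_at_in_open') (auto simp: open_halfspace_Re_gt)
    ultimately have "eventually (\<lambda>w. False) (at (1 :: complex))" by eventually_elim (use eq in auto)
    then show ?thesis by simp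
  qed
  then have "eventually (\<lambda>w. F w - G w = 0) (at z)" by (rule eventually_cosparse_imp_eventually_at) simp
  then show ?thesis by simp
qed

section \<open>Moments and their meromorphic continuation\<close>

text \<open>For \<open>j = 1\<close> the terms are nonnegative, and the partial sums are limits at \<open>1\<close> of partial sums of \<open>F\<close>, which is bounded.\<close>

lemma integrated_coeff_summable:
  assumes j: "1 \<le> j"
  shows "summable (\<lambda>k. \<bar>maclaurin_coeff j k\<bar> / real (2 * k + 2))"
proof (cases "j = 1")
  case False
  then have "2 \<le> j" using j by simp
  from maclaurin_coeff_summable[OF this] show ?thesis
  proof (rule summable_comparison_test'[where N = 0])
    fix k :: nat
    have "\<bar>maclaurin_coeff j k\<bar> / real (2 * k + 2) \<le> \<bar>maclaurin_coeff j k\<bar> / 1" by (intro divide_left_mono) auto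
    then show "norm (\<bar>maclaurin_coeff j k\<bar> / real (2 * k + 2)) \<le> \<bar>maclaurin_coeff j k\<bar>" by simp
  qed
next
  case True
  obtain C where C: "C > 0" "\<And>x. \<bar>kluyver_cdf 3 x\<bar> \<le> C * \<bar>x\<bar>" by (rule kluyver_cdf_bound[of 3]) (simp, rule that)
  show ?thesis
  proof (rule summableI_nonneg_bounded)
    fix N
    let ?p = "\<lambda>x. \<Sum>k<N. maclaurin_coeff 1 k * (x ^ (2 * k + 2) / real (2 * k + 2))"
    have "isCont ?p 1" by (intro continuous_intros) auto
    then have lim: "(?p \<longlongrightarrow> (\<Sum>k<N. maclaurin_coeff 1 k / real (2 * k + 2))) (at_left 1)" by (simp add: isCont_def filterlim_at_split)
    have "eventually (\<lambda>x. x \<in> {0<..<1}) (at_left (1::real))" by (rule eventually_at_left_real) simp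
    then have "eventually (\<lambda>x. ?p x \<le> C) (at_left 1)"
    proof eventually_elim
      case (elim x)
      have s: "(\<lambda>k. maclaurin_coeff 1 k * (x ^ (2 * k + 2) / real (2 * k + 2))) sums kluyver_cdf 3 x"
        using kluyver_cdf_sums[of 1 x] elim by simp
      have "?p x \<le> (\<Sum>k. maclaurin_coeff 1 k * (x ^ (2 * k + 2) / real (2 * k + 2)))"
        by (rule sum_le_suminf[OF sums_summable[OF s]]) (use elim maclaurin_coeff_1_nonneg in \<open>auto intro!: mult_nonneg_nonneg\<close>)
      also have "\<dots> = kluyver_cdf 3 x" using s by (simp only: sums_iff)
      also have "\<dots> \<le> C * x" using C(2)[of x] elim by simp
      also have "\<dots> \<le> C" using C(1) elim by simp
      finally show ?case .
    qed
    from tendsto_upperbound[OF lim this]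
    show "(\<Sum>k<N. \<bar>maclaurin_coeff j k\<bar> / real (2 * k + 2)) \<le> C" using True maclaurin_coeff_1_nonneg by simp
  qed simp
qed

lemma right_half_plane_avoids_poles:
  assumes "0 < Re s"
  shows "s + 2 * of_nat k + 2 \<noteq> 0"
proof
  assume "s + 2 * of_nat k + 2 = 0"
  then have "Re (s + 2 * of_nat k + 2) = Re 0" by (rule arg_cong)
  then show False using assms by simp
qed

text \<open>Term-by-term integration of the series of \<open>F\<close>, dominated by \<open>x powr (Re s - 1)\<close> times the sum of the absolute values of the coefficients.\<close>

lemma cdf_mellin_head:
  assumes j: "1 \<le> j" and s: "0 < Re s"
  shows "((\<lambda>x. s * of_real x powr (s - 1) * of_real (kluyver_cdf (2 * j + 1) x)) has_integral
            s * partial_fractions (\<lambda>k. maclaurin_coeff j k / real (2 * k + 2)) UNIV s) {0..1}"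
proof -
  let ?b = "\<lambda>k. maclaurin_coeff j k / real (2 * k + 2)"
  let ?F = "kluyver_cdf (2 * j + 1)"
  have b: "summable (\<lambda>k. \<bar>?b k\<bar>)" using integrated_coeff_summable[OF j] by simp
  define B where "B = (\<Sum>k. \<bar>?b k\<bar>)"
  define G where "G x = (\<Sum>k. ?b k * x ^ (2 * k + 2))" for x
  have le: "\<bar>?b k * x ^ (2 * k + 2)\<bar> \<le> \<bar>?b k\<bar>" if "x \<in> {0..1}" for k and x :: real
    unfolding abs_mult by (rule mult_left_le) (use that in \<open>simp_all add: power_le_one del: power_Suc\<close>)
  have G: "(\<lambda>k. ?b k * x ^ (2 * k + 2)) sums G x" if "x \<in> {0..1}" for x
    unfolding G_def using le[OF that] by (intro summable_sums summable_comparison_test'[OF b]) simp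
  have pb: "\<bar>\<Sum>k<m. ?b k * x ^ (2 * k + 2)\<bar> \<le> B" if "x \<in> {0..1}" for m x
  proof -
    have "\<bar>\<Sum>k<m. ?b k * x ^ (2 * k + 2)\<bar> \<le> (\<Sum>k<m. \<bar>?b k * x ^ (2 * k + 2)\<bar>)" by (rule sum_abs)
    also have "\<dots> \<le> (\<Sum>k<m. \<bar>?b k\<bar>)" by (intro sum_mono le that)
    also have "\<dots> \<le> B" unfolding B_def by (rule sum_le_suminf[OF b]) auto
    finally show ?thesis .
  qed
  define f where "f m x = s * of_real x powr (s - 1) * of_real (\<Sum>k<m. ?b k * x ^ (2 * k + 2))" for m x
  have fi: "(f m has_integral (\<Sum>k<m. s * (of_real (?b k) / (s + 2 * of_nat k + 2)))) {0..1}" for m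
  proof -
    have "((\<lambda>x. \<Sum>k<m. (s * of_real (?b k) / (s + 2 * of_nat k + 2)) * ((s + 2 * of_nat k + 2) * of_real x powr (s + 2 * of_nat k + 2 - 1)))
       has_integral (\<Sum>k<m. (s * of_real (?b k) / (s + 2 * of_nat k + 2)) * (of_real 1 powr (s + 2 * of_nat k + 2) - of_real 0 powr (s + 2 * of_nat k + 2)))) {0..1}"
      by (intro has_integral_sum has_integral_mult_right of_real_powr_has_integral) (use s in auto)
    moreover have "(\<Sum>k<m. (s * of_real (?b k) / (s + 2 * of_nat k + 2)) * ((s + 2 * of_nat k + 2) * of_real x powr (s + 2 * of_nat k + 2 - 1))) = f m x" if x: "x \<in> {0..1}" for x
    proof (cases "x = 0")
      case False
      have "(s * of_real (?b k) / (s + 2 * of_nat k + 2)) * ((s + 2 * of_nat k + 2) * of_real x powr (s + 2 * of_nat k + 2 - 1))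
          = s * of_real x powr (s - 1) * of_real (?b k * x ^ (2 * k + 2))" for k
      proof -
        have nz: "s + 2 * of_nat k + 2 \<noteq> 0" by (rule right_half_plane_avoids_poles[OF s])
        have e: "s + 2 * of_nat k + 2 - 1 = (s - 1) + of_nat (2 * k + 2)" by simp
        have "of_real x powr (s + 2 * of_nat k + 2 - 1) = of_real x powr (s - 1) * of_real x ^ (2 * k + 2)"
          unfolding e powr_add using powr_nat'[of "of_real x :: complex" "2 * k + 2"] False by (simp only: of_real_eq_0_iff not_False_eq_True simp_thms)
        then show ?thesis using nz by simp
      qed
      then show ?thesis unfolding f_def of_real_sum sum_distrib_left by (simp only:)
    qed (simp add: f_def)
    ultimately have "(f m has_integral (\<Sum>k<m. (s * of_real (?b k) / (s + 2 * of_nat k + 2)) * (of_real 1 powr (s + 2 * of_nat k + 2) - of_real 0 powr (s + 2 * of_nat k + 2)))) {0..1}"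
      by (rule has_integral_eq[rotated]) simp
    then show ?thesis by (simp add: mult.assoc)
  qed
  have hi: "(\<lambda>x. cmod s * B * x powr (Re s - 1)) integrable_on {0..1}"
    using has_integral_mult_right[OF has_integral_powr_from_0[of "Re s - 1" 1], of "cmod s * B"] s by (auto simp: integrable_on_def)
  have dom: "norm (f m x) \<le> cmod s * B * x powr (Re s - 1)" if x: "x \<in> {0..1}" for m x
  proof -
    have "norm (f m x) = cmod s * x powr (Re s - 1) * \<bar>\<Sum>k<m. ?b k * x ^ (2 * k + 2)\<bar>"
      unfolding f_def norm_mult using x by (simp add: norm_powr_real_powr del: of_real_sum)
    also have "\<dots> \<le> cmod s * x powr (Re s - 1) * B" by (intro mult_left_mono pb x) simp
    finally show ?thesis by (simp add: mult_ac)
  qed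
  have lim: "(\<lambda>m. f m x) \<longlonglongrightarrow> s * of_real x powr (s - 1) * of_real (G x)" if x: "x \<in> {0..1}" for x
    unfolding f_def by (intro tendsto_mult tendsto_const tendsto_of_real G[OF x, unfolded sums_def])
  note D = dominated_convergence[OF has_integral_integrable[OF fi] hi dom lim]
  obtain M where M: "summable M" "\<And>w k. w \<in> {s} \<Longrightarrow> cmod (if k \<in> UNIV then of_real (?b k) / (w + 2 * of_nat k + 2) else 0) \<le> M k"
  proof (rule partial_fractions_bound[where I = UNIV and K = "{s}" and r = ?b])
    show "summable (\<lambda>k. \<bar>?b k\<bar> / real (2 * k + 2))"
    proof (rule summable_comparison_test'[OF b, where N = 0])
      fix k :: nat
      have "\<bar>?b k\<bar> / real (2 * k + 2) \<le> \<bar>?b k\<bar> / 1" by (intro divide_left_mono) auto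
      then show "norm (\<bar>?b k\<bar> / real (2 * k + 2)) \<le> \<bar>?b k\<bar>" by simp
    qed
    show "w + 2 * of_nat k + 2 \<noteq> 0" if "w \<in> {s}" for w and k :: nat
      using that s by (intro right_half_plane_avoids_poles) simp
  qed auto
  have "summable (\<lambda>k. if k \<in> UNIV then of_real (?b k) / (s + 2 * of_nat k + 2) else 0)"
    by (rule summable_comparison_test'[OF M(1), where N = 0]) (use M(2) in blast)
  then have "(\<lambda>k. s * (of_real (?b k) / (s + 2 * of_nat k + 2))) sums (s * partial_fractions ?b UNIV s)"
    unfolding partial_fractions_def by (intro sums_mult) (simp add: summable_sums)
  then have "(\<lambda>m. integral {0..1} (f m)) \<longlonglongrightarrow> s * partial_fractions ?b UNIV s"
    unfolding sums_def integral_unique[OF fi] .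
  from LIMSEQ_unique[OF this D(2)] integrable_integral[OF D(1)]
  have "((\<lambda>x. s * of_real x powr (s - 1) * of_real (G x)) has_integral s * partial_fractions ?b UNIV s) {0..1}"
    by simp
  then show ?thesis
  \<comment> \<open>The series represents \<open>F\<close> for \<open>x < 1\<close>; the endpoint is negligible.\<close>
  proof (rule has_integral_spike[of "{1}", rotated 2])
    fix x :: real assume x: "x \<in> {0..1} - {1}"
    have "(\<lambda>k. ?b k * x ^ (2 * k + 2)) sums ?F x" using kluyver_cdf_sums[of j x] j x by (simp only: times_divide_eq_left times_divide_eq_right) auto
    then have "?F x = G x" using G[of x] x sums_unique2 by force
    then show "s * of_real x powr (s - 1) * of_real (?F x) = s * of_real x powr (s - 1) * of_real (G x)" by simp
  qed simp
qed

text \<open>The part of the Mellin transform of \<open>F\<close> over \<open>{1..n + 1}\<close>, which stays away from the singularity of \<open>x powr (s - 1)\<close> and is therefore entire in \<open>s\<close>.\<close>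

definition mellin_middle :: "nat \<Rightarrow> complex \<Rightarrow> complex" where
  "mellin_middle n s = integral {1..real n + 1} (\<lambda>x. of_real x powr (s - 1) * of_real (kluyver_cdf n x))"

lemma mellin_middle_entire:
  assumes n: "3 \<le> n"
  shows "mellin_middle n holomorphic_on UNIV"
proof -
  have Fc: "continuous_on A (kluyver_cdf n)" for A by (rule continuous_on_subset[OF continuous_on_kluyver_cdf[OF n]]) simp
  let ?f = "\<lambda>s x. exp ((s - 1) * complex_of_real (ln x)) * complex_of_real (kluyver_cdf n x)"
  have "(\<lambda>s. integral (cbox 1 (real n + 1)) (?f s)) holomorphic_on UNIV"
  proof (rule leibniz_rule_holomorphic)
    show "((\<lambda>s. ?f s x) has_field_derivative of_real (ln x) * ?f s x) (at s within UNIV)" for s x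
      by (auto intro!: derivative_eq_intros)
    show "?f s integrable_on cbox 1 (real n + 1)" for s
      by (intro integrable_continuous continuous_intros Fc) auto
    have c1: "continuous_on (UNIV \<times> cbox 1 (real n + 1)) (\<lambda>z. ln (snd z) :: real)"
      by (intro continuous_intros) auto
    have c2: "continuous_on (UNIV \<times> cbox 1 (real n + 1)) (\<lambda>z. kluyver_cdf n (snd z))"
      by (rule continuous_on_compose2[OF Fc[of UNIV]]) (auto intro!: continuous_intros)
    show "continuous_on (UNIV \<times> cbox 1 (real n + 1)) (\<lambda>(s :: complex, x). of_real (ln x) * ?f s x)"
      unfolding case_prod_unfold by (intro continuous_intros c1 c2)
  qed simp
  moreover have "integral (cbox 1 (real n + 1)) (?f s) = mellin_middle n s" for s
    unfolding mellin_middle_def box_real by (rule integral_cong) (simp add: powr_def Ln_of_real mult.commute)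
  ultimately show ?thesis by simp
qed

lemma ramble_integral_formula:
  assumes j: "1 \<le> j" and s: "0 < Re s"
  shows "ramble_integral (2 * j + 1) s = of_real (real (2 * j + 2)) powr s - s * mellin_middle (2 * j + 1) s
           - s * partial_fractions (\<lambda>k. maclaurin_coeff j k / real (2 * k + 2)) UNIV s"
proof -
  let ?n = "2 * j + 1"
  let ?N = "real ?n + 1"
  let ?g = "\<lambda>x. s * of_real x powr (s - 1) * of_real (kluyver_cdf ?n x)"
  let ?S = "partial_fractions (\<lambda>k. maclaurin_coeff j k / real (2 * k + 2)) UNIV s"
  have n: "3 \<le> ?n" using j by simp
  have W: "(?g has_integral of_real ?N powr s - ramble_integral ?n s) {0..?N}" by (rule ramble_integral_eq_cdf[OF n s])
  have Fc: "continuous_on A (kluyver_cdf ?n)" for A by (rule continuous_on_subset[OF continuous_on_kluyver_cdf[OF n]]) simp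
  have "(\<lambda>x. of_real x powr (s - 1) * of_real (kluyver_cdf ?n x)) integrable_on {1..?N}"
    by (intro integrable_continuous_interval continuous_intros Fc) auto
  then have "((\<lambda>x. s * (of_real x powr (s - 1) * of_real (kluyver_cdf ?n x))) has_integral s * mellin_middle ?n s) {1..?N}"
    unfolding mellin_middle_def by (intro has_integral_mult_right integrable_integral)
  then have mid: "(?g has_integral s * mellin_middle ?n s) {1..?N}" by (simp only: mult.assoc)
  have "(?g has_integral s * ?S + s * mellin_middle ?n s) {0..?N}"
    by (rule has_integral_combine[OF _ _ cdf_mellin_head[OF j s] mid]) auto
  from has_integral_unique[OF W this] have "of_real ?N powr s - ramble_integral ?n s = s * ?S + s * mellin_middle ?n s" .
  moreover have "?N = real (2 * j + 2)" by simp
  ultimately show ?thesis by (simp only:) (simp add: algebra_simps)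
qed

definition ramble_extension :: "nat \<Rightarrow> complex \<Rightarrow> complex" where
  "ramble_extension j s = of_real (real (2 * j + 2)) powr s - s * mellin_middle (2 * j + 1) s
     - s * partial_fractions (\<lambda>k. maclaurin_coeff j k / real (2 * k + 2)) UNIV s"

text \<open>Near \<open>z\<close> write \<open>w * (c / (w - z)) = c + z * c / (w - z)\<close>: the factor in front of the series does not raise the order of the pole.\<close>

lemma ramble_extension_simple_pole_form:
  assumes j: "1 \<le> j"
  obtains \<rho> h c where "0 < \<rho>" "h holomorphic_on ball z \<rho>"
    "eventually (\<lambda>w. ramble_extension j w = h w + c / (w - z)) (at z)"
proof -
  let ?b = "\<lambda>k. maclaurin_coeff j k / real (2 * k + 2)"
  have b: "summable (\<lambda>k. \<bar>?b k\<bar> / real (2 * k + 2))"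
  proof (rule summable_comparison_test'[OF integrated_coeff_summable[OF j], where N = 0])
    fix k :: nat
    have "\<bar>?b k\<bar> / real (2 * k + 2) \<le> \<bar>?b k\<bar> / 1" by (intro divide_left_mono) auto
    then show "norm (\<bar>?b k\<bar> / real (2 * k + 2)) \<le> \<bar>maclaurin_coeff j k\<bar> / real (2 * k + 2)" by simp
  qed
  obtain \<rho> g c where \<rho>: "0 < \<rho>" and g: "g holomorphic_on ball z \<rho>"
    and pf: "\<And>w. w \<in> ball z \<rho> - {z} \<Longrightarrow> partial_fractions ?b UNIV w = g w + c / (w - z)"
    by (rule partial_fractions_at_pole[OF b, of z]) (rule that)
  have n: "3 \<le> 2 * j + 1" using j by simp
  show thesis
  proof (rule that[OF \<rho>])
    show "(\<lambda>w. of_real (real (2 * j + 2)) powr w - w * mellin_middle (2 * j + 1) w - w * g w - c) holomorphic_on ball z \<rho>"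
      by (intro holomorphic_intros g holomorphic_on_subset[OF mellin_middle_entire[OF n]]) auto
    have "eventually (\<lambda>w. w \<in> ball z \<rho> - {z}) (at z)" using \<rho> by (intro eventually_at_in_open) auto
    then show "eventually (\<lambda>w. ramble_extension j w
        = (of_real (real (2 * j + 2)) powr w - w * mellin_middle (2 * j + 1) w - w * g w - c) + (- z * c) / (w - z)) (at z)"
    proof eventually_elim
      case (elim w)
      have "w * (c / (w - z)) = c + z * c / (w - z)" using elim by (simp add: field_simps)
      then show ?case unfolding ramble_extension_def pf[OF elim] by (simp add: ring_distribs)
    qed
  qed
qed

lemma ramble_extension_continuation:
  assumes j: "1 \<le> j"
  shows "ramble_continuation (2 * j + 1) (ramble_extension j)"
  unfolding ramble_continuation_def
proof
  show "ramble_extension j meromorphic_on UNIV"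
    unfolding meromorphic_on_meromorphic_at[of _ UNIV]
  proof
    fix z
    obtain \<rho> h c where "0 < \<rho>" "h holomorphic_on ball z \<rho>"
      "eventually (\<lambda>w. ramble_extension j w = h w + c / (w - z)) (at z)"
      by (rule ramble_extension_simple_pole_form[OF j, of z]) (rule that)
    then show "ramble_extension j meromorphic_on {z}" by (rule simple_pole_form_meromorphic)
  qed
  show "\<forall>s. 0 < Re s \<longrightarrow> ramble_extension j s = ramble_integral (2 * j + 1) s"
    using ramble_integral_formula[OF j] by (auto simp: ramble_extension_def)
qed

lemma ramble_continuation_simple_poles:
  assumes j: "1 \<le> j" and F: "ramble_continuation (2 * j + 1) F" and pole: "is_pole F z"
  shows "zorder F z = -1"
proof -
  obtain \<rho> h c where h: "0 < \<rho>" "h holomorphic_on ball z \<rho>"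
    and e: "eventually (\<lambda>w. ramble_extension j w = h w + c / (w - z)) (at z)"
    by (rule ramble_extension_simple_pole_form[OF j, of z]) (rule that)
  have "eventually (\<lambda>w. F w = ramble_extension j w) (at z)"
    using F ramble_extension_continuation[OF j] unfolding ramble_continuation_def
    by (intro meromorphic_eventually_eq) auto
  with e have "eventually (\<lambda>w. F w = h w + c / (w - z)) (at z)" by eventually_elim simp
  then show ?thesis by (rule simple_pole_form_zorder[OF h _ pole])
qed

text \<open>Integrate the derivative \<open>s * x powr (s - 1) * F x + x powr s * p x\<close> of \<open>x powr s * F x\<close> over \<open>{0..N}\<close> and subtract \<open>ramble_integral_eq_cdf\<close>. Beyond \<open>n\<close> the density vanishes, as \<open>F\<close> is constant there.\<close>

lemma kluyver_density_moment:
  assumes j: "1 \<le> j" and s: "0 < Re s"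
  shows "((\<lambda>x. of_real x powr s * of_real (kluyver_density (2 * j + 1) x)) has_integral ramble_integral (2 * j + 1) s) {0..}"
proof -
  let ?n = "2 * j + 1"
  let ?N = "real ?n + 1"
  let ?F = "kluyver_cdf ?n" and ?p = "kluyver_density ?n"
  let ?g = "\<lambda>x. s * of_real x powr (s - 1) * of_real (?F x)"
  let ?h = "\<lambda>x. of_real x powr s * of_real (?p x) :: complex"
  have n: "3 \<le> ?n" and n': "?n = 3 \<or> 5 \<le> ?n" using j by auto
  have Fc: "continuous_on A ?F" for A by (rule continuous_on_subset[OF continuous_on_kluyver_cdf[OF n]]) simp
  have "((\<lambda>x. ?g x + ?h x) has_integral of_real ?N powr s * of_real (?F ?N) - of_real 0 powr s * of_real (?F 0)) {0..?N}"
  \<comment> \<open>Continuity of \<open>F\<close> bridges the points \<open>1\<close> and \<open>3\<close>, where for \<open>n = 3\<close> it need not be differentiable.\<close>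
  proof (rule fundamental_theorem_of_calculus_interior_strong[of "{1, 3}"])
    show "continuous_on {0..?N} (\<lambda>x. of_real x powr s * of_real (?F x))"
      using s by (intro continuous_intros Fc) auto
    fix x assume x: "x \<in> {0<..<?N} - {1, 3}"
    have "((\<lambda>z. z powr s) has_field_derivative s * of_real x powr (s - 1)) (at (of_real x))"
      using x s by (intro has_field_derivative_powr) auto
    then have 1: "((\<lambda>x. of_real x powr s) has_vector_derivative s * of_real x powr (s - 1)) (at x)"
      by (rule has_vector_derivative_real_field)
    have "x \<in> regular_points ?n" using x by (auto simp: regular_points_def)
    from kluyver_cdf_has_real_derivative[OF n' this]
    have 2: "((\<lambda>x. complex_of_real (?F x)) has_vector_derivative complex_of_real (?p x)) (at x)"
      by (simp add: has_real_derivative_iff_has_vector_derivative has_vector_derivative_of_real)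
    from has_vector_derivative_mult[OF 1 2]
    show "((\<lambda>x. of_real x powr s * of_real (?F x)) has_vector_derivative ?g x + ?h x) (at x)"
      by (simp add: add.commute)
  qed auto
  from has_integral_diff[OF this ramble_integral_eq_cdf[OF n s]]
  have I: "(?h has_integral ramble_integral ?n s) {0..?N}"
    using kluyver_cdf_eq_1[OF n, of ?N] by simp
  have zero: "?p x = 0" if "x > ?N" for x
  proof -
    have "x \<in> regular_points ?n" using that j by (auto simp: regular_points_def)
    from kluyver_cdf_has_real_derivative[OF n' this] have "(?F has_real_derivative ?p x) (at x)" .
    moreover have "(?F has_real_derivative 0) (at x)"
      by (rule has_field_derivative_transform_within_open[OF DERIV_const[of 1], where S = "{?N<..}"])
         (use that kluyver_cdf_eq_1[OF n] in auto)
    ultimately show ?thesis by (rule DERIV_unique)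
  qed
  have "((\<lambda>x. if x \<in> {0..?N} then ?h x else 0) has_integral ramble_integral ?n s) {0..}"
    using I by (subst has_integral_restrict) auto
  then show ?thesis
  proof (rule has_integral_eq[rotated])
    fix x :: real assume x: "x \<in> {0..}"
    show "(if x \<in> {0..?N} then ?h x else 0) = ?h x"
    proof (cases "x \<in> {0..?N}")
      case False
      then have "x > ?N" using x by simp
      then show ?thesis using False by (simp only: zero if_False of_real_0 mult_zero_right)
    qed (simp only: if_True)
  qed
qed

theorem theorem5p2:
  shows
   "((\<forall>j::nat. j > 1 \<longrightarrow>
        uniform_limit {0..1}
          (\<lambda>N x. \<Sum>k<N. kluyver_coeff (2 * j + 1) k * x ^ (2 * k + 1))
          (kluyver_density (2 * j + 1)) sequentially)
     \<and> filterlim (kluyver_density 3) at_top (at_left 1)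
     \<and> (\<forall>\<delta>\<in>{0<..<1}.
          uniform_limit {0..\<delta>}
            (\<lambda>N x. \<Sum>k<N. kluyver_coeff 3 k * x ^ (2 * k + 1))
            (kluyver_density 3) sequentially))
    \<and>
    (\<forall>j::nat. j > 0 \<longrightarrow>
        (\<forall>s. Re s > 0 \<longrightarrow>
           ((\<lambda>x. complex_of_real x powr s * complex_of_real (kluyver_density (2 * j + 1) x))
              has_integral ramble_integral (2 * j + 1) s) {0..})
      \<and> (\<exists>F. ramble_continuation (2 * j + 1) F)
      \<and> (\<forall>F. ramble_continuation (2 * j + 1) F \<longrightarrow>
              (\<forall>z. is_pole F z \<longrightarrow> zorder F z = -1)))
    \<and>
    (\<forall>j::nat. j > 0 \<longrightarrow>
        (\<forall>K. compact K \<and> K \<subseteq> - {complex_of_int (2 * m) | m. m < 0} \<longrightarrow>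
           (\<forall>s\<in>K. summable (\<lambda>k.
               norm (complex_of_real (kluyver_coeff (2 * j + 1) k) / (s + 2 * of_nat k + 2))))
         \<and> uniformly_convergent_on K (\<lambda>N s. \<Sum>k<N.
               complex_of_real (kluyver_coeff (2 * j + 1) k) / (s + 2 * of_nat k + 2))))"
proof (intro conjI allI impI)
  fix j :: nat assume "j > 1"
  then show "uniform_limit {0..1} (\<lambda>N x. \<Sum>k<N. kluyver_coeff (2 * j + 1) k * x ^ (2 * k + 1))
          (kluyver_density (2 * j + 1)) sequentially"
    by (intro kluyver_density_uniform_maclaurin) simp
next
  show "filterlim (kluyver_density 3) at_top (at_left 1)" by (rule kluyver_density_3_at_left_1)
next
  show "\<forall>\<delta>\<in>{0<..<1}. uniform_limit {0..\<delta>} (\<lambda>N x. \<Sum>k<N. kluyver_coeff 3 k * x ^ (2 * k + 1)) (kluyver_density 3) sequentially"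
    using kluyver_density_3_uniform_maclaurin by simp
next
  fix j :: nat and s :: complex assume "j > 0" "Re s > 0"
  then show "((\<lambda>x. complex_of_real x powr s * complex_of_real (kluyver_density (2 * j + 1) x))
              has_integral ramble_integral (2 * j + 1) s) {0..}"
    by (intro kluyver_density_moment) simp_all
next
  fix j :: nat assume "j > 0"
  then show "\<exists>F. ramble_continuation (2 * j + 1) F" using ramble_extension_continuation[of j] by (intro exI) simp
next
  fix j :: nat and F z assume "j > 0" "ramble_continuation (2 * j + 1) F" "is_pole F z"
  then show "zorder F z = -1" by (intro ramble_continuation_simple_poles[of j]) simp_all
next
  fix j :: nat and K :: "complex set"
  assume "j > 0" and K: "compact K \<and> K \<subseteq> - {complex_of_int (2 * m) | m. m < 0}"
  then have j: "1 \<le> j" by simp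
  let ?r = "kluyver_coeff (2 * j + 1)"
  have b: "summable (\<lambda>k. \<bar>?r k\<bar> / real (2 * k + 2))" unfolding kluyver_coeff_eq[OF j] by (rule integrated_coeff_summable[OF j])
  obtain M where M: "summable M" "\<And>s k. s \<in> K \<Longrightarrow> cmod (if k \<in> UNIV then of_real (?r k) / (s + 2 * of_nat k + 2) else 0) \<le> M k"
  proof (rule partial_fractions_bound[OF b, where I = UNIV and K = K])
    show "s + 2 * of_nat k + 2 \<noteq> 0" if s: "s \<in> K" for s and k :: nat
    proof
      assume "s + 2 * of_nat k + 2 = 0"
      moreover have "s = (s + 2 * of_nat k + 2) + complex_of_int (2 * (- int k - 1))" by (simp add: algebra_simps)
      ultimately have "s = complex_of_int (2 * (- int k - 1))" by (simp only: add_0_left)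
      then have "s \<in> {complex_of_int (2 * m) | m. m < 0}" by (intro CollectI exI[of _ "- int k - 1"]) simp
      then show False using s K by blast
    qed
  qed (use K in auto)
  then have le: "norm (complex_of_real (?r k) / (s + 2 * of_nat k + 2)) \<le> M k" if "s \<in> K" for s k using that by simp
  show "\<forall>s\<in>K. summable (\<lambda>k. norm (complex_of_real (?r k) / (s + 2 * of_nat k + 2)))"
  proof
    fix s assume "s \<in> K"
    then show "summable (\<lambda>k. norm (complex_of_real (?r k) / (s + 2 * of_nat k + 2)))"
      by (intro summable_comparison_test'[OF M(1), where N = 0]) (simp only: real_norm_def abs_norm_cancel, rule le)
  qed
  have "uniform_limit K (\<lambda>N s. \<Sum>k<N. complex_of_real (?r k) / (s + 2 * of_nat k + 2))
     (\<lambda>s. \<Sum>k. complex_of_real (?r k) / (s + 2 * of_nat k + 2)) sequentially"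
    by (rule Weierstrass_m_test[OF le M(1)])
  then show "uniformly_convergent_on K (\<lambda>N s. \<Sum>k<N. complex_of_real (?r k) / (s + 2 * of_nat k + 2))"
    unfolding uniformly_convergent_on_def by blast
qed

end
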